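(* Let $G=\langle a,w\rangle$ be a permutation group with a cyclic regular normal subgroup $W=\langle w\rangle$ of order $n$ and a cyclic point stabilizer $A=\langle a\rangle$. Let $\alpha$ be an integer such that $w^a=w^\alpha$. Let $H$ be a relatively closed subgroup of $G$ which is second maximal in the lattice of proper relatively closed subgroups of $G$. Then $H$ is conjugate in $\operatorname{Hol}(W)$ to exactly one of the following subgroups: (1) $H_1=\langle a^s,w^r\rangle$, where $r\in\pi(n)$ and $s\in\pi(\operatorname{ord}_r(\alpha))$; (2) $H_2=\langle a,w^{sr}\rangle$, where $s,r\in\pi(n)$ and $sr$ divides $n$; (3) $H_3=\langle a^{\operatorname{ord}_s(\alpha)}w^r,w^{sr}\rangle$, where $r\in\pi(n)$, $s\in\pi(n)\cap\pi(\operatorname{ord}_r(\alpha))$, $(\operatorname{ord}_r(\alpha),\operatorname{ord}_s(\alpha))=1$; (4) $H_4=\langle aw^r,w^{4r}\rangle$, where $r\in\pi(n)\setminus\{2\}$, provided $4$ divides $n$ and $\alpha\equiv-1\pmod 4$; (5) $H_5=\langle a^2,w^4\rangle$, provided $4$ divides $n$ and $\alpha\equiv-1\pmod4$; (6) $H_6=\langle aw,w^8\rangle$, provided $8$ divides $n$ and $\alpha\equiv-1\pmod 8$. All subgroups in (1)--(6) are second maximal relatively closed subgroups of $G$. The multisets of orbit lengths are as follows: - $\Omega(H_1)=\Omega(H_3)=\left\{\!\!\left\{\frac nr,\ \frac{s(r-1)}{\operatorname{ord}_r(\alpha)}\times\frac nr\frac{\operatorname{ord}_r(\alpha)}{s}\right\}\!\!\right\}$;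 - $\Omega(H_2)=\left\{\!\!\left\{\frac n{r^2},\ \frac{r-1}{\operatorname{ord}_r(\alpha)}\times\frac n{r^2}\operatorname{ord}_r(\alpha),\ \frac{r(r-1)}{\operatorname{ord}_{r^2}(\alpha)}\times\frac n{r^2}\operatorname{ord}_{r^2}(\alpha)\right\}\!\!\right\}$ for $s=r$; - $\Omega(H_2)=\left\{\!\!\left\{\frac n{sr},\ \frac{r-1}{\operatorname{ord}_r(\alpha)}\times\frac n{sr}\operatorname{ord}_r(\alpha),\ \frac{s-1}{\operatorname{ord}_s(\alpha)}\times\frac n{sr}\operatorname{ord}_s(\alpha),\ \frac{(s-1)(r-1)}{\operatorname{ord}_{sr}(\alpha)}\times\frac n{sr}\operatorname{ord}_{sr}(\alpha)\right\}\!\!\right\}$ for $s\neq r$; - $\Omega(H_4)=\left\{\!\!\left\{2\times\frac n{2r},\ \frac{2(r-1)(2,\operatorname{ord}_r(\alpha))}{\operatorname{ord}_r(\alpha)}\times\frac n{2r}\frac{\operatorname{ord}_r(\alpha)}{(2,\operatorname{ord}_r(\alpha))}\right\}\!\!\right\}$; - $\Omega(H_5)=\Omega(H_6)=\left\{\!\!\left\{4\times\frac n4\right\}\!\!\right\}$.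
   Context: All groups are finite. $G=A\ltimes W$ is regarded as a permutation group on the set $W$ via $u^{cv}=u^cv$ for $u,v\in W$, $c\in A$ (where $u^c=c^{-1}uc$). As $A$ acts faithfully on $W$ by automorphisms, $G\leqslant\operatorname{Hol}(W)=\operatorname{Aut}(W)\ltimes W$. The relative closure of a subgroup $K$ in $G$ is the largest subgroup of $G$ having the same orbits on $W$ as $K$; $K$ is relatively closed in $G$ if it coincides with its relative closure. A second maximal relatively closed subgroup of $G$ is a subgroup $H$ that is maximal among the proper relatively closed subgroups of some $M$, where $M$ is maximal among the proper relatively closed subgroups of $G$. $\pi(m)$ is the set of prime divisors of $m$; $(m,k)$ is the greatest common divisor; $\operatorname{ord}_m(k)$ is the multiplicative order of $k$ modulo $m$ for coprime $m,k$. $\Omega(H)$ is the multiset of lengths of the orbits of $H$ on $W$; $\{\!\{n_1\times m_1,\dots,n_s\times m_s\}\!\}$ is the multiset consisting of $m_1,\dots,m_s$ with multiplicities $n_1,\dots,n_s$, where $m_i$ alone means $1\times m_i$ (if $m_i=m_j$ for $i\neq j$, multiplicities add). In (2), $s$ and $r$ are primes, possibly equal, and the subgroup depends only on the product $sr$. *)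

theory Defs
  imports "HOL-Algebra.Algebra" "HOL-Number_Theory.Number_Theory"
begin

text \<open>
  Permutations of a set \<open>\<Omega>\<close> are the elements of \<^const>\<open>BijGroup\<close>, which multiplies from right to
  left: \<open>f \<otimes> g\<close> applies \<open>g\<close> first. The source lets permutations act on the right, so that its
  product \<open>f g\<close> applies \<open>f\<close> first. Hence every product of the source is written here in the opposite
  order: \<open>f g\<close> becomes \<open>g \<otimes> f\<close>. (Powers, inverses, generated subgroups and orbits are the same for
  both conventions.)
\<close>

abbreviation perm_group :: "'a set \<Rightarrow> ('a \<Rightarrow> 'a) set \<Rightarrow> ('a \<Rightarrow> 'a) monoid" where
  "perm_group \<Omega> K \<equiv> (BijGroup \<Omega>)\<lparr>carrier := K\<rparr>"

definition orbits_on :: "'a set \<Rightarrow> ('a \<Rightarrow> 'a) set \<Rightarrow> 'a set set" where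
  "orbits_on \<Omega> K = orbits (perm_group \<Omega> K) \<Omega> (\<lambda>g. g)"

definition orbit_lengths :: "'a set \<Rightarrow> ('a \<Rightarrow> 'a) set \<Rightarrow> nat multiset" where
  "orbit_lengths \<Omega> K = image_mset card (mset_set (orbits_on \<Omega> K))"

definition regular_on :: "'a set \<Rightarrow> ('a \<Rightarrow> 'a) set \<Rightarrow> bool" where
  "regular_on \<Omega> K \<longleftrightarrow> (\<forall>x\<in>\<Omega>. \<forall>y\<in>\<Omega>. \<exists>!g. g \<in> K \<and> g x = y)"

text \<open>
  The order on sets is inclusion. The greatest element exists for every subgroup \<open>K\<close> of a
  permutation group \<open>G\<close>: the subgroup generated by all subgroups with the same orbits as \<open>K\<close> again
  has these orbits.
\<close>

definition relative_closure ::
    "'a set \<Rightarrow> ('a \<Rightarrow> 'a) set \<Rightarrow> ('a \<Rightarrow> 'a) set \<Rightarrow> ('a \<Rightarrow> 'a) set" where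
  "relative_closure \<Omega> G K =
     (GREATEST L. subgroup L (perm_group \<Omega> G) \<and> orbits_on \<Omega> L = orbits_on \<Omega> K)"

definition relatively_closed ::
    "'a set \<Rightarrow> ('a \<Rightarrow> 'a) set \<Rightarrow> ('a \<Rightarrow> 'a) set \<Rightarrow> bool" where
  "relatively_closed \<Omega> G K \<longleftrightarrow>
     subgroup K (perm_group \<Omega> G) \<and> relative_closure \<Omega> G K = K"

definition maximal_relatively_closed_in ::
    "'a set \<Rightarrow> ('a \<Rightarrow> 'a) set \<Rightarrow> ('a \<Rightarrow> 'a) set \<Rightarrow> ('a \<Rightarrow> 'a) set \<Rightarrow> bool" where
  "maximal_relatively_closed_in \<Omega> G M K \<longleftrightarrow>
     relatively_closed \<Omega> G K \<and> K \<subset> M \<and>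
     (\<forall>L. relatively_closed \<Omega> G L \<and> L \<subset> M \<and> K \<subseteq> L \<longrightarrow> L = K)"

definition second_maximal_relatively_closed ::
    "'a set \<Rightarrow> ('a \<Rightarrow> 'a) set \<Rightarrow> ('a \<Rightarrow> 'a) set \<Rightarrow> bool" where
  "second_maximal_relatively_closed \<Omega> G H \<longleftrightarrow>
     (\<exists>M. maximal_relatively_closed_in \<Omega> G G M \<and> maximal_relatively_closed_in \<Omega> G M H)"

text \<open>
  The holomorph of a regular group \<open>W\<close> as a group of permutations of \<open>\<Omega>\<close>. Here \<open>\<Omega>\<close> is identified
  with \<open>W\<close> through \<open>u \<mapsto> u \<omega>\<close> for the base point \<open>\<omega>\<close>; the element \<open>c v\<close> of \<open>Aut(W) \<ltimes> W\<close> then maps the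
  point \<open>u\<close> to \<open>u\<^sup>c v\<close>.
\<close>

definition holomorph ::
    "'a set \<Rightarrow> 'a \<Rightarrow> ('a \<Rightarrow> 'a) set \<Rightarrow> ('a \<Rightarrow> 'a) set" where
  "holomorph \<Omega> \<omega> W =
     {h \<in> carrier (BijGroup \<Omega>).
        \<exists>c \<in> auto (perm_group \<Omega> W). \<exists>v \<in> W. \<forall>u \<in> W. h (u \<omega>) = (v \<otimes>\<^bsub>BijGroup \<Omega>\<^esub> c u) \<omega>}"

definition conjugate_by ::
    "'a set \<Rightarrow> ('a \<Rightarrow> 'a) set \<Rightarrow> ('a \<Rightarrow> 'a) set \<Rightarrow> ('a \<Rightarrow> 'a) set \<Rightarrow> bool" where
  "conjugate_by \<Omega> U H K \<longleftrightarrow>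
     (\<exists>h \<in> U. K = (\<lambda>x. h \<otimes>\<^bsub>BijGroup \<Omega>\<^esub> x \<otimes>\<^bsub>BijGroup \<Omega>\<^esub> inv\<^bsub>BijGroup \<Omega>\<^esub> h) ` H)"

definition H1 :: "'a set \<Rightarrow> ('a \<Rightarrow> 'a) \<Rightarrow> ('a \<Rightarrow> 'a) \<Rightarrow> nat \<Rightarrow> nat \<Rightarrow> ('a \<Rightarrow> 'a) set" where
  "H1 \<Omega> a w s r = generate (BijGroup \<Omega>) {a [^]\<^bsub>BijGroup \<Omega>\<^esub> s, w [^]\<^bsub>BijGroup \<Omega>\<^esub> r}"

definition H2 :: "'a set \<Rightarrow> ('a \<Rightarrow> 'a) \<Rightarrow> ('a \<Rightarrow> 'a) \<Rightarrow> nat \<Rightarrow> nat \<Rightarrow> ('a \<Rightarrow> 'a) set" where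
  "H2 \<Omega> a w s r = generate (BijGroup \<Omega>) {a, w [^]\<^bsub>BijGroup \<Omega>\<^esub> (s * r)}"

definition H3 ::
    "'a set \<Rightarrow> int \<Rightarrow> ('a \<Rightarrow> 'a) \<Rightarrow> ('a \<Rightarrow> 'a) \<Rightarrow> nat \<Rightarrow> nat \<Rightarrow> ('a \<Rightarrow> 'a) set" where
  "H3 \<Omega> \<alpha> a w s r = generate (BijGroup \<Omega>)
     {w [^]\<^bsub>BijGroup \<Omega>\<^esub> r \<otimes>\<^bsub>BijGroup \<Omega>\<^esub> a [^]\<^bsub>BijGroup \<Omega>\<^esub> ord (int s) \<alpha>,
      w [^]\<^bsub>BijGroup \<Omega>\<^esub> (s * r)}"

definition H4 :: "'a set \<Rightarrow> ('a \<Rightarrow> 'a) \<Rightarrow> ('a \<Rightarrow> 'a) \<Rightarrow> nat \<Rightarrow> ('a \<Rightarrow> 'a) set" where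
  "H4 \<Omega> a w r = generate (BijGroup \<Omega>)
     {w [^]\<^bsub>BijGroup \<Omega>\<^esub> r \<otimes>\<^bsub>BijGroup \<Omega>\<^esub> a, w [^]\<^bsub>BijGroup \<Omega>\<^esub> (4 * r)}"

definition H5 :: "'a set \<Rightarrow> ('a \<Rightarrow> 'a) \<Rightarrow> ('a \<Rightarrow> 'a) \<Rightarrow> ('a \<Rightarrow> 'a) set" where
  "H5 \<Omega> a w = generate (BijGroup \<Omega>)
     {a [^]\<^bsub>BijGroup \<Omega>\<^esub> (2::nat), w [^]\<^bsub>BijGroup \<Omega>\<^esub> (4::nat)}"

definition H6 :: "'a set \<Rightarrow> ('a \<Rightarrow> 'a) \<Rightarrow> ('a \<Rightarrow> 'a) \<Rightarrow> ('a \<Rightarrow> 'a) set" where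
  "H6 \<Omega> a w = generate (BijGroup \<Omega>)
     {w \<otimes>\<^bsub>BijGroup \<Omega>\<^esub> a, w [^]\<^bsub>BijGroup \<Omega>\<^esub> (8::nat)}"

definition cond1 :: "nat \<Rightarrow> int \<Rightarrow> nat \<Rightarrow> nat \<Rightarrow> bool" where
  "cond1 n \<alpha> s r \<longleftrightarrow> r \<in> prime_factors n \<and> s \<in> prime_factors (ord (int r) \<alpha>)"

definition cond2 :: "nat \<Rightarrow> nat \<Rightarrow> nat \<Rightarrow> bool" where
  "cond2 n s r \<longleftrightarrow> s \<in> prime_factors n \<and> r \<in> prime_factors n \<and> s * r dvd n"

definition cond3 :: "nat \<Rightarrow> int \<Rightarrow> nat \<Rightarrow> nat \<Rightarrow> bool" where
  "cond3 n \<alpha> s r \<longleftrightarrow>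
     r \<in> prime_factors n \<and> s \<in> prime_factors n \<inter> prime_factors (ord (int r) \<alpha>) \<and>
     gcd (ord (int r) \<alpha>) (ord (int s) \<alpha>) = 1"

definition cond4 :: "nat \<Rightarrow> int \<Rightarrow> nat \<Rightarrow> bool" where
  "cond4 n \<alpha> r \<longleftrightarrow> r \<in> prime_factors n - {2} \<and> 4 dvd n \<and> [\<alpha> = -1] (mod 4)"

definition cond5 :: "nat \<Rightarrow> int \<Rightarrow> bool" where
  "cond5 n \<alpha> \<longleftrightarrow> 4 dvd n \<and> [\<alpha> = -1] (mod 4)"

definition cond6 :: "nat \<Rightarrow> int \<Rightarrow> bool" where
  "cond6 n \<alpha> \<longleftrightarrow> 8 dvd n \<and> [\<alpha> = -1] (mod 8)"

text \<open>
  \<open>listed \<Omega> n \<alpha> a w i K\<close>: the subgroup \<open>K\<close> occurs under item \<open>i\<close> of the list. Different parameters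
  may give the same subgroup (\<open>H2\<close> depends only on the product \<open>s r\<close>), whence the entries of the
  list are pairs of an item and a subgroup.
\<close>

inductive listed ::
    "'a set \<Rightarrow> nat \<Rightarrow> int \<Rightarrow> ('a \<Rightarrow> 'a) \<Rightarrow> ('a \<Rightarrow> 'a) \<Rightarrow> nat \<Rightarrow> ('a \<Rightarrow> 'a) set \<Rightarrow> bool"
  for \<Omega> n \<alpha> a w where
  "cond1 n \<alpha> s r \<Longrightarrow> listed \<Omega> n \<alpha> a w 1 (H1 \<Omega> a w s r)"
| "cond2 n s r \<Longrightarrow> listed \<Omega> n \<alpha> a w 2 (H2 \<Omega> a w s r)"
| "cond3 n \<alpha> s r \<Longrightarrow> listed \<Omega> n \<alpha> a w 3 (H3 \<Omega> \<alpha> a w s r)"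
| "cond4 n \<alpha> r \<Longrightarrow> listed \<Omega> n \<alpha> a w 4 (H4 \<Omega> a w r)"
| "cond5 n \<alpha> \<Longrightarrow> listed \<Omega> n \<alpha> a w 5 (H5 \<Omega> a w)"
| "cond6 n \<alpha> \<Longrightarrow> listed \<Omega> n \<alpha> a w 6 (H6 \<Omega> a w)"

end

(*
  If the point w^x omega gets the coordinate x modulo n, then G consists of the maps x -> c x + b
  with c in the group generated by alpha, and the relative closure of L consists of the elements of G
  that map every x into its L-orbit.

  Dichotomy: if L is not transitive modulo n, then it fixes a residue class modulo some prime r
  dividing n, or else 4 divides n and L preserves a pair of classes modulo 4, with multipliers -1
  modulo 4 occurring. Indeed, if no class modulo r is fixed, then a commutator produces an element
  with c = 1 and b nonzero modulo r, and by the congruences for 1 + c + ... + c^(k-1) its powers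
  act transitively modulo every power of r, unless r = 2 and c = -1 modulo 4. So the maximal closed
  subgroups are the stabilizers of a class modulo r and of a pair of classes modulo 4.

  Let L be closed and properly contained in the stabilizer of the class 0 modulo r; then L is
  intransitive on the orbit of some x. If r divides x, rescaling the class reduces to the dichotomy.
  Otherwise either the multipliers of L generate a proper subgroup modulo r, which gives H1, or the
  kernel of L modulo r is intransitive on the class of x. The dichotomy then applies to this kernel,
  which is normal in L, so that an element generating L modulo r moves one fixed class of the kernel
  to another. Comparing the two shows that L fixes a smaller class, preserves a pair of classes, or
  is contained in the twisted subgroup H3. A pair stabilizer is treated in the same way.

  Conjugation in Hol(W) preserves the multipliers, the translations and the moduli of the fixed
  classes, and these distinguish the entries of the list. For the orbit lengths, the points are
  split according to their divisibility by r, s or r s: on each part the period of the generating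
  affine map is constant.
*)
theory Submission
  imports Defs
begin

hide_const (open) Divisibility.prime

text \<open>Residues are kept as integers and subgroups as sets of integer pairs saturated modulo
  \<open>n\<close>. One element can then be reduced modulo \<open>r\<close>, 4 or a prime power, and
  a class \<open>t + D z\<close> can be rescaled, without changing the type. Inverses are powers, so
  monoids suffice for the dichotomy.

  Closedness is tested point by point: the element of \<open>L\<close> that agrees with a given map
  may vary with the point. A proper closed subgroup therefore provides only one orbit that it
  splits, and a maximality claim that is no index argument goes back to the classification of proper
  closed subgroups.

  The number 4 enters because \<open>1 + c\<close> is divisible by 4 when \<open>c\<close> is -1
  modulo 4. The sum of two terms then gains 2-adic valuation, the powers of
  \<open>x -> c x + b\<close> return too early, and a reflection without fixed class modulo 4 can
  generate an intransitive group. The coprimality in the third item says that a power of \<alpha>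
  can be 1 modulo \<open>s\<close> and equal to \<alpha> modulo \<open>r\<close>; this lets a
  translation modulo \<open>s\<close> be tied to the multiplier modulo \<open>r\<close>.\<close>

lemma dvd_lin1: "D dvd x \<Longrightarrow> e = p * x \<Longrightarrow> D dvd e" for D :: int
  by simp

text \<open>Congruences are proved by certificates: the coefficients are given by hand, and the
  equation that remains is a ring identity.\<close>

lemma dvd_lin2: "D dvd x \<Longrightarrow> D dvd y \<Longrightarrow> e = p * x + q * y \<Longrightarrow> D dvd e" for D :: int
  by simp

lemma dvd_lin3: "D dvd x \<Longrightarrow> D dvd y \<Longrightarrow> D dvd z \<Longrightarrow> e = p * x + q * y + r * z \<Longrightarrow> D dvd e" for D :: int
  by simp

text \<open>The quotient of \<open>n\<close> by \<open>gcd k n\<close> becomes a multiple of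
  \<open>n\<close> after multiplication by \<open>k\<close>, so it is one already and the gcd is 1.
  This turns injectivity of a map of points into invertibility of its multiplier.\<close>

lemma coprime_if_mult_inj:
  fixes k n :: int
  assumes "0 < n" and inj: "\<And>m. n dvd k * m \<Longrightarrow> n dvd m"
  shows "coprime k n"
proof -
  obtain m where m: "n = gcd k n * m" by (metis dvdE gcd_dvd2)
  obtain j where j: "k = gcd k n * j" by (metis dvdE gcd_dvd1)
  have "k * m = n * j" using m j by (metis mult.assoc mult.commute)
  then have "n dvd m" using inj by simp
  then have "gcd k n * m dvd 1 * m" using m by simp
  moreover have "m \<noteq> 0" using m assms(1) by auto
  ultimately have "gcd k n dvd 1" by (metis dvd_times_right_cancel_iff)
  then show ?thesis by (simp add: coprime_iff_gcd_eq_1)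
qed

section \<open>Geometric sums\<close>

text \<open>The \<open>k\<close>-th power of the map \<open>x -> c x + b\<close> has translation
  part \<open>b * geo c k\<close>, so these sums decide which points the powers of one affine map
  reach.\<close>

definition geo :: "int \<Rightarrow> nat \<Rightarrow> int" where
  "geo c k = (\<Sum>i<k. c ^ i)"

lemma geo_0 [simp]: "geo c 0 = 0" and geo_Suc: "geo c (Suc k) = geo c k + c ^ k"
  by (simp_all add: geo_def)

lemma geo_add: "geo c (j + k) = geo c j + c ^ j * geo c k"
  by (induction k) (simp_all add: geo_Suc algebra_simps power_add)

lemma geo_diff: "(c - 1) * geo c k = c ^ k - 1"
  by (induction k) (simp_all add: geo_Suc algebra_simps)

lemma geo_mult: "geo c (j * k) = geo c j * geo (c ^ j) k"
proof (induction k)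
  case (Suc k)
  have "geo c (j * Suc k) = geo c (j * k) + c ^ (j * k) * geo c j"
    by (simp only: mult_Suc_right add.commute[of j] geo_add)
  then show ?case using Suc by (simp add: geo_Suc power_mult algebra_simps)
qed simp

lemma dvd_pow_minus_1: "D dvd c - 1 \<Longrightarrow> D dvd c ^ k - 1" for c D :: int
  by (metis geo_diff dvd_mult2)

lemma geo_cong_1: "D dvd c - 1 \<Longrightarrow> D dvd geo c k - int k"
proof (induction k)
  case (Suc k)
  have "D dvd c ^ k - 1" by (rule dvd_pow_minus_1) fact
  then show ?case using Suc dvd_add[of D "geo c k - int k" "c ^ k - 1"]
    by (simp add: geo_Suc algebra_simps)
qed simp

text \<open>With \<open>c = 1 + p t\<close> the binomial expansion gives
  \<open>c ^ i = 1 + i p t\<close> modulo \<open>p^2\<close>, and the linear terms add up to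
  \<open>p t\<close> times \<open>p (p - 1) / 2\<close>, a multiple of \<open>p^2\<close> for odd
  \<open>p\<close>. For \<open>p = 2\<close> the sum is \<open>1 + c\<close>, whence the condition
  modulo 4.\<close>

lemma geo_prime:
  assumes p: "prime (p::nat)" and c: "int p dvd c - 1" and c2: "p = 2 \<Longrightarrow> 4 dvd c - 1"
  shows "(int p)\<^sup>2 dvd geo c p - int p"
proof (cases "p = 2")
  case True
  then show ?thesis using c2 by (simp add: geo_def numeral_2_eq_2)
next
  case False
  obtain t where t: "c = 1 + int p * t" using c by (metis dvdE add_diff_cancel_left' diff_add_cancel add.commute)
  have pw: "(int p)\<^sup>2 dvd c ^ i - (1 + int i * (int p * t))" for i
  proof (induction i)
    case (Suc i)
    have "c ^ Suc i - (1 + int (Suc i) * (int p * t)) = c * (c ^ i - (1 + int i * (int p * t))) + (int p)\<^sup>2 * (int i * t\<^sup>2)"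
      by (simp add: t algebra_simps power2_eq_square)
    then show ?case using Suc by (metis dvd_add dvd_mult dvd_triv_left)
  qed simp
  have sum: "(int p)\<^sup>2 dvd geo c k - (\<Sum>i<k. 1 + int i * (int p * t))" for k
    unfolding geo_def sum_subtractf [symmetric] by (intro dvd_sum pw)
  \<comment> \<open>Twice the sum, to avoid the fraction \<open>p (p - 1) / 2\<close>; the factor 2
    is cancelled at the end because \<open>p\<close> is odd.\<close>
  have gauss: "2 * (\<Sum>i<k. 1 + int i * x) = 2 * int k + x * int k * (int k - 1)" for k and x :: int
    by (induction k) (simp_all add: algebra_simps)
  have "(int p)\<^sup>2 dvd 2 * (geo c p - int p)"
  proof (rule dvd_lin2[OF sum[of p] dvd_refl])
    show "2 * (geo c p - int p) = 2 * (geo c p - (\<Sum>i<p. 1 + int i * (int p * t))) + (t * (int p - 1)) * (int p)\<^sup>2"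
      using gauss[where k = p and x = "int p * t"] by (simp add: algebra_simps power2_eq_square)
  qed
  moreover have "coprime ((int p)\<^sup>2) 2"
    using False p primes_dvd_imp_eq[OF two_is_prime_nat p] by auto
  ultimately show ?thesis using coprime_dvd_mult_right_iff by blast
qed

text \<open>By \<open>geo_mult\<close>, each factor \<open>p\<close> of the exponent contributes a
  factor \<open>p (1 + p v)\<close>. Hence the \<open>p\<close>-adic valuation of the sum is exactly
  \<open>e\<close>, with cofactor 1 modulo \<open>p\<close>.\<close>

lemma geo_prime_power:
  assumes "prime (p::nat)" "int p dvd c - 1" "p = 2 \<Longrightarrow> 4 dvd c - 1"
  shows "\<exists>u. geo c (p ^ e) = int p ^ e * u \<and> int p dvd u - 1"
proof (induction e)
  case 0
  then show ?case by (auto simp: geo_def)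
next
  case (Suc e)
  then obtain u where u: "geo c (p ^ e) = int p ^ e * u" "int p dvd u - 1" by blast
  have "(int p)\<^sup>2 dvd geo (c ^ (p ^ e)) p - int p"
    using assms by (intro geo_prime dvd_pow_minus_1) auto
  then obtain v where v: "geo (c ^ (p ^ e)) p = int p + (int p)\<^sup>2 * v"
    by (metis dvdE add.commute diff_add_cancel)
  have "geo c (p ^ Suc e) = int p ^ Suc e * (u * (1 + int p * v))"
    using geo_mult[of c "p ^ e" p] u v by (simp add: algebra_simps power2_eq_square)
  moreover have "int p dvd u * (1 + int p * v) - 1"
    by (rule dvd_lin2[OF u(2) dvd_refl, where p = 1 and q = "u * v"]) (simp add: algebra_simps)
  ultimately show ?case by blast
qed

text \<open>Approximation by \<open>p\<close>-adic digits: raising the exponent \<open>k\<close> by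
  \<open>p ^ e * j\<close> changes the sum by \<open>p ^ e * j\<close> modulo
  \<open>p ^ (e + 1)\<close>, so the next digit can be corrected.\<close>

lemma geo_surj:
  assumes "prime (p::nat)" "int p dvd c - 1" "p = 2 \<Longrightarrow> 4 dvd c - 1"
  shows "\<exists>k. int p ^ e dvd geo c k - y"
proof (induction e)
  case (Suc e)
  then obtain k z where z: "geo c k - y = int p ^ e * z" by (auto elim!: dvdE)
  obtain u where u: "geo c (p ^ e) = int p ^ e * u" "int p dvd u - 1"
    using geo_prime_power[OF assms] by blast
  have p0: "int p > 0" using assms(1) prime_gt_0_nat by simp
  \<comment> \<open>The digit that cancels the error \<open>z\<close> modulo
    \<open>p\<close>.\<close>
  define j where "j = nat ((- z) mod int p)"
  have j: "int p dvd z + int j"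
    using p0 by (simp add: j_def mod_eq_0_iff_dvd [symmetric] mod_add_right_eq)
  have pu: "int p dvd c ^ k - 1" by (rule dvd_pow_minus_1) fact
  have pg: "int p dvd geo (c ^ (p ^ e)) j - int j" using assms(2) by (intro geo_cong_1 dvd_pow_minus_1)
  have "[z + c ^ k * u * geo (c ^ (p ^ e)) j = z + 1 * 1 * int j] (mod int p)"
    using u(2) pu pg by (intro cong_add cong_mult cong_refl) (auto simp: cong_iff_dvd_diff)
  then have "int p dvd z + c ^ k * u * geo (c ^ (p ^ e)) j" using j by (simp add: cong_dvd_iff)
  moreover have "geo c (k + p ^ e * j) - y = int p ^ e * (z + c ^ k * u * geo (c ^ (p ^ e)) j)"
  proof -
    have "geo c (k + p ^ e * j) = geo c k + c ^ k * (geo c (p ^ e) * geo (c ^ (p ^ e)) j)"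
      by (simp only: geo_add geo_mult)
    then show ?thesis using z u(1) by (simp add: algebra_simps)
  qed
  ultimately have "int p ^ Suc e dvd geo c (k + p ^ e * j) - y"
    by (simp add: mult.commute)
  then show ?case by blast
qed simp

section \<open>Monoids of affine maps\<close>

text \<open>A pair \<open>(c, b)\<close> stands for the map \<open>x \<mapsto> c x + b\<close> on integers.\<close>

definition aff_monoid :: "(int \<times> int) set \<Rightarrow> bool" where
  "aff_monoid S \<longleftrightarrow> (1, 0) \<in> S \<and>
     (\<forall>c b c' b'. (c, b) \<in> S \<longrightarrow> (c', b') \<in> S \<longrightarrow> (c * c', c * b' + b) \<in> S)"

definition aff_transitive :: "(int \<times> int) set \<Rightarrow> int \<Rightarrow> bool" where
  "aff_transitive S m \<longleftrightarrow> (\<forall>x y. \<exists>(c, b) \<in> S. m dvd c * x + b - y)"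

lemma aff_monoid_one: "aff_monoid S \<Longrightarrow> (1, 0) \<in> S"
  by (simp add: aff_monoid_def)

lemma aff_monoid_mult:
  "aff_monoid S \<Longrightarrow> (c, b) \<in> S \<Longrightarrow> (c', b') \<in> S \<Longrightarrow> (c * c', c * b' + b) \<in> S"
  by (simp add: aff_monoid_def)

lemma aff_monoid_pow:
  assumes "aff_monoid S" "(c, b) \<in> S"
  shows "(c ^ k, b * geo c k) \<in> S"
proof (induction k)
  case 0
  then show ?case using assms by (simp add: aff_monoid_one)
next
  case (Suc k)
  then show ?case using aff_monoid_mult[OF assms(1) Suc assms(2)]
    by (simp add: geo_Suc algebra_simps)
qed

lemma aff_transitiveI: "(\<And>x y. \<exists>c b. (c, b) \<in> S \<and> m dvd c * x + b - y) \<Longrightarrow> aff_transitive S m"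
  by (fastforce simp: aff_transitive_def)

lemma aff_transitiveD: "aff_transitive S m \<Longrightarrow> \<exists>c b. (c, b) \<in> S \<and> m dvd c * x + b - y"
  by (fastforce simp: aff_transitive_def)

text \<open>The \<open>k\<close>-th power moves \<open>x\<close> by
  \<open>((c - 1) * x + b) * geo c k\<close>. The first factor is a unit modulo \<open>p\<close>
  because \<open>p\<close> divides \<open>c - 1\<close> but not \<open>b\<close>, and the second
  takes every value modulo \<open>p ^ e\<close>.\<close>

lemma aff_transitive_prime_power:
  assumes S: "aff_monoid S" "(c, b) \<in> S"
    and p: "prime (p::nat)" "int p dvd c - 1" "p = 2 \<Longrightarrow> 4 dvd c - 1" "\<not> int p dvd b"
  shows "aff_transitive S (int p ^ e)"
proof (rule aff_transitiveI)
  fix x y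
  have "\<not> int p dvd (c - 1) * x + b"
    using p(2,4) by (metis dvd_add_right_iff dvd_mult2)
  then have "coprime ((c - 1) * x + b) (int p ^ e)"
    using p(1) prime_imp_coprime[of "int p" "(c - 1) * x + b"] by (simp add: coprime_commute)
  then obtain v where v: "[((c - 1) * x + b) * v = 1] (mod int p ^ e)"
    using cong_solve_coprime_int by blast
  obtain k where k: "int p ^ e dvd geo c k - v * (y - x)"
    using geo_surj[OF p(1-3)] by blast
  have "c ^ k * x + b * geo c k - y = ((c - 1) * x + b) * geo c k - (y - x)"
  proof -
    have "c ^ k = (c - 1) * geo c k + 1" using geo_diff[of c k] by simp
    then show ?thesis by (simp only:) (simp add: algebra_simps)
  qed
  also have "\<dots> = ((c - 1) * x + b) * (geo c k - v * (y - x)) + (y - x) * (((c - 1) * x + b) * v - 1)"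
    by (simp add: algebra_simps)
  finally have "int p ^ e dvd c ^ k * x + b * geo c k - y"
    using k v by (simp add: cong_iff_dvd_diff)
  then show "\<exists>c b. (c, b) \<in> S \<and> int p ^ e dvd c * x + b - y"
    using aff_monoid_pow[OF S] by blast
qed

text \<open>The orbit of \<open>x\<close> modulo \<open>n\<close> is split according to residues
  modulo \<open>m\<close>. Elements of \<open>S\<close> act injectively modulo \<open>n\<close>; by
  transitivity modulo \<open>m\<close> they inject any part into any other, so all \<open>m\<close>
  parts have the same size.\<close>

lemma aff_transitive_imp_dvd_card:
  assumes S: "aff_monoid S" and n: "0 < n" and cop: "\<And>c b. (c, b) \<in> S \<Longrightarrow> coprime c n"
    and m: "m dvd n" "0 < m" "aff_transitive S m"
  shows "m dvd int (card ((\<lambda>(c, b). (c * x + b) mod n) ` S))"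
proof -
  define Orb where "Orb = (\<lambda>(c, b). (c * x + b) mod n) ` S"
  define F where "F j = {z \<in> Orb. z mod m = j}" for j
  have Orb_sub: "Orb \<subseteq> {0..<n}" using n by (auto simp: Orb_def)
  then have fin: "finite Orb" using finite_subset by blast
  have "card (F j) \<le> card (F j')" if jj: "j \<in> {0..<m}" "j' \<in> {0..<m}" for j j'
  proof -
    obtain c b where cb: "(c, b) \<in> S" "m dvd c * j + b - j'"
      using aff_transitiveD[OF m(3)] by blast
    have "inj_on (\<lambda>z. (c * z + b) mod n) (F j)"
    proof (rule inj_onI)
      fix y z assume yz: "y \<in> F j" "z \<in> F j" "(c * y + b) mod n = (c * z + b) mod n"
      then have "n dvd c * (y - z)"
        by (simp add: mod_eq_dvd_iff algebra_simps)
      then have "n dvd y - z" using cop[OF cb(1)]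
        by (simp add: coprime_commute coprime_dvd_mult_right_iff)
      moreover have "y \<in> {0..<n}" "z \<in> {0..<n}" using yz Orb_sub by (auto simp: F_def)
      ultimately show "y = z" by (metis atLeastLessThan_iff mod_eq_dvd_iff mod_pos_pos_trivial)
    qed
    moreover have "(\<lambda>z. (c * z + b) mod n) ` F j \<subseteq> F j'"
    proof clarify
      fix z assume z: "z \<in> F j"
      then obtain c' b' where c': "(c', b') \<in> S" "z = (c' * x + b') mod n" by (auto simp: F_def Orb_def)
      have "(c * z + b) mod n = (c * (c' * x + b') + b) mod n"
        unfolding c'(2) by (metis mod_add_left_eq mod_mult_right_eq)
      also have "\<dots> = (case (c * c', c * b' + b) of (c, b) \<Rightarrow> (c * x + b) mod n)"
        by (simp add: algebra_simps)
      finally have 1: "(c * z + b) mod n \<in> Orb"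
        unfolding Orb_def using aff_monoid_mult[OF S cb(1) c'(1)] by (rule image_eqI)
      have "(c * z + b) mod n mod m = (c * z + b) mod m" using m(1) by (simp add: mod_mod_cancel)
      also have "\<dots> = (c * (z mod m) + b) mod m" by (metis mod_add_left_eq mod_mult_right_eq)
      also have "\<dots> = (c * j + b) mod m" using z by (simp add: F_def)
      also have "\<dots> = j' mod m" using cb(2) by (simp add: mod_eq_dvd_iff)
      also have "\<dots> = j'" using jj by simp
      finally show "(c * z + b) mod n \<in> F j'" using 1 by (simp add: F_def)
    qed
    ultimately show ?thesis
      using fin by (intro card_inj_on_le) (auto simp: F_def)
  qed
  then have eq: "card (F j) = card (F 0)" if "j \<in> {0..<m}" for j
    using that m(2) by (metis atLeastLessThan_iff le_antisym order_refl)
  have "Orb = (\<Union>j\<in>{0..<m}. F j)" using m(2) by (auto simp: F_def)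
  then have "card Orb = card (\<Union>j\<in>{0..<m}. F j)" by (rule arg_cong)
  also have "\<dots> = (\<Sum>j\<in>{0..<m}. card (F j))"
    by (rule card_UN_disjoint) (use fin in \<open>auto simp: F_def\<close>)
  also have "\<dots> = (\<Sum>j\<in>{0..<m}. card (F 0))" by (rule sum.cong[OF refl eq])
  also have "\<dots> = nat m * card (F 0)" by simp
  finally show ?thesis using m(2) by (simp add: Orb_def)
qed

text \<open>Transitivity modulo the prime powers does not combine by Chinese remainders, since
  different primes may use different elements. Instead the size of an orbit modulo \<open>n\<close>
  is divisible by every prime power of \<open>n\<close>, hence by \<open>n\<close>, and the orbit
  contains all residues.\<close>

lemma aff_transitive_if_primes:
  assumes S: "aff_monoid S" and n: "0 < n" and cop: "\<And>c b. (c, b) \<in> S \<Longrightarrow> coprime c n"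
    and tr: "\<And>p. prime p \<Longrightarrow> p dvd n \<Longrightarrow> aff_transitive S (p ^ multiplicity p n)"
  shows "aff_transitive S n"
proof (rule aff_transitiveI)
  fix x y
  define Orb where "Orb = (\<lambda>(c, b). (c * x + b) mod n) ` S"
  have Orb_sub: "Orb \<subseteq> {0..<n}" using n by (auto simp: Orb_def)
  then have fin: "finite Orb" using finite_subset by blast
  have "Orb \<noteq> {}" using aff_monoid_one[OF S] by (auto simp: Orb_def)
  then have pos: "int (card Orb) > 0" using fin by (simp add: card_gt_0_iff)
  have "n dvd int (card Orb)"
  proof (rule multiplicity_le_imp_dvd)
    fix p :: int assume p: "prime p"
    show "multiplicity p n \<le> multiplicity p (int (card Orb))"
    proof (cases "p dvd n")
      case True
      have "p ^ multiplicity p n dvd int (card Orb)"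
        unfolding Orb_def
        by (rule aff_transitive_imp_dvd_card[OF S n cop])
           (use True p tr in \<open>auto simp: multiplicity_dvd prime_gt_0_int\<close>)
      then show ?thesis using pos p by (intro multiplicity_geI) auto
    qed (simp add: not_dvd_imp_multiplicity_0)
  qed (use n in simp)
  then have "n \<le> int (card Orb)" using pos zdvd_imp_le by blast
  then have "card {0..<n} \<le> card Orb" by simp
  then have "Orb = {0..<n}" using Orb_sub card_seteq by blast
  then have "y mod n \<in> Orb" using n by simp
  then obtain c b where "(c, b) \<in> S" "y mod n = (c * x + b) mod n" by (auto simp: Orb_def)
  then show "\<exists>c b. (c, b) \<in> S \<and> n dvd c * x + b - y" by (metis mod_eq_dvd_iff)
qed

section \<open>Multiplicative orders of integers\<close>

text \<open>Passing to the natural representative makes the divisibility facts on orders of natural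
  numbers available for \<alpha>, which may be negative.\<close>

lemma ord_int_eq:
  assumes "0 < D"
  shows "ord D a = ord (nat D) (nat (a mod D))"
proof -
  have 1: "[a ^ i = 1] (mod D) \<longleftrightarrow> [nat (a mod D) ^ i = 1] (mod nat D)" for i
  proof -
    have "[nat (a mod D) ^ i = 1] (mod nat D) \<longleftrightarrow> [int (nat (a mod D) ^ i) = int 1] (mod int (nat D))"
      by (rule cong_int_iff [symmetric])
    also have "\<dots> \<longleftrightarrow> [(a mod D) ^ i = 1] (mod D)" using assms by simp
    also have "\<dots> \<longleftrightarrow> [a ^ i = 1] (mod D)" by (simp add: cong_def power_mod)
    finally show ?thesis by simp
  qed
  have "coprime (nat D) (nat (a mod D)) \<longleftrightarrow> coprime (int (nat D)) (int (nat (a mod D)))"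
    by (rule coprime_int_iff [symmetric])
  also have "\<dots> \<longleftrightarrow> coprime D a" using assms by simp
  finally show ?thesis unfolding ord_def 1 by simp
qed

lemma dvd_power_minus_1_iff_ord: "D dvd a ^ i - 1 \<longleftrightarrow> ord D a dvd i" if "0 < D" for D a :: int
proof -
  have "[nat (a mod D) ^ i = 1] (mod nat D) \<longleftrightarrow> [int (nat (a mod D) ^ i) = int 1] (mod int (nat D))"
    by (rule cong_int_iff [symmetric])
  also have "\<dots> \<longleftrightarrow> [(a mod D) ^ i = 1] (mod D)" using that by simp
  also have "\<dots> \<longleftrightarrow> [a ^ i = 1] (mod D)" by (simp add: cong_def power_mod)
  finally show ?thesis using ord_divides[of "nat (a mod D)" i "nat D"] ord_int_eq[OF that]
    by (simp add: cong_iff_dvd_diff)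
qed

lemma ord_int_pos: "0 < D \<Longrightarrow> coprime D a \<Longrightarrow> 0 < ord D a" for D a :: int
proof -
  assume D: "0 < D" "coprime D a"
  have "coprime (nat D) (nat (a mod D)) \<longleftrightarrow> coprime (int (nat D)) (int (nat (a mod D)))"
    by (rule coprime_int_iff [symmetric])
  also have "\<dots>" using D by simp
  finally show ?thesis using ord_int_eq[OF D(1)] by simp
qed

lemma dvd_power_diff_iff_ord:
  fixes D a :: int
  assumes "0 < D" "coprime D a"
  shows "D dvd a ^ i - a ^ j \<longleftrightarrow> int (ord D a) dvd int i - int j"
proof (induction i j rule: linorder_wlog)
  case (le i j)
  then obtain k where k: "j = i + k" using le_Suc_ex by blast
  have "a ^ i - a ^ j = - (a ^ i * (a ^ k - 1))" by (simp add: k power_add algebra_simps)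
  then have "D dvd a ^ i - a ^ j \<longleftrightarrow> D dvd a ^ k - 1"
    using assms(2) by (simp add: coprime_dvd_mult_right_iff)
  then show ?case using dvd_power_minus_1_iff_ord[OF assms(1), of a k] k by simp
next
  case (sym i j)
  then show ?case by (metis dvd_minus_iff minus_diff_eq)
qed

lemma ex_power_dvd_minus_1:
  fixes D a :: int
  assumes "0 < D" "coprime D a"
  shows "\<exists>k>0. D dvd a ^ k - 1"
  using assms by (intro exI[of _ "ord D a"]) (simp add: dvd_power_minus_1_iff_ord ord_int_pos)

lemma ord_dvd_prime_minus_1:
  fixes r a :: int
  assumes "prime r" "\<not> r dvd a"
  shows "ord r a dvd nat r - 1"
proof -
  have r: "0 < r" using assms prime_gt_0_int by blast
  have pr: "prime (nat r)" using assms(1) by (simp add: prime_nat_iff_prime)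
  have cop: "coprime (nat r) (nat (a mod r)) \<longleftrightarrow> coprime (int (nat r)) (int (nat (a mod r)))"
    by (rule coprime_int_iff [symmetric])
  also have "\<dots>" using r assms by (simp add: prime_imp_coprime)
  finally show ?thesis using order_divides_totient ord_int_eq[OF r] totient_prime[OF pr] by metis
qed

text \<open>By Fermat the order divides \<open>r - 1\<close>. The strict bound later gives
  \<open>s < r\<close> for twisted subgroups and keeps \<open>s\<close> from dividing
  \<open>ord s \<alpha>\<close>.\<close>

lemma ord_prime_less:
  fixes r a :: int
  assumes "prime r" "\<not> r dvd a"
  shows "0 < ord r a" "int (ord r a) < r"
proof -
  have r: "1 < r" using assms prime_gt_1_int by blast
  show "0 < ord r a" using assms r by (intro ord_int_pos) (auto simp: prime_imp_coprime)
  have "ord r a \<le> nat r - 1" using ord_dvd_prime_minus_1[OF assms] r by (intro dvd_imp_le) auto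
  then show "int (ord r a) < r" using r by linarith
qed

section \<open>Intransitive monoids of affine maps\<close>

text \<open>If multiplier 1 modulo \<open>r\<close> forced translation 0, an element would be
  determined modulo \<open>r\<close> by its multiplier. The two products of any two elements share a
  multiplier, so the group would be commutative modulo \<open>r\<close>, and the fixed point of one
  nontrivial element would be fixed by all.\<close>

lemma ex_translation_mod_prime:
  assumes S: "aff_monoid S" and r: "prime r" and cop: "\<And>c b. (c, b) \<in> S \<Longrightarrow> \<not> r dvd c"
    and nofix: "\<And>t. \<exists>c b. (c, b) \<in> S \<and> \<not> r dvd c * t + b - t"
  shows "\<exists>c b. (c, b) \<in> S \<and> r dvd c - 1 \<and> \<not> r dvd b"
proof (rule ccontr)
  assume "\<not> ?thesis"
  then have triv: "r dvd b" if "(c, b) \<in> S" "r dvd c - 1" for c b using that by blast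
  have comm: "r dvd (c1 - 1) * b2 - (c2 - 1) * b1" if 1: "(c1, b1) \<in> S" and 2: "(c2, b2) \<in> S" for c1 b1 c2 b2
  proof -
    define c where "c = c1 * c2"
    define b where "b = c2 * b1 + b2"
    define b' where "b' = c1 * b2 + b1"
    have g: "(c, b) \<in> S" using aff_monoid_mult[OF S 2 1] by (simp add: c_def b_def mult.commute)
    have g': "(c, b') \<in> S" using aff_monoid_mult[OF S 1 2] by (simp add: c_def b'_def)
    obtain k where k: "0 < k" "r dvd c ^ k - 1"
      using ex_power_dvd_minus_1[of r c] r cop[OF g] prime_gt_0_int prime_imp_coprime by blast
    then obtain j where j: "k = Suc j" by (metis gr0_conv_Suc)
    \<comment> \<open>This power has the inverse multiplier modulo \<open>r\<close>; composed with
      either product it has multiplier 1, so both resulting translations vanish modulo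
      \<open>r\<close>.\<close>
    have gj: "(c ^ j, b * geo c j) \<in> S" by (rule aff_monoid_pow[OF S g])
    have "r dvd c * (b * geo c j) + b"
      using aff_monoid_mult[OF S g gj] triv k(2) j by simp
    moreover have "r dvd c * (b * geo c j) + b'"
      using aff_monoid_mult[OF S g' gj] triv k(2) j by simp
    ultimately have "r dvd (c * (b * geo c j) + b') - (c * (b * geo c j) + b)" by (rule dvd_diff[rotated])
    then show ?thesis by (simp add: b_def b'_def algebra_simps)
  qed
  obtain c0 b0 where 0: "(c0, b0) \<in> S" "\<not> r dvd b0" using nofix[of 0] by auto
  then have "\<not> r dvd c0 - 1" using triv by blast
  then have "coprime (c0 - 1) r" using prime_imp_coprime[OF r] coprime_commute by blast
  then obtain v where v: "r dvd (c0 - 1) * v - 1" using cong_solve_coprime_int by (auto simp: cong_iff_dvd_diff)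
  \<comment> \<open>The point \<open>- v * b0\<close> is the fixed point of \<open>(c0, b0)\<close>,
    since \<open>v\<close> inverts \<open>c0 - 1\<close>.\<close>
  obtain c b where cb: "(c, b) \<in> S" "\<not> r dvd c * (- v * b0) + b - (- v * b0)" using nofix by blast
  have "r dvd c * (- v * b0) + b - (- v * b0)"
    by (rule dvd_lin2[OF v comm[OF 0(1) cb(1)], where p = "- b" and q = v]) (simp add: algebra_simps)
  then show False using cb by blast
qed

text \<open>A map with multiplier 1 and translation 2 modulo 4 moves every point by twice an odd
  number, so its powers reach all points of the same parity; \<open>(ch, bh)\<close> exchanges the
  parities.\<close>

lemma aff_transitive_2_power:
  assumes S: "aff_monoid S" and odd: "\<And>c b. (c, b) \<in> S \<Longrightarrow> odd c"
    and h: "(ch, bh) \<in> S" "odd bh" and g: "(cg, bg) \<in> S" "4 dvd cg - 1" "4 dvd bg - 2"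
  shows "aff_transitive S (2 ^ e)"
proof (rule aff_transitiveI)
  fix x y :: int
  have even_case: "\<exists>c b. (c, b) \<in> S \<and> 2 ^ e dvd c * z + b - y" if "even (z - y)" for z
  proof -
    obtain t where t: "cg = 1 + 4 * t" using g(2) by (metis dvdE add.commute diff_add_cancel)
    obtain u where u: "bg = 2 + 4 * u" using g(3) by (metis dvdE add.commute diff_add_cancel)
    have "even (y - z)" using that by presburger
    then obtain w where w: "y - z = 2 * w" by (elim dvdE)
    \<comment> \<open>Half of the displacement \<open>(cg - 1) * z + bg\<close>; it is odd.\<close>
    define q where "q = 2 * t * z + 1 + 2 * u"
    have "coprime q (2 ^ e)" by (simp add: q_def)
    then obtain v where v: "2 ^ e dvd q * v - 1"
      by (metis cong_solve_coprime_int cong_iff_dvd_diff)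
    obtain k where k: "2 ^ e dvd geo cg k - v * w"
      using geo_surj[of 2 cg e "v * w"] g(2) two_is_prime_nat dvd_trans[of 2 4 "cg - 1"] by auto
    have "cg ^ k = (cg - 1) * geo cg k + 1" using geo_diff[of cg k] by simp
    then have "cg ^ k * z + bg * geo cg k - y = 2 * (q * geo cg k - w)"
      using w by (simp only: t u q_def) (simp add: algebra_simps)
    also have "\<dots> = (2 * q) * (geo cg k - v * w) + (2 * w) * (q * v - 1)" by (simp add: algebra_simps)
    finally have "2 ^ e dvd cg ^ k * z + bg * geo cg k - y"
      using k v by simp
    then show ?thesis using aff_monoid_pow[OF S g(1)] by blast
  qed
  show "\<exists>c b. (c, b) \<in> S \<and> 2 ^ e dvd c * x + b - y"
  proof (cases "even (x - y)")
    case False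
    have "even (ch * x + bh - y)" using False h odd[OF h(1)] by auto
    then obtain c b where cb: "(c, b) \<in> S" "2 ^ e dvd c * (ch * x + bh) + b - y"
      using even_case by blast
    then have "2 ^ e dvd (c * ch) * x + (c * bh + b) - y" by (simp add: algebra_simps)
    then show ?thesis using aff_monoid_mult[OF S cb(1) h(1)] by blast
  qed (rule even_case)
qed

text \<open>In the pair case the image of \<open>S\<close> modulo 4 consists of the identity and the
  reflection \<open>x -> \<beta> - x\<close>, which fixes no class because \<beta> is odd. The
  witness \<open>(c0, b0)\<close> records that the reflection does occur.\<close>

theorem aff_monoid_intransitive:
  assumes S: "aff_monoid S" and n: "0 < n" and cop: "\<And>c b. (c, b) \<in> S \<Longrightarrow> coprime c n"
    and intr: "\<not> aff_transitive S n"
  obtains (point) r t where "prime r" "r dvd n" "\<And>c b. (c, b) \<in> S \<Longrightarrow> r dvd c * t + b - t"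
  | (pair) \<beta> c0 b0 where "4 dvd n" "odd \<beta>" "(c0, b0) \<in> S" "4 dvd c0 + 1"
      "\<And>c b. (c, b) \<in> S \<Longrightarrow> 4 dvd c - 1 \<and> 4 dvd b \<or> 4 dvd c + 1 \<and> 4 dvd b - \<beta>"
proof (cases "\<exists>r t. prime r \<and> r dvd n \<and> (\<forall>c b. (c, b) \<in> S \<longrightarrow> r dvd c * t + b - t)")
  case True
  then show ?thesis using point by blast
next
  case False
  have el: "\<exists>c b. (c, b) \<in> S \<and> r dvd c - 1 \<and> \<not> r dvd b" if r: "prime r" "r dvd n" for r
  proof (rule ex_translation_mod_prime[OF S r(1)])
    show "\<not> r dvd c" if "(c, b) \<in> S" for c b
      using cop[OF that] r by (metis coprime_common_divisor not_prime_unit)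
  qed (use r False in blast)
  have "\<exists>p. prime p \<and> p dvd n \<and> \<not> aff_transitive S (p ^ multiplicity p n)"
  proof (rule ccontr)
    assume "\<not> ?thesis"
    then have "aff_transitive S n" by (intro aff_transitive_if_primes[OF S n cop]) auto
    then show False using intr by simp
  qed
  then obtain p where p: "prime p" "p dvd n" "\<not> aff_transitive S (p ^ multiplicity p n)" by blast
  have p_nat: "prime (nat p)" "int (nat p) = p"
    using p(1) prime_gt_0_int[OF p(1)] by (simp_all add: prime_nat_iff_prime)
  obtain ch bh where h: "(ch, bh) \<in> S" "p dvd ch - 1" "\<not> p dvd bh" using el p by blast
  have p2: "p = 2"
  proof (rule ccontr)
    assume "p \<noteq> 2"
    then have "aff_transitive S (int (nat p) ^ multiplicity p n)"
      using h p_nat by (intro aff_transitive_prime_power[OF S h(1) p_nat(1)]) auto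
    then show False using p(3) p_nat by simp
  qed
  \<comment> \<open>Otherwise the 2-part of \<open>n\<close> is at most 2, and
    \<open>(ch, bh)\<close>, which exchanges the parities, makes \<open>S\<close> transitive modulo
    it.\<close>
  have n4: "4 dvd n"
  proof (rule ccontr)
    assume n4: "\<not> 4 dvd n"
    have "multiplicity 2 n < 2"
    proof (rule ccontr)
      assume "\<not> multiplicity 2 n < 2"
      then have "(2::int) ^ 2 dvd n" by (intro multiplicity_dvd') simp
      then show False using n4 by simp
    qed
    moreover have "aff_transitive S (2 ^ e)" if "e < 2" for e
    proof (rule aff_transitiveI)
      fix x y
      have "e = 0 \<or> e = 1" using that by auto
      moreover have "\<exists>c b. (c, b) \<in> S \<and> even (c * x + b - y)"
      proof (cases "even (x - y)")
        case True
        then show ?thesis using aff_monoid_one[OF S] by (metis add.right_neutral mult_1)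
      next
        case False
        then have "even (ch * x + bh - y)" using h p2 by auto
        then show ?thesis using h(1) by blast
      qed
      moreover have "2 ^ e dvd z" if "e = 0 \<or> e = 1" "even z" for z :: int
        using that by auto
      ultimately show "\<exists>c b. (c, b) \<in> S \<and> 2 ^ e dvd c * x + b - y" by blast
    qed
    ultimately show False using p(3) p2 by blast
  qed
  have odd_c: "odd c" if "(c, b) \<in> S" for c b
  proof -
    have "2 dvd n" by (rule dvd_trans[OF _ n4]) simp
    then have "coprime c 2" using cop[OF that] coprime_divisors[OF dvd_refl] by blast
    then show ?thesis by simp
  qed
  have c4: "4 dvd c - 1 \<or> 4 dvd c + 1" if "odd c" for c :: int using that by presburger
  \<comment> \<open>An odd translation with multiplier 1 modulo 4 has powers that are transitive
    modulo every power of 2.\<close>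
  have h': "4 dvd c + 1" if "(c, b) \<in> S" "odd b" for c b
  proof (rule ccontr)
    assume "\<not> 4 dvd c + 1"
    then have "4 dvd c - 1" using c4 odd_c that by blast
    then have "aff_transitive S (int 2 ^ multiplicity p n)"
      by (intro aff_transitive_prime_power[OF S that(1)]) (use that odd_c in auto)
    then show False using p(3) p2 by simp
  qed
  have hodd: "odd bh" using h p2 by simp
  \<comment> \<open>Composition with \<open>(ch, bh)\<close> makes the translation odd, so the
    composite has multiplier -1 modulo 4 and \<open>c\<close> is 1 modulo 4. Translation 2 modulo 4
    is excluded by \<open>aff_transitive_2_power\<close>.\<close>
  have even_b: "4 dvd c - 1 \<and> 4 dvd b" if cb: "(c, b) \<in> S" "even b" for c b
  proof -
    have "odd (ch * b + bh)" using cb hodd by simp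
    then have "4 dvd ch * c + 1" using h' aff_monoid_mult[OF S h(1) cb(1)] by blast
    moreover have "4 dvd ch + 1" using h' h(1) hodd by blast
    ultimately have c: "4 dvd c - 1"
      by (rule dvd_lin2[where p = "-1" and q = c]) (simp add: algebra_simps)
    moreover have "\<not> 4 dvd b - 2"
    proof
      assume "4 dvd b - 2"
      then have "aff_transitive S (2 ^ multiplicity p n)"
        by (intro aff_transitive_2_power[OF S _ h(1) hodd cb(1) c]) (use odd_c in auto)
      then show False using p(3) p2 by simp
    qed
    ultimately show ?thesis using cb(2) by presburger
  qed
  have "4 dvd b - bh" if "(c, b) \<in> S" "odd b" for c b
  proof -
    have "4 dvd ch * b + bh" using even_b aff_monoid_mult[OF S h(1) that(1)] that(2) hodd odd_c[OF h(1)] by simp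
    then show ?thesis using h'[OF h(1) hodd]
      by (rule dvd_lin2[where p = "-1" and q = b]) (simp add: algebra_simps)
  qed
  then show ?thesis by (intro pair[OF n4 hodd h(1) h'[OF h(1) hodd]]) (metis h' even_b)
qed

section \<open>Subgroups of the affine group modulo n\<close>

locale affine_group =
  fixes n \<alpha> :: int
  assumes n_pos: "0 < n" and cop: "coprime \<alpha> n"
begin

definition mults :: "int set" where
  "mults = {c. \<exists>i::nat. n dvd c - \<alpha> ^ i}"

text \<open>Subgroups of the affine group modulo \<open>n\<close>, as saturated sets of integer
  pairs; the inverses are powers, see \<open>affsub_inv\<close>.\<close>

definition affsub :: "(int \<times> int) set \<Rightarrow> bool" where
  "affsub S \<longleftrightarrow> aff_monoid S \<and> (\<forall>c b. (c, b) \<in> S \<longrightarrow> c \<in> mults) \<and>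
     (\<forall>c b c' b'. (c, b) \<in> S \<longrightarrow> n dvd c' - c \<longrightarrow> n dvd b' - b \<longrightarrow> (c', b') \<in> S)"

definition affclosed :: "(int \<times> int) set \<Rightarrow> bool" where
  "affclosed S \<longleftrightarrow> affsub S \<and>
     (\<forall>c b. c \<in> mults \<longrightarrow> (\<forall>x. \<exists>c' b'. (c', b') \<in> S \<and> n dvd c * x + b - (c' * x + b')) \<longrightarrow> (c, b) \<in> S)"

definition full :: "(int \<times> int) set" where
  "full = {(c, b). c \<in> mults}"

lemma mults_pow [simp]: "\<alpha> ^ i \<in> mults"
  by (auto simp: mults_def intro: exI[of _ i])

lemma mults_one [simp]: "1 \<in> mults"
  using mults_pow[of 0] by simp

lemma mults_gen [simp]: "\<alpha> \<in> mults"
  using mults_pow[of 1] by simp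

lemma mults_mult: "c \<in> mults \<Longrightarrow> c' \<in> mults \<Longrightarrow> c * c' \<in> mults"
proof -
  assume "c \<in> mults" "c' \<in> mults"
  then obtain i j where ij: "n dvd c - \<alpha> ^ i" "n dvd c' - \<alpha> ^ j" by (auto simp: mults_def)
  have "n dvd c * c' - \<alpha> ^ (i + j)"
    by (rule dvd_lin2[OF ij, where p = c' and q = "\<alpha> ^ i"]) (simp add: power_add algebra_simps)
  then show ?thesis by (auto simp: mults_def)
qed

lemma mults_cong: "c \<in> mults \<Longrightarrow> n dvd c' - c \<Longrightarrow> c' \<in> mults"
proof -
  assume "c \<in> mults" "n dvd c' - c"
  then obtain i where i: "n dvd c - \<alpha> ^ i" by (auto simp: mults_def)
  have "n dvd c' - \<alpha> ^ i" using dvd_add[OF \<open>n dvd c' - c\<close> i] by simp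
  then show ?thesis by (auto simp: mults_def)
qed

lemma mults_coprime: "c \<in> mults \<Longrightarrow> D dvd n \<Longrightarrow> coprime c D"
proof -
  assume "c \<in> mults" "D dvd n"
  then obtain i where "n dvd c - \<alpha> ^ i" by (auto simp: mults_def)
  then have "[\<alpha> ^ i = c] (mod n)" by (simp add: cong_iff_dvd_diff dvd_diff_commute)
  moreover have "coprime (\<alpha> ^ i) n" using cop by simp
  ultimately have "coprime c n" by (metis cong_imp_coprime)
  then show ?thesis by (rule coprime_divisors[OF dvd_refl \<open>D dvd n\<close>])
qed

lemma mults_prime: "c \<in> mults \<Longrightarrow> r dvd n \<Longrightarrow> prime r \<Longrightarrow> \<not> r dvd c"
  using mults_coprime[of c r] by (metis coprime_absorb_right not_prime_unit)

lemma affsub_monoid: "affsub S \<Longrightarrow> aff_monoid S"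
  by (simp add: affsub_def)

lemma affsub_mults: "affsub S \<Longrightarrow> (c, b) \<in> S \<Longrightarrow> c \<in> mults"
  by (auto simp: affsub_def)

lemma affsub_cong: "affsub S \<Longrightarrow> (c, b) \<in> S \<Longrightarrow> n dvd c' - c \<Longrightarrow> n dvd b' - b \<Longrightarrow> (c', b') \<in> S"
  by (auto simp: affsub_def)

lemma affsub_mult: "affsub S \<Longrightarrow> (c, b) \<in> S \<Longrightarrow> (c', b') \<in> S \<Longrightarrow> (c * c', c * b' + b) \<in> S"
  using affsub_monoid aff_monoid_mult by blast

lemma affsub_one: "affsub S \<Longrightarrow> (1, 0) \<in> S"
  using affsub_monoid aff_monoid_one by blast

lemma affsub_pow: "affsub S \<Longrightarrow> (c, b) \<in> S \<Longrightarrow> (c ^ k, b * geo c k) \<in> S"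
  using affsub_monoid aff_monoid_pow by blast

lemma affsub_full: "affsub S \<Longrightarrow> S \<subseteq> full"
  using affsub_mults by (auto simp: full_def)

text \<open>Some power of the element is the identity modulo \<open>n\<close>, and the power before
  it is the inverse.\<close>

lemma affsub_inv:
  assumes "affsub S" "(c, b) \<in> S"
  obtains c' b' where "(c', b') \<in> S" "n dvd c * c' - 1" "n dvd c * b' + b" "n dvd c' * b + b'"
proof -
  have "coprime n c" using mults_coprime[OF affsub_mults[OF assms] dvd_refl] coprime_commute by blast
  then obtain k where k: "0 < k" "n dvd c ^ k - 1" using ex_power_dvd_minus_1[OF n_pos] by blast
  \<comment> \<open>The exponent \<open>k\<close> only makes the multiplier trivial. The further
    factor \<open>n\<close> kills the translation: a sum of \<open>n\<close> terms that are 1 modulo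
    \<open>n\<close> is divisible by \<open>n\<close>.\<close>
  define m where "m = k * nat n"
  have m: "0 < m" using k(1) n_pos by (simp add: m_def)
  then obtain j where j: "m = Suc j" using gr0_conv_Suc by blast
  have "n dvd (c ^ k) ^ nat n - 1" by (rule dvd_pow_minus_1[OF k(2)])
  then have cm: "n dvd c ^ m - 1" by (simp add: m_def power_mult)
  have "n dvd geo (c ^ k) (nat n) - int (nat n)" by (rule geo_cong_1[OF k(2)])
  then have "n dvd geo (c ^ k) (nat n) - n" using n_pos by simp
  then have "n dvd geo (c ^ k) (nat n)" by (metis dvd_add_triv_right_iff diff_add_cancel)
  then have gm: "n dvd geo c m" by (simp add: m_def geo_mult)
  have "(c ^ j, b * geo c j) \<in> S" by (rule affsub_pow[OF assms])
  moreover have "n dvd c * c ^ j - 1" using cm j by simp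
  moreover have "c * (b * geo c j) + b = b * geo c m"
    using geo_add[of c 1 j] by (simp add: j geo_Suc algebra_simps)
  then have "n dvd c * (b * geo c j) + b" using gm by simp
  moreover have "c ^ j * b + b * geo c j = b * geo c m"
    by (simp add: j geo_Suc algebra_simps)
  then have "n dvd c ^ j * b + b * geo c j" using gm by simp
  ultimately show ?thesis by (rule that)
qed

lemma affsub_transl_mult: "affsub S \<Longrightarrow> (1, b) \<in> S \<Longrightarrow> (1, k * b) \<in> S" for k :: int
proof -
  assume S: "affsub S" "(1, b) \<in> S"
  have "(1 ^ nat (k mod n), b * geo 1 (nat (k mod n))) \<in> S" by (rule affsub_pow[OF S])
  then have "(1, b * (k mod n)) \<in> S" using n_pos by (simp add: geo_def)
  moreover have "n dvd k * b - b * (k mod n)"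
  proof -
    have "k * b - b * (k mod n) = b * (k - k mod n)" by (simp add: algebra_simps)
    then show ?thesis by (simp add: minus_mod_eq_mult_div)
  qed
  ultimately show ?thesis using affsub_cong[OF S(1)] by simp
qed

lemma affsub_transl:
  assumes "affsub S" "(c, b) \<in> S" "(c, b') \<in> S"
  shows "(1, b - b') \<in> S"
proof -
  obtain c'' b'' where i: "(c'', b'') \<in> S" "n dvd c * c'' - 1" "n dvd c * b'' + b'"
    using affsub_inv[OF assms(1,3)] by metis
  have "(c * c'', c * b'' + b) \<in> S" by (rule affsub_mult[OF assms(1,2) i(1)])
  moreover have "n dvd 1 - c * c''" using i(2) by (simp add: dvd_diff_commute)
  moreover have "n dvd (b - b') - (c * b'' + b)"
    by (rule dvd_lin1[OF i(3), where p = "-1"]) simp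
  ultimately show ?thesis using affsub_cong[OF assms(1)] by blast
qed

lemma affsub_add_transl:
  assumes "affsub S" "(c, b') \<in> S" "(1, b - b') \<in> S"
  shows "(c, b) \<in> S"
  using affsub_mult[OF assms(1,3,2)] by simp

lemma affclosed_sub: "affclosed S \<Longrightarrow> affsub S"
  by (simp add: affclosed_def)

lemma affclosedD:
  "affclosed S \<Longrightarrow> c \<in> mults \<Longrightarrow> (\<And>x. \<exists>c' b'. (c', b') \<in> S \<and> n dvd c * x + b - (c' * x + b')) \<Longrightarrow> (c, b) \<in> S"
  by (simp add: affclosed_def)

lemma affclosedI:
  assumes "affsub S"
    and "\<And>c b. c \<in> mults \<Longrightarrow> (\<And>x. \<exists>c' b'. (c', b') \<in> S \<and> n dvd c * x + b - (c' * x + b')) \<Longrightarrow> (c, b) \<in> S"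
  shows "affclosed S"
  using assms by (simp add: affclosed_def)

lemma affsubI:
  assumes "(1, 0) \<in> S" "\<And>c b. (c, b) \<in> S \<Longrightarrow> c \<in> mults"
    and "\<And>c b c' b'. (c, b) \<in> S \<Longrightarrow> (c', b') \<in> S \<Longrightarrow> (c * c', c * b' + b) \<in> S"
    and "\<And>c b c' b'. (c, b) \<in> S \<Longrightarrow> n dvd c' - c \<Longrightarrow> n dvd b' - b \<Longrightarrow> (c', b') \<in> S"
  shows "affsub S"
  unfolding affsub_def aff_monoid_def using assms by blast

section \<open>The closed subgroups of the classification\<close>

definition point_stab :: "int \<Rightarrow> int \<Rightarrow> (int \<times> int) set" where
  "point_stab D t = {(c, b). c \<in> mults \<and> D dvd c * t + b - t}"

text \<open>The setwise stabilizer of the classes of \<open>t\<close> and \<open>t + u\<close> modulo \<open>D\<close>.\<close>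

definition pair_stab :: "int \<Rightarrow> int \<Rightarrow> int \<Rightarrow> (int \<times> int) set" where
  "pair_stab D t u = {(c, b). c \<in> mults \<and>
     (D dvd c * t + b - t \<and> D dvd c * u - u \<or> D dvd c * t + b - t - u \<and> D dvd c * u + u)}"

definition index_sub :: "nat \<Rightarrow> int \<Rightarrow> (int \<times> int) set" where
  "index_sub s r = {(c, b). r dvd b \<and> (\<exists>j. n dvd c - \<alpha> ^ (s * j))}"

text \<open>Since \<alpha> to the power \<open>ord s \<alpha>\<close> is 1 modulo \<open>s\<close>,
  the \<open>i\<close>-th power of the map with this multiplier and translation \<open>r * l\<close>
  has translation \<open>r * l * i\<close> modulo \<open>s * r\<close>. Only \<open>l = 1\<close> is
  listed; other values occur before conjugation.\<close>

definition twisted_sub :: "int \<Rightarrow> int \<Rightarrow> int \<Rightarrow> (int \<times> int) set" where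
  "twisted_sub s r l =
     {(c, b). \<exists>i. n dvd c - \<alpha> ^ (ord s \<alpha> * i) \<and> s * r dvd b - r * l * int i}"

text \<open>The elements acting trivially on the residues modulo 4: a pair stabilizer without its
  reflections.\<close>

definition ker4 :: "(int \<times> int) set" where
  "ker4 = {(c, b). c \<in> mults \<and> 4 dvd c - 1 \<and> 4 dvd b}"

lemma affsub_full_self: "affsub full"
  by (rule affsubI) (auto simp: full_def intro: mults_mult mults_cong)

text \<open>Membership depends only on the image of \<open>t\<close> modulo \<open>D\<close>, so the
  orbit condition is evaluated at the point \<open>t\<close>.\<close>

lemma affclosed_point_stab:
  assumes D: "D dvd n"
  shows "affclosed (point_stab D t)"
proof (rule affclosedI)
  show "affsub (point_stab D t)"
  proof (rule affsubI)
    fix c b c' b' assume a: "(c, b) \<in> point_stab D t" "(c', b') \<in> point_stab D t"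
    then have "D dvd c * t + b - t" "D dvd c' * t + b' - t" by (auto simp: point_stab_def)
    then have "D dvd c * c' * t + (c * b' + b) - t"
      by (rule dvd_lin2[where p = 1 and q = c]) (simp add: algebra_simps)
    then show "(c * c', c * b' + b) \<in> point_stab D t"
      using a by (auto simp: point_stab_def mults_mult)
  next
    fix c b c' b' assume a: "(c, b) \<in> point_stab D t" "n dvd c' - c" "n dvd b' - b"
    then have "D dvd c * t + b - t" "D dvd c' - c" "D dvd b' - b"
      using D by (auto simp: point_stab_def intro: dvd_trans)
    then have "D dvd c' * t + b' - t"
      by (rule dvd_lin3[where p = 1 and q = t and r = 1]) (simp add: algebra_simps)
    then show "(c', b') \<in> point_stab D t"
      using a by (auto simp: point_stab_def intro: mults_cong)
  qed (auto simp: point_stab_def)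
  fix c b assume c: "c \<in> mults"
    and a: "\<And>x. \<exists>c' b'. (c', b') \<in> point_stab D t \<and> n dvd c * x + b - (c' * x + b')"
  from a[of t] obtain c' b' where 1: "D dvd c' * t + b' - t" "n dvd c * t + b - (c' * t + b')"
    by (auto simp: point_stab_def)
  have "D dvd c * t + b - (c' * t + b')" by (rule dvd_trans[OF D 1(2)])
  then have "D dvd c * t + b - t" using 1(1)
    by (rule dvd_lin2[where p = 1 and q = 1]) simp
  then show "(c, b) \<in> point_stab D t" using c by (simp add: point_stab_def)
qed

text \<open>The test points are \<open>t\<close> and \<open>t + u\<close>. Sending both to the same
  class gives \<open>D dvd c * u\<close>, hence \<open>D dvd u\<close> because \<open>c\<close> is a
  unit, and then the two classes of the pair coincide.\<close>

lemma affclosed_pair_stab: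
  assumes D: "D dvd n"
  shows "affclosed (pair_stab D t u)"
proof (rule affclosedI)
  show "affsub (pair_stab D t u)"
  proof (rule affsubI)
    fix c b c' b' assume a: "(c, b) \<in> pair_stab D t u" "(c', b') \<in> pair_stab D t u"
    have m: "c * c' \<in> mults" using a by (auto simp: pair_stab_def mults_mult)
    consider (11) "D dvd c * t + b - t" "D dvd c * u - u" "D dvd c' * t + b' - t" "D dvd c' * u - u"
      | (12) "D dvd c * t + b - t" "D dvd c * u - u" "D dvd c' * t + b' - t - u" "D dvd c' * u + u"
      | (21) "D dvd c * t + b - t - u" "D dvd c * u + u" "D dvd c' * t + b' - t" "D dvd c' * u - u"
      | (22) "D dvd c * t + b - t - u" "D dvd c * u + u" "D dvd c' * t + b' - t - u" "D dvd c' * u + u"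
      using a by (auto simp: pair_stab_def)
    then have "D dvd c * c' * t + (c * b' + b) - t \<and> D dvd c * c' * u - u
      \<or> D dvd c * c' * t + (c * b' + b) - t - u \<and> D dvd c * c' * u + u"
    proof cases
      case 11
      have "D dvd c * c' * t + (c * b' + b) - t"
        by (rule dvd_lin2[OF 11(1,3), where p = 1 and q = c]) (simp add: algebra_simps)
      moreover have "D dvd c * c' * u - u"
        by (rule dvd_lin2[OF 11(2,4), where p = 1 and q = c]) (simp add: algebra_simps)
      ultimately show ?thesis by blast
    next
      case 12
      have "D dvd c * c' * t + (c * b' + b) - t - u"
        by (rule dvd_lin3[OF 12(1,2,3), where p = 1 and q = 1 and r = c]) (simp add: algebra_simps)
      moreover have "D dvd c * c' * u + u"
        by (rule dvd_lin2[OF 12(2,4), where p = "-1" and q = c]) (simp add: algebra_simps)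
      ultimately show ?thesis by blast
    next
      case 21
      have "D dvd c * c' * t + (c * b' + b) - t - u"
        by (rule dvd_lin2[OF 21(1,3), where p = 1 and q = c]) (simp add: algebra_simps)
      moreover have "D dvd c * c' * u + u"
        by (rule dvd_lin2[OF 21(2,4), where p = 1 and q = c]) (simp add: algebra_simps)
      ultimately show ?thesis by blast
    next
      case 22
      have "D dvd c * c' * t + (c * b' + b) - t"
        by (rule dvd_lin3[OF 22(1,2,3), where p = 1 and q = 1 and r = c]) (simp add: algebra_simps)
      moreover have "D dvd c * c' * u - u"
        by (rule dvd_lin2[OF 22(2,4), where p = "-1" and q = c]) (simp add: algebra_simps)
      ultimately show ?thesis by blast
    qed
    then show "(c * c', c * b' + b) \<in> pair_stab D t u" using m by (auto simp: pair_stab_def)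
  next
    fix c b c' b' assume a: "(c, b) \<in> pair_stab D t u" "n dvd c' - c" "n dvd b' - b"
    have d: "D dvd c' - c" "D dvd b' - b" using a D dvd_trans by blast+
    have "D dvd c' * t + b' - v" if "D dvd c * t + b - v" for v
      by (rule dvd_lin3[OF that d, where p = 1 and q = t and r = 1]) (simp add: algebra_simps)
    from this[of t] this[of "t + u"] have 1: "D dvd c * t + b - t \<Longrightarrow> D dvd c' * t + b' - t"
      "D dvd c * t + b - t - u \<Longrightarrow> D dvd c' * t + b' - t - u" by (simp_all add: algebra_simps)
    have 2: "D dvd c' * u - v" if "D dvd c * u - v" for v
      by (rule dvd_lin2[OF that d(1), where p = 1 and q = u]) (simp add: algebra_simps)
    from this[of u] this[of "-u"] show "(c', b') \<in> pair_stab D t u"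
      using a 1 by (auto simp: pair_stab_def intro: mults_cong)
  qed (auto simp: pair_stab_def)
  fix c b assume c: "c \<in> mults"
    and a: "\<And>x. \<exists>c' b'. (c', b') \<in> pair_stab D t u \<and> n dvd c * x + b - (c' * x + b')"
  have t: "D dvd c * t + b - t \<or> D dvd c * t + b - t - u"
  proof -
    from a[of t] obtain c' b' where b': "(c', b') \<in> pair_stab D t u" "n dvd c * t + b - (c' * t + b')"
      by blast
    have "D dvd c * t + b - (c' * t + b')" using b'(2) D dvd_trans by blast
    then have "D dvd c * t + b - v" if "D dvd c' * t + b' - v" for v
      using that by (rule dvd_lin2[where p = 1 and q = 1]) simp
    from this[of t] this[of "t + u"] show ?thesis using b'(1) by (auto simp: pair_stab_def algebra_simps)
  qed
  have tu: "D dvd c * (t + u) + b - t \<or> D dvd c * (t + u) + b - t - u"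
  proof -
    from a[of "t + u"] obtain c' b' where b': "(c', b') \<in> pair_stab D t u"
      "n dvd c * (t + u) + b - (c' * (t + u) + b')" by blast
    have d: "D dvd c * (t + u) + b - (c' * (t + u) + b')" using b'(2) D dvd_trans by blast
    from b'(1) consider "D dvd c' * t + b' - t" "D dvd c' * u - u"
      | "D dvd c' * t + b' - t - u" "D dvd c' * u + u" by (auto simp: pair_stab_def)
    then show ?thesis
    proof cases
      case 1
      have "D dvd c * (t + u) + b - t - u"
        by (rule dvd_lin3[OF d 1, where p = 1 and q = 1 and r = 1]) (simp add: algebra_simps)
      then show ?thesis ..
    next
      case 2
      have "D dvd c * (t + u) + b - t"
        by (rule dvd_lin3[OF d 2, where p = 1 and q = 1 and r = 1]) (simp add: algebra_simps)
      then show ?thesis ..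
    qed
  qed
  have u0: "D dvd u" if "D dvd c * u"
    using that mults_coprime[OF c D] by (metis coprime_commute coprime_dvd_mult_right_iff)
  have "D dvd c * t + b - t \<and> D dvd c * u - u \<or> D dvd c * t + b - t - u \<and> D dvd c * u + u"
    using t tu
  proof (elim disjE)
    assume h: "D dvd c * t + b - t" "D dvd c * (t + u) + b - t"
    have "D dvd c * u" by (rule dvd_lin2[OF h, where p = "-1" and q = 1]) (simp add: algebra_simps)
    then show ?thesis using h u0 by simp
  next
    assume h: "D dvd c * t + b - t" "D dvd c * (t + u) + b - t - u"
    have "D dvd c * u - u" by (rule dvd_lin2[OF h, where p = "-1" and q = 1]) (simp add: algebra_simps)
    then show ?thesis using h by simp
  next
    assume h: "D dvd c * t + b - t - u" "D dvd c * (t + u) + b - t"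
    have "D dvd c * u + u" by (rule dvd_lin2[OF h, where p = "-1" and q = 1]) (simp add: algebra_simps)
    then show ?thesis using h by simp
  next
    assume h: "D dvd c * t + b - t - u" "D dvd c * (t + u) + b - t - u"
    have "D dvd c * u" by (rule dvd_lin2[OF h, where p = "-1" and q = 1]) (simp add: algebra_simps)
    then show ?thesis using h u0 by simp
  qed
  then show "(c, b) \<in> pair_stab D t u" using c by (simp add: pair_stab_def)
qed

lemma dvd_power_diffD:
  assumes "r dvd n" "0 < r" "r dvd \<alpha> ^ i - \<alpha> ^ j" "s dvd ord r \<alpha>"
  shows "int s dvd int i - int j"
proof -
  have "coprime r \<alpha>" using coprime_divisors[OF dvd_refl assms(1) cop] by (simp add: coprime_commute)
  then have "int (ord r \<alpha>) dvd int i - int j"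
    using dvd_power_diff_iff_ord assms by blast
  then show ?thesis using assms(4) by (meson dvd_trans int_dvd_int_iff)
qed

text \<open>At the point 0 the orbit condition yields the translation modulo \<open>r\<close>, at 1
  then the multiplier modulo \<open>r\<close>. The latter determines the exponent of \<alpha> modulo
  \<open>ord r \<alpha>\<close>, hence modulo its divisor \<open>s\<close>.\<close>

lemma affclosed_index_sub:
  assumes r: "prime r" "r dvd n" and s: "s dvd ord r \<alpha>"
  shows "affclosed (index_sub s r)"
proof (rule affclosedI)
  show "affsub (index_sub s r)"
  proof (rule affsubI)
    show "(1, 0) \<in> index_sub s r" by (auto simp: index_sub_def intro: exI[of _ 0])
    show "c \<in> mults" if "(c, b) \<in> index_sub s r" for c b
      using that by (auto simp: index_sub_def mults_def)
    fix c b c' b' assume "(c, b) \<in> index_sub s r"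
    then obtain i where i: "r dvd b" "n dvd c - \<alpha> ^ (s * i)" by (auto simp: index_sub_def)
    {
      assume "(c', b') \<in> index_sub s r"
      then obtain j where j: "r dvd b'" "n dvd c' - \<alpha> ^ (s * j)" by (auto simp: index_sub_def)
      have "n dvd c * c' - \<alpha> ^ (s * (i + j))"
        by (rule dvd_lin2[OF i(2) j(2), where p = c' and q = "\<alpha> ^ (s * i)"])
           (simp add: power_add algebra_simps)
      then show "(c * c', c * b' + b) \<in> index_sub s r" using i j by (auto simp: index_sub_def)
    next
      assume d: "n dvd c' - c" "n dvd b' - b"
      have "n dvd c' - \<alpha> ^ (s * i)" using dvd_add[OF d(1) i(2)] by simp
      moreover have "r dvd b' - b" using d(2) r(2) dvd_trans by blast
      then have "r dvd b'" using i(1) by (metis diff_add_cancel dvd_add)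
      ultimately show "(c', b') \<in> index_sub s r" by (auto simp: index_sub_def)
    }
  qed
  fix c b assume c: "c \<in> mults"
    and a: "\<And>x. \<exists>c' b'. (c', b') \<in> index_sub s r \<and> n dvd c * x + b - (c' * x + b')"
  have r0: "0 < r" using r(1) prime_gt_0_int by blast
  from a[of 0] obtain b' where "r dvd b'" "n dvd b - b'" by (auto simp: index_sub_def)
  moreover from this have "r dvd b - b'" using r(2) dvd_trans by blast
  ultimately have b: "r dvd b" by (metis diff_add_cancel dvd_add)
  from a[of 1] obtain c' b' j where j: "r dvd b'" "n dvd c' - \<alpha> ^ (s * j)" "n dvd c + b - (c' + b')"
    by (auto simp: index_sub_def)
  obtain i where i: "n dvd c - \<alpha> ^ i" using c by (auto simp: mults_def)
  have "n dvd \<alpha> ^ i - \<alpha> ^ (s * j) + (b - b')"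
    by (rule dvd_lin3[OF j(2,3) i, where p = 1 and q = 1 and r = "-1"]) simp
  then have "r dvd \<alpha> ^ i - \<alpha> ^ (s * j) + (b - b')" using r(2) dvd_trans by blast
  moreover have "r dvd b - b'" using b j(1) by (rule dvd_diff)
  ultimately have "r dvd \<alpha> ^ i - \<alpha> ^ (s * j)" using dvd_add_left_iff by blast
  then have "int s dvd int i - int (s * j)" using dvd_power_diffD[OF r(2) r0 _ s] by blast
  moreover have "int s dvd int (s * j)" by simp
  ultimately have "int s dvd int i" by (metis diff_add_cancel dvd_add)
  then have "s dvd i" by simp
  then obtain k where "i = s * k" by (elim dvdE)
  then show "(c, b) \<in> index_sub s r" using i b by (auto simp: index_sub_def)
qed

lemma affclosed_ker4:
  assumes "4 dvd n"
  shows "affclosed ker4"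
proof (rule affclosedI)
  show "affsub ker4"
  proof (rule affsubI)
    fix c b c' b' assume a: "(c, b) \<in> ker4" "(c', b') \<in> ker4"
    then have d: "4 dvd c - 1" "4 dvd c' - 1" by (auto simp: ker4_def)
    have "4 dvd c * c' - 1"
      by (rule dvd_lin2[OF d, where p = c' and q = 1]) (simp add: algebra_simps)
    then show "(c * c', c * b' + b) \<in> ker4" using a by (auto simp: ker4_def mults_mult)
  next
    fix c b c' b' assume a: "(c, b) \<in> ker4" "n dvd c' - c" "n dvd b' - b"
    then have "4 dvd c - 1" "4 dvd b" "4 dvd c' - c" "4 dvd b' - b"
      using assms by (auto simp: ker4_def intro: dvd_trans)
    then have "4 dvd c' - 1" "4 dvd b'" by presburger+
    then show "(c', b') \<in> ker4" using a by (auto simp: ker4_def intro: mults_cong)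
  qed (auto simp: ker4_def)
  fix c b assume c: "c \<in> mults"
    and a: "\<And>x. \<exists>c' b'. (c', b') \<in> ker4 \<and> n dvd c * x + b - (c' * x + b')"
  from a[of 0] obtain b' where 1: "4 dvd b'" "n dvd b - b'" by (auto simp: ker4_def)
  then have "4 dvd b - b'" using assms dvd_trans by blast
  then have b: "4 dvd b" using 1(1) by presburger
  from a[of 1] obtain c' b' where 2: "4 dvd b'" "4 dvd c' - 1" "n dvd c + b - (c' + b')"
    by (auto simp: ker4_def)
  then have "4 dvd c + b - (c' + b')" using assms dvd_trans by blast
  then have "4 dvd c - 1" using 2(1,2) b by presburger
  then show "(c, b) \<in> ker4" using b c by (simp add: ker4_def)
qed

text \<open>Coprimality of the two orders means that the powers of \<alpha> that are 1 modulo
  \<open>s\<close> still realize every power of \<alpha> modulo \<open>r\<close>.\<close>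

definition twisted_ok :: "int \<Rightarrow> int \<Rightarrow> bool" where
  "twisted_ok s r \<longleftrightarrow> prime r \<and> r dvd n \<and> prime s \<and> s dvd n \<and> s dvd int (ord r \<alpha>) \<and>
     coprime (ord r \<alpha>) (ord s \<alpha>)"

text \<open>As a divisor of the order of \<alpha> modulo \<open>r\<close>, \<open>s\<close> stays
  below \<open>r\<close>. So \<open>s\<close> and \<open>r\<close> are coprime, and later both can
  be read off from their product.\<close>

lemma twisted_ok_less: assumes "twisted_ok s r" shows "s < r"
proof -
  have r: "prime r" "\<not> r dvd \<alpha>" using assms mults_prime[OF mults_gen] by (auto simp: twisted_ok_def)
  have "s \<le> int (ord r \<alpha>)"
    using assms ord_prime_less[OF r] by (intro zdvd_imp_le) (auto simp: twisted_ok_def)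
  then show ?thesis using ord_prime_less(2)[OF r] by simp
qed

lemma twisted_ok_coprime: assumes "twisted_ok s r" shows "coprime s r" "s * r dvd n"
proof -
  show c: "coprime s r" using assms twisted_ok_less[OF assms]
    by (metis twisted_ok_def less_irrefl primes_coprime)
  then show "s * r dvd n" using assms by (intro divides_mult) (auto simp: twisted_ok_def)
qed

text \<open>The orders being coprime, the power of \<alpha> modulo \<open>r\<close> determines
  \<open>i\<close> modulo \<open>ord r \<alpha>\<close> and so modulo \<open>s\<close>. In
  \<open>twisted_sub\<close> the translation modulo \<open>s * r\<close> thereby becomes a function
  of the multiplier modulo \<open>r\<close>.\<close>

lemma twisted_index:
  assumes ok: "twisted_ok s r" and d: "r dvd \<alpha> ^ (ord s \<alpha> * i) - \<alpha> ^ (ord s \<alpha> * j)"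
  shows "s dvd int i - int j"
proof -
  have r: "0 < r" "r dvd n" using ok prime_gt_0_int by (auto simp: twisted_ok_def)
  have "int (ord r \<alpha>) dvd int (ord s \<alpha> * i) - int (ord s \<alpha> * j)"
    using dvd_power_diffD[OF r(2,1) d dvd_refl] .
  then have "int (ord r \<alpha>) dvd int (ord s \<alpha>) * (int i - int j)" by (simp add: algebra_simps)
  moreover have "coprime (int (ord r \<alpha>)) (int (ord s \<alpha>))"
    using ok by (simp add: twisted_ok_def)
  ultimately have "int (ord r \<alpha>) dvd int i - int j" using coprime_dvd_mult_right_iff by blast
  then show ?thesis using ok dvd_trans by (auto simp: twisted_ok_def)
qed

lemma twisted_mod_s:
  assumes ok: "twisted_ok s r" and d: "n dvd c - \<alpha> ^ (ord s \<alpha> * i)"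
  shows "s dvd c - 1"
proof -
  have s: "0 < s" "s dvd n" using ok prime_gt_0_int by (auto simp: twisted_ok_def)
  have "s dvd \<alpha> ^ (ord s \<alpha> * i) - 1" by (simp add: dvd_power_minus_1_iff_ord[OF s(1)])
  moreover have "s dvd c - \<alpha> ^ (ord s \<alpha> * i)" using s d dvd_trans by blast
  ultimately show ?thesis by (rule dvd_lin2[where p = 1 and q = 1]) simp
qed

lemma affclosed_twisted_sub:
  assumes ok: "twisted_ok s r"
  shows "affclosed (twisted_sub s r l)"
proof (rule affclosedI)
  have s: "0 < s" "prime s" "s dvd n" and r: "prime r" "r dvd n" "0 < r"
    using ok prime_gt_0_int by (auto simp: twisted_ok_def)
  note cop_sr = twisted_ok_coprime(1)[OF ok] and sr = twisted_ok_coprime(2)[OF ok]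
  show "affsub (twisted_sub s r l)"
  proof (rule affsubI)
    show "(1, 0) \<in> twisted_sub s r l" by (auto simp: twisted_sub_def intro: exI[of _ 0])
    show "c \<in> mults" if "(c, b) \<in> twisted_sub s r l" for c b
      using that by (auto simp: twisted_sub_def mults_def)
    fix c b c' b' assume "(c, b) \<in> twisted_sub s r l"
    then obtain i where i: "n dvd c - \<alpha> ^ (ord s \<alpha> * i)" "s * r dvd b - r * l * int i"
      by (auto simp: twisted_sub_def)
    {
      assume "(c', b') \<in> twisted_sub s r l"
      then obtain j where j: "n dvd c' - \<alpha> ^ (ord s \<alpha> * j)" "s * r dvd b' - r * l * int j"
        by (auto simp: twisted_sub_def)
      have "n dvd c * c' - \<alpha> ^ (ord s \<alpha> * (i + j))"
        by (rule dvd_lin2[OF i(1) j(1), where p = c' and q = "\<alpha> ^ (ord s \<alpha> * i)"])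
           (simp add: power_add algebra_simps)
      moreover have "s * r dvd (c - 1) * r" using twisted_mod_s[OF ok i(1)] by simp
      then have "s * r dvd c * b' + b - r * l * int (i + j)"
        by (rule dvd_lin3[OF i(2) j(2), where p = 1 and q = c and r = "l * int j"])
           (simp add: algebra_simps)
      ultimately show "(c * c', c * b' + b) \<in> twisted_sub s r l" by (auto simp: twisted_sub_def)
    next
      assume d: "n dvd c' - c" "n dvd b' - b"
      have "n dvd c' - \<alpha> ^ (ord s \<alpha> * i)" using dvd_add[OF d(1) i(1)] by simp
      moreover have "s * r dvd b' - b" using d(2) sr dvd_trans by blast
      then have "s * r dvd b' - r * l * int i"
        using i(2) by (rule dvd_lin2[where p = 1 and q = 1]) simp
      ultimately show "(c', b') \<in> twisted_sub s r l" by (auto simp: twisted_sub_def)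
    }
  qed
  fix c b assume c: "c \<in> mults"
    and a: "\<And>x. \<exists>c' b'. (c', b') \<in> twisted_sub s r l \<and> n dvd c * x + b - (c' * x + b')"
  have rb: "r dvd b" if "s * r dvd b - r * l * int i" for b i
    using dvd_trans[OF dvd_triv_right that] by (rule dvd_lin2[OF _ dvd_refl, where p = 1 and q = "l * int i"]) simp
  have mod_s: "s dvd b - r * l * int i" if "s * r dvd b - r * l * int i" for b i
    using dvd_trans[OF dvd_triv_left that] .
  have toD: "r dvd x" "s dvd x" if "n dvd x" for x using that r(2) s(3) dvd_trans by blast+
  from a[of 0] obtain b' i where "s * r dvd b' - r * l * int i" "n dvd b - b'"
    by (auto simp: twisted_sub_def)
  then have b: "r dvd b" using rb toD by (metis diff_add_cancel dvd_add)
  \<comment> \<open>At this point the image modulo \<open>r\<close> shows the multiplier and the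
    image modulo \<open>s\<close> shows the translation, both compared with one and the same element
    of the group; this ties the two together.\<close>
  obtain x where "[x = 1] (mod r)" "[x = 0] (mod s)"
    using binary_chinese_remainder_int[of r s 1 0] cop_sr coprime_commute by blast
  then have x: "r dvd x - 1" "s dvd x" by (simp_all add: cong_iff_dvd_diff)
  from a[of x] obtain c2 b2 i where 2: "n dvd c2 - \<alpha> ^ (ord s \<alpha> * i)" "s * r dvd b2 - r * l * int i"
    "n dvd c * x + b - (c2 * x + b2)" by (auto simp: twisted_sub_def)
  from a[of 1] obtain c1 b1 j where 1: "n dvd c1 - \<alpha> ^ (ord s \<alpha> * j)" "s * r dvd b1 - r * l * int j"
    "n dvd c + b - (c1 + b1)" by (auto simp: twisted_sub_def)
  have "r dvd (c * x + b - (c2 * x + b2)) - (b - b2)" by (rule dvd_diff[OF toD(1)[OF 2(3)] dvd_diff[OF b rb[OF 2(2)]]])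
  then have cr: "r dvd c - c2"
    using x(1) by (rule dvd_lin2[where p = 1 and q = "- (c - c2)"]) (simp add: algebra_simps)
  have "r dvd (c + b - (c1 + b1)) - (b - b1)" by (rule dvd_diff[OF toD(1)[OF 1(3)] dvd_diff[OF b rb[OF 1(2)]]])
  then have cr1: "r dvd c - c1" by (simp add: algebra_simps)
  have "r dvd \<alpha> ^ (ord s \<alpha> * i) - \<alpha> ^ (ord s \<alpha> * j)"
  proof -
    have "r dvd c2 - c1" using dvd_diff[OF cr1 cr] by simp
    then show ?thesis using toD(1)[OF 2(1)] toD(1)[OF 1(1)]
      by (rule dvd_lin3[where p = 1 and q = "-1" and r = 1]) simp
  qed
  then have ij: "s dvd int i - int j" by (rule twisted_index[OF ok])
  have bs: "s dvd b - r * l * int i"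
  proof -
    have "s dvd b - b2" using toD(2)[OF 2(3)] x(2)
      by (rule dvd_lin2[where p = 1 and q = "c2 - c"]) (simp add: algebra_simps)
    then show ?thesis using mod_s[OF 2(2)] by (rule dvd_lin2[where p = 1 and q = 1]) simp
  qed
  have "s dvd b - b1"
    using bs mod_s[OF 1(2)] ij
    by (rule dvd_lin3[where p = 1 and q = "-1" and r = "r * l"]) (simp add: algebra_simps)
  \<comment> \<open>The element found at the point 1 has the same translation modulo
    \<open>s\<close>, so the comparison there concerns the multipliers alone, and its multiplier is
    1 modulo \<open>s\<close>.\<close>
  then have c1: "s dvd c - 1" using toD(2)[OF 1(3)] twisted_mod_s[OF ok 1(1)]
    by (rule dvd_lin3[where p = "-1" and q = 1 and r = 1]) simp
  obtain k where k: "n dvd c - \<alpha> ^ k" using c by (auto simp: mults_def)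
  have "s dvd \<alpha> ^ k - 1" using c1 toD(2)[OF k] by (rule dvd_lin2[where p = 1 and q = "-1"]) simp
  then obtain k' where k': "k = ord s \<alpha> * k'" using dvd_power_minus_1_iff_ord[OF s(1)] by (metis dvdE)
  have "r dvd \<alpha> ^ (ord s \<alpha> * k') - \<alpha> ^ (ord s \<alpha> * i)"
    using toD(1)[OF k] cr toD(1)[OF 2(1)]
    by (rule dvd_lin3[where p = "-1" and q = 1 and r = 1]) (simp add: k')
  then have "s dvd int k' - int i" by (rule twisted_index[OF ok])
  then have "s dvd b - r * l * int k'"
    using bs by (rule dvd_lin2[where p = "- r * l" and q = 1]) (simp add: algebra_simps)
  moreover have "r dvd b - r * l * int k'" using b by simp
  ultimately have "s * r dvd b - r * l * int k'" using cop_sr divides_mult by blast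
  then show "(c, b) \<in> twisted_sub s r l" using k k' by (auto simp: twisted_sub_def)
qed

end

section \<open>Proper closed subgroups\<close>

text \<open>The action on the class of \<open>t\<close> modulo \<open>D\<close>, rescaled by \<open>x = t + D z\<close>, is affine modulo \<open>n div D\<close>.\<close>

lemma class_intransitive:
  assumes S: "aff_monoid S" and N: "0 < N" "D dvd N" "0 < D"
    and cop: "\<And>c b. (c, b) \<in> S \<Longrightarrow> coprime c N"
    and fixed: "\<And>c b. (c, b) \<in> S \<Longrightarrow> D dvd c * t + b - t"
    and xy: "D dvd x - t" "D dvd y - t" "\<And>c b. (c, b) \<in> S \<Longrightarrow> \<not> N dvd c * x + b - y"
  obtains (point) s t' where "prime s" "s * D dvd N" "D dvd t' - t"
      "\<And>c b. (c, b) \<in> S \<Longrightarrow> s * D dvd c * t' + b - t'"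
  | (pair) \<beta> c0 b0 where "4 * D dvd N" "odd \<beta>" "(c0, b0) \<in> S" "4 dvd c0 + 1"
      "\<And>c b. (c, b) \<in> S \<Longrightarrow> 4 dvd c - 1 \<and> 4 * D dvd c * t + b - t
         \<or> 4 dvd c + 1 \<and> 4 * D dvd c * t + b - t - D * \<beta>"
proof -
  obtain M where M: "N = D * M" using N(2) by (elim dvdE)
  have "0 < M" using N M by (simp add: zero_less_mult_iff)
  \<comment> \<open>The action on the coordinate \<open>z'\<close> of \<open>t + D * z'\<close>: the
    map with multiplier \<open>c\<close> and translation \<open>D * z + t - c * t\<close> sends this
    point to \<open>t + D * (c * z' + z)\<close>.\<close>
  define P where "P = {(c, z). (c, D * z + t - c * t) \<in> S}"
  have P_ex: "\<exists>z. (c, z) \<in> P \<and> c * t + b - t = D * z" if cb: "(c, b) \<in> S" for c b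
  proof -
    obtain z where "c * t + b - t = D * z" using fixed[OF cb] by (elim dvdE)
    moreover from this have "b = D * z + t - c * t" by simp
    ultimately show ?thesis using cb by (auto simp: P_def)
  qed
  have P: "aff_monoid P"
    unfolding aff_monoid_def
  proof (intro conjI allI impI)
    show "(1, 0) \<in> P" using aff_monoid_one[OF S] by (simp add: P_def)
    fix c b c' b' assume "(c, b) \<in> P" "(c', b') \<in> P"
    then have "(c * c', c * (D * b' + t - c' * t) + (D * b + t - c * t)) \<in> S"
      using aff_monoid_mult[OF S] by (simp add: P_def)
    moreover have "c * (D * b' + t - c' * t) + (D * b + t - c * t) = D * (c * b' + b) + t - c * c' * t"
      by (simp add: algebra_simps)
    ultimately show "(c * c', c * b' + b) \<in> P" by (simp add: P_def)
  qed
  have copP: "coprime c M" if "(c, z) \<in> P" for c z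
    using cop[of c "D * z + t - c * t"] that M by (simp add: P_def)
  have intr: "\<not> aff_transitive P M"
  proof
    assume tr: "aff_transitive P M"
    obtain x' y' where x': "x - t = D * x'" and y': "y - t = D * y'" using xy by (elim dvdE)
    obtain c z where cz: "(c, z) \<in> P" "M dvd c * x' + z - y'" using aff_transitiveD[OF tr] by blast
    have "c * x + (D * z + t - c * t) - y = D * (c * x' + z - y')"
    proof -
      have "x = D * x' + t" "y = D * y' + t" using x' y' by simp_all
      then show ?thesis by (simp add: algebra_simps)
    qed
    then have "N dvd c * x + (D * z + t - c * t) - y" using cz(2) M by simp
    then show False using xy(3) cz(1) by (simp add: P_def)
  qed
  show ?thesis
  proof (rule aff_monoid_intransitive)
    show "aff_monoid P" "0 < M" "\<not> aff_transitive P M" by fact+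
    show "coprime c M" if "(c, z) \<in> P" for c z by (rule copP[OF that])
  next
    fix s u assume s: "prime s" "s dvd M" and u: "\<And>c z. (c, z) \<in> P \<Longrightarrow> s dvd c * u + z - u"
    show thesis
    proof (rule point[OF s(1)])
      show "s * D dvd N" using s(2) by (simp add: M mult.commute)
      show "D dvd (t + D * u) - t" by simp
      fix c b assume "(c, b) \<in> S"
      then obtain z where z: "(c, z) \<in> P" "c * t + b - t = D * z" using P_ex by blast
      have "c * (t + D * u) + b - (t + D * u) = D * (c * u + z - u)"
        using z(2) by (simp add: algebra_simps)
      then show "s * D dvd c * (t + D * u) + b - (t + D * u)" using u[OF z(1)] by (simp add: mult.commute)
    qed
  next
    fix \<beta> c0 z0 assume a: "4 dvd M" "odd \<beta>" "(c0, z0) \<in> P" "4 dvd c0 + 1"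
      "\<And>c z. (c, z) \<in> P \<Longrightarrow> 4 dvd c - 1 \<and> 4 dvd z \<or> 4 dvd c + 1 \<and> 4 dvd z - \<beta>"
    show thesis
    proof (rule pair)
      show "4 * D dvd N" using a(1) by (simp add: M mult.commute)
      show "odd \<beta>" by fact
      show "(c0, D * z0 + t - c0 * t) \<in> S" using a(3) by (simp add: P_def)
      show "4 dvd c0 + 1" by fact
      fix c b assume "(c, b) \<in> S"
      then obtain z where z: "(c, z) \<in> P" "c * t + b - t = D * z" using P_ex by blast
      have "4 * D dvd D * w" if "4 dvd w" for w using that by (simp add: mult.commute)
      moreover have "D * z - D * \<beta> = D * (z - \<beta>)" by (simp add: algebra_simps)
      ultimately show "4 dvd c - 1 \<and> 4 * D dvd c * t + b - t
         \<or> 4 dvd c + 1 \<and> 4 * D dvd c * t + b - t - D * \<beta>"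
        unfolding z(2) using a(5)[OF z(1)] by metis
    qed
  qed
qed

context affine_group
begin

lemma mults_odd: "c \<in> mults \<Longrightarrow> even n \<Longrightarrow> odd c"
  using mults_prime[of c 2] by auto

text \<open>If \<alpha> were 1 modulo 4, so would be all of its powers.\<close>

lemma alpha_mod_4:
  assumes "4 dvd n" "c \<in> mults" "4 dvd c + 1"
  shows "4 dvd \<alpha> + 1"
proof (rule ccontr)
  assume a: "\<not> 4 dvd \<alpha> + 1"
  have "even n" by (rule dvd_trans[OF _ assms(1)]) simp
  then have "odd \<alpha>" using mults_odd by simp
  then have "4 dvd \<alpha> - 1" using a by presburger
  then have p: "4 dvd \<alpha> ^ i - 1" for i by (rule dvd_pow_minus_1)
  obtain i where "n dvd c - \<alpha> ^ i" using assms(2) by (auto simp: mults_def)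
  then have "4 dvd c - \<alpha> ^ i" by (rule dvd_trans[OF assms(1)])
  then show False using p[of i] assms(3) by presburger
qed

lemma pow_alpha_mod:
  assumes "D dvd \<alpha> + 1"
  shows "even i \<Longrightarrow> D dvd \<alpha> ^ i - 1" "odd i \<Longrightarrow> D dvd \<alpha> ^ i + 1"
proof -
  have "D dvd \<alpha>\<^sup>2 - 1"
    by (rule dvd_lin1[OF assms, where p = "\<alpha> - 1"]) (simp add: algebra_simps power2_eq_square)
  then have p: "D dvd (\<alpha>\<^sup>2) ^ j - 1" for j by (rule dvd_pow_minus_1)
  show "D dvd \<alpha> ^ i - 1" if "even i" using that p by (auto elim!: evenE simp: power_mult)
  show "D dvd \<alpha> ^ i + 1" if i: "odd i"
  proof -
    obtain j where j: "i = 2 * j + 1" using i by (elim oddE)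
    have "\<alpha> ^ i = (\<alpha>\<^sup>2) ^ j * \<alpha>" by (simp only: j power_add power_mult power_one_right)
    then show ?thesis
      by (intro dvd_lin2[OF p[of j] assms, where p = \<alpha> and q = 1]) (simp add: algebra_simps)
  qed
qed

lemma mults_mod:
  assumes "D dvd n" "D dvd \<alpha> + 1" "c \<in> mults"
  shows "D dvd c - 1 \<or> D dvd c + 1"
proof -
  obtain i where "n dvd c - \<alpha> ^ i" using assms(3) by (auto simp: mults_def)
  then have d: "D dvd c - \<alpha> ^ i" by (rule dvd_trans[OF assms(1)])
  show ?thesis
  proof (cases "even i")
    case True
    then have "D dvd c - 1"
      by (intro dvd_lin2[OF d pow_alpha_mod(1)[OF assms(2) True], where p = 1 and q = 1]) simp
    then show ?thesis ..
  next
    case False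
    then have "D dvd c + 1"
      by (intro dvd_lin2[OF d pow_alpha_mod(2)[OF assms(2) False], where p = 1 and q = 1]) simp
    then show ?thesis ..
  qed
qed

lemma affsub_coprime: "affsub S \<Longrightarrow> (c, b) \<in> S \<Longrightarrow> coprime c n"
  using mults_coprime[OF affsub_mults dvd_refl] .

text \<open>By closedness, an element outside of \<open>L\<close> must take some point
  \<open>x\<close> out of its \<open>L\<close>-orbit. Every classification below starts from such a
  pair of points.\<close>

lemma closed_intransitive:
  assumes "affclosed L" "(c, b) \<notin> L" "c \<in> mults"
  obtains x where "\<And>c' b'. (c', b') \<in> L \<Longrightarrow> \<not> n dvd c' * x + b' - (c * x + b)"
proof -
  have "\<exists>x. \<forall>c' b'. (c', b') \<in> L \<longrightarrow> \<not> n dvd c * x + b - (c' * x + b')"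
    using affclosedD[OF assms(1,3)] assms(2) by metis
  then obtain x where x: "\<And>c' b'. (c', b') \<in> L \<Longrightarrow> \<not> n dvd c * x + b - (c' * x + b')" by metis
  show ?thesis by (rule that[of x]) (use x in \<open>simp add: dvd_diff_commute\<close>)
qed

theorem proper_closed_cases:
  assumes L: "affclosed L" "L \<noteq> full"
  obtains (point) r t where "prime r" "r dvd n" "L \<subseteq> point_stab r t"
  | (pair) \<beta> where "4 dvd n" "4 dvd \<alpha> + 1" "odd \<beta>" "L \<subseteq> pair_stab 4 0 \<beta>"
proof -
  note sub = affclosed_sub[OF L(1)]
  obtain c b where cb: "(c, b) \<notin> L" "c \<in> mults" using affsub_full[OF sub] L(2) by (auto simp: full_def)
  obtain x where x: "\<And>c' b'. (c', b') \<in> L \<Longrightarrow> \<not> n dvd c' * x + b' - (c * x + b)"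
    using closed_intransitive[OF L(1) cb] by metis
  have intr: "\<not> aff_transitive L n"
    using x aff_transitiveD[of L n x "c * x + b"] by metis
  show ?thesis
  proof (rule aff_monoid_intransitive)
    show "aff_monoid L" "0 < n" "\<not> aff_transitive L n" by (fact affsub_monoid[OF sub] n_pos intr)+
    show "coprime c n" if "(c, b) \<in> L" for c b by (rule affsub_coprime[OF sub that])
  next
    fix r t assume r: "prime r" "r dvd n" "\<And>c b. (c, b) \<in> L \<Longrightarrow> r dvd c * t + b - t"
    show thesis by (rule point[OF r(1,2)]) (use r(3) affsub_mults[OF sub] in \<open>auto simp: point_stab_def\<close>)
  next
    fix \<beta> c0 b0 assume a: "4 dvd n" "odd \<beta>" "(c0, b0) \<in> L" "4 dvd c0 + 1"
      "\<And>c b. (c, b) \<in> L \<Longrightarrow> 4 dvd c - 1 \<and> 4 dvd b \<or> 4 dvd c + 1 \<and> 4 dvd b - \<beta>"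
    show thesis
    proof (rule pair[OF a(1) alpha_mod_4[OF a(1) affsub_mults[OF sub a(3)] a(4)] a(2)], clarify)
      fix c b assume cb: "(c, b) \<in> L"
      have "4 dvd c * \<beta> - \<beta>" if "4 dvd c - 1"
        by (rule dvd_lin1[OF that, where p = \<beta>]) (simp add: algebra_simps)
      moreover have "4 dvd c * \<beta> + \<beta>" if "4 dvd c + 1"
        by (rule dvd_lin1[OF that, where p = \<beta>]) (simp add: algebra_simps)
      ultimately show "(c, b) \<in> pair_stab 4 0 \<beta>"
        using a(5)[OF cb] affsub_mults[OF sub cb] by (auto simp: pair_stab_def)
    qed
  qed
qed

text \<open>For \<open>r = 2\<close> the pair case disappears: a map that preserves \<open>{t, t + 2 \<beta>}\<close> modulo 8 fixes the
  class of the midpoint \<open>t + \<beta>\<close> modulo 4.\<close>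

lemma point_stab_intransitive:
  assumes L: "affsub L" "L \<subseteq> point_stab r t" and r: "prime r" "r dvd n"
    and xy: "r dvd x - t" "r dvd y - t" "\<And>c b. (c, b) \<in> L \<Longrightarrow> \<not> n dvd c * x + b - y"
  obtains (point) s t' where "prime s" "s * r dvd n" "L \<subseteq> point_stab (s * r) t'"
      "point_stab (s * r) t' \<subseteq> point_stab r t"
  | (pair) \<beta> t' where "odd r" "4 dvd n" "4 dvd \<alpha> + 1" "odd \<beta>" "L \<subseteq> pair_stab (4 * r) t' (r * \<beta>)"
      "pair_stab (4 * r) t' (r * \<beta>) \<subseteq> point_stab r t"
proof -
  have r0: "0 < r" using r(1) prime_gt_0_int by blast
  have fixed: "r dvd c * t + b - t" if "(c, b) \<in> L" for c b using L(2) that by (auto simp: point_stab_def)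
  show ?thesis
  proof (rule class_intransitive)
    show "aff_monoid L" "0 < n" "r dvd n" "0 < r" "r dvd x - t" "r dvd y - t"
      by (fact affsub_monoid[OF L(1)] n_pos r(2) r0 xy(1,2))+
    fix c b assume "(c, b) \<in> L"
    then show "coprime c n" "r dvd c * t + b - t" "\<not> n dvd c * x + b - y"
      by (fact affsub_coprime[OF L(1)] fixed xy(3))+
  next
    fix s t' assume s: "prime s" "s * r dvd n" "r dvd t' - t"
      "\<And>c b. (c, b) \<in> L \<Longrightarrow> s * r dvd c * t' + b - t'"
    show thesis
    proof (rule point[OF s(1,2)])
      show "L \<subseteq> point_stab (s * r) t'" using s(4) affsub_mults[OF L(1)] by (auto simp: point_stab_def)
      show "point_stab (s * r) t' \<subseteq> point_stab r t"
      proof (clarify, unfold point_stab_def, clarify)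
        fix c b assume "s * r dvd c * t' + b - t'"
        then have "r dvd c * t' + b - t'" by (rule dvd_trans[OF dvd_triv_right])
        then show "r dvd c * t + b - t" using s(3)
          by (rule dvd_lin2[where p = 1 and q = "1 - c"]) (simp add: algebra_simps)
      qed
    qed
  next
    fix \<beta> c0 b0 assume a: "4 * r dvd n" "odd \<beta>" "(c0, b0) \<in> L" "4 dvd c0 + 1"
      "\<And>c b. (c, b) \<in> L \<Longrightarrow> 4 dvd c - 1 \<and> 4 * r dvd c * t + b - t
         \<or> 4 dvd c + 1 \<and> 4 * r dvd c * t + b - t - r * \<beta>"
    have n4: "4 dvd n" using a(1) by (rule dvd_mult_left)
    have \<alpha>4: "4 dvd \<alpha> + 1" by (rule alpha_mod_4[OF n4 affsub_mults[OF L(1) a(3)] a(4)])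
    have m1: "4 * r dvd c * (r * \<beta>) - r * \<beta>" if d: "4 dvd c - 1" for c
    proof -
      have "4 * r dvd (c - 1) * r" using d by (intro mult_dvd_mono) simp_all
      then show ?thesis by (rule dvd_lin1[where p = \<beta>]) (simp add: algebra_simps)
    qed
    have m2: "4 * r dvd c * (r * \<beta>) + r * \<beta>" if d: "4 dvd c + 1" for c
    proof -
      have "4 * r dvd (c + 1) * r" using d by (intro mult_dvd_mono) simp_all
      then show ?thesis by (rule dvd_lin1[where p = \<beta>]) (simp add: algebra_simps)
    qed
    show thesis
    proof (cases "odd r")
      case True
      show thesis
      proof (rule pair[OF True n4 \<alpha>4 a(2)])
        show "L \<subseteq> pair_stab (4 * r) t (r * \<beta>)"
          using a(5) m1 m2 affsub_mults[OF L(1)] by (fastforce simp: pair_stab_def)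
        show "pair_stab (4 * r) t (r * \<beta>) \<subseteq> point_stab r t"
        proof (clarify, unfold point_stab_def pair_stab_def, clarify)
          fix c b assume "4 * r dvd c * t + b - t \<and> 4 * r dvd c * (r * \<beta>) - r * \<beta> \<or>
            4 * r dvd c * t + b - t - r * \<beta> \<and> 4 * r dvd c * (r * \<beta>) + r * \<beta>"
          then have "r dvd c * t + b - t \<or> r dvd c * t + b - t - r * \<beta>"
            using dvd_mult_right by blast
          moreover have "r dvd c * t + b - t" if "r dvd c * t + b - t - r * \<beta>"
            using that dvd_refl by (rule dvd_lin2[where p = 1 and q = \<beta>]) simp
          ultimately show "r dvd c * t + b - t" by blast
        qed
      qed
    next
      case False
      then have r2: "r = 2" using r(1) primes_dvd_imp_eq[of 2 r] by auto
      have "even n" by (rule dvd_trans[OF _ n4]) simp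
      show thesis
      proof (rule point[of 2 "t + \<beta>"])
        show "2 * r dvd n" using n4 r2 by simp
        show "L \<subseteq> point_stab (2 * r) (t + \<beta>)"
        proof (clarify, unfold point_stab_def, clarify, intro conjI)
          fix c b assume cb: "(c, b) \<in> L"
          show "c \<in> mults" by (rule affsub_mults[OF L(1) cb])
          from a(5)[OF cb] show "2 * r dvd c * (t + \<beta>) + b - (t + \<beta>)"
          proof (elim disjE conjE)
            assume h: "4 dvd c - 1" "4 * r dvd c * t + b - t"
            have "4 dvd c * (t + \<beta>) + b - (t + \<beta>)"
              by (rule dvd_lin2[OF h(1) dvd_mult_left[OF h(2)], where p = \<beta> and q = 1])
                 (simp add: algebra_simps r2)
            then show ?thesis by (simp add: r2)
          next
            assume h: "4 dvd c + 1" "4 * r dvd c * t + b - t - r * \<beta>"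
            have "4 dvd c * (t + \<beta>) + b - (t + \<beta>)"
              by (rule dvd_lin2[OF h(1) dvd_mult_left[OF h(2)], where p = \<beta> and q = 1])
                 (simp add: algebra_simps r2)
            then show ?thesis by (simp add: r2)
          qed
        qed
        show "point_stab (2 * r) (t + \<beta>) \<subseteq> point_stab r t"
        proof (clarify, unfold point_stab_def, clarify)
          fix c b assume c: "c \<in> mults" and h: "2 * r dvd c * (t + \<beta>) + b - (t + \<beta>)"
          have "odd c" by (rule mults_odd[OF c \<open>even n\<close>])
          moreover have "even (c * (t + \<beta>) + b - (t + \<beta>))" using h by (rule dvd_mult_left)
          ultimately show "r dvd c * t + b - t" unfolding r2 by auto
        qed
      qed simp
    qed
  qed
qed

text \<open>As \<open>h\<close> agrees with \<alpha> modulo \<open>r\<close>, the powers of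
  \<open>(h, e)\<close> represent all cosets of the subgroup of elements with multiplier 1 modulo
  \<open>r\<close>.\<close>

lemma kernel_decomp:
  assumes L: "affsub L" "(h, e) \<in> L" "(c, b) \<in> L" and r: "r dvd n" "r dvd h - \<alpha>" "r dvd c - \<alpha> ^ j"
  obtains c' b' where "(c', b') \<in> L" "r dvd c' - 1" "n dvd c - h ^ j * c'"
    "n dvd b - (h ^ j * b' + e * geo h j)"
proof -
  have hj: "(h ^ j, e * geo h j) \<in> L" by (rule affsub_pow[OF L(1,2)])
  obtain i d where i: "(i, d) \<in> L" "n dvd h ^ j * i - 1" "n dvd h ^ j * d + e * geo h j"
    using affsub_inv[OF L(1) hj] by metis
  have "[h ^ j = \<alpha> ^ j] (mod r)" using r(2) by (intro cong_pow) (simp add: cong_iff_dvd_diff)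
  then have "r dvd h ^ j - \<alpha> ^ j" by (simp add: cong_iff_dvd_diff)
  then have hc: "r dvd h ^ j - c" using r(3) by (rule dvd_lin2[where p = 1 and q = "-1"]) simp
  have ri: "r dvd h ^ j * i - 1" by (rule dvd_trans[OF r(1) i(2)])
  show ?thesis
  proof (rule that)
    show "(i * c, i * b + d) \<in> L" by (rule affsub_mult[OF L(1) i(1) L(3)])
    show "r dvd i * c - 1"
      by (rule dvd_lin2[OF ri hc, where p = 1 and q = "- i"]) (simp add: algebra_simps)
    show "n dvd c - h ^ j * (i * c)"
      by (rule dvd_lin1[OF i(2), where p = "- c"]) (simp add: algebra_simps)
    show "n dvd b - (h ^ j * (i * b + d) + e * geo h j)"
      by (rule dvd_lin2[OF i(2,3), where p = "- b" and q = "-1"]) (simp add: algebra_simps)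
  qed
qed

text \<open>Normality of the kernel. The conjugate \<open>(k', d')\<close> is described by the
  equation \<open>(c, b) (k', d') = (k, d) (c, b)\<close> modulo \<open>n\<close>, so that no
  inverse appears.\<close>

lemma kernel_conj:
  assumes L: "affsub L" "(c, b) \<in> L" "(k, d) \<in> L" and r: "r dvd n" "r dvd k - 1"
  obtains k' d' where "(k', d') \<in> L" "r dvd k' - 1" "n dvd c * k' - k * c"
    "n dvd c * d' + b - (k * b + d)"
proof -
  obtain i f where i: "(i, f) \<in> L" "n dvd c * i - 1" "n dvd c * f + b" "n dvd i * b + f"
    by (rule affsub_inv[OF L(1,2)])
  have ri: "r dvd c * i - 1" by (rule dvd_trans[OF r(1) i(2)])
  show ?thesis
  proof (rule that)
    show "(i * (k * c), i * (k * b + d) + f) \<in> L"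
      by (intro affsub_mult[OF L(1)] L i(1))
    show "r dvd i * (k * c) - 1"
      by (rule dvd_lin2[OF ri r(2), where p = k and q = 1]) (simp add: algebra_simps)
    show "n dvd c * (i * (k * c)) - k * c"
      by (rule dvd_lin1[OF i(2), where p = "k * c"]) (simp add: algebra_simps)
    show "n dvd c * (i * (k * b + d) + f) + b - (k * b + d)"
      by (rule dvd_lin2[OF i(2,3), where p = "k * b + d" and q = 1]) (simp add: algebra_simps)
  qed
qed

text \<open>The elements with multiplier 1 modulo \<open>r\<close> form a normal subgroup, so with \<open>t\<close> they fix
  the whole orbit of \<open>t\<close>.\<close>

lemma kernel_fixes:
  assumes L: "affsub L" "(c, b) \<in> L" "(k, d) \<in> L" and r: "r dvd n" "r dvd k - 1" and D: "D dvd n"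
    and fixed: "\<And>k d. (k, d) \<in> L \<Longrightarrow> r dvd k - 1 \<Longrightarrow> D dvd k * t + d - t"
  shows "D dvd k * (c * t + b) + d - (c * t + b)"
    and "D dvd (k - 1) * (c * t + b - t)"
proof -
  obtain k' d' where k': "(k', d') \<in> L" "r dvd k' - 1" "n dvd c * k' - k * c"
    "n dvd c * d' + b - (k * b + d)"
    by (rule kernel_conj[OF L r])
  show 1: "D dvd k * (c * t + b) + d - (c * t + b)"
    by (rule dvd_lin3[OF dvd_trans[OF D k'(3)] dvd_trans[OF D k'(4)] fixed[OF k'(1,2)],
        where p = "- t" and q = "-1" and r = c]) (simp add: algebra_simps)
  show "D dvd (k - 1) * (c * t + b - t)"
    by (rule dvd_lin2[OF 1 fixed[OF L(3) r(2)], where p = 1 and q = "-1"]) (simp add: algebra_simps)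
qed

text \<open>When the kernel is trivial modulo \<open>D\<close>, the group \<open>L\<close> is cyclic
  modulo \<open>D\<close>, generated by \<open>(h, e)\<close>.\<close>

lemma kernel_decomp_trivial:
  assumes L: "affsub L" "(h, e) \<in> L" "(c, b) \<in> L" and r: "r dvd n" "r dvd h - \<alpha>" "r dvd c - \<alpha> ^ j"
    and D: "D dvd n"
    and triv: "\<And>k d. (k, d) \<in> L \<Longrightarrow> r dvd k - 1 \<Longrightarrow> D dvd k - 1 \<and> D dvd d"
  shows "D dvd c - h ^ j" "D dvd b - e * geo h j"
proof -
  obtain k d where k: "(k, d) \<in> L" "r dvd k - 1" "n dvd c - h ^ j * k"
    "n dvd b - (h ^ j * d + e * geo h j)" by (rule kernel_decomp[OF L r])
  have kd: "D dvd k - 1" "D dvd d" using triv[OF k(1,2)] by auto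
  show "D dvd c - h ^ j"
    by (rule dvd_lin2[OF dvd_trans[OF D k(3)] kd(1), where p = 1 and q = "h ^ j"]) (simp add: algebra_simps)
  show "D dvd b - e * geo h j"
    by (rule dvd_lin2[OF dvd_trans[OF D k(4)] kd(2), where p = 1 and q = "h ^ j"]) (simp add: algebra_simps)
qed

lemma power_fix: "D dvd h * f + e - f \<Longrightarrow> D dvd h ^ j * f + e * geo h j - f" for D :: int
proof -
  assume d: "D dvd h * f + e - f"
  have "h ^ j = (h - 1) * geo h j + 1" using geo_diff[of h j] by simp
  then have "h ^ j * f + e * geo h j - f = geo h j * (h * f + e - f)"
    by (simp only:) (simp add: algebra_simps)
  then show ?thesis using d by simp
qed

text \<open>The fixed point is \<open>e\<close> divided by \<open>1 - h\<close>. The form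
  \<open>v * e\<close> is recorded because divisors of \<open>e\<close> then pass on to it.\<close>

lemma solve_fixed_point:
  fixes h D e :: int
  assumes "coprime (h - 1) D"
  obtains f v where "D dvd h * f + e - f" "f = v * e"
proof -
  obtain v where v: "D dvd (h - 1) * v - 1"
    using cong_solve_coprime_int[OF assms] by (auto simp: cong_iff_dvd_diff)
  have "D dvd h * (- v * e) + e - (- v * e)"
    by (rule dvd_lin1[OF v, where p = "- e"]) (simp add: algebra_simps)
  then show ?thesis by (rule that[of "- v * e" "- v"]) simp
qed

lemma generator_mult:
  assumes "(c, b) \<in> L" "affsub L" "r dvd n"
  shows "\<exists>j. n dvd c - \<alpha> ^ j \<and> r dvd c - \<alpha> ^ j"
proof -
  obtain j where "n dvd c - \<alpha> ^ j" using affsub_mults[OF assms(2,1)] by (auto simp: mults_def)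
  moreover from this have "r dvd c - \<alpha> ^ j" by (rule dvd_trans[OF assms(3)])
  ultimately show ?thesis by blast
qed

text \<open>The exponents \<open>i\<close> for which \<open>\<alpha> ^ i\<close> occurs as a
  multiplier modulo \<open>r\<close> are multiples of the least positive one, \<open>m\<close>.
  Since \<alpha> itself does not occur, \<open>m\<close> is not 1, and any prime divisor
  \<open>s\<close> of \<open>m\<close> serves.\<close>

lemma index_case:
  assumes L: "affsub L" "L \<subseteq> point_stab r 0" and r: "prime r" "r dvd n"
    and nogen: "\<And>c b. (c, b) \<in> L \<Longrightarrow> \<not> r dvd c - \<alpha>"
  obtains s where "prime (s::nat)" "s dvd ord r \<alpha>" "L \<subseteq> index_sub s r"
proof -
  have r0: "0 < r" using r(1) prime_gt_0_int by blast
  define ord_r where "ord_r = ord r \<alpha>"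
  have o: "r dvd \<alpha> ^ i - 1 \<longleftrightarrow> ord_r dvd i" for i
    unfolding ord_r_def by (rule dvd_power_minus_1_iff_ord[OF r0])
  have o0: "0 < ord_r" unfolding ord_r_def
    by (rule ord_int_pos[OF r0]) (use mults_coprime[OF mults_gen r(2)] in \<open>simp add: coprime_commute\<close>)
  define I where "I = {i. \<exists>c b. (c, b) \<in> L \<and> r dvd c - \<alpha> ^ i}"
  have oI: "ord_r \<in> I"
  proof -
    have "r dvd 1 - \<alpha> ^ ord_r" using o[of ord_r] by (simp add: dvd_diff_commute)
    then show ?thesis unfolding I_def using affsub_one[OF L(1)] by blast
  qed
  define m where "m = (LEAST i. 0 < i \<and> i \<in> I)"
  have m: "0 < m" "m \<in> I" using LeastI[of "\<lambda>i. 0 < i \<and> i \<in> I" ord_r] o0 oI by (auto simp: m_def)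
  have m_min: "m \<le> i" if "0 < i" "i \<in> I" for i
    unfolding m_def using that by (intro Least_le) auto
  obtain cm bm where cm: "(cm, bm) \<in> L" "r dvd cm - \<alpha> ^ m" using m(2) by (auto simp: I_def)
  have m_dvd: "m dvd i" if i: "i \<in> I" for i
  proof -
    obtain c b where c: "(c, b) \<in> L" "r dvd c - \<alpha> ^ i" using i by (auto simp: I_def)
    \<comment> \<open>The factor \<open>ord_r - 1\<close> acts on exponents as -1 modulo
      \<open>ord_r\<close>, so multiplication by \<open>cm ^ e\<close> removes
      \<open>m * (i div m)\<close> from the exponent \<open>i\<close>.\<close>
    define e where "e = i div m * (ord_r - 1)"
    have e: "i + m * e = i mod m + ord_r * (m * (i div m))"
    proof -
      have "m * (i div m) + m * e = ord_r * (m * (i div m))"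
        using o0 by (cases ord_r) (simp_all add: e_def algebra_simps)
      then show ?thesis using mult_div_mod_eq[of m i] by linarith
    qed
    have "(cm ^ e * c, cm ^ e * b + bm * geo cm e) \<in> L"
      by (rule affsub_mult[OF L(1) affsub_pow[OF L(1) cm(1)] c(1)])
    moreover have "r dvd cm ^ e * c - \<alpha> ^ (i mod m)"
    proof -
      have "[cm ^ e * c = (\<alpha> ^ m) ^ e * \<alpha> ^ i] (mod r)"
        using cm c by (intro cong_mult cong_pow) (simp_all add: cong_iff_dvd_diff)
      then have 1: "r dvd cm ^ e * c - \<alpha> ^ (i + m * e)"
        by (simp add: cong_iff_dvd_diff power_add power_mult mult.commute[of "\<alpha> ^ i"])
      have 2: "r dvd \<alpha> ^ (ord_r * (m * (i div m))) - 1" by (simp add: o)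
      have "\<alpha> ^ (i + m * e) = \<alpha> ^ (i mod m) * \<alpha> ^ (ord_r * (m * (i div m)))"
        by (simp only: e power_add)
      then show ?thesis
        by (intro dvd_lin2[OF 1 2, where p = 1 and q = "\<alpha> ^ (i mod m)"]) (simp only:, simp only: ring_distribs)
    qed
    ultimately have "i mod m \<in> I" by (auto simp: I_def)
    then have "i mod m = 0" using m_min[of "i mod m"] m(1) by (metis mod_less_divisor not_gr_zero not_le)
    then show ?thesis by (simp add: mod_eq_0_iff_dvd)
  qed
  have "m \<noteq> 1"
  proof
    assume "m = 1"
    then have "r dvd cm - \<alpha>" using cm(2) by simp
    then show False using nogen[OF cm(1)] by simp
  qed
  then obtain s where s: "prime s" "s dvd m" using prime_factor_nat by blast
  show ?thesis
  proof (rule that[OF s(1)])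
    show "s dvd ord r \<alpha>" using dvd_trans[OF s(2) m_dvd[OF oI]] by (simp add: ord_r_def)
    show "L \<subseteq> index_sub s r"
    proof clarify
      fix c b assume cb: "(c, b) \<in> L"
      obtain j where j: "n dvd c - \<alpha> ^ j" "r dvd c - \<alpha> ^ j" using generator_mult[OF cb L(1) r(2)] by blast
      have "j \<in> I" using cb j(2) by (auto simp: I_def)
      then have "s dvd j" using m_dvd s(2) dvd_trans by blast
      then obtain i where "j = s * i" by (elim dvdE)
      moreover have "r dvd b" using L(2) cb by (auto simp: point_stab_def)
      ultimately show "(c, b) \<in> index_sub s r" using j(1) by (auto simp: index_sub_def)
    qed
  qed
qed

text \<open>The kernel fixes \<open>t\<close> and the image of \<open>t\<close> under
  \<open>(h, e)\<close> modulo \<open>r * r\<close>; their difference is a unit, so the kernel is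
  trivial there. Then \<open>(h, e)\<close> generates \<open>L\<close> modulo \<open>r * r\<close>,
  and it has a fixed point because \<open>h - 1\<close> is a unit.\<close>

lemma square_case:
  assumes L: "affsub L" "L \<subseteq> point_stab r 0" and r: "prime r" "r dvd n" "r * r dvd n"
    and h: "(h, e) \<in> L" "r dvd h - \<alpha>" and gen: "\<not> r dvd \<alpha> - 1"
    and t: "\<not> r dvd t" "\<And>k d. (k, d) \<in> L \<Longrightarrow> r dvd k - 1 \<Longrightarrow> r * r dvd k * t + d - t"
  obtains f where "L \<subseteq> point_stab (r * r) f" "point_stab (r * r) f \<subseteq> point_stab r 0"
proof -
  have e: "r dvd e" using L(2) h(1) by (auto simp: point_stab_def)
  have h1: "\<not> r dvd h - 1"
  proof
    assume "r dvd h - 1"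
    then have "r dvd \<alpha> - 1" using h(2) by (rule dvd_lin2[where p = 1 and q = "-1"]) simp
    then show False using gen by simp
  qed
  have copr: "coprime x (r * r)" if "\<not> r dvd x" for x
    using prime_imp_coprime[OF r(1) that] by (simp add: coprime_commute)
  obtain f v where f: "r * r dvd h * f + e - f" "f = v * e"
    using solve_fixed_point[OF copr[OF h1]] by metis
  have rf: "r dvd f" using e f(2) by simp
  \<comment> \<open>Since \<open>r\<close> divides \<open>e\<close>, the displacement of
    \<open>t\<close> is \<open>(h - 1) * t\<close> modulo \<open>r\<close>.\<close>
  have "\<not> r dvd h * t + e - t"
  proof
    assume "r dvd h * t + e - t"
    then have "r dvd (h - 1) * t" using e by (rule dvd_lin2[where p = 1 and q = "-1"]) (simp add: algebra_simps)
    then show False using h1 t(1) r(1) by (simp add: prime_dvd_mult_iff)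
  qed
  note cop_ht = copr[OF this]
  have triv: "r * r dvd k - 1 \<and> r * r dvd d" if k: "(k, d) \<in> L" "r dvd k - 1" for k d
  proof -
    have "r * r dvd (k - 1) * (h * t + e - t)"
      by (rule kernel_fixes(2)[OF L(1) h(1) k(1) r(2) k(2) r(3) t(2)])
    then have k1: "r * r dvd k - 1" using cop_ht by (simp add: coprime_commute coprime_dvd_mult_left_iff)
    moreover have "r * r dvd d"
      by (rule dvd_lin2[OF k1 t(2)[OF k], where p = "- t" and q = 1]) (simp add: algebra_simps)
    ultimately show ?thesis ..
  qed
  show ?thesis
  proof (rule that)
    show "L \<subseteq> point_stab (r * r) f"
    proof clarify
      fix c b assume cb: "(c, b) \<in> L"
      obtain j where j: "r dvd c - \<alpha> ^ j" using generator_mult[OF cb L(1) r(2)] by blast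
      have d: "r * r dvd c - h ^ j" "r * r dvd b - e * geo h j"
        using kernel_decomp_trivial[OF L(1) h(1) cb r(2) h(2) j r(3) triv] by blast+
      have "r * r dvd c * f + b - f"
        by (rule dvd_lin3[OF d power_fix[OF f(1), of j], where p = f and q = 1 and r = 1])
           (simp add: algebra_simps)
      then show "(c, b) \<in> point_stab (r * r) f"
        using affsub_mults[OF L(1) cb] by (simp add: point_stab_def)
    qed
    show "point_stab (r * r) f \<subseteq> point_stab r 0"
    proof (clarify, unfold point_stab_def, clarify)
      fix c b assume "r * r dvd c * f + b - f"
      then have "r dvd c * f + b - f" by (rule dvd_mult_left)
      then show "r dvd c * 0 + b - 0" using rf
        by (rule dvd_lin2[where p = 1 and q = "1 - c"]) (simp add: algebra_simps)
    qed
  qed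
qed

text \<open>A class modulo \<open>s\<close> fixed by \<open>L\<close> is combined with the class 0
  modulo \<open>r\<close>. Otherwise two points fixed by the kernel differ by a unit modulo
  \<open>s\<close>, the kernel is trivial modulo \<open>s\<close>, and \<open>(h, e)\<close>
  generates \<open>L\<close> modulo \<open>s\<close> without fixing a class, so it is a translation
  there.\<close>

lemma coprime_case:
  assumes L: "affsub L" "L \<subseteq> point_stab r 0" and r: "prime r" "r dvd n"
    and s: "prime s" "s \<noteq> r" "s dvd n"
    and h: "(h, e) \<in> L" "r dvd h - \<alpha>"
    and t: "\<And>k d. (k, d) \<in> L \<Longrightarrow> r dvd k - 1 \<Longrightarrow> s dvd k * t + d - t"
  obtains (point) f where "L \<subseteq> point_stab (s * r) f" "point_stab (s * r) f \<subseteq> point_stab r 0"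
  | (twisted) l where "twisted_ok s r" "coprime l s" "L \<subseteq> twisted_sub s r l"
proof (cases "\<exists>f. \<forall>c b. (c, b) \<in> L \<longrightarrow> s dvd c * f + b - f")
  case True
  have cop_sr: "coprime r s" using primes_coprime[OF r(1) s(1)] s(2) by blast
  obtain f where f: "\<And>c b. (c, b) \<in> L \<Longrightarrow> s dvd c * f + b - f" using True by blast
  obtain g where "[g = 0] (mod r)" "[g = f] (mod s)"
    using binary_chinese_remainder_int[OF cop_sr, of 0 f] by blast
  then have g: "r dvd g" "s dvd g - f" by (simp_all add: cong_iff_dvd_diff)
  show ?thesis
  proof (rule point)
    show "L \<subseteq> point_stab (s * r) g"
    proof clarify
      fix c b assume cb: "(c, b) \<in> L"
      have "r dvd b" using L(2) cb by (auto simp: point_stab_def)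
      then have "r dvd c * g + b - g" using g(1)
        by (rule dvd_lin2[where p = 1 and q = "c - 1"]) (simp add: algebra_simps)
      moreover have "s dvd c * g + b - g"
        by (rule dvd_lin2[OF f[OF cb] g(2), where p = 1 and q = "c - 1"]) (simp add: algebra_simps)
      ultimately have "s * r dvd c * g + b - g"
        using cop_sr by (simp add: divides_mult coprime_commute)
      then show "(c, b) \<in> point_stab (s * r) g"
        using affsub_mults[OF L(1) cb] by (simp add: point_stab_def)
    qed
    show "point_stab (s * r) g \<subseteq> point_stab r 0"
    proof (clarify, unfold point_stab_def, clarify)
      fix c b assume "s * r dvd c * g + b - g"
      then have "r dvd c * g + b - g" by (rule dvd_mult_right)
      then show "r dvd c * 0 + b - 0" using g(1)
        by (rule dvd_lin2[where p = 1 and q = "1 - c"]) (simp add: algebra_simps)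
    qed
  qed
next
  case False
  have r0: "0 < r" and s0: "0 < s" using r(1) s(1) prime_gt_0_int by blast+
  have cop_sr: "coprime r s" using primes_coprime[OF r(1) s(1)] s(2) by blast
  obtain c0 b0 where 0: "(c0, b0) \<in> L" "\<not> s dvd c0 * t + b0 - t" using False by blast
  have triv: "s dvd k - 1 \<and> s dvd d" if k: "(k, d) \<in> L" "r dvd k - 1" for k d
  proof -
    have "s dvd (k - 1) * (c0 * t + b0 - t)"
      by (rule kernel_fixes(2)[OF L(1) 0(1) k(1) r(2) k(2) s(3) t])
    then have k1: "s dvd k - 1" using 0(2) s(1) by (simp add: prime_dvd_mult_iff)
    moreover have "s dvd d"
      by (rule dvd_lin2[OF k1 t[OF k], where p = "- t" and q = 1]) (simp add: algebra_simps)
    ultimately show ?thesis ..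
  qed
  have dec: "s dvd c - h ^ j \<and> s dvd b - e * geo h j" if "(c, b) \<in> L" "r dvd c - \<alpha> ^ j" for c b j
    using kernel_decomp_trivial[OF L(1) h(1) that(1) r(2) h(2) that(2) s(3) triv] by blast
  have nofix: "\<not> s dvd h * f + e - f" for f
  proof
    assume f: "s dvd h * f + e - f"
    have "s dvd c * f + b - f" if cb: "(c, b) \<in> L" for c b
    proof -
      obtain j where j: "r dvd c - \<alpha> ^ j" using generator_mult[OF cb L(1) r(2)] by blast
      have d: "s dvd c - h ^ j" "s dvd b - e * geo h j" using dec[OF cb j] by auto
      show ?thesis
        by (rule dvd_lin3[OF d power_fix[OF f(1), of j], where p = f and q = 1 and r = 1])
           (simp add: algebra_simps)
    qed
    then show False using False by blast
  qed
  have h1: "s dvd h - 1"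
  proof (rule ccontr)
    assume "\<not> s dvd h - 1"
    then have "coprime s (h - 1)" by (rule prime_imp_coprime[OF s(1)])
    then have "coprime (h - 1) s" by (simp only: coprime_commute)
    then show False using solve_fixed_point nofix by metis
  qed
  have e: "\<not> s dvd e" using nofix[of 0] by simp
  define q where "q = ord s \<alpha>"
  define ord_r where "ord_r = ord r \<alpha>"
  have \<alpha>_r: "\<not> r dvd \<alpha>" and \<alpha>_s: "\<not> s dvd \<alpha>"
    using mults_prime[OF mults_gen] r s by blast+
  have q: "s dvd \<alpha> ^ i - 1 \<longleftrightarrow> q dvd i" for i
    unfolding q_def by (rule dvd_power_minus_1_iff_ord[OF s0])
  \<comment> \<open>The power of \<open>(h, e)\<close> with exponent \<open>ord_r\<close> has
    multiplier 1 modulo \<open>r\<close>, so it lies in the kernel; modulo \<open>s\<close> it is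
    the translation by \<open>e * ord_r\<close>, which must vanish.\<close>
  have s_ord: "s dvd int ord_r"
  proof -
    have "(h ^ ord_r, e * geo h ord_r) \<in> L" by (rule affsub_pow[OF L(1) h(1)])
    moreover have "r dvd h ^ ord_r - 1"
    proof -
      have "[h ^ ord_r = \<alpha> ^ ord_r] (mod r)" using h(2) by (intro cong_pow) (simp add: cong_iff_dvd_diff)
      then have "r dvd h ^ ord_r - \<alpha> ^ ord_r" by (simp add: cong_iff_dvd_diff)
      moreover have "r dvd \<alpha> ^ ord_r - 1" by (simp add: ord_r_def dvd_power_minus_1_iff_ord[OF r0])
      ultimately show ?thesis by (rule dvd_lin2[where p = 1 and q = 1]) simp
    qed
    ultimately have "s dvd e * geo h ord_r" using triv by blast
    then have "s dvd geo h ord_r" using e s(1) by (simp add: prime_dvd_mult_iff)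
    then show ?thesis using geo_cong_1[OF h1, of ord_r] by (rule dvd_lin2[where p = 1 and q = "-1"]) simp
  qed
  \<comment> \<open>If \<open>h\<close> is \<open>\<alpha> ^ i\<close>, then \<open>i\<close> is 1
    modulo \<open>ord_r\<close> because \<open>h\<close> is \<alpha> modulo \<open>r\<close>, and 0
    modulo \<open>q\<close> because \<open>h\<close> is 1 modulo \<open>s\<close>.\<close>
  have cop_ord: "coprime ord_r q"
  proof -
    obtain i where i: "n dvd h - \<alpha> ^ i" "r dvd h - \<alpha> ^ i" using generator_mult[OF h(1) L(1) r(2)] by blast
    have "r dvd \<alpha> ^ i - \<alpha> ^ 1" using i(2) h(2) by (rule dvd_lin2[where p = "-1" and q = 1]) simp
    then have 1: "int ord_r dvd int i - int 1"
      using dvd_power_diffD[OF r(2) r0 _ dvd_refl] ord_r_def by blast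
    have "s dvd h - \<alpha> ^ i" by (rule dvd_trans[OF s(3) i(1)])
    then have "s dvd \<alpha> ^ i - 1" using h1 by (rule dvd_lin2[where p = "-1" and q = 1]) simp
    then have 2: "int q dvd int i" by (simp add: q)
    have "int x dvd 1" if "x dvd ord_r" "x dvd q" for x
    proof -
      have "int x dvd int i - int 1" using that(1) 1 by (meson dvd_trans int_dvd_int_iff)
      moreover have "int x dvd int i" using that(2) 2 by (meson dvd_trans int_dvd_int_iff)
      ultimately have "int x dvd int i - (int i - int 1)" by (rule dvd_diff[rotated])
      then show ?thesis by simp
    qed
    then show ?thesis by (intro coprimeI) simp
  qed
  have ok: "twisted_ok s r" using r s s_ord cop_ord by (simp add: twisted_ok_def ord_r_def q_def)
  obtain v where v: "s dvd r * v - 1"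
    using cong_solve_coprime_int[OF cop_sr] by (auto simp: cong_iff_dvd_diff)
  \<comment> \<open>An element with multiplier \<open>\<alpha> ^ (q * i)\<close> has translation
    \<open>e * q * i\<close> modulo \<open>s\<close>. Division by \<open>r\<close>, whose inverse
    modulo \<open>s\<close> is \<open>v\<close>, gives \<open>l * i\<close>.\<close>
  define l where "l = v * int q * e"
  show ?thesis
  proof (rule twisted[OF ok])
    have "\<not> s dvd v"
    proof
      assume "s dvd v"
      then have "s dvd 1" using v by (rule dvd_lin2[where p = r and q = "-1"]) simp
      then show False using s(1) not_prime_unit by blast
    qed
    moreover have "\<not> s dvd int q"
    proof
      assume "s dvd int q"
      then have "s \<le> int q" using ord_prime_less(1)[OF s(1) \<alpha>_s] by (intro zdvd_imp_le) (auto simp: q_def)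
      then show False using ord_prime_less(2)[OF s(1) \<alpha>_s] by (simp add: q_def)
    qed
    ultimately have "\<not> s dvd l" using e s(1) by (simp add: l_def prime_dvd_mult_iff)
    then have "coprime s l" by (rule prime_imp_coprime[OF s(1)])
    then show "coprime l s" by (simp only: coprime_commute)
    show "L \<subseteq> twisted_sub s r l"
    proof clarify
      fix c b assume cb: "(c, b) \<in> L"
      have rb: "r dvd b" using L(2) cb by (auto simp: point_stab_def)
      obtain k where k: "n dvd c - \<alpha> ^ k" "r dvd c - \<alpha> ^ k" using generator_mult[OF cb L(1) r(2)] by blast
      have d: "s dvd c - h ^ k" "s dvd b - e * geo h k" using dec[OF cb k(2)] by auto
      have "s dvd \<alpha> ^ k - 1"
        by (rule dvd_lin3[OF dvd_trans[OF s(3) k(1)] d(1) dvd_pow_minus_1[OF h1, of k],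
            where p = "-1" and q = 1 and r = 1]) simp
      then obtain i where i: "k = q * i" using q by (meson dvdE)
      have "s dvd b - r * l * int i"
        by (rule dvd_lin3[OF d(2) geo_cong_1[OF h1, of k] v, where p = 1 and q = e and r = "- (int q * e * int i)"])
           (simp add: l_def i algebra_simps)
      moreover have "r dvd b - r * l * int i" using rb by simp
      ultimately have "s * r dvd b - r * l * int i"
        using cop_sr by (simp add: divides_mult coprime_commute)
      then show "(c, b) \<in> twisted_sub s r l" using k(1) by (auto simp: twisted_sub_def i q_def)
    qed
  qed
qed

lemma kernel_monoid:
  assumes "affsub L"
  shows "aff_monoid {(c, b). (c, b) \<in> L \<and> r dvd c - 1}"
  unfolding aff_monoid_def
proof (intro conjI allI impI)
  fix c b c' b' assume "(c, b) \<in> {(c, b). (c, b) \<in> L \<and> r dvd c - 1}"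
    "(c', b') \<in> {(c, b). (c, b) \<in> L \<and> r dvd c - 1}"
  then have c: "(c, b) \<in> L" "r dvd c - 1" "(c', b') \<in> L" "r dvd c' - 1" by auto
  have "r dvd c * c' - 1"
    by (rule dvd_lin2[OF c(2,4), where p = c' and q = 1]) (simp add: algebra_simps)
  then show "(c * c', c * b' + b) \<in> {(c, b). (c, b) \<in> L \<and> r dvd c - 1}"
    using affsub_mult[OF assms c(1,3)] by simp
qed (simp add: affsub_one[OF assms])

text \<open>Modulo 4 the kernel is generated by a reflection, which a map normalizing it must preserve
  up to its central translation; an odd power of the map lies in the kernel, so the translation is
  trivial.\<close>

lemma pair_case:
  assumes L: "affsub L" "L \<subseteq> point_stab r 0" and r: "prime r" "4 * r dvd n" "\<not> r dvd \<alpha> - 1"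
    and h: "(h, e) \<in> L" "r dvd h - \<alpha>"
    and k0: "(k0, d0) \<in> L" "r dvd k0 - 1" "4 dvd k0 + 1" and \<beta>: "odd \<beta>"
    and K: "\<And>k d. (k, d) \<in> L \<Longrightarrow> r dvd k - 1 \<Longrightarrow>
      4 dvd k - 1 \<and> 4 * r dvd k * x + d - x \<or> 4 dvd k + 1 \<and> 4 * r dvd k * x + d - x - r * \<beta>"
  obtains t where "odd r" "4 dvd n" "4 dvd \<alpha> + 1" "L \<subseteq> pair_stab (4 * r) t (r * \<beta>)"
    "pair_stab (4 * r) t (r * \<beta>) \<subseteq> point_stab r 0"
proof -
  have n4: "4 dvd n" and rn: "r dvd n" using r(2) dvd_mult_left dvd_mult_right by blast+
  have r0: "0 < r" using r(1) prime_gt_0_int by blast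
  have "even n" by (rule dvd_trans[OF _ n4]) simp
  have \<alpha>4: "4 dvd \<alpha> + 1" by (rule alpha_mod_4[OF n4 affsub_mults[OF L(1) k0(1)] k0(3)])
  have odd_r: "odd r"
  proof
    assume "even r"
    then have "r = 2" using r(1) primes_dvd_imp_eq[of 2 r] by auto
    moreover have "odd \<alpha>" by (rule mults_odd[OF mults_gen \<open>even n\<close>])
    ultimately show False using r(3) by simp
  qed
  define \<gamma> where "\<gamma> = r * \<beta>"
  have \<gamma>: "odd \<gamma>" using odd_r \<beta> by (simp add: \<gamma>_def)
  \<comment> \<open>The displacement of \<open>x\<close> under \<open>(h, e)\<close>. The aim is
    that modulo 4 it is 0 or \<gamma> according to the sign of \<open>h\<close>.\<close>
  define g where "g = h * x + e - x"
  have K4: "4 dvd k - 1 \<and> 4 dvd k * x + d - x \<or> 4 dvd k + 1 \<and> 4 dvd k * x + d - x - \<gamma>"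
    if "(k, d) \<in> L" "r dvd k - 1" for k d
    using K[OF that] dvd_mult_left[of 4 r] by (auto simp: \<gamma>_def)
  have odd_m: "4 dvd c - 1 \<or> 4 dvd c + 1" if "(c, b) \<in> L" for c b
    using mults_mod[OF n4 \<alpha>4 affsub_mults[OF L(1) that]] .
  have k0x: "4 dvd k0 * x + d0 - x - \<gamma>"
  proof -
    have "\<not> 4 dvd k0 - 1" using k0(3) by presburger
    then show ?thesis using K4[OF k0(1,2)] by blast
  qed
  define m where "m = ord r \<alpha>"
  \<comment> \<open>The exponent of the reflection \<open>k0\<close> is odd because \<alpha> is -1
    modulo 4, and it is a multiple of \<open>m\<close> because \<open>k0\<close> is 1 modulo
    \<open>r\<close>.\<close>
  have m_odd: "odd m"
  proof -
    obtain i where i: "n dvd k0 - \<alpha> ^ i" using affsub_mults[OF L(1) k0(1)] by (auto simp: mults_def)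
    have "r dvd \<alpha> ^ i - 1"
      by (rule dvd_lin2[OF dvd_trans[OF rn i] k0(2), where p = "-1" and q = 1]) simp
    then have mi: "m dvd i" by (simp add: m_def dvd_power_minus_1_iff_ord[OF r0])
    have "odd i"
    proof
      assume "even i"
      then have "4 dvd \<alpha> ^ i - 1" by (rule pow_alpha_mod(1)[OF \<alpha>4])
      moreover have "4 dvd k0 - \<alpha> ^ i" by (rule dvd_trans[OF n4 i])
      ultimately show False using k0(3) by presburger
    qed
    then show ?thesis using mi dvd_trans by blast
  qed
  \<comment> \<open>The reflection \<open>(k0, d0)\<close> and its conjugate by
    \<open>(h, e)\<close> both send \<open>x\<close> to \<open>x + \<gamma>\<close> modulo 4;
    comparing them determines \<open>g\<close> modulo 2.\<close>
  have norm: "4 dvd h * \<gamma> + 2 * g - \<gamma>"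
  proof -
    obtain k1 d1 where k1: "(k1, d1) \<in> L" "r dvd k1 - 1" "n dvd h * k1 - k0 * h"
      "n dvd h * d1 + e - (k0 * e + d0)" by (rule kernel_conj[OF L(1) h(1) k0(1) rn k0(2)])
    have "4 dvd h * (k1 - k0)"
      using dvd_trans[OF n4 k1(3)] by (rule dvd_lin1[where p = 1]) (simp add: algebra_simps)
    moreover have "coprime 4 h"
      using mults_coprime[OF affsub_mults[OF L(1) h(1)] n4] by (simp only: coprime_commute)
    ultimately have "4 dvd k1 - k0" using coprime_dvd_mult_right_iff by blast
    then have "\<not> 4 dvd k1 - 1" using k0(3) by presburger
    then have k1x: "4 dvd k1 * x + d1 - x - \<gamma>" using K4[OF k1(1,2)] by blast
    have 1: "4 dvd h * k1 * x - k0 * h * x + (h * d1 + e - (k0 * e + d0))"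
      by (rule dvd_lin2[OF dvd_trans[OF n4 k1(3)] dvd_trans[OF n4 k1(4)], where p = x and q = 1])
         (simp add: algebra_simps)
    have 2: "4 dvd h * \<gamma> + x + g - (k0 * (x + g) + d0)"
      by (rule dvd_lin2[OF 1 k1x, where p = 1 and q = "- h"]) (simp add: g_def algebra_simps)
    show ?thesis
      by (rule dvd_lin3[OF 2 k0x k0(3), where p = 1 and q = 1 and r = g]) (simp add: algebra_simps)
  qed
  have h4: "4 dvd h - 1 \<and> 4 dvd 2 * g \<or> 4 dvd h + 1 \<and> 4 dvd 2 * g - 2 * \<gamma>"
    using odd_m[OF h(1)]
  proof
    assume a: "4 dvd h - 1"
    have "4 dvd 2 * g" by (rule dvd_lin2[OF norm a, where p = 1 and q = "- \<gamma>"]) (simp add: algebra_simps)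
    then show ?thesis using a by blast
  next
    assume a: "4 dvd h + 1"
    have "4 dvd 2 * g - 2 * \<gamma>"
      by (rule dvd_lin2[OF norm a, where p = 1 and q = "- \<gamma>"]) (simp add: algebra_simps)
    then show ?thesis using a by blast
  qed
  have gh: "4 dvd g * (h + 1)"
    using h4
  proof (elim disjE conjE)
    assume a: "4 dvd h - 1" "4 dvd 2 * g"
    show ?thesis by (rule dvd_lin2[OF a, where p = g and q = 1]) (simp add: algebra_simps)
  qed simp
  obtain i where i: "m = 2 * i + 1" using m_odd by (elim oddE)
  have "(h ^ m, e * geo h m) \<in> L" by (rule affsub_pow[OF L(1) h(1)])
  moreover have "r dvd h ^ m - 1"
  proof -
    have "[h ^ m = \<alpha> ^ m] (mod r)" using h(2) by (intro cong_pow) (simp add: cong_iff_dvd_diff)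
    then have "r dvd h ^ m - \<alpha> ^ m" by (simp add: cong_iff_dvd_diff)
    moreover have "r dvd \<alpha> ^ m - 1" by (simp add: m_def dvd_power_minus_1_iff_ord[OF r0])
    ultimately show ?thesis by (rule dvd_lin2[where p = 1 and q = 1]) simp
  qed
  ultimately have hm: "4 dvd h ^ m - 1 \<and> 4 dvd h ^ m * x + e * geo h m - x
      \<or> 4 dvd h ^ m + 1 \<and> 4 dvd h ^ m * x + e * geo h m - x - \<gamma>" by (rule K4)
  have "4 dvd h\<^sup>2 - 1"
    using odd_m[OF h(1)]
  proof
    assume a: "4 dvd h - 1"
    show ?thesis by (rule dvd_lin1[OF a, where p = "h + 1"]) (simp add: power2_eq_square algebra_simps)
  next
    assume a: "4 dvd h + 1"
    show ?thesis by (rule dvd_lin1[OF a, where p = "h - 1"]) (simp add: power2_eq_square algebra_simps)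
  qed
  then have h2i: "4 dvd (h\<^sup>2) ^ i - 1" by (rule dvd_pow_minus_1)
  have "h ^ m = (h\<^sup>2) ^ i * h" by (simp only: i power_add power_mult power_one_right)
  then have hmh: "4 dvd h ^ m - h" by (intro dvd_lin1[OF h2i, where p = h]) (simp add: algebra_simps)
  have geo_m: "4 dvd h ^ m * x + e * geo h m - x - g"
  proof -
    have "h ^ m = (h - 1) * geo h m + 1" using geo_diff[of h m] by simp
    then have 1: "h ^ m * x + e * geo h m - x = g * geo h m"
      by (simp only: g_def) (simp add: algebra_simps)
    \<comment> \<open>As \<open>m\<close> is odd, the sum is 1 plus a multiple of
      \<open>1 + h\<close>, and \<open>gh\<close> removes that multiple modulo 4. So the
      \<open>m\<close>-th power, which lies in the kernel, displaces \<open>x\<close> by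
      \<open>g\<close> as well.\<close>
    have "geo h m = 1 + h * ((1 + h) * geo (h\<^sup>2) i)"
    proof -
      have "geo h (1 + 2 * i) = geo h 1 + h ^ 1 * (geo h 2 * geo (h\<^sup>2) i)" by (simp only: geo_add geo_mult)
      then show ?thesis by (simp add: i geo_def numeral_2_eq_2)
    qed
    then have "g * geo h m - g = (h * geo (h\<^sup>2) i) * (g * (h + 1))" by (simp add: algebra_simps)
    then show ?thesis using gh 1 by (metis dvd_mult)
  qed
  have h_fin: "4 dvd h - 1 \<and> 4 dvd g \<or> 4 dvd h + 1 \<and> 4 dvd g - \<gamma>"
    using hm
  proof (elim disjE conjE)
    assume a: "4 dvd h ^ m - 1" "4 dvd h ^ m * x + e * geo h m - x"
    have "4 dvd h - 1" using a(1) hmh by (rule dvd_lin2[where p = 1 and q = "-1"]) simp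
    moreover have "4 dvd g" using a(2) geo_m by (rule dvd_lin2[where p = 1 and q = "-1"]) simp
    ultimately show ?thesis by blast
  next
    assume a: "4 dvd h ^ m + 1" "4 dvd h ^ m * x + e * geo h m - x - \<gamma>"
    have "4 dvd h + 1" using a(1) hmh by (rule dvd_lin2[where p = 1 and q = "-1"]) simp
    moreover have "4 dvd g - \<gamma>" using a(2) geo_m by (rule dvd_lin2[where p = 1 and q = "-1"]) simp
    ultimately show ?thesis by blast
  qed
  have mult\<gamma>: "4 dvd c - 1 \<Longrightarrow> 4 dvd c * \<gamma> - \<gamma>" "4 dvd c + 1 \<Longrightarrow> 4 dvd c * \<gamma> + \<gamma>" for c
    by (erule dvd_lin1[where p = \<gamma>], simp add: algebra_simps)+
  have P: "affsub (pair_stab 4 x \<gamma>)" by (rule affclosed_sub[OF affclosed_pair_stab[OF n4]])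
  have hP: "(h, e) \<in> pair_stab 4 x \<gamma>"
    using h_fin mult\<gamma>[of h] affsub_mults[OF L(1) h(1)] by (auto simp: pair_stab_def g_def)
  have KP: "(k, d) \<in> pair_stab 4 x \<gamma>" if "(k, d) \<in> L" "r dvd k - 1" for k d
    using K4[OF that] mult\<gamma>[of k] affsub_mults[OF L(1) that(1)] by (auto simp: pair_stab_def)
  have LP: "(c, b) \<in> pair_stab 4 x \<gamma>" if cb: "(c, b) \<in> L" for c b
  proof -
    obtain j where j: "r dvd c - \<alpha> ^ j" using generator_mult[OF cb L(1) rn] by blast
    obtain k d where k: "(k, d) \<in> L" "r dvd k - 1" "n dvd c - h ^ j * k"
      "n dvd b - (h ^ j * d + e * geo h j)" by (rule kernel_decomp[OF L(1) h(1) cb rn h(2) j])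
    have "(h ^ j * k, h ^ j * d + e * geo h j) \<in> pair_stab 4 x \<gamma>"
      by (rule affsub_mult[OF P affsub_pow[OF P hP] KP[OF k(1,2)]])
    then show ?thesis by (rule affsub_cong[OF P _ k(3,4)])
  qed
  have cop4: "coprime 4 r"
  proof -
    have "coprime (2\<^sup>2) r" using odd_r by (simp only: coprime_power_left_iff) (simp add: coprime_left_2_iff_odd)
    then show ?thesis by simp
  qed
  \<comment> \<open>The class of \<open>x\<close> modulo 4 is joined with the class 0 modulo
    \<open>r\<close>, which \<open>L\<close> fixes.\<close>
  obtain t where "[t = x] (mod 4)" "[t = 0] (mod r)"
    using binary_chinese_remainder_int[OF cop4, of x 0] by blast
  then have t: "4 dvd t - x" "r dvd t" by (simp_all add: cong_iff_dvd_diff)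
  show ?thesis
  proof (rule that[OF odd_r n4 \<alpha>4])
    show "L \<subseteq> pair_stab (4 * r) t (r * \<beta>)"
    proof clarify
      fix c b assume cb: "(c, b) \<in> L"
      have c: "c \<in> mults" by (rule affsub_mults[OF L(1) cb])
      have rb: "r dvd b" using L(2) cb by (auto simp: point_stab_def)
      have rt: "r dvd c * t + b - t" using t(2) rb by simp
      have r\<gamma>: "r dvd \<gamma>" by (simp add: \<gamma>_def)
      consider (1) "4 dvd c * x + b - x" "4 dvd c * \<gamma> - \<gamma>"
        | (2) "4 dvd c * x + b - x - \<gamma>" "4 dvd c * \<gamma> + \<gamma>"
        using LP[OF cb] by (auto simp: pair_stab_def)
      then have "4 dvd c * t + b - t \<and> 4 dvd c * \<gamma> - \<gamma> \<or> 4 dvd c * t + b - t - \<gamma> \<and> 4 dvd c * \<gamma> + \<gamma>"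
      proof cases
        case a: 1
        have "4 dvd c * t + b - t"
          by (rule dvd_lin2[OF a(1) t(1), where p = 1 and q = "c - 1"]) (simp add: algebra_simps)
        then show ?thesis using a by blast
      next
        case a: 2
        have "4 dvd c * t + b - t - \<gamma>"
          by (rule dvd_lin2[OF a(1) t(1), where p = 1 and q = "c - 1"]) (simp add: algebra_simps)
        then show ?thesis using a by blast
      qed
      moreover have "r dvd c * \<gamma> - \<gamma>" "r dvd c * \<gamma> + \<gamma>" "r dvd c * t + b - t - \<gamma>"
        using r\<gamma> rt by (auto intro: dvd_diff)
      ultimately have "4 * r dvd c * t + b - t \<and> 4 * r dvd c * \<gamma> - \<gamma> \<or>
          4 * r dvd c * t + b - t - \<gamma> \<and> 4 * r dvd c * \<gamma> + \<gamma>"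
        using rt divides_mult[OF _ _ cop4] by blast
      then show "(c, b) \<in> pair_stab (4 * r) t (r * \<beta>)" using c by (simp add: pair_stab_def \<gamma>_def)
    qed
    show "pair_stab (4 * r) t (r * \<beta>) \<subseteq> point_stab r 0"
    proof (clarify, unfold point_stab_def pair_stab_def, clarify)
      fix c b assume "4 * r dvd c * t + b - t \<and> 4 * r dvd c * (r * \<beta>) - r * \<beta> \<or>
        4 * r dvd c * t + b - t - r * \<beta> \<and> 4 * r dvd c * (r * \<beta>) + r * \<beta>"
      then have "r dvd c * t + b - t \<or> r dvd c * t + b - t - r * \<beta>"
        using dvd_mult_right by blast
      then show "r dvd c * 0 + b - 0"
      proof
        assume "r dvd c * t + b - t"
        then show ?thesis using t(2) by (rule dvd_lin2[where p = 1 and q = "1 - c"]) (simp add: algebra_simps)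
      next
        assume "r dvd c * t + b - t - r * \<beta>"
        then show ?thesis using t(2) dvd_refl
          by (rule dvd_lin3[where p = 1 and q = "1 - c" and r = \<beta>]) (simp add: algebra_simps)
      qed
    qed
  qed
qed

theorem proper_in_point_stab:
  assumes L: "affclosed L" "L \<subset> point_stab r 0" and r: "prime r" "r dvd n"
  obtains (point) s t where "prime s" "s * r dvd n" "L \<subseteq> point_stab (s * r) t"
      "point_stab (s * r) t \<subseteq> point_stab r 0"
  | (pair) \<beta> t where "odd r" "4 dvd n" "4 dvd \<alpha> + 1" "odd \<beta>" "L \<subseteq> pair_stab (4 * r) t (r * \<beta>)"
      "pair_stab (4 * r) t (r * \<beta>) \<subseteq> point_stab r 0"
  | (index) s where "prime (s::nat)" "s dvd ord r \<alpha>" "L \<subseteq> index_sub s r"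
  | (twisted) s l where "twisted_ok s r" "coprime l s" "L \<subseteq> twisted_sub s r l"
proof -
  note sub = affclosed_sub[OF L(1)]
  have Lp: "L \<subseteq> point_stab r 0" using L(2) by blast
  have rb: "r dvd b" if "(c, b) \<in> L" for c b using Lp that by (auto simp: point_stab_def)
  have r0: "0 < r" using r(1) prime_gt_0_int by blast
  obtain cg bg where g: "(cg, bg) \<in> point_stab r 0" "(cg, bg) \<notin> L" using L(2) by auto
  then have g': "cg \<in> mults" "r dvd bg" by (auto simp: point_stab_def)
  obtain x where x: "\<And>c b. (c, b) \<in> L \<Longrightarrow> \<not> n dvd c * x + b - (cg * x + bg)"
    using closed_intransitive[OF L(1) g(2) g'(1)] by metis
  show thesis
  proof (cases "r dvd x")
    case True
    show thesis
    proof (rule point_stab_intransitive)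
      show "affsub L" "L \<subseteq> point_stab r 0" "prime r" "r dvd n" by (fact sub Lp r)+
      show "r dvd x - 0" "r dvd cg * x + bg - 0" using True g' by simp_all
      show "\<not> n dvd c * x + b - (cg * x + bg)" if "(c, b) \<in> L" for c b using x that by blast
    qed (use point pair in blast)+
  next
    case rx: False
    show thesis
    proof (cases "\<exists>h e. (h, e) \<in> L \<and> r dvd h - \<alpha>")
      case False
      then show thesis using index_case[OF sub Lp r] index by metis
    next
      case True
      then obtain h e where h: "(h, e) \<in> L" "r dvd h - \<alpha>" by blast
      show thesis
      \<comment> \<open>If \<alpha> is 1 modulo \<open>r\<close>, then \<open>L\<close> fixes the
        class of \<open>x\<close> too and the argument for a fixed class applies to it. The case is
        split off because \<open>square_case\<close> and \<open>pair_case\<close> rely on \<alpha>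
        being different from 1 modulo \<open>r\<close>.\<close>
      proof (cases "r dvd \<alpha> - 1")
        case True
        have r1: "r dvd c - 1" if cm: "c \<in> mults" for c
        proof -
          obtain i where i: "n dvd c - \<alpha> ^ i" using cm by (auto simp: mults_def)
          show ?thesis
            by (rule dvd_lin2[OF dvd_trans[OF r(2) i] dvd_pow_minus_1[OF True, of i], where p = 1 and q = 1]) simp
        qed
        have eq: "point_stab r x = point_stab r 0"
        proof -
          have "r dvd c * x + b - x \<longleftrightarrow> r dvd b" if "c \<in> mults" for c b
          proof -
            have "r dvd (c - 1) * x" using r1[OF that] by simp
            then have "r dvd (c - 1) * x + b \<longleftrightarrow> r dvd b" by (rule dvd_add_right_iff)
            moreover have "c * x + b - x = (c - 1) * x + b" by (simp add: algebra_simps)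
            ultimately show ?thesis by (simp only:)
          qed
          then show ?thesis by (auto simp: point_stab_def)
        qed
        show thesis
        proof (rule point_stab_intransitive)
          show "affsub L" "L \<subseteq> point_stab r x" "prime r" "r dvd n" using sub Lp r eq by auto
          show "r dvd x - x" by simp
          show "r dvd cg * x + bg - x" using g(1) eq by (auto simp: point_stab_def)
          show "\<not> n dvd c * x + b - (cg * x + bg)" if "(c, b) \<in> L" for c b using x that by blast
        qed (use point pair eq in blast)+
      next
        case gen: False
        obtain j where j: "n dvd cg - \<alpha> ^ j" using g'(1) by (auto simp: mults_def)
        have hj: "(h ^ j, e * geo h j) \<in> L" by (rule affsub_pow[OF sub h(1)])
        obtain i d where i: "(i, d) \<in> L" "n dvd h ^ j * i - 1" "n dvd h ^ j * d + e * geo h j"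
          using affsub_inv[OF sub hj] by metis
        have hj_r: "r dvd h ^ j - \<alpha> ^ j"
        proof -
          have "[h ^ j = \<alpha> ^ j] (mod r)" using h(2) by (intro cong_pow) (simp add: cong_iff_dvd_diff)
          then show ?thesis by (simp add: cong_iff_dvd_diff)
        qed
        \<comment> \<open>The target \<open>cg * x + bg\<close>, pulled back by the
          \<open>j\<close>-th power of \<open>(h, e)\<close>. It lies in the class of
          \<open>x\<close>, so the kernel, which fixes this class, can be tested on \<open>x\<close>
          and \<open>y\<close>.\<close>
        define y where "y = i * (cg * x + bg) + d"
        have yx: "r dvd y - x"
        proof -
          have 1: "r dvd i * (h ^ j - cg)"
            using hj_r dvd_trans[OF r(2) j]
            by (rule dvd_lin2[where p = i and q = "- i"]) (simp add: algebra_simps)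
          have 2: "r dvd i * bg + d" using g'(2) rb[OF i(1)] by simp
          show ?thesis
            by (rule dvd_lin3[OF 1 dvd_trans[OF r(2) i(2)] 2, where p = "- x" and q = x and r = 1])
               (simp add: y_def algebra_simps)
        qed
        define K where "K = {(c, b). (c, b) \<in> L \<and> r dvd c - 1}"
        have Kint: "\<not> n dvd c * x + b - y" if "(c, b) \<in> K" for c b
        proof
          assume a: "n dvd c * x + b - y"
          have "(h ^ j * c, h ^ j * b + e * geo h j) \<in> L"
            using affsub_mult[OF sub hj] that by (simp add: K_def)
          moreover have "n dvd (h ^ j * c) * x + (h ^ j * b + e * geo h j) - (cg * x + bg)"
            by (rule dvd_lin3[OF a i(2,3), where p = "h ^ j" and q = "cg * x + bg" and r = 1])
               (simp add: y_def algebra_simps)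
          ultimately show False using x by blast
        qed
        show thesis
        proof (rule class_intransitive)
          show "aff_monoid K" unfolding K_def by (rule kernel_monoid[OF sub])
          show "0 < n" "r dvd n" "0 < r" "r dvd x - x" "r dvd y - x" using n_pos r(2) r0 yx by simp_all
          fix c b assume cb: "(c, b) \<in> K"
          then have cb': "(c, b) \<in> L" "r dvd c - 1" by (auto simp: K_def)
          show "coprime c n" by (rule affsub_coprime[OF sub cb'(1)])
          show "r dvd c * x + b - x"
            by (rule dvd_lin2[OF cb'(2) rb[OF cb'(1)], where p = x and q = 1]) (simp add: algebra_simps)
          show "\<not> n dvd c * x + b - y" by (rule Kint[OF cb])
        next
          fix s t assume s: "prime s" "s * r dvd n" "r dvd t - x"
            and t: "\<And>c b. (c, b) \<in> K \<Longrightarrow> s * r dvd c * t + b - t"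
          have rt: "\<not> r dvd t"
          proof
            assume "r dvd t"
            then have "r dvd x" using s(3) by (rule dvd_lin2[where p = 1 and q = "-1"]) simp
            then show False using rx by simp
          qed
          show thesis
          proof (cases "s = r")
            case True
            have t': "r * r dvd k * t + d - t" if "(k, d) \<in> L" "r dvd k - 1" for k d
              using t[of k d] that True by (simp add: K_def)
            have "r * r dvd n" using s(2) True by simp
            then show thesis
              using square_case[OF sub Lp r _ h gen rt t'] point[OF r(1)] by metis
          next
            case False
            have sn: "s dvd n" by (rule dvd_mult_left[OF s(2)])
            have t': "s dvd k * t + d - t" if "(k, d) \<in> L" "r dvd k - 1" for k d
              using dvd_mult_left[OF t[of k d]] that by (simp add: K_def)
            show thesis
              using coprime_case[OF sub Lp r s(1) False sn h t'] point[OF s(1,2)] twisted by metis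
          qed
        next
          fix \<beta> k0 d0 assume a: "4 * r dvd n" "odd \<beta>" "(k0, d0) \<in> K" "4 dvd k0 + 1"
            and t: "\<And>c b. (c, b) \<in> K \<Longrightarrow> 4 dvd c - 1 \<and> 4 * r dvd c * x + b - x
                \<or> 4 dvd c + 1 \<and> 4 * r dvd c * x + b - x - r * \<beta>"
          have k0: "(k0, d0) \<in> L" "r dvd k0 - 1" using a(3) by (auto simp: K_def)
          show thesis
          proof (rule pair_case[OF sub Lp r(1) a(1) gen h k0 a(4,2)])
            show "4 dvd k - 1 \<and> 4 * r dvd k * x + d - x \<or> 4 dvd k + 1 \<and> 4 * r dvd k * x + d - x - r * \<beta>"
              if "(k, d) \<in> L" "r dvd k - 1" for k d
              by (rule t) (use that in \<open>simp add: K_def\<close>)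
          qed (use pair a(2) in blast)
        qed
      qed
    qed
  qed
qed

section \<open>Closed subgroups of a pair stabilizer modulo 4\<close>

lemma pair_stab_4_iff:
  assumes "4 dvd n" "odd \<beta>"
  shows "(c, b) \<in> pair_stab 4 0 \<beta> \<longleftrightarrow>
    c \<in> mults \<and> (4 dvd c - 1 \<and> 4 dvd b \<or> 4 dvd c + 1 \<and> 4 dvd b - \<beta>)"
proof -
  have "coprime (2\<^sup>2) \<beta>" using assms(2) by (simp only: coprime_power_left_iff) (simp add: coprime_left_2_iff_odd)
  then have c: "coprime 4 \<beta>" by simp
  have "c * \<beta> - \<beta> = (c - 1) * \<beta>" "c * \<beta> + \<beta> = (c + 1) * \<beta>" by (simp_all add: algebra_simps)
  then have "4 dvd c * \<beta> - \<beta> \<longleftrightarrow> 4 dvd c - 1" "4 dvd c * \<beta> + \<beta> \<longleftrightarrow> 4 dvd c + 1"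
    using coprime_dvd_mult_left_iff[OF c] by simp_all
  then show ?thesis by (auto simp: pair_stab_def)
qed

text \<open>A multiplier that is -1 modulo 4 is an odd power of \<alpha>, and the square of \<alpha>
  is 1 modulo 8; so the multiplier agrees with \<alpha> modulo 8.\<close>

lemma alpha_mod_8:
  assumes "8 dvd n" "h \<in> mults" "8 dvd h + 1" "4 dvd \<alpha> + 1"
  shows "8 dvd \<alpha> + 1"
proof -
  obtain i where i: "n dvd h - \<alpha> ^ i" using assms(2) by (auto simp: mults_def)
  then have d: "8 dvd h - \<alpha> ^ i" by (rule dvd_trans[OF assms(1)])
  have "odd i"
  proof
    assume "even i"
    then have "4 dvd \<alpha> ^ i - 1" by (rule pow_alpha_mod(1)[OF assms(4)])
    then show False using d assms(3) by presburger
  qed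
  then obtain j where j: "i = 2 * j + 1" by (elim oddE)
  have "8 dvd \<alpha>\<^sup>2 - 1"
  proof -
    obtain k where k: "\<alpha> + 1 = 4 * k" using assms(4) by (elim dvdE)
    have "\<alpha>\<^sup>2 - 1 = 8 * (k * (2 * k - 1))"
    proof -
      have "\<alpha> = 4 * k - 1" using k by simp
      then show ?thesis by (simp only: power2_eq_square) (simp add: algebra_simps)
    qed
    then show ?thesis by simp
  qed
  then have 1: "8 dvd (\<alpha>\<^sup>2) ^ j - 1" by (rule dvd_pow_minus_1)
  have "\<alpha> ^ i = (\<alpha>\<^sup>2) ^ j * \<alpha>" by (simp only: j power_add power_mult power_one_right)
  then have "8 dvd \<alpha> ^ i - \<alpha>" by (intro dvd_lin1[OF 1, where p = \<alpha>]) (simp add: algebra_simps)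
  then show ?thesis using d assms(3)
    by (rule dvd_lin3[where p = "-1" and q = "-1" and r = 1]) simp
qed

text \<open>The product of two multipliers that are -1 modulo 4 is 1 modulo 4, so a single
  reflection represents the nontrivial coset of the kernel.\<close>

lemma reflection_decomp:
  assumes L: "affsub L" "(h, e) \<in> L" "(c, b) \<in> L" and n4: "4 dvd n" and hc: "4 dvd h + 1" "4 dvd c + 1"
  obtains k d where "(k, d) \<in> L" "4 dvd k - 1" "n dvd c - h * k" "n dvd b - (h * d + e)"
proof -
  obtain i f where i: "(i, f) \<in> L" "n dvd h * i - 1" "n dvd h * f + e" "n dvd i * e + f"
    by (rule affsub_inv[OF L(1,2)])
  show ?thesis
  proof (rule that)
    show "(i * c, i * b + f) \<in> L" by (rule affsub_mult[OF L(1) i(1) L(3)])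
    show "4 dvd i * c - 1"
      by (rule dvd_lin3[OF dvd_trans[OF n4 i(2)] hc, where p = 1 and q = "- i" and r = i])
         (simp add: algebra_simps)
    show "n dvd c - h * (i * c)"
      by (rule dvd_lin1[OF i(2), where p = "- c"]) (simp add: algebra_simps)
    show "n dvd b - (h * (i * b + f) + e)"
      by (rule dvd_lin2[OF i(2,3), where p = "- b" and q = "-1"]) (simp add: algebra_simps)
  qed
qed

text \<open>With \<open>t\<close> and \<open>h t\<close> the kernel fixes their midpoint, which \<open>h\<close> fixes as well.\<close>

lemma midpoint_fixed:
  assumes L: "affsub L" "(h, e) \<in> L" "4 dvd h + 1" and n4: "4 dvd n"
    and s: "odd s" "s dvd n"
    and t: "\<And>k d. (k, d) \<in> L \<Longrightarrow> 4 dvd k - 1 \<Longrightarrow> s dvd k * t + d - t"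
    and two: "\<And>c b. (c, b) \<in> L \<Longrightarrow> 4 dvd c - 1 \<or> 4 dvd c + 1"
  obtains m where "\<And>c b. (c, b) \<in> L \<Longrightarrow> s dvd c * m + b - m"
proof -
  have cop2: "coprime s 2" using s(1) by simp
  then have "coprime 2 s" by (simp only: coprime_commute)
  then obtain v where v: "s dvd 2 * v - 1"
    using cong_solve_coprime_int[of 2 s] unfolding cong_iff_dvd_diff by blast
  have half: "s dvd z" if "s dvd 2 * z" for z
    using that cop2 by (simp add: coprime_dvd_mult_right_iff)
  define m where "m = v * (t + (h * t + e))"
  have m: "s dvd 2 * m - (t + (h * t + e))"
    by (rule dvd_lin1[OF v, where p = "t + (h * t + e)"]) (simp add: m_def algebra_simps)
  have km: "s dvd k * m + d - m" if k: "(k, d) \<in> L" "4 dvd k - 1" for k d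
  proof (rule half)
    have "s dvd k * (h * t + e) + d - (h * t + e)"
      by (rule kernel_fixes(1)[OF L(1,2) k(1) n4 k(2) s(2) t])
    then show "s dvd 2 * (k * m + d - m)"
      using t[OF k] m by (rule dvd_lin3[where p = 1 and q = 1 and r = "k - 1"]) (simp add: algebra_simps)
  qed
  \<comment> \<open>The square of \<open>(h, e)\<close> lies in the kernel and fixes
    \<open>t\<close>, so \<open>(h, e)\<close> swaps \<open>t\<close> with its image modulo
    \<open>s\<close>.\<close>
  have hm: "s dvd h * m + e - m"
  proof (rule half)
    have "(h * h, h * e + e) \<in> L" by (rule affsub_mult[OF L(1,2,2)])
    moreover have "4 dvd h * h - 1"
      by (rule dvd_lin1[OF L(3), where p = "h - 1"]) (simp add: algebra_simps)
    ultimately have "s dvd (h * h) * t + (h * e + e) - t" by (rule t)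
    then show "s dvd 2 * (h * m + e - m)"
      using m by (rule dvd_lin2[where p = 1 and q = "h - 1"]) (simp add: algebra_simps)
  qed
  show ?thesis
  proof (rule that)
    fix c b assume cb: "(c, b) \<in> L"
    show "s dvd c * m + b - m"
      using two[OF cb]
    proof
      assume "4 dvd c - 1"
      then show ?thesis by (rule km[OF cb])
    next
      assume c: "4 dvd c + 1"
      obtain k d where k: "(k, d) \<in> L" "4 dvd k - 1" "n dvd c - h * k" "n dvd b - (h * d + e)"
        by (rule reflection_decomp[OF L(1,2) cb n4 L(3) c])
      have "s dvd (c - h * k) * m + (b - (h * d + e))"
        using dvd_trans[OF s(2) k(3)] dvd_trans[OF s(2) k(4)] by simp
      then show ?thesis using km[OF k(1,2)] hm
        by (rule dvd_lin3[where p = 1 and q = h and r = 1]) (simp add: algebra_simps)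
    qed
  qed
qed

text \<open>The elements of \<open>L\<close> with multiplier 1 modulo 4 fix every class modulo 4, so
  the dichotomy applies to them on the class of \<open>x\<close>; its pair alternative would need a
  multiplier -1 modulo 4. An odd prime leads to a fixed midpoint, the prime 2 to a kernel that is
  trivial modulo 8.\<close>

theorem proper_in_pair_stab:
  assumes L: "affclosed L" "L \<subset> pair_stab 4 0 \<beta>" and \<beta>: "odd \<beta>" and n4: "4 dvd n" and \<alpha>4: "4 dvd \<alpha> + 1"
  obtains (kernel) "L \<subseteq> ker4"
  | (pair) s \<beta>' t where "prime s" "odd s" "s dvd n" "odd \<beta>'" "L \<subseteq> pair_stab (4 * s) t (s * \<beta>')"
      "pair_stab (4 * s) t (s * \<beta>') \<subseteq> pair_stab 4 0 \<beta>"
  | (eight) \<gamma> where "odd \<gamma>" "8 dvd n" "8 dvd \<alpha> + 1" "L \<subseteq> pair_stab 8 0 \<gamma>"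
      "pair_stab 8 0 \<gamma> \<subseteq> pair_stab 4 0 \<beta>"
proof (cases "\<exists>h e. (h, e) \<in> L \<and> 4 dvd h + 1")
  case False
  have "L \<subseteq> ker4"
  proof clarify
    fix c b assume cb: "(c, b) \<in> L"
    then have "(c, b) \<in> pair_stab 4 0 \<beta>" "\<not> 4 dvd c + 1" using L(2) False by blast+
    then show "(c, b) \<in> ker4" by (auto simp: pair_stab_4_iff[OF n4 \<beta>] ker4_def)
  qed
  then show ?thesis by (rule kernel)
next
  case True
  then obtain h e where h: "(h, e) \<in> L" "4 dvd h + 1" by blast
  note sub = affclosed_sub[OF L(1)]
  have Lc: "4 dvd c - 1 \<and> 4 dvd b \<or> 4 dvd c + 1 \<and> 4 dvd b - \<beta>" if "(c, b) \<in> L" for c b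
  proof -
    have "(c, b) \<in> pair_stab 4 0 \<beta>" using L(2) that by blast
    then show ?thesis by (simp add: pair_stab_4_iff[OF n4 \<beta>])
  qed
  have not_both: "\<not> (4 dvd c - 1 \<and> 4 dvd c + 1)" for c :: int by presburger
  have e4: "4 dvd e - \<beta>" using Lc[OF h(1)] h(2) not_both by blast
  have e_odd: "odd e" using e4 \<beta> by presburger
  define K where "K = {(c, b). (c, b) \<in> L \<and> 4 dvd c - 1}"
  obtain cg bg where g: "(cg, bg) \<in> pair_stab 4 0 \<beta>" "(cg, bg) \<notin> L" using L(2) by auto
  then have cg: "cg \<in> mults" "4 dvd cg - 1 \<and> 4 dvd bg \<or> 4 dvd cg + 1 \<and> 4 dvd bg - \<beta>"
    by (auto simp: pair_stab_4_iff[OF n4 \<beta>])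
  obtain x where x: "\<And>c b. (c, b) \<in> L \<Longrightarrow> \<not> n dvd c * x + b - (cg * x + bg)"
    using closed_intransitive[OF L(1) g(2) cg(1)] by metis
  have "\<exists>y. 4 dvd y - x \<and> (\<forall>c b. (c, b) \<in> K \<longrightarrow> \<not> n dvd c * x + b - y)"
    using cg(2)
  proof (elim disjE conjE)
    assume a: "4 dvd cg - 1" "4 dvd bg"
    have "4 dvd cg * x + bg - x"
      by (rule dvd_lin2[OF a, where p = x and q = 1]) (simp add: algebra_simps)
    then show ?thesis using x by (auto simp: K_def)
  next
    assume a: "4 dvd cg + 1" "4 dvd bg - \<beta>"
    obtain i d where i: "(i, d) \<in> L" "n dvd h * i - 1" "n dvd h * d + e" "n dvd i * e + d"
      by (rule affsub_inv[OF sub h(1)])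
    have i1: "4 dvd i + 1"
      by (rule dvd_lin2[OF dvd_trans[OF n4 i(2)] h(2), where p = "-1" and q = i]) (simp add: algebra_simps)
    then have d: "4 dvd d - \<beta>" using Lc[OF i(1)] not_both by blast
    \<comment> \<open>If the witness is a reflection, its image of \<open>x\<close> is pulled back
      by the reflection \<open>(h, e)\<close>, which brings it into the class of \<open>x\<close>
      modulo 4.\<close>
    define y where "y = i * (cg * x + bg) + d"
    have "4 dvd i * (cg + 1) * x + i * (bg - \<beta>) + (d - \<beta>)" using a d by simp
    then have "4 dvd y - x"
      using i1 by (rule dvd_lin2[where p = 1 and q = "\<beta> - x"]) (simp add: y_def algebra_simps)
    moreover have "\<not> n dvd c * x + b - y" if cb: "(c, b) \<in> K" for c b
    proof
      assume z: "n dvd c * x + b - y"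
      have "(h * c, h * b + e) \<in> L" using affsub_mult[OF sub h(1)] cb by (simp add: K_def)
      moreover have "n dvd (h * c) * x + (h * b + e) - (cg * x + bg)"
        by (rule dvd_lin3[OF z i(2,3), where p = h and q = "cg * x + bg" and r = 1])
           (simp add: y_def algebra_simps)
      ultimately show False using x by blast
    qed
    ultimately show ?thesis by blast
  qed
  then obtain y where y: "4 dvd y - x" "\<And>c b. (c, b) \<in> K \<Longrightarrow> \<not> n dvd c * x + b - y" by blast
  show ?thesis
  proof (rule class_intransitive)
    show "aff_monoid K" unfolding K_def by (rule kernel_monoid[OF sub])
    show "0 < n" "4 dvd n" "(0::int) < 4" "4 dvd x - x" "4 dvd y - x" using n_pos n4 y(1) by simp_all
    fix c b assume cb: "(c, b) \<in> K"
    then have cb': "(c, b) \<in> L" "4 dvd c - 1" by (auto simp: K_def)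
    then have b: "4 dvd b" using Lc[OF cb'(1)] not_both by blast
    show "coprime c n" by (rule affsub_coprime[OF sub cb'(1)])
    show "4 dvd c * x + b - x"
      by (rule dvd_lin2[OF cb'(2) b, where p = x and q = 1]) (simp add: algebra_simps)
    show "\<not> n dvd c * x + b - y" by (rule y(2)[OF cb])
  next
    fix \<gamma> k0 d0 assume "(k0, d0) \<in> K" "4 dvd k0 + 1"
    then show thesis using not_both[of k0] by (simp add: K_def)
  next
    fix s t assume s: "prime s" "s * 4 dvd n" "4 dvd t - x"
      and t: "\<And>c b. (c, b) \<in> K \<Longrightarrow> s * 4 dvd c * t + b - t"
    have sn: "s dvd n" by (rule dvd_mult_left[OF s(2)])
    show thesis
    proof (cases "odd s")
      case True
      have t': "s dvd k * t + d - t" if "(k, d) \<in> L" "4 dvd k - 1" for k d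
        using dvd_mult_left[OF t[of k d]] that by (simp add: K_def)
      have two: "4 dvd c - 1 \<or> 4 dvd c + 1" if "(c, b) \<in> L" for c b using Lc[OF that] by blast
      have "\<exists>m. \<forall>c b. (c, b) \<in> L \<longrightarrow> s dvd c * m + b - m"
      proof (rule midpoint_fixed[OF sub h n4 True sn])
        show "s dvd k * t + d - t" if "(k, d) \<in> L" "4 dvd k - 1" for k d by (rule t'[OF that])
        show "4 dvd c - 1 \<or> 4 dvd c + 1" if "(c, b) \<in> L" for c b by (rule two[OF that])
      qed blast
      then obtain m where m: "\<And>c b. (c, b) \<in> L \<Longrightarrow> s dvd c * m + b - m" by blast
      have "coprime (2\<^sup>2) s" using True by (simp only: coprime_power_left_iff) (simp add: coprime_left_2_iff_odd)
      then have cop4: "coprime 4 s" by simp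
      obtain u where "[u = 0] (mod 4)" "[u = m] (mod s)"
        using binary_chinese_remainder_int[OF cop4, of 0 m] by blast
      then have u: "4 dvd u" "s dvd u - m" by (simp_all add: cong_iff_dvd_diff)
      \<comment> \<open>The difference of the pair will be \<open>s * (s * \<beta>)\<close>, which
        is divisible by \<open>s\<close> and equal to \<beta> modulo 4.\<close>
      have s2: "4 dvd s * s - 1"
      proof -
        obtain j where "s = 2 * j + 1" using True by (elim oddE)
        then have "s * s - 1 = 4 * (j * j + j)" by (simp add: algebra_simps)
        then show ?thesis by simp
      qed
      show thesis
      proof (rule pair[OF s(1) True sn, of "s * \<beta>"])
        show "odd (s * \<beta>)" using True \<beta> by simp
        show "L \<subseteq> pair_stab (4 * s) u (s * (s * \<beta>))"
        proof clarify
          fix c b assume cb: "(c, b) \<in> L"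
          have sb: "s dvd c * u + b - u"
            by (rule dvd_lin2[OF m[OF cb] u(2), where p = 1 and q = "c - 1"]) (simp add: algebra_simps)
          have join: "4 * s dvd z" if "4 dvd z" "s dvd z" for z using divides_mult[OF that cop4] .
          from Lc[OF cb] have "4 * s dvd c * u + b - u \<and> 4 * s dvd c * (s * (s * \<beta>)) - s * (s * \<beta>) \<or>
            4 * s dvd c * u + b - u - s * (s * \<beta>) \<and> 4 * s dvd c * (s * (s * \<beta>)) + s * (s * \<beta>)"
          proof (elim disjE conjE)
            assume a: "4 dvd c - 1" "4 dvd b"
            have "4 dvd c * u + b - u"
              by (rule dvd_lin2[OF a(2) u(1), where p = 1 and q = "c - 1"]) (simp add: algebra_simps)
            moreover have "4 dvd c * (s * (s * \<beta>)) - s * (s * \<beta>)"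
              by (rule dvd_lin1[OF a(1), where p = "s * s * \<beta>"]) (simp add: algebra_simps)
            ultimately show ?thesis using sb join by simp
          next
            assume a: "4 dvd c + 1" "4 dvd b - \<beta>"
            have "4 dvd c * u + b - u - s * (s * \<beta>)"
              by (rule dvd_lin3[OF a(2) u(1) s2, where p = 1 and q = "c - 1" and r = "- \<beta>"])
                 (simp add: algebra_simps)
            moreover have "4 dvd c * (s * (s * \<beta>)) + s * (s * \<beta>)"
              by (rule dvd_lin1[OF a(1), where p = "s * s * \<beta>"]) (simp add: algebra_simps)
            ultimately show ?thesis using sb join by simp
          qed
          then show "(c, b) \<in> pair_stab (4 * s) u (s * (s * \<beta>))"
            using affsub_mults[OF sub cb] by (simp add: pair_stab_def)
        qed
        show "pair_stab (4 * s) u (s * (s * \<beta>)) \<subseteq> pair_stab 4 0 \<beta>"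
        proof clarify
          fix c b assume cb: "(c, b) \<in> pair_stab (4 * s) u (s * (s * \<beta>))"
          have can: "4 dvd z" if "4 * s dvd s * (s * \<beta>) * z" for z
          proof -
            have "coprime 4 (s * s * \<beta>)"
            proof -
              have "coprime (2\<^sup>2) (s * s * \<beta>)" using True \<beta>
                by (simp only: coprime_power_left_iff) (simp add: coprime_left_2_iff_odd)
              then show ?thesis by simp
            qed
            moreover have "4 dvd (s * s * \<beta>) * z" using dvd_mult_left[OF that] by (simp only: mult.assoc)
            ultimately show ?thesis by (simp add: coprime_dvd_mult_right_iff)
          qed
          from cb consider (1) "4 * s dvd c * u + b - u" "4 * s dvd c * (s * (s * \<beta>)) - s * (s * \<beta>)"
            | (2) "4 * s dvd c * u + b - u - s * (s * \<beta>)" "4 * s dvd c * (s * (s * \<beta>)) + s * (s * \<beta>)"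
            by (auto simp: pair_stab_def)
          then have "4 dvd c - 1 \<and> 4 dvd b \<or> 4 dvd c + 1 \<and> 4 dvd b - \<beta>"
          proof cases
            case 1
            have "4 dvd b"
              by (rule dvd_lin2[OF dvd_mult_left[OF 1(1)] u(1), where p = 1 and q = "1 - c"]) (simp add: algebra_simps)
            moreover have "4 dvd c - 1" by (rule can, rule dvd_lin1[OF 1(2), where p = 1]) (simp add: algebra_simps)
            ultimately show ?thesis by blast
          next
            case 2
            have "4 dvd b - \<beta>"
              by (rule dvd_lin3[OF dvd_mult_left[OF 2(1)] u(1) s2, where p = 1 and q = "1 - c" and r = \<beta>])
                 (simp add: algebra_simps)
            moreover have "4 dvd c + 1" by (rule can, rule dvd_lin1[OF 2(2), where p = 1]) (simp add: algebra_simps)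
            ultimately show ?thesis by blast
          qed
          moreover have "c \<in> mults" using cb by (simp add: pair_stab_def)
          ultimately show "(c, b) \<in> pair_stab 4 0 \<beta>" by (simp add: pair_stab_4_iff[OF n4 \<beta>])
        qed
      qed
    next
      case False
      then have s2: "s = 2" using s(1) primes_dvd_imp_eq[of 2 s] by auto
      have n8: "8 dvd n" using s(2) s2 by simp
      have t8: "8 dvd k * t + d - t" if "(k, d) \<in> L" "4 dvd k - 1" for k d
        using t[of k d] that s2 by (simp add: K_def)
      have "odd h" using h(2) by presburger
      then have "odd (h * t + e - t)" using e_odd by simp
      then have "coprime (2 ^ 3) (h * t + e - t)"
        by (simp only: coprime_power_left_iff) (simp add: coprime_left_2_iff_odd)
      then have cop8: "coprime 8 (h * t + e - t)" by simp
      \<comment> \<open>The kernel fixes \<open>t\<close> and the image of \<open>t\<close> modulo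
        8, and these differ by an odd number, a unit modulo 8.\<close>
      have triv: "8 dvd k - 1 \<and> 8 dvd d" if k: "(k, d) \<in> L" "4 dvd k - 1" for k d
      proof -
        have "8 dvd (k - 1) * (h * t + e - t)"
          by (rule kernel_fixes(2)[OF sub h(1) k(1) n4 k(2) n8 t8])
        then have k1: "8 dvd k - 1" using cop8 coprime_dvd_mult_left_iff by blast
        have "8 dvd d"
          by (rule dvd_lin2[OF k1 t8[OF k], where p = "- t" and q = 1]) (simp add: algebra_simps)
        then show ?thesis using k1 by blast
      qed
      \<comment> \<open>The square of \<open>(h, e)\<close> lies in the kernel, and its translation
        is \<open>(h + 1) * e\<close> with \<open>e\<close> odd.\<close>
      have h8: "8 dvd h + 1"
      proof -
        have "(h * h, h * e + e) \<in> L" by (rule affsub_mult[OF sub h(1) h(1)])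
        moreover have "4 dvd h * h - 1"
          by (rule dvd_lin1[OF h(2), where p = "h - 1"]) (simp add: algebra_simps)
        ultimately have "8 dvd h * e + e" using triv by blast
        then have "8 dvd (h + 1) * e" by (simp add: algebra_simps)
        moreover have "coprime (2 ^ 3) e" using e_odd
          by (simp only: coprime_power_left_iff) (simp add: coprime_left_2_iff_odd)
        then have "coprime 8 e" by simp
        ultimately show ?thesis using coprime_dvd_mult_left_iff by blast
      qed
      have \<alpha>8: "8 dvd \<alpha> + 1" by (rule alpha_mod_8[OF n8 affsub_mults[OF sub h(1)] h8 \<alpha>4])
      show thesis
      proof (rule eight[OF e_odd n8 \<alpha>8])
        show "L \<subseteq> pair_stab 8 0 e"
        proof clarify
          fix c b assume cb: "(c, b) \<in> L"
          have "8 dvd b \<and> 8 dvd c * e - e \<or> 8 dvd b - e \<and> 8 dvd c * e + e"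
            using Lc[OF cb]
          proof (elim disjE conjE)
            assume "4 dvd c - 1"
            then have d: "8 dvd c - 1" "8 dvd b" using triv[OF cb] by blast+
            have "8 dvd c * e - e" by (rule dvd_lin1[OF d(1), where p = e]) (simp add: algebra_simps)
            then show ?thesis using d by blast
          next
            assume c: "4 dvd c + 1"
            obtain k d where k: "(k, d) \<in> L" "4 dvd k - 1" "n dvd c - h * k" "n dvd b - (h * d + e)"
              by (rule reflection_decomp[OF sub h(1) cb n4 h(2) c])
            have kd: "8 dvd k - 1" "8 dvd d" using triv[OF k(1,2)] by blast+
            have "8 dvd c + 1"
              by (rule dvd_lin3[OF dvd_trans[OF n8 k(3)] kd(1) h8, where p = 1 and q = h and r = 1]) (simp add: algebra_simps)
            then have "8 dvd c * e + e" by (rule dvd_lin1[where p = e]) (simp add: algebra_simps)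
            moreover have "8 dvd b - e"
              by (rule dvd_lin2[OF dvd_trans[OF n8 k(4)] kd(2), where p = 1 and q = h]) (simp add: algebra_simps)
            ultimately show ?thesis by blast
          qed
          then show "(c, b) \<in> pair_stab 8 0 e" using affsub_mults[OF sub cb] by (simp add: pair_stab_def)
        qed
        show "pair_stab 8 0 e \<subseteq> pair_stab 4 0 \<beta>"
        proof clarify
          fix c b assume cb: "(c, b) \<in> pair_stab 8 0 e"
          have "(4::int) dvd 8" by simp
          then have d4: "4 dvd z" if "8 dvd z" for z :: int using that by (rule dvd_trans)
          have "(c, b) \<in> pair_stab 4 0 e" using cb d4 by (auto simp: pair_stab_def)
          then show "(c, b) \<in> pair_stab 4 0 \<beta>"
          proof -
            have "4 dvd b - e \<longleftrightarrow> 4 dvd b - \<beta>" using e4 by presburger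
            then show ?thesis using \<open>(c, b) \<in> pair_stab 4 0 e\<close>
              by (simp add: pair_stab_4_iff[OF n4 \<beta>] pair_stab_4_iff[OF n4 e_odd])
          qed
        qed
      qed
    qed
  qed
qed

end

text \<open>Add to \<open>x\<close> the number \<open>D\<close> times all primes of \<open>n\<close>
  that do not divide \<open>x\<close>. A prime of \<open>n\<close> dividing \<open>x\<close> divides
  neither \<open>D\<close> nor this product, any other divides the product but not \<open>x\<close>.
  The lift is needed because conjugating factors are determined only modulo \<open>s\<close> or
  8.\<close>

lemma coprime_lift:
  fixes n D x :: int
  assumes n: "0 < n" and D: "coprime x D"
  obtains v where "coprime v n" "D dvd v - x"
proof -
  define P where "P = {p. prime p \<and> p dvd n \<and> \<not> p dvd x}"
  have "P \<subseteq> {1..n}" using n by (auto simp: P_def zdvd_imp_le dest: prime_ge_1_int)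
  then have fin: "finite P" using finite_subset by blast
  define v where "v = x + D * \<Prod>P"
  have "coprime v n"
  proof (rule ccontr)
    assume "\<not> coprime v n"
    then have "\<not> is_unit (gcd v n)" by (simp add: coprime_iff_gcd_eq_1)
    moreover have "gcd v n \<noteq> 0" using n by simp
    ultimately obtain p where p: "prime p" "p dvd gcd v n" using prime_divisorE by blast
    then have pv: "p dvd v" "p dvd n" by auto
    show False
    proof (cases "p dvd x")
      case True
      then have "p dvd D * \<Prod>P" using pv(1) by (simp add: v_def dvd_add_right_iff)
      then consider "p dvd D" | "p dvd \<Prod>P" using p(1) prime_dvd_mult_iff by blast
      then show False
      proof cases
        case 1
        then show False using True D p(1) by (meson coprime_common_divisor not_prime_unit)
      next
        case 2
        then obtain q where "q \<in> P" "p dvd q" using prime_dvd_prod_iff[OF fin p(1), of id] by auto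
        then have "p = q" using p(1) primes_dvd_imp_eq by (auto simp: P_def)
        then show False using True \<open>q \<in> P\<close> by (simp add: P_def)
      qed
    next
      case False
      then have "p \<in> P" using p(1) pv by (simp add: P_def)
      then have "p dvd \<Prod>P" using dvd_prodI[OF fin, of p id] by simp
      then have "p dvd x" using pv(1) by (simp add: v_def dvd_add_left_iff)
      then show False using False by simp
    qed
  qed
  then show ?thesis by (rule that) (simp add: v_def)
qed

context affine_group
begin

section \<open>Maximality\<close>

definition maximal_closed :: "(int \<times> int) set \<Rightarrow> (int \<times> int) set \<Rightarrow> bool" where
  "maximal_closed M K \<longleftrightarrow> affclosed K \<and> K \<subset> M \<and> (\<forall>L. affclosed L \<and> L \<subset> M \<and> K \<subseteq> L \<longrightarrow> L = K)"

lemma maximal_closed_eq: "maximal_closed M K \<Longrightarrow> affclosed T \<Longrightarrow> K \<subseteq> T \<Longrightarrow> T \<subset> M \<Longrightarrow> T = K"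
  by (simp add: maximal_closed_def)

text \<open>As \<open>H\<close> realizes every multiplier of \<open>M\<close>, the index of
  \<open>H\<close> in \<open>M\<close> is that of the translation subgroups. These lie between the
  multiples of \<open>p * D\<close> and the multiples of \<open>D\<close>, and a prime index leaves
  no room for an intermediate group.\<close>

lemma transl_index:
  assumes sub: "affsub H" "affsub L" "affsub M" and HL: "H \<subseteq> L" "L \<subseteq> M"
    and rep: "\<And>c b. (c, b) \<in> M \<Longrightarrow> \<exists>b'. (c, b') \<in> H"
    and D: "D \<noteq> 0" "\<And>b. (1, b) \<in> M \<Longrightarrow> D dvd b" and p: "prime p" "(1, p * D) \<in> H"
  shows "L = H \<or> L = M"
proof (cases "L \<subseteq> H")
  case True
  then show ?thesis using HL by blast
next
  case False
  then obtain c b where cb: "(c, b) \<in> L" "(c, b) \<notin> H" by auto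
  obtain b' where b': "(c, b') \<in> H" using rep cb(1) HL(2) by blast
  define t where "t = b - b'"
  have tL: "(1, t) \<in> L" using affsub_transl[OF sub(2) cb(1)] b' HL(1) by (auto simp: t_def)
  then obtain u where u: "t = D * u" using D(2) HL(2) by blast
  have "\<not> p dvd u"
  proof
    assume "p dvd u"
    then obtain k where "u = p * k" by (elim dvdE)
    then have "t = k * (p * D)" using u by simp
    then have "(1, t) \<in> H" using affsub_transl_mult[OF sub(1) p(2)] by simp
    then show False using affsub_add_transl[OF sub(1) b'] cb(2) by (simp add: t_def)
  qed
  then have "coprime p u" by (rule prime_imp_coprime[OF p(1)])
  then have "coprime u p" by (simp only: coprime_commute)
  then obtain v where "[u * v = 1] (mod p)" using cong_solve_coprime_int by blast
  then obtain k where k: "u * v - 1 = p * k" unfolding cong_iff_dvd_diff by (elim dvdE)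
  have "(1, v * t) \<in> L" by (rule affsub_transl_mult[OF sub(2) tL])
  moreover have "(1, (- k) * (p * D)) \<in> L" using affsub_transl_mult[OF sub(1) p(2)] HL(1) by blast
  ultimately have "(1 * 1, 1 * (- k * (p * D)) + v * t) \<in> L" by (rule affsub_mult[OF sub(2)])
  moreover have "u * v - p * k = 1" using k by linarith
  then have "D * (u * v - p * k) = D" by simp
  then have "1 * (- k * (p * D)) + v * t = D" by (simp add: u algebra_simps)
  ultimately have DL: "(1, D) \<in> L" by simp
  have "M \<subseteq> L"
  proof clarify
    fix c b assume M: "(c, b) \<in> M"
    obtain b' where b': "(c, b') \<in> H" using rep M by blast
    have "(1, b - b') \<in> M" using affsub_transl[OF sub(3) M] b' HL by blast
    then obtain j where "b - b' = j * D" using D(2) by (metis dvdE mult.commute)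
    then have "(1, b - b') \<in> L" using affsub_transl_mult[OF sub(2) DL] by simp
    then show "(c, b) \<in> L" using affsub_add_transl[OF sub(2)] b' HL(1) by blast
  qed
  then show ?thesis using HL by blast
qed

text \<open>\<open>H\<close> contains the translations of \<open>M\<close> and realizes the
  multipliers \<open>\<alpha> ^ (s * j)\<close>, so its index is 1 or the prime
  \<open>s\<close>.\<close>

lemma mult_index:
  assumes sub: "affsub H" "affsub L" "affsub M" and HL: "H \<subseteq> L" "L \<subseteq> M"
    and s: "prime (s::nat)" and rep: "\<And>j. \<exists>b. (\<alpha> ^ (s * j), b) \<in> H"
    and transl: "\<And>b. (1, b) \<in> M \<Longrightarrow> (1, b) \<in> H"
  shows "L = H \<or> L = M"
proof (cases "L \<subseteq> H")
  case True
  then show ?thesis using HL by blast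
next
  case False
  then obtain c b where cb: "(c, b) \<in> L" "(c, b) \<notin> H" by auto
  obtain i where i: "n dvd c - \<alpha> ^ i" using affsub_mults[OF sub(2) cb(1)] by (auto simp: mults_def)
  have "\<not> s dvd i"
  proof
    assume "s dvd i"
    then obtain j where "i = s * j" by (elim dvdE)
    then obtain b' where "(\<alpha> ^ i, b') \<in> H" using rep by blast
    then have b': "(c, b') \<in> H" by (rule affsub_cong[OF sub(1) _ i]) simp
    then have "(1, b - b') \<in> M" using affsub_transl[OF sub(3)] cb(1) HL by blast
    then show False using affsub_add_transl[OF sub(1) b'] transl cb(2) by blast
  qed
  then have "coprime i s" using prime_imp_coprime[OF s] by (simp add: coprime_commute)
  then obtain u where u: "[i * u = 1] (mod s)" using cong_solve_coprime_nat by auto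
  have s1: "1 < s" using s prime_gt_1_nat by blast
  define w where "w = i * u div s"
  have w: "i * u = s * w + 1"
  proof -
    have "i * u mod s = 1" using u s1 by (simp add: cong_def)
    then show ?thesis using mult_div_mod_eq[of s "i * u"] by (simp add: w_def)
  qed
  have "coprime n \<alpha>" using cop by (simp only: coprime_commute)
  define N where "N = ord n \<alpha>"
  have N: "0 < N" using ord_int_pos[OF n_pos \<open>coprime n \<alpha>\<close>] by (simp add: N_def)
  then obtain N' where N': "N = Suc N'" using gr0_conv_Suc by blast
  have "M \<subseteq> L"
  proof clarify
    fix c0 b0 assume M: "(c0, b0) \<in> M"
    obtain k where k: "n dvd c0 - \<alpha> ^ k" using affsub_mults[OF sub(3) M] by (auto simp: mults_def)
    have 1: "(c ^ (u * k), b * geo c (u * k)) \<in> L" by (rule affsub_pow[OF sub(2) cb(1)])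
    obtain d where "(\<alpha> ^ (s * (w * k * N')), d) \<in> H" using rep by blast
    then have 2: "(\<alpha> ^ (s * (w * k * N')), d) \<in> L" using HL(1) by blast
    \<comment> \<open>Here \<open>c ^ u\<close> has exponent \<open>s * w + 1\<close>. The second
      factor removes the surplus \<open>s * w * k\<close>, because \<open>N' = N - 1\<close> acts as
      -1 modulo the order \<open>N\<close> of \<alpha>.\<close>
    define c' where "c' = c ^ (u * k) * \<alpha> ^ (s * (w * k * N'))"
    obtain b' where b': "(c', b') \<in> L" using affsub_mult[OF sub(2) 1 2] by (auto simp: c'_def)
    have "[c' = (\<alpha> ^ i) ^ (u * k) * \<alpha> ^ (s * (w * k * N'))] (mod n)"
      unfolding c'_def using i by (intro cong_mult cong_pow cong_refl) (simp add: cong_iff_dvd_diff)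
    also have "(\<alpha> ^ i) ^ (u * k) * \<alpha> ^ (s * (w * k * N')) = \<alpha> ^ (i * u * k + s * (w * k * N'))"
      by (simp only: power_add power_mult mult.assoc)
    also have "i * u * k + s * (w * k * N') = k + N * (s * w * k)"
      by (simp add: w N' algebra_simps)
    also have "[\<alpha> ^ (k + N * (s * w * k)) = \<alpha> ^ k * 1] (mod n)"
      unfolding power_add
      by (intro cong_mult cong_refl)
         (simp add: cong_iff_dvd_diff dvd_power_minus_1_iff_ord[OF n_pos] N_def)
    finally have "n dvd c' - \<alpha> ^ k" by (simp add: cong_iff_dvd_diff)
    then have "n dvd c0 - c'" using k by (rule dvd_lin2[where p = "-1" and q = 1]) simp
    then have c0: "(c0, b') \<in> L" by (rule affsub_cong[OF sub(2) b']) simp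
    then have "(1, b0 - b') \<in> M" using affsub_transl[OF sub(3) M] HL by blast
    then have "(1, b0 - b') \<in> L" using transl HL by blast
    then show "(c0, b0) \<in> L" by (rule affsub_add_transl[OF sub(2) c0])
  qed
  then show ?thesis using HL by blast
qed

lemma maximal_closedI:
  assumes "affclosed K" "K \<subseteq> M" "K \<noteq> M" "\<And>L. affclosed L \<Longrightarrow> K \<subseteq> L \<Longrightarrow> L \<subseteq> M \<Longrightarrow> L = K \<or> L = M"
  shows "maximal_closed M K"
  unfolding maximal_closed_def using assms by blast

lemma transl_in_point_stab: "(1, b) \<in> point_stab D t \<longleftrightarrow> D dvd b"
  by (simp add: point_stab_def)

lemma prime_pos: "prime r \<Longrightarrow> 0 < r \<and> \<not> r dvd 1 \<and> r \<noteq> 0 \<and> r \<noteq> 1" for r :: int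
  using prime_gt_1_int[of r] by auto

lemma maximal_point_stab:
  assumes "prime r" "r dvd n"
  shows "maximal_closed full (point_stab r t)"
proof (rule maximal_closedI)
  show cl: "affclosed (point_stab r t)" by (rule affclosed_point_stab[OF assms(2)])
  show sub: "point_stab r t \<subseteq> full" by (auto simp: point_stab_def full_def)
  have "(1, 1) \<in> full" "(1, 1) \<notin> point_stab r t"
    using prime_pos[OF assms(1)] by (simp_all add: full_def transl_in_point_stab)
  then show "point_stab r t \<noteq> full" by blast
  fix L assume L: "affclosed L" "point_stab r t \<subseteq> L" "L \<subseteq> full"
  show "L = point_stab r t \<or> L = full"
  proof (rule transl_index[OF affclosed_sub[OF cl] affclosed_sub[OF L(1)] affsub_full_self L(2,3)])
    show "\<exists>b'. (c, b') \<in> point_stab r t" if "(c, b) \<in> full" for c b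
      using that by (intro exI[of _ "t - c * t"]) (simp add: full_def point_stab_def)
    show "(1, r * 1) \<in> point_stab r t" by (simp add: transl_in_point_stab)
  qed (use assms in simp_all)
qed

lemma maximal_point_stab2:
  assumes "prime r" "prime s" "s * r dvd n"
  shows "maximal_closed (point_stab r 0) (point_stab (s * r) 0)"
proof (rule maximal_closedI)
  have rn: "r dvd n" by (rule dvd_mult_right[OF assms(3)])
  show cl: "affclosed (point_stab (s * r) 0)" by (rule affclosed_point_stab[OF assms(3)])
  show sub: "point_stab (s * r) 0 \<subseteq> point_stab r 0" using dvd_mult_right by (fastforce simp: point_stab_def)
  have "(1, r) \<in> point_stab r 0" "(1, r) \<notin> point_stab (s * r) 0"
    using prime_pos[OF assms(1)] prime_pos[OF assms(2)] by (simp_all add: transl_in_point_stab)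
  then show "point_stab (s * r) 0 \<noteq> point_stab r 0" by blast
  fix L assume L: "affclosed L" "point_stab (s * r) 0 \<subseteq> L" "L \<subseteq> point_stab r 0"
  show "L = point_stab (s * r) 0 \<or> L = point_stab r 0"
  proof (rule transl_index[OF affclosed_sub[OF cl] affclosed_sub[OF L(1)]
        affclosed_sub[OF affclosed_point_stab[OF rn]] L(2,3)])
    show "\<exists>b'. (c, b') \<in> point_stab (s * r) 0" if "(c, b) \<in> point_stab r 0" for c b
      using that by (intro exI[of _ 0]) (simp add: point_stab_def)
    show "r \<noteq> 0" using prime_pos[OF assms(1)] by simp
    show "r dvd b" if "(1, b) \<in> point_stab r 0" for b using that by (simp add: transl_in_point_stab)
    show "(1, s * r) \<in> point_stab (s * r) 0" by (simp add: transl_in_point_stab)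
  qed (rule assms)
qed

lemma index_sub_sub: "s dvd ord r \<alpha> \<Longrightarrow> index_sub s r \<subseteq> point_stab r 0"
  by (auto simp: index_sub_def point_stab_def mults_def)

lemma alpha_in_index_sub:
  assumes r: "prime r" "r dvd n" and s: "prime s" "s dvd ord r \<alpha>"
  shows "(\<alpha> ^ i, b) \<in> index_sub s r \<longleftrightarrow> r dvd b \<and> s dvd i"
proof
  assume "(\<alpha> ^ i, b) \<in> index_sub s r"
  then obtain j where j: "r dvd b" "n dvd \<alpha> ^ i - \<alpha> ^ (s * j)" by (auto simp: index_sub_def)
  have "r dvd \<alpha> ^ i - \<alpha> ^ (s * j)" by (rule dvd_trans[OF r(2) j(2)])
  then have "int s dvd int i - int (s * j)" using dvd_power_diffD[OF r(2) _ _ s(2)] prime_pos[OF r(1)] by blast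
  then have "int s dvd int i - int (s * j) + int (s * j)" by (intro dvd_add) simp_all
  then show "r dvd b \<and> s dvd i" using j(1) by simp
next
  assume a: "r dvd b \<and> s dvd i"
  then obtain j where "i = s * j" by (elim conjE dvdE)
  then show "(\<alpha> ^ i, b) \<in> index_sub s r" using a by (auto simp: index_sub_def intro!: exI[of _ j])
qed

lemma maximal_index_sub:
  assumes r: "prime r" "r dvd n" and s: "prime s" "s dvd ord r \<alpha>"
  shows "maximal_closed (point_stab r 0) (index_sub s r)"
proof (rule maximal_closedI)
  show cl: "affclosed (index_sub s r)" by (rule affclosed_index_sub[OF r s(2)])
  show "index_sub s r \<subseteq> point_stab r 0" by (rule index_sub_sub[OF s(2)])
  have "\<not> s dvd 1" using prime_gt_1_nat[OF s(1)] by auto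
  then have "(\<alpha> ^ 1, 0) \<in> point_stab r 0" "(\<alpha> ^ 1, 0) \<notin> index_sub s r"
    unfolding alpha_in_index_sub[OF r s] by (simp_all add: point_stab_def)
  then show "index_sub s r \<noteq> point_stab r 0" by blast
  fix L assume L: "affclosed L" "index_sub s r \<subseteq> L" "L \<subseteq> point_stab r 0"
  show "L = index_sub s r \<or> L = point_stab r 0"
  proof (rule mult_index[OF affclosed_sub[OF cl] affclosed_sub[OF L(1)]
        affclosed_sub[OF affclosed_point_stab[OF r(2)]] L(2,3) s(1)])
    show "\<exists>b. (\<alpha> ^ (s * j), b) \<in> index_sub s r" for j
      by (intro exI[of _ 0]) (simp add: alpha_in_index_sub[OF r s])
    show "(1, b) \<in> index_sub s r" if "(1, b) \<in> point_stab r 0" for b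
      using that alpha_in_index_sub[OF r s, of 0 b] by (simp add: transl_in_point_stab)
  qed
qed

lemma twisted_generator: "(\<alpha> ^ (ord s \<alpha> * i), r * l * int i) \<in> twisted_sub s r l"
  by (auto simp: twisted_sub_def intro!: exI[of _ i])

lemma transl_in_twisted_sub:
  assumes "twisted_ok s r"
  shows "(1, b) \<in> twisted_sub s r l \<longleftrightarrow> s * r dvd b"
proof
  assume "(1, b) \<in> twisted_sub s r l"
  then obtain i where i: "n dvd 1 - \<alpha> ^ (ord s \<alpha> * i)" "s * r dvd b - r * l * int i"
    by (auto simp: twisted_sub_def)
  have rn: "r dvd n" using assms by (simp add: twisted_ok_def)
  have "r dvd \<alpha> ^ (ord s \<alpha> * 0) - \<alpha> ^ (ord s \<alpha> * i)" using dvd_trans[OF rn i(1)] by simp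
  then have "s dvd int 0 - int i" by (rule twisted_index[OF assms])
  then have "s * r dvd int i * r" by (intro mult_dvd_mono) simp_all
  then show "s * r dvd b" using i(2) by (rule dvd_lin2[where p = l and q = 1]) (simp add: algebra_simps)
qed (auto simp: twisted_sub_def intro: exI[of _ 0])

lemma twisted_sub_sub:
  assumes "twisted_ok s r"
  shows "twisted_sub s r l \<subseteq> point_stab r 0"
proof clarify
  fix c b assume "(c, b) \<in> twisted_sub s r l"
  then obtain i where i: "n dvd c - \<alpha> ^ (ord s \<alpha> * i)" "s * r dvd b - r * l * int i"
    by (auto simp: twisted_sub_def)
  have "r dvd b" by (rule dvd_lin2[OF dvd_mult_right[OF i(2)] dvd_refl, where p = 1 and q = "l * int i"]) simp
  then show "(c, b) \<in> point_stab r 0" using i(1) by (auto simp: point_stab_def mults_def)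
qed

text \<open>Modulo \<open>s\<close> the generator is the translation by \<open>r * l\<close>, which
  is not 0.\<close>

lemma twisted_sub_no_fixed_class:
  assumes ok: "twisted_ok s r" and l: "coprime l s"
  shows "\<not> twisted_sub s r l \<subseteq> point_stab s t"
proof
  assume "twisted_sub s r l \<subseteq> point_stab s t"
  then have 1: "s dvd \<alpha> ^ (ord s \<alpha> * 1) * t + r * l * int 1 - t"
    using twisted_generator[of s 1 r l] by (auto simp: point_stab_def)
  have s: "prime s" "\<not> s dvd 1" "0 < s" using ok prime_pos by (auto simp: twisted_ok_def)
  have 2: "s dvd \<alpha> ^ (ord s \<alpha> * 1) - 1" by (simp add: dvd_power_minus_1_iff_ord[OF s(3)])
  have "s dvd r * l" by (rule dvd_lin2[OF 1 2, where p = 1 and q = "- t"]) (simp add: algebra_simps)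
  moreover have "coprime s r" by (rule twisted_ok_coprime(1)[OF ok])
  ultimately have "s dvd l" using coprime_dvd_mult_right_iff by blast
  then show False using l s(2) by (metis coprime_common_divisor dvd_refl)
qed

text \<open>The index is not prime in general, since multipliers and translations both shrink. A
  proper closed overgroup is therefore located by \<open>proper_in_point_stab\<close>, and the
  alternatives are refuted with two elements: the translation by \<open>s * r\<close> and the
  generator.\<close>

lemma maximal_twisted_sub:
  assumes ok: "twisted_ok s r"
  shows "maximal_closed (point_stab r 0) (twisted_sub s r 1)"
proof (rule maximal_closedI)
  have r: "prime r" "r dvd n" and s: "prime s" "0 < s" using ok prime_pos by (auto simp: twisted_ok_def)
  show cl: "affclosed (twisted_sub s r 1)" by (rule affclosed_twisted_sub[OF ok])
  show sub: "twisted_sub s r 1 \<subseteq> point_stab r 0" by (rule twisted_sub_sub[OF ok])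
  have "(1, r) \<in> point_stab r 0" "(1, r) \<notin> twisted_sub s r 1"
    using prime_pos[OF s(1)] prime_pos[OF r(1)]
    by (simp_all add: transl_in_point_stab transl_in_twisted_sub[OF ok])
  then show "twisted_sub s r 1 \<noteq> point_stab r 0" by blast
  note gen = twisted_generator[of s 1 r 1, simplified]
  have tr: "(1, s * r) \<in> twisted_sub s r 1" by (simp add: transl_in_twisted_sub[OF ok])
  have cop_sr: "coprime s r" by (rule twisted_ok_coprime(1)[OF ok])
  fix L assume L: "affclosed L" "twisted_sub s r 1 \<subseteq> L" "L \<subseteq> point_stab r 0"
  show "L = twisted_sub s r 1 \<or> L = point_stab r 0"
  proof (rule ccontr)
    assume neq: "\<not> ?thesis"
    then have "L \<subset> point_stab r 0" using L(3) by blast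
    then show False
    proof (rule proper_in_point_stab[OF L(1) _ r])
      fix s' t assume a: "prime s'" "s' * r dvd n" "L \<subseteq> point_stab (s' * r) t"
      have "(1, s * r) \<in> point_stab (s' * r) t" using tr L(2) a(3) by blast
      then have "s' dvd s" using prime_pos[OF r(1)] by (simp add: transl_in_point_stab)
      then have "s' = s" using primes_dvd_imp_eq[OF a(1) s(1)] by blast
      then have "twisted_sub s r 1 \<subseteq> point_stab s t"
        using L(2) a(3) dvd_mult_left by (fastforce simp: point_stab_def)
      then show False using twisted_sub_no_fixed_class[OF ok] by simp
    next
      fix \<beta> t assume a: "odd r" "odd \<beta>" "L \<subseteq> pair_stab (4 * r) t (r * \<beta>)"
      have "(1, s * r) \<in> pair_stab (4 * r) t (r * \<beta>)" using tr L(2) a(3) by blast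
      then have "4 * r dvd r * s \<or> 4 * r dvd r * (2 * \<beta>)" by (auto simp: pair_stab_def algebra_simps)
      then have "4 dvd s \<or> 4 dvd 2 * \<beta>" using prime_pos[OF r(1)] by (simp add: mult.commute[of 4])
      then have "4 dvd s" using a(2) by presburger
      then have "2 dvd s" "s \<noteq> 2" by (auto dest: dvd_trans[of 2 4 s, rotated])
      then show False using primes_dvd_imp_eq[of 2 s] s(1) by auto
    next
      fix s' assume a: "prime (s'::nat)" "s' dvd ord r \<alpha>" "L \<subseteq> index_sub s' r"
      have "(\<alpha> ^ ord s \<alpha>, r) \<in> index_sub s' r" using gen L(2) a(3) by blast
      then have "s' dvd ord s \<alpha>" by (simp add: alpha_in_index_sub[OF r a(1,2)])
      then have "is_unit s'" using a(2) ok by (meson coprime_common_divisor twisted_ok_def)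
      then show False using a(1) not_prime_unit by blast
    next
      fix s' l assume a: "twisted_ok s' r" "coprime l s'" "L \<subseteq> twisted_sub s' r l"
      have s': "prime s'" using a(1) by (simp add: twisted_ok_def)
      have "(1, s * r) \<in> twisted_sub s' r l" using tr L(2) a(3) by blast
      then have "s' dvd s" using prime_pos[OF r(1)] by (simp add: transl_in_twisted_sub[OF a(1)])
      then have ss: "s' = s" using primes_dvd_imp_eq[OF s' s(1)] by blast
      have "(\<alpha> ^ ord s \<alpha>, r) \<in> twisted_sub s r l" using gen L(2) a(3) ss by blast
      then obtain i where i: "n dvd \<alpha> ^ ord s \<alpha> - \<alpha> ^ (ord s \<alpha> * i)" "s * r dvd r - r * l * int i"
        by (auto simp: twisted_sub_def)
      have "r dvd \<alpha> ^ (ord s \<alpha> * 1) - \<alpha> ^ (ord s \<alpha> * i)" using dvd_trans[OF r(2) i(1)] by simp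
      \<comment> \<open>The exponent of the generator is 1 modulo \<open>s\<close>, so its
        translation \<open>r\<close> forces \<open>l\<close> to be 1 modulo \<open>s\<close>; the
        larger twisted group is then the original one.\<close>
      then have si: "s dvd int 1 - int i" by (rule twisted_index[OF ok])
      have "s dvd r * (1 - l * int i)" using dvd_mult_left[OF i(2)] by (simp add: algebra_simps)
      then have "s dvd 1 - l * int i" using cop_sr coprime_dvd_mult_right_iff by blast
      then have sl: "s dvd 1 - l" using si by (rule dvd_lin2[where p = 1 and q = "- l"]) (simp add: algebra_simps)
      have "twisted_sub s r l \<subseteq> twisted_sub s r 1"
      proof clarify
        fix c b assume "(c, b) \<in> twisted_sub s r l"
        then obtain j where j: "n dvd c - \<alpha> ^ (ord s \<alpha> * j)" "s * r dvd b - r * l * int j"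
          by (auto simp: twisted_sub_def)
        have "s * r dvd (1 - l) * r" using sl by simp
        then have "s * r dvd b - r * 1 * int j"
          using j(2) by (rule dvd_lin2[where p = "- int j" and q = 1]) (simp add: algebra_simps)
        then show "(c, b) \<in> twisted_sub s r 1" using j(1) by (auto simp: twisted_sub_def)
      qed
      then show False using a(3) ss L(2) neq by blast
    qed
  qed
qed

lemma transl_in_pair_stab:
  "(1, b) \<in> pair_stab D t u \<longleftrightarrow> D dvd b \<or> D dvd b - u \<and> D dvd 2 * u"
  by (auto simp: pair_stab_def)

lemma transl_in_pair_stab_4: "odd r \<Longrightarrow> 4 dvd D \<Longrightarrow> (1, b) \<in> pair_stab D t r \<longleftrightarrow> D dvd b"
proof -
  assume a: "odd r" "4 dvd D"
  have "\<not> 4 dvd 2 * r" using a(1) by presburger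
  then have "\<not> D dvd 2 * r" using a(2) dvd_trans by blast
  then show ?thesis by (simp add: transl_in_pair_stab)
qed

lemma reflection_in_pair_stab:
  assumes "4 dvd n" "odd \<beta>" "4 dvd \<alpha> + 1"
  shows "(\<alpha>, \<beta>) \<in> pair_stab 4 0 \<beta>"
  using assms by (simp add: pair_stab_4_iff)

text \<open>The index is 4, so the classification of proper closed subgroups is used. The
  translation by 4 leaves only \<open>r = 2\<close> for a fixed class, and the reflection, having
  odd translation, exchanges the parities.\<close>

lemma maximal_pair_stab_4:
  assumes n4: "4 dvd n" and \<alpha>4: "4 dvd \<alpha> + 1" and \<beta>: "odd \<beta>"
  shows "maximal_closed full (pair_stab 4 0 \<beta>)"
proof (rule maximal_closedI)
  show cl: "affclosed (pair_stab 4 0 \<beta>)" by (rule affclosed_pair_stab[OF n4])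
  show "pair_stab 4 0 \<beta> \<subseteq> full" by (auto simp: pair_stab_def full_def)
  have "(1, 1) \<in> full" "(1, 1) \<notin> pair_stab 4 0 \<beta>"
    by (simp_all add: full_def transl_in_pair_stab_4[OF \<beta>])
  then show "pair_stab 4 0 \<beta> \<noteq> full" by blast
  fix L assume L: "affclosed L" "pair_stab 4 0 \<beta> \<subseteq> L" "L \<subseteq> full"
  have refl: "(\<alpha>, \<beta>) \<in> L" using reflection_in_pair_stab[OF n4 \<beta> \<alpha>4] L(2) by blast
  have tr: "(1, 4) \<in> L" using L(2) transl_in_pair_stab_4[OF \<beta>, of 4 4 0] by auto
  show "L = pair_stab 4 0 \<beta> \<or> L = full"
  proof (rule ccontr)
    assume neq: "\<not> ?thesis"
    then have "L \<noteq> full" by blast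
    then show False
    proof (rule proper_closed_cases[OF L(1)])
      fix r t assume a: "prime r" "r dvd n" "L \<subseteq> point_stab r t"
      have "(1, 4) \<in> point_stab r t" using tr a(3) by blast
      then have "r dvd 2 * 2" by (simp add: transl_in_point_stab)
      then have "r dvd 2" using a(1) prime_dvd_mult_iff by blast
      then have "r = 2" using primes_dvd_imp_eq[OF a(1)] by auto
      moreover have "(\<alpha>, \<beta>) \<in> point_stab r t" using refl a(3) by blast
      moreover have "even n" using dvd_trans[OF _ n4, of 2] by simp
      then have "odd \<alpha>" using mults_odd[OF mults_gen] by blast
      ultimately show False using \<beta> by (auto simp: point_stab_def)
    next
      fix \<gamma> assume a: "odd \<gamma>" "L \<subseteq> pair_stab 4 0 \<gamma>"
      have "(\<alpha>, \<beta>) \<in> pair_stab 4 0 \<gamma>" using refl a(2) by blast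
      then have "4 dvd \<beta> - \<gamma>" using \<alpha>4 \<beta> a(1) by (auto simp: pair_stab_4_iff[OF n4 a(1)])
      then have "pair_stab 4 0 \<gamma> = pair_stab 4 0 \<beta>"
      proof -
        assume d: "4 dvd \<beta> - \<gamma>"
        have "4 dvd b - \<gamma> \<longleftrightarrow> 4 dvd b - \<beta>" for b using d by presburger
        then show ?thesis by (auto simp: pair_stab_4_iff[OF n4 a(1)] pair_stab_4_iff[OF n4 \<beta>])
      qed
      then show False using a(2) L(2) neq by blast
    qed
  qed
qed

lemma maximal_ker4:
  assumes n4: "4 dvd n" and \<alpha>4: "4 dvd \<alpha> + 1" and \<beta>: "odd \<beta>"
  shows "maximal_closed (pair_stab 4 0 \<beta>) ker4"
proof (rule maximal_closedI)
  show cl: "affclosed ker4" by (rule affclosed_ker4[OF n4])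
  show "ker4 \<subseteq> pair_stab 4 0 \<beta>" by (auto simp: ker4_def pair_stab_4_iff[OF n4 \<beta>])
  have "\<not> 4 dvd \<alpha> - 1" using \<alpha>4 by presburger
  then have "(\<alpha>, \<beta>) \<notin> ker4" by (simp add: ker4_def)
  then show "ker4 \<noteq> pair_stab 4 0 \<beta>" using reflection_in_pair_stab[OF n4 \<beta> \<alpha>4] by blast
  fix L assume L: "affclosed L" "ker4 \<subseteq> L" "L \<subseteq> pair_stab 4 0 \<beta>"
  show "L = ker4 \<or> L = pair_stab 4 0 \<beta>"
  proof (rule mult_index[OF affclosed_sub[OF cl] affclosed_sub[OF L(1)]
        affclosed_sub[OF affclosed_pair_stab[OF n4]] L(2,3) two_is_prime_nat])
    show "\<exists>b. (\<alpha> ^ (2 * j), b) \<in> ker4" for j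
      by (intro exI[of _ 0]) (simp add: ker4_def pow_alpha_mod(1)[OF \<alpha>4])
    show "(1, b) \<in> ker4" if "(1, b) \<in> pair_stab 4 0 \<beta>" for b
      using that by (simp add: transl_in_pair_stab_4[OF \<beta>] ker4_def)
  qed
qed

text \<open>As \<alpha> is -1 modulo 8, every multiplier is 1 or -1 modulo 8; both groups thus
  realize all multipliers, and their translation subgroups have index 2.\<close>

lemma maximal_pair_stab_8:
  assumes n8: "8 dvd n" and \<alpha>8: "8 dvd \<alpha> + 1"
  shows "maximal_closed (pair_stab 4 0 1) (pair_stab 8 0 1)"
proof (rule maximal_closedI)
  have "(4::int) dvd 8" by simp
  then have n4: "4 dvd n" and \<alpha>4: "4 dvd \<alpha> + 1" using n8 \<alpha>8 dvd_trans by blast+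
  have d4: "4 dvd z" if "8 dvd z" for z :: int by (rule dvd_trans[OF \<open>4 dvd 8\<close> that])
  have "odd (1::int)" by simp
  show cl: "affclosed (pair_stab 8 0 1)" by (rule affclosed_pair_stab[OF n8])
  show "pair_stab 8 0 1 \<subseteq> pair_stab 4 0 1" using d4 by (auto simp: pair_stab_def)
  have "(1, 4) \<in> pair_stab 4 0 1" "(1, 4) \<notin> pair_stab 8 0 1"
    by (simp_all add: transl_in_pair_stab)
  then show "pair_stab 8 0 1 \<noteq> pair_stab 4 0 1" by blast
  fix L assume L: "affclosed L" "pair_stab 8 0 1 \<subseteq> L" "L \<subseteq> pair_stab 4 0 1"
  show "L = pair_stab 8 0 1 \<or> L = pair_stab 4 0 1"
  proof (rule transl_index[OF affclosed_sub[OF cl] affclosed_sub[OF L(1)]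
        affclosed_sub[OF affclosed_pair_stab[OF n4]] L(2,3)])
    show "\<exists>b'. (c, b') \<in> pair_stab 8 0 1" if "(c, b) \<in> pair_stab 4 0 1" for c b
    proof -
      have c: "c \<in> mults" using that by (simp add: pair_stab_def)
      consider "8 dvd c - 1" | "8 dvd c + 1" using mults_mod[OF n8 \<alpha>8 c] by blast
      then show ?thesis
      proof cases
        case 1
        then show ?thesis using c by (intro exI[of _ 0]) (simp add: pair_stab_def)
      next
        case 2
        then show ?thesis using c by (intro exI[of _ 1]) (simp add: pair_stab_def)
      qed
    qed
    show "4 dvd b" if "(1, b) \<in> pair_stab 4 0 1" for b
      using that by (simp add: transl_in_pair_stab)
    show "(1, 2 * 4) \<in> pair_stab 8 0 1" by (simp add: transl_in_pair_stab)
  qed simp_all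
qed

text \<open>Both groups realize all multipliers, and their translations are the multiples of 4 and
  of \<open>4 * r\<close>. With \<open>r\<close> as second point of the pair the smaller group also
  fixes the class 0 modulo \<open>r\<close>.\<close>

lemma maximal_pair_stab_4r:
  assumes n4: "4 dvd n" and \<alpha>4: "4 dvd \<alpha> + 1" and r: "prime r" "odd r" "r dvd n"
  shows "maximal_closed (pair_stab 4 0 r) (pair_stab (4 * r) 0 r)"
proof (rule maximal_closedI)
  have "coprime (2\<^sup>2) r" using r(2) by (simp only: coprime_power_left_iff) (simp add: coprime_left_2_iff_odd)
  then have cop4: "coprime 4 r" by simp
  have rn: "4 * r dvd n" by (rule divides_mult[OF n4 r(3) cop4])
  show cl: "affclosed (pair_stab (4 * r) 0 r)" by (rule affclosed_pair_stab[OF rn])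
  show "pair_stab (4 * r) 0 r \<subseteq> pair_stab 4 0 r" using dvd_mult_left[of 4 r] by (auto simp: pair_stab_def)
  have "\<not> r * 4 dvd 1 * 4" using prime_pos[OF r(1)] by (subst dvd_times_right_cancel_iff) simp_all
  then have "\<not> r * 4 dvd 4" by simp
  then have "(1, 4) \<in> pair_stab 4 0 r" "(1, 4) \<notin> pair_stab (4 * r) 0 r"
    using transl_in_pair_stab_4[OF r(2)] by (simp_all add: mult.commute)
  then show "pair_stab (4 * r) 0 r \<noteq> pair_stab 4 0 r" by blast
  fix L assume L: "affclosed L" "pair_stab (4 * r) 0 r \<subseteq> L" "L \<subseteq> pair_stab 4 0 r"
  show "L = pair_stab (4 * r) 0 r \<or> L = pair_stab 4 0 r"
  proof (rule transl_index[OF affclosed_sub[OF cl] affclosed_sub[OF L(1)]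
        affclosed_sub[OF affclosed_pair_stab[OF n4]] L(2,3)])
    show "\<exists>b'. (c, b') \<in> pair_stab (4 * r) 0 r" if "(c, b) \<in> pair_stab 4 0 r" for c b
    proof -
      have c: "c \<in> mults" using that by (simp add: pair_stab_def)
      have e: "c * r - r = (c - 1) * r" "c * r + r = (c + 1) * r" by (simp_all add: algebra_simps)
      consider "4 dvd c - 1" | "4 dvd c + 1" using mults_mod[OF n4 \<alpha>4 c] by blast
      then show ?thesis
      proof cases
        case 1
        then show ?thesis using c by (intro exI[of _ 0]) (simp add: pair_stab_def e)
      next
        case 2
        then show ?thesis using c by (intro exI[of _ r]) (simp add: pair_stab_def e)
      qed
    qed
    show "4 dvd b" if "(1, b) \<in> pair_stab 4 0 r" for b
      using that by (simp add: transl_in_pair_stab_4[OF r(2)])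
    show "(1, r * 4) \<in> pair_stab (4 * r) 0 r"
      using transl_in_pair_stab_4[OF r(2), of "4 * r" "r * 4"] by (simp add: mult.commute)
  qed (use r in simp_all)
qed

section \<open>Conjugation in the holomorph\<close>

text \<open>Conjugating \<open>x \<mapsto> c x + b'\<close> by \<open>x \<mapsto> v x + z\<close> gives \<open>x \<mapsto> c x + (v b' + z - c z)\<close>.\<close>

definition aff_conj :: "int \<Rightarrow> int \<Rightarrow> (int \<times> int) set \<Rightarrow> (int \<times> int) set" where
  "aff_conj v z S = {(c, b). \<exists>b'. (c, b') \<in> S \<and> n dvd b - (v * b' + z - c * z)}"

lemma aff_conj_mono: "S \<subseteq> T \<Longrightarrow> aff_conj v z S \<subseteq> aff_conj v z T"
  by (auto simp: aff_conj_def)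

lemma fst_imageI: "(c, b) \<in> S \<Longrightarrow> c \<in> fst ` S"
  by (rule image_eqI[of _ fst "(c, b)"]) simp_all

lemma fst_aff_conj: "fst ` aff_conj v z S = fst ` S"
proof -
  have "c \<in> fst ` aff_conj v z S \<longleftrightarrow> c \<in> fst ` S" for c
  proof
    assume "c \<in> fst ` S"
    then obtain b where "(c, b) \<in> S" by auto
    then have "(c, v * b + z - c * z) \<in> aff_conj v z S" by (auto simp: aff_conj_def intro!: exI[of _ b])
    then show "c \<in> fst ` aff_conj v z S" by (rule fst_imageI)
  next
    assume "c \<in> fst ` aff_conj v z S"
    then obtain b where "(c, b) \<in> S" by (auto simp: aff_conj_def)
    then show "c \<in> fst ` S" by (rule fst_imageI)
  qed
  then show ?thesis by blast
qed

lemma aff_conj_conj: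
  "aff_conj v z (aff_conj v' z' S) = aff_conj (v * v') (v * z' + z) S"
proof -
  have "(c, b) \<in> aff_conj v z (aff_conj v' z' S) \<longleftrightarrow> (c, b) \<in> aff_conj (v * v') (v * z' + z) S" for c b
  proof
    assume "(c, b) \<in> aff_conj v z (aff_conj v' z' S)"
    then obtain b1 b2 where b: "(c, b2) \<in> S" "n dvd b1 - (v' * b2 + z' - c * z')" "n dvd b - (v * b1 + z - c * z)"
      by (auto simp: aff_conj_def)
    have "n dvd b - (v * v' * b2 + (v * z' + z) - c * (v * z' + z))"
      by (rule dvd_lin2[OF b(2,3), where p = v and q = 1]) (simp add: algebra_simps)
    then show "(c, b) \<in> aff_conj (v * v') (v * z' + z) S" using b(1) by (auto simp: aff_conj_def)
  next
    assume "(c, b) \<in> aff_conj (v * v') (v * z' + z) S"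
    then obtain b2 where b: "(c, b2) \<in> S" "n dvd b - (v * v' * b2 + (v * z' + z) - c * (v * z' + z))"
      by (auto simp: aff_conj_def)
    have "(c, v' * b2 + z' - c * z') \<in> aff_conj v' z' S"
      using b(1) by (auto simp: aff_conj_def intro!: exI[of _ b2])
    moreover have "n dvd b - (v * (v' * b2 + z' - c * z') + z - c * z)"
      by (rule dvd_lin1[OF b(2), where p = 1]) (simp add: algebra_simps)
    ultimately show "(c, b) \<in> aff_conj v z (aff_conj v' z' S)" unfolding aff_conj_def[of v z] by blast
  qed
  then show ?thesis by auto
qed

lemma aff_conj_id:
  assumes "affsub S" "n dvd v - 1" "n dvd z"
  shows "aff_conj v z S = S"
proof -
  have "(c, b) \<in> aff_conj v z S \<longleftrightarrow> (c, b) \<in> S" for c b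
  proof
    assume "(c, b) \<in> aff_conj v z S"
    then obtain b' where b: "(c, b') \<in> S" "n dvd b - (v * b' + z - c * z)" by (auto simp: aff_conj_def)
    have "n dvd b - b'"
      by (rule dvd_lin3[OF b(2) assms(2,3), where p = 1 and q = b' and r = "1 - c"]) (simp add: algebra_simps)
    then show "(c, b) \<in> S" by (intro affsub_cong[OF assms(1) b(1)]) simp_all
  next
    assume b: "(c, b) \<in> S"
    have "n dvd b - (v * b + z - c * z)"
      by (rule dvd_lin2[OF assms(2,3), where p = "- b" and q = "c - 1"]) (simp add: algebra_simps)
    then show "(c, b) \<in> aff_conj v z S" using b by (auto simp: aff_conj_def)
  qed
  then show ?thesis by auto
qed

lemma ex_inverse:
  assumes "coprime v n"
  obtains v' where "n dvd v * v' - 1" "coprime v' n"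
proof -
  obtain v' where v': "[v * v' = 1] (mod n)" using cong_solve_coprime_int[OF assms] by blast
  then have "[v' * v = 1] (mod n)" by (simp only: mult.commute)
  then have "coprime v' n" using coprime_iff_invertible_int by blast
  then show ?thesis using that v' by (simp add: cong_iff_dvd_diff)
qed

lemma aff_conj_inverse:
  assumes "affsub S" "n dvd v * v' - 1"
  shows "aff_conj v z (aff_conj v' (- v' * z) S) = S" "aff_conj v' (- v' * z) (aff_conj v z S) = S"
proof -
  have "n dvd v * (- v' * z) + z"
    by (rule dvd_lin1[OF assms(2), where p = "- z"]) (simp add: algebra_simps)
  then show "aff_conj v z (aff_conj v' (- v' * z) S) = S"
    unfolding aff_conj_conj by (intro aff_conj_id assms)
  have "n dvd v' * v - 1" using assms(2) by (simp only: mult.commute)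
  moreover have "n dvd v' * z + (- v' * z)" by simp
  ultimately show "aff_conj v' (- v' * z) (aff_conj v z S) = S"
    unfolding aff_conj_conj by (intro aff_conj_id assms)
qed

lemma affsub_aff_conj:
  assumes S: "affsub S"
  shows "affsub (aff_conj v z S)"
proof (rule affsubI)
  show "(1, 0) \<in> aff_conj v z S" using affsub_one[OF S] by (auto simp: aff_conj_def intro!: exI[of _ 0])
  show "c \<in> mults" if "(c, b) \<in> aff_conj v z S" for c b
    using that affsub_mults[OF S] by (auto simp: aff_conj_def)
  fix c b c' b' assume "(c, b) \<in> aff_conj v z S"
  then obtain d where d: "(c, d) \<in> S" "n dvd b - (v * d + z - c * z)" by (auto simp: aff_conj_def)
  {
    assume "(c', b') \<in> aff_conj v z S"
    then obtain d' where d': "(c', d') \<in> S" "n dvd b' - (v * d' + z - c' * z)" by (auto simp: aff_conj_def)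
    have "n dvd c * b' + b - (v * (c * d' + d) + z - c * c' * z)"
      by (rule dvd_lin2[OF d(2) d'(2), where p = 1 and q = c]) (simp add: algebra_simps)
    then show "(c * c', c * b' + b) \<in> aff_conj v z S"
      using affsub_mult[OF S d(1) d'(1)] by (auto simp: aff_conj_def)
  next
    assume e: "n dvd c' - c" "n dvd b' - b"
    have "(c', d) \<in> S" by (rule affsub_cong[OF S d(1) e(1)]) simp
    moreover have "n dvd b' - (v * d + z - c' * z)"
      by (rule dvd_lin3[OF d(2) e, where p = 1 and q = z and r = 1]) (simp add: algebra_simps)
    ultimately show "(c', b') \<in> aff_conj v z S" by (auto simp: aff_conj_def)
  }
qed

text \<open>The orbit condition for the conjugate at \<open>v * x + z\<close> is the orbit condition
  for \<open>S\<close> at \<open>x\<close>.\<close>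

lemma affclosed_aff_conj:
  assumes S: "affclosed S" and v: "coprime v n"
  shows "affclosed (aff_conj v z S)"
proof (rule affclosedI[OF affsub_aff_conj[OF affclosed_sub[OF S]]])
  fix c b assume c: "c \<in> mults"
    and a: "\<And>x. \<exists>c' b'. (c', b') \<in> aff_conj v z S \<and> n dvd c * x + b - (c' * x + b')"
  obtain v' where v': "n dvd v * v' - 1" using ex_inverse[OF v] by blast
  define d where "d = v' * (b - z + c * z)"
  have d: "n dvd v * d - (b - z + c * z)"
    by (rule dvd_lin1[OF v', where p = "b - z + c * z"]) (simp add: d_def algebra_simps)
  have "(c, d) \<in> S"
  proof (rule affclosedD[OF S c])
    fix x
    obtain c' b' d' where d': "(c', d') \<in> S" "n dvd b' - (v * d' + z - c' * z)"
      "n dvd c * (v * x + z) + b - (c' * (v * x + z) + b')"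
      using a[of "v * x + z"] by (auto simp: aff_conj_def)
    have "n dvd v * (c * x + d - (c' * x + d'))"
      by (rule dvd_lin3[OF d'(2,3) d, where p = 1 and q = 1 and r = 1]) (simp add: algebra_simps)
    then have "n dvd c * x + d - (c' * x + d')"
      using v by (simp add: coprime_dvd_mult_right_iff coprime_commute)
    then show "\<exists>c' d'. (c', d') \<in> S \<and> n dvd c * x + d - (c' * x + d')" using d'(1) by blast
  qed
  moreover have "n dvd b - (v * d + z - c * z)"
    by (rule dvd_lin1[OF d, where p = "-1"]) (simp add: algebra_simps)
  ultimately show "(c, b) \<in> aff_conj v z S" by (auto simp: aff_conj_def)
qed

lemma maximal_closed_aff_conj:
  assumes M: "affsub M" and K: "maximal_closed M K" and v: "coprime v n"
  shows "maximal_closed (aff_conj v z M) (aff_conj v z K)"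
proof -
  obtain v' where v': "n dvd v * v' - 1" "coprime v' n" by (rule ex_inverse[OF v])
  note inv = aff_conj_inverse[OF _ v'(1), where z = z]
  have clK: "affclosed K" and KM: "K \<subset> M" using K by (auto simp: maximal_closed_def)
  note subK = affclosed_sub[OF clK]
  show ?thesis
    unfolding maximal_closed_def
  proof (intro conjI allI impI)
    show "affclosed (aff_conj v z K)" by (rule affclosed_aff_conj[OF clK v])
    have "aff_conj v z K \<noteq> aff_conj v z M"
    proof
      assume eq: "aff_conj v z K = aff_conj v z M"
      have "K = aff_conj v' (- v' * z) (aff_conj v z K)" by (simp only: inv(2)[OF subK])
      also have "\<dots> = M" unfolding eq by (rule inv(2)[OF M])
      finally show False using KM by simp
    qed
    then show "aff_conj v z K \<subset> aff_conj v z M" using aff_conj_mono KM by blast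
    fix L assume L: "affclosed L \<and> L \<subset> aff_conj v z M \<and> aff_conj v z K \<subseteq> L"
    define L' where "L' = aff_conj v' (- v' * z) L"
    have clL: "affclosed L'" unfolding L'_def by (rule affclosed_aff_conj[OF _ v'(2)]) (use L in blast)
    have L_eq: "aff_conj v z L' = L" unfolding L'_def by (rule inv(1)) (use L affclosed_sub in blast)
    have "aff_conj v' (- v' * z) (aff_conj v z K) \<subseteq> L'" unfolding L'_def
      by (rule aff_conj_mono) (use L in blast)
    then have "K \<subseteq> L'" by (simp only: inv(2)[OF subK])
    moreover have "L' \<subseteq> aff_conj v' (- v' * z) (aff_conj v z M)" unfolding L'_def
      by (rule aff_conj_mono) (use L in blast)
    then have "L' \<subseteq> M" by (simp only: inv(2)[OF M])
    moreover have "L' \<noteq> M" using L_eq L by blast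
    ultimately have "L' = K" using K clL by (auto simp: maximal_closed_def)
    then show "L = aff_conj v z K" using L_eq by simp
  qed
qed

text \<open>As \<open>v\<close> is a unit, every \<open>b\<close> comes from some \<open>b'\<close>;
  an equality of groups is thereby reduced to comparing the two conditions for related
  translations.\<close>

lemma aff_conj_eqI:
  assumes v: "coprime v n"
    and "\<And>c b b'. n dvd b - (v * b' + z - c * z) \<Longrightarrow> (c, b') \<in> S \<longleftrightarrow> (c, b) \<in> T"
  shows "aff_conj v z S = T"
proof -
  obtain v' where v': "n dvd v * v' - 1" using ex_inverse[OF v] by blast
  have "(c, b) \<in> aff_conj v z S \<longleftrightarrow> (c, b) \<in> T" for c b
  proof -
    have "n dvd b - (v * (v' * (b - z + c * z)) + z - c * z)"
      by (rule dvd_lin1[OF v', where p = "- (b - z + c * z)"]) (simp add: algebra_simps)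
    then show ?thesis using assms(2) unfolding aff_conj_def by blast
  qed
  then show ?thesis by auto
qed

lemma aff_conj_transfer:
  assumes v: "coprime v n" and D: "D dvd n" and b: "n dvd b - (v * b' + z - c * z)"
    and e: "f = v * e + (b - (v * b' + z - c * z))"
  shows "D dvd e \<longleftrightarrow> D dvd f"
proof -
  have "coprime v D" using coprime_divisors[OF dvd_refl D v] .
  then have "D dvd e \<longleftrightarrow> D dvd v * e" by (simp add: coprime_dvd_mult_right_iff coprime_commute)
  moreover have "D dvd b - (v * b' + z - c * z)" by (rule dvd_trans[OF D b])
  then have "D dvd v * e \<longleftrightarrow> D dvd f" unfolding e by (simp only: dvd_add_left_iff)
  ultimately show ?thesis by simp
qed

lemma aff_conj_point_stab:
  assumes v: "coprime v n" and D: "D dvd n"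
  shows "aff_conj v z (point_stab D t) = point_stab D (v * t + z)"
proof (rule aff_conj_eqI[OF v])
  fix c b b' assume b: "n dvd b - (v * b' + z - c * z)"
  have "D dvd c * t + b' - t \<longleftrightarrow> D dvd c * (v * t + z) + b - (v * t + z)"
    by (rule aff_conj_transfer[OF v D b]) (simp add: algebra_simps)
  then show "(c, b') \<in> point_stab D t \<longleftrightarrow> (c, b) \<in> point_stab D (v * t + z)"
    by (simp add: point_stab_def)
qed

lemma aff_conj_pair_stab:
  assumes v: "coprime v n" and D: "D dvd n"
  shows "aff_conj v z (pair_stab D t u) = pair_stab D (v * t + z) (v * u)"
proof (rule aff_conj_eqI[OF v])
  fix c b b' assume b: "n dvd b - (v * b' + z - c * z)"
  have 1: "D dvd c * t + b' - t \<longleftrightarrow> D dvd c * (v * t + z) + b - (v * t + z)"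
    by (rule aff_conj_transfer[OF v D b]) (simp add: algebra_simps)
  have 2: "D dvd c * t + b' - t - u \<longleftrightarrow> D dvd c * (v * t + z) + b - (v * t + z) - v * u"
    by (rule aff_conj_transfer[OF v D b]) (simp add: algebra_simps)
  have "coprime D v" using coprime_divisors[OF dvd_refl D v] by (simp only: coprime_commute)
  then have 3: "D dvd v * e \<longleftrightarrow> D dvd e" for e by (rule coprime_dvd_mult_right_iff)
  have 4: "c * (v * u) - v * u = v * (c * u - u)" "c * (v * u) + v * u = v * (c * u + u)"
    by (simp_all add: algebra_simps)
  show "(c, b') \<in> pair_stab D t u \<longleftrightarrow> (c, b) \<in> pair_stab D (v * t + z) (v * u)"
    by (simp only: pair_stab_def mem_Collect_eq prod.case 1 2 4 3)
qed

lemma aff_conj_twisted_sub: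
  assumes v: "coprime v n" and ok: "twisted_ok s r"
  shows "aff_conj v 0 (twisted_sub s r l) = twisted_sub s r (v * l)"
proof (rule aff_conj_eqI[OF v])
  fix c b b' assume b: "n dvd b - (v * b' + 0 - c * 0)"
  have "s * r dvd b' - r * l * int i \<longleftrightarrow> s * r dvd b - r * (v * l) * int i" for i
    by (rule aff_conj_transfer[OF v twisted_ok_coprime(2)[OF ok] b]) (simp add: algebra_simps)
  then show "(c, b') \<in> twisted_sub s r l \<longleftrightarrow> (c, b) \<in> twisted_sub s r (v * l)"
    by (simp add: twisted_sub_def)
qed

lemma pair_stab_cong:
  assumes "D dvd u - u'"
  shows "pair_stab D t u = pair_stab D t u'"
proof -
  have *: "pair_stab D t u \<subseteq> pair_stab D t u'" if d: "D dvd u - u'" for u u'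
  proof clarify
    fix c b assume "(c, b) \<in> pair_stab D t u"
    then consider (1) "c \<in> mults" "D dvd c * t + b - t" "D dvd c * u - u"
      | (2) "c \<in> mults" "D dvd c * t + b - t - u" "D dvd c * u + u" by (auto simp: pair_stab_def)
    then show "(c, b) \<in> pair_stab D t u'"
    proof cases
      case 1
      have "D dvd c * u' - u'" by (rule dvd_lin2[OF 1(3) d, where p = 1 and q = "1 - c"]) (simp add: algebra_simps)
      then show ?thesis using 1 by (simp add: pair_stab_def)
    next
      case 2
      have "D dvd c * u' + u'" by (rule dvd_lin2[OF 2(3) d, where p = 1 and q = "- 1 - c"]) (simp add: algebra_simps)
      moreover have "D dvd c * t + b - t - u'" by (rule dvd_lin2[OF 2(2) d, where p = 1 and q = 1]) simp
      ultimately show ?thesis using 2 by (simp add: pair_stab_def)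
    qed
  qed
  have "D dvd u' - u" using assms by (simp add: dvd_diff_commute)
  then show ?thesis using *[OF assms] *[of u' u] by blast
qed

lemma twisted_sub_cong:
  assumes "s dvd l - l'"
  shows "twisted_sub s r l = twisted_sub s r l'"
proof -
  have "s * r dvd b - r * l * int i \<longleftrightarrow> s * r dvd b - r * l' * int i" for b i
  proof -
    have "s * r dvd (l - l') * r" using assms by simp
    then have "s * r dvd (l - l') * r * int i" by simp
    moreover have "b - r * l' * int i = (b - r * l * int i) + (l - l') * r * int i" by (simp add: algebra_simps)
    ultimately show ?thesis by (simp only: dvd_add_left_iff)
  qed
  then show ?thesis by (simp add: twisted_sub_def)
qed

section \<open>Second maximal closed subgroups\<close>

definition second_maximal :: "(int \<times> int) set \<Rightarrow> bool" where
  "second_maximal S \<longleftrightarrow> (\<exists>M. maximal_closed full M \<and> maximal_closed M S)"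

text \<open>The list in coordinates. In items 4 and 6 the second point of the pair, \<open>r\<close>
  or 1, is the image of 0 under the first generator, and the modulus is the translation of the
  second generator.\<close>

inductive entry :: "nat \<Rightarrow> (int \<times> int) set \<Rightarrow> bool" where
  entry1: "prime r \<Longrightarrow> r dvd n \<Longrightarrow> prime s \<Longrightarrow> s dvd ord r \<alpha> \<Longrightarrow> entry 1 (index_sub s r)"
| entry2: "prime s \<Longrightarrow> prime r \<Longrightarrow> s * r dvd n \<Longrightarrow> entry 2 (point_stab (s * r) 0)"
| entry3: "twisted_ok s r \<Longrightarrow> entry 3 (twisted_sub s r 1)"
| entry4: "prime r \<Longrightarrow> odd r \<Longrightarrow> r dvd n \<Longrightarrow> 4 dvd n \<Longrightarrow> 4 dvd \<alpha> + 1 \<Longrightarrow> entry 4 (pair_stab (4 * r) 0 r)"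
| entry5: "4 dvd n \<Longrightarrow> 4 dvd \<alpha> + 1 \<Longrightarrow> entry 5 ker4"
| entry6: "8 dvd n \<Longrightarrow> 8 dvd \<alpha> + 1 \<Longrightarrow> entry 6 (pair_stab 8 0 1)"

theorem entry_second_maximal:
  assumes "entry i K"
  shows "second_maximal K"
  using assms
proof cases
  case (entry1 r s)
  then show ?thesis unfolding second_maximal_def
    using maximal_point_stab[of r 0] maximal_index_sub by blast
next
  case (entry2 s r)
  have "r dvd n" by (rule dvd_mult_right[OF entry2(5)])
  then show ?thesis unfolding second_maximal_def
    using maximal_point_stab[of r 0] maximal_point_stab2[of r s] entry2 by blast
next
  case (entry3 s r)
  have "prime r" "r dvd n" using entry3 by (auto simp: twisted_ok_def)
  then show ?thesis unfolding second_maximal_def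
    using maximal_point_stab[of r 0] maximal_twisted_sub[of s r] entry3 by blast
next
  case (entry4 r)
  then show ?thesis unfolding second_maximal_def
    using maximal_pair_stab_4[of r] maximal_pair_stab_4r[of r] by blast
next
  case entry5
  have "odd (1::int)" by simp
  then show ?thesis unfolding second_maximal_def
    using maximal_pair_stab_4[of 1] maximal_ker4[of 1] entry5 by blast
next
  case entry6
  have "(4::int) dvd 8" by simp
  then have "4 dvd n" "4 dvd \<alpha> + 1" using entry6 dvd_trans by blast+
  moreover have "odd (1::int)" by simp
  ultimately show ?thesis unfolding second_maximal_def
    using maximal_pair_stab_4[of 1] maximal_pair_stab_8 entry6 by blast
qed

definition conj_entry :: "(int \<times> int) set \<Rightarrow> bool" where
  "conj_entry S \<longleftrightarrow> (\<exists>i v z. coprime v n \<and> entry i (aff_conj v z S))"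

lemma conj_entry_aff_conj:
  assumes "conj_entry (aff_conj v z S)" "coprime v n"
  shows "conj_entry S"
proof -
  obtain i v' z' where "coprime v' n" "entry i (aff_conj v' z' (aff_conj v z S))"
    using assms(1) by (auto simp: conj_entry_def)
  then have "coprime (v' * v) n" "entry i (aff_conj (v' * v) (v' * z + z') S)"
    using assms(2) by (simp_all add: aff_conj_conj)
  then show ?thesis unfolding conj_entry_def by blast
qed

lemma conj_entry_self: "entry i S \<Longrightarrow> affsub S \<Longrightarrow> conj_entry S"
  unfolding conj_entry_def by (metis aff_conj_id coprime_1_left diff_self dvd_0_right)

lemma conj_entry_point_stab:
  assumes "prime s" "prime r" "s * r dvd n"
  shows "conj_entry (point_stab (s * r) t)"
proof -
  have "aff_conj 1 (- t) (point_stab (s * r) t) = point_stab (s * r) 0"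
    by (subst aff_conj_point_stab) (use assms in simp_all)
  then show ?thesis unfolding conj_entry_def using entry2[OF assms] by (metis coprime_1_left)
qed

text \<open>The factor -1 is a unit modulo every \<open>n\<close>, so \<beta> becomes 1 modulo 4
  under \<open>v = 1\<close> or \<open>v = -1\<close> without lifting; the shift
  \<open>- v * t\<close> moves the pair to 0.\<close>

lemma conj_entry_pair_stab:
  assumes r: "prime r" "odd r" "r dvd n" and n4: "4 dvd n" "4 dvd \<alpha> + 1" and \<beta>: "odd \<beta>"
  shows "conj_entry (pair_stab (4 * r) t (r * \<beta>))" "4 * r dvd n"
proof -
  have "coprime (2\<^sup>2) r" using r(2) by (simp only: coprime_power_left_iff) (simp add: coprime_left_2_iff_odd)
  then have "coprime 4 r" by simp
  then show rn: "4 * r dvd n" by (rule divides_mult[OF n4(1) r(3)])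
  obtain v :: int where v: "v = 1 \<or> v = -1" "4 dvd v * \<beta> - 1"
  proof (cases "4 dvd \<beta> - 1")
    case True
    then show ?thesis using that[of 1] by simp
  next
    case False
    then have "4 dvd - \<beta> - 1" using \<beta> by presburger
    then show ?thesis using that[of "-1"] by simp
  qed
  have vn: "coprime v n" using v(1) by auto
  have "4 * r dvd (v * \<beta> - 1) * r" using v(2) by (intro mult_dvd_mono) simp_all
  then have "4 * r dvd v * (r * \<beta>) - r" by (simp add: algebra_simps)
  then have "pair_stab (4 * r) 0 (v * (r * \<beta>)) = pair_stab (4 * r) 0 r" by (rule pair_stab_cong)
  then have "aff_conj v (- v * t) (pair_stab (4 * r) t (r * \<beta>)) = pair_stab (4 * r) 0 r"
    by (subst aff_conj_pair_stab[OF vn rn]) simp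
  then show "conj_entry (pair_stab (4 * r) t (r * \<beta>))"
    unfolding conj_entry_def using entry4[OF r n4] vn by metis
qed

text \<open>Each alternative yields a closed group between \<open>S\<close> and the point
  stabilizer. It is proper, in most cases because it misses the translation by \<open>r\<close>, so
  it equals \<open>S\<close> by maximality.\<close>

lemma second_maximal_in_point_stab:
  assumes r: "prime r" "r dvd n" and S: "maximal_closed (point_stab r 0) S"
  shows "conj_entry S"
proof -
  have clS: "affclosed S" and sub: "S \<subset> point_stab r 0" using S by (auto simp: maximal_closed_def)
  have one: "(1, r) \<in> point_stab r 0" by (simp add: transl_in_point_stab)
  from clS sub r show ?thesis
  proof (rule proper_in_point_stab)
    fix s t assume a: "prime s" "s * r dvd n" "S \<subseteq> point_stab (s * r) t"
      "point_stab (s * r) t \<subseteq> point_stab r 0"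
    have "(1, r) \<notin> point_stab (s * r) t"
      using prime_pos[OF a(1)] prime_pos[OF r(1)] by (simp add: transl_in_point_stab)
    then have "point_stab (s * r) t \<subset> point_stab r 0" using a(4) one by blast
    then have "point_stab (s * r) t = S" by (rule maximal_closed_eq[OF S affclosed_point_stab[OF a(2)] a(3)])
    then show ?thesis using conj_entry_point_stab[OF a(1) r(1) a(2), of t] by simp
  next
    fix \<beta> t assume a: "odd r" "4 dvd n" "4 dvd \<alpha> + 1" "odd \<beta>" "S \<subseteq> pair_stab (4 * r) t (r * \<beta>)"
      "pair_stab (4 * r) t (r * \<beta>) \<subseteq> point_stab r 0"
    note c = conj_entry_pair_stab[OF r(1) a(1) r(2) a(2,3,4)]
    have "odd (r * \<beta>)" using a by simp
    then have "(1, r) \<notin> pair_stab (4 * r) t (r * \<beta>)"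
      using transl_in_pair_stab_4[of "r * \<beta>" "4 * r" r t] prime_pos[OF r(1)] by simp
    then have "pair_stab (4 * r) t (r * \<beta>) \<subset> point_stab r 0" using a(6) one by blast
    then have "pair_stab (4 * r) t (r * \<beta>) = S" by (rule maximal_closed_eq[OF S affclosed_pair_stab[OF c(2)] a(5)])
    then show ?thesis using c(1)[of t] by simp
  next
    fix s assume a: "prime (s::nat)" "s dvd ord r \<alpha>" "S \<subseteq> index_sub s r"
    have "index_sub s r \<subset> point_stab r 0" using maximal_index_sub[OF r a(1,2)] by (simp add: maximal_closed_def)
    then have "index_sub s r = S" by (rule maximal_closed_eq[OF S affclosed_index_sub[OF r a(2)] a(3)])
    then show ?thesis using conj_entry_self[OF entry1[OF r a(1,2)]] affclosed_sub[OF clS] by simp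
  next
    fix s l assume a: "twisted_ok s r" "coprime l s" "S \<subseteq> twisted_sub s r l"
    have s: "prime s" "s dvd n" using a(1) by (auto simp: twisted_ok_def)
    have "(1, r) \<notin> twisted_sub s r l"
      using prime_pos[OF s(1)] prime_pos[OF r(1)] by (simp add: transl_in_twisted_sub[OF a(1)])
    then have "twisted_sub s r l \<subset> point_stab r 0" using twisted_sub_sub[OF a(1)] one by blast
    then have eq: "twisted_sub s r l = S" by (rule maximal_closed_eq[OF S affclosed_twisted_sub[OF a(1)] a(3)])
    \<comment> \<open>The inverse of \<open>l\<close> modulo \<open>s\<close>, lifted to a unit
      modulo \<open>n\<close>, is the factor that conjugates \<open>l\<close> to 1.\<close>
    obtain u where u: "[l * u = 1] (mod s)" using cong_solve_coprime_int[OF a(2)] by blast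
    then have "[u * l = 1] (mod s)" by (simp only: mult.commute)
    then have "coprime u s" using coprime_iff_invertible_int by blast
    then obtain v where v: "coprime v n" "s dvd v - u" by (rule coprime_lift[OF n_pos])
    have "s dvd l * u - 1" using u by (simp add: cong_iff_dvd_diff)
    then have "s dvd v * l - 1"
      using v(2) by (rule dvd_lin2[where p = 1 and q = l]) (simp add: algebra_simps)
    then have "aff_conj v 0 S = twisted_sub s r 1"
      using aff_conj_twisted_sub[OF v(1) a(1), of l] twisted_sub_cong[of s "v * l" 1 r] eq by simp
    then show ?thesis unfolding conj_entry_def using entry3[OF a(1)] v(1) by metis
  qed
qed

lemma second_maximal_in_pair_stab:
  assumes n4: "4 dvd n" and \<alpha>4: "4 dvd \<alpha> + 1" and \<beta>: "odd \<beta>" and S: "maximal_closed (pair_stab 4 0 \<beta>) S"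
  shows "conj_entry S"
proof -
  have clS: "affclosed S" and sub: "S \<subset> pair_stab 4 0 \<beta>" using S by (auto simp: maximal_closed_def)
  have four: "(1, 4) \<in> pair_stab 4 0 \<beta>" by (simp add: transl_in_pair_stab)
  from clS sub \<beta> n4 \<alpha>4 show ?thesis
  proof (rule proper_in_pair_stab)
    assume a: "S \<subseteq> ker4"
    have "ker4 \<subset> pair_stab 4 0 \<beta>" using maximal_ker4[OF n4 \<alpha>4 \<beta>] by (simp add: maximal_closed_def)
    then have "ker4 = S" by (rule maximal_closed_eq[OF S affclosed_ker4[OF n4] a])
    then show ?thesis using conj_entry_self[OF entry5[OF n4 \<alpha>4]] affclosed_sub[OF clS] by simp
  next
    fix s \<beta>' t assume a: "prime s" "odd s" "s dvd n" "odd \<beta>'" "S \<subseteq> pair_stab (4 * s) t (s * \<beta>')"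
      "pair_stab (4 * s) t (s * \<beta>') \<subseteq> pair_stab 4 0 \<beta>"
    note c = conj_entry_pair_stab[OF a(1-3) n4 \<alpha>4 a(4)]
    have "odd (s * \<beta>')" using a by simp
    moreover have "\<not> 4 * s dvd 4" using prime_pos[OF a(1)] dvd_mult_cancel_left[of 4 s 1] by simp
    ultimately have "(1, 4) \<notin> pair_stab (4 * s) t (s * \<beta>')"
      using transl_in_pair_stab_4[of "s * \<beta>'" "4 * s" 4 t] by simp
    then have "pair_stab (4 * s) t (s * \<beta>') \<subset> pair_stab 4 0 \<beta>" using a(6) four by blast
    then have "pair_stab (4 * s) t (s * \<beta>') = S" by (rule maximal_closed_eq[OF S affclosed_pair_stab[OF c(2)] a(5)])
    then show ?thesis using c(1)[of t] by simp
  next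
    fix \<gamma> assume a: "odd \<gamma>" "8 dvd n" "8 dvd \<alpha> + 1" "S \<subseteq> pair_stab 8 0 \<gamma>"
      "pair_stab 8 0 \<gamma> \<subseteq> pair_stab 4 0 \<beta>"
    have "(1, 4) \<notin> pair_stab 8 0 \<gamma>" using transl_in_pair_stab_4[OF a(1), of 8 4 0] by simp
    then have "pair_stab 8 0 \<gamma> \<subset> pair_stab 4 0 \<beta>" using a(5) four by blast
    then have eq: "pair_stab 8 0 \<gamma> = S" by (rule maximal_closed_eq[OF S affclosed_pair_stab[OF a(2)] a(4)])
    have "coprime (2 ^ 3) \<gamma>" using a(1)
      by (simp only: coprime_power_left_iff) (simp add: coprime_left_2_iff_odd)
    then have "coprime \<gamma> 8" by (simp add: coprime_commute)
    \<comment> \<open>Modulo 8 the odd residues are not only 1 and -1, so the conjugating factor has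
      to be lifted to a unit modulo \<open>n\<close>.\<close>
    then obtain u where u: "[\<gamma> * u = 1] (mod 8)" using cong_solve_coprime_int by blast
    then have "[u * \<gamma> = 1] (mod 8)" by (simp only: mult.commute)
    then have "coprime u 8" using coprime_iff_invertible_int by blast
    then obtain v where v: "coprime v n" "8 dvd v - u" by (rule coprime_lift[OF n_pos])
    have "8 dvd \<gamma> * u - 1" using u by (simp add: cong_iff_dvd_diff)
    then have "8 dvd v * \<gamma> - 1"
      using v(2) by (rule dvd_lin2[where p = 1 and q = \<gamma>]) (simp add: algebra_simps)
    then have "aff_conj v 0 S = pair_stab 8 0 1"
      using aff_conj_pair_stab[OF v(1) a(2), of 0 0 \<gamma>] pair_stab_cong[of 8 "v * \<gamma>" 1 0] eq by simp
    then show ?thesis unfolding conj_entry_def using entry6[OF a(2,3)] v(1) by metis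
  qed
qed

theorem second_maximal_conj_entry:
  assumes "second_maximal S"
  shows "conj_entry S"
proof -
  obtain M where M: "maximal_closed full M" "maximal_closed M S" using assms by (auto simp: second_maximal_def)
  have clM: "affclosed M" and "M \<noteq> full" using M(1) by (auto simp: maximal_closed_def)
  then show ?thesis
  proof (rule proper_closed_cases)
    fix r t assume a: "prime r" "r dvd n" "M \<subseteq> point_stab r t"
    have "point_stab r t \<subset> full" "affclosed (point_stab r t)"
      using maximal_point_stab[OF a(1,2), of t] by (simp_all add: maximal_closed_def)
    then have "point_stab r t = M" using maximal_closed_eq[OF M(1)] a(3) by blast
    then have "maximal_closed (aff_conj 1 (- t) (point_stab r t)) (aff_conj 1 (- t) S)"
      using maximal_closed_aff_conj[OF affclosed_sub[OF clM] M(2), of 1] by simp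
    moreover have "aff_conj 1 (- t) (point_stab r t) = point_stab r 0"
      by (subst aff_conj_point_stab) (use a in simp_all)
    ultimately have "conj_entry (aff_conj 1 (- t) S)"
      using second_maximal_in_point_stab[OF a(1,2)] by simp
    then show ?thesis by (rule conj_entry_aff_conj) simp
  next
    fix \<beta> assume a: "4 dvd n" "4 dvd \<alpha> + 1" "odd \<beta>" "M \<subseteq> pair_stab 4 0 \<beta>"
    have "pair_stab 4 0 \<beta> \<subset> full" "affclosed (pair_stab 4 0 \<beta>)"
      using maximal_pair_stab_4[OF a(1-3)] by (simp_all add: maximal_closed_def)
    then have "pair_stab 4 0 \<beta> = M" using maximal_closed_eq[OF M(1)] a(4) by blast
    then show ?thesis using second_maximal_in_pair_stab[OF a(1-3)] M(2) by simp
  qed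
qed

section \<open>The entries are pairwise not conjugate\<close>

text \<open>Requiring a positive divisor of \<open>n\<close> makes \<open>D\<close> unique, so that
  it can serve as an invariant.\<close>

definition transl_mod :: "(int \<times> int) set \<Rightarrow> int \<Rightarrow> bool" where
  "transl_mod S D \<longleftrightarrow> 0 < D \<and> D dvd n \<and> (\<forall>b. (1, b) \<in> S \<longleftrightarrow> D dvd b)"

lemma transl_mod_unique: "transl_mod S D \<Longrightarrow> transl_mod S D' \<Longrightarrow> D = D'"
  by (metis transl_mod_def dvd_refl order_less_imp_le zdvd_antisym_nonneg)

lemma transl_mod_aff_conj:
  assumes "transl_mod S D" "coprime v n"
  shows "transl_mod (aff_conj v z S) D"
  unfolding transl_mod_def
proof (intro conjI allI)
  show "0 < D" "D dvd n" using assms(1) by (auto simp: transl_mod_def)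
  obtain v' where v': "n dvd v * v' - 1" using ex_inverse[OF assms(2)] by blast
  fix b
  show "(1, b) \<in> aff_conj v z S \<longleftrightarrow> D dvd b"
  proof
    assume "(1, b) \<in> aff_conj v z S"
    then obtain b' where b': "D dvd b'" "n dvd b - v * b'" using assms(1) by (auto simp: aff_conj_def transl_mod_def)
    show "D dvd b" by (rule dvd_lin2[OF b'(1) dvd_trans[OF \<open>D dvd n\<close> b'(2)], where p = v and q = 1]) simp
  next
    assume "D dvd b"
    then have "(1, v' * b) \<in> S" using assms(1) by (simp add: transl_mod_def)
    moreover have "n dvd b - (v * (v' * b) + z - 1 * z)"
      by (rule dvd_lin1[OF v', where p = "- b"]) (simp add: algebra_simps)
    ultimately show "(1, b) \<in> aff_conj v z S" by (auto simp: aff_conj_def)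
  qed
qed

text \<open>For translations and fixed classes only implications are demanded; uniqueness of the
  entry uses the relation in both directions.\<close>

definition same_invariants :: "(int \<times> int) set \<Rightarrow> (int \<times> int) set \<Rightarrow> bool" where
  "same_invariants S T \<longleftrightarrow> fst ` S = fst ` T \<and> (\<forall>D. transl_mod S D \<longrightarrow> transl_mod T D) \<and>
     (\<forall>D. D dvd n \<longrightarrow> (\<exists>t. S \<subseteq> point_stab D t) \<longrightarrow> (\<exists>t. T \<subseteq> point_stab D t))"

lemma same_invariants_aff_conj:
  assumes "coprime v n"
  shows "same_invariants S (aff_conj v z S)"
  unfolding same_invariants_def
proof (intro conjI allI impI)
  show "fst ` S = fst ` aff_conj v z S" by (simp add: fst_aff_conj)
  show "transl_mod (aff_conj v z S) D" if "transl_mod S D" for D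
    by (rule transl_mod_aff_conj[OF that assms])
  show "\<exists>t. aff_conj v z S \<subseteq> point_stab D t" if D: "D dvd n" and ex: "\<exists>t. S \<subseteq> point_stab D t" for D
    using ex aff_conj_mono[of S "point_stab D _" v z] by (auto simp: aff_conj_point_stab[OF assms D])
qed

text \<open>The second conjugate arises from the first by undoing \<open>(v, z)\<close> and then
  applying \<open>(v', z')\<close>.\<close>

lemma same_invariants_sym_conj:
  assumes "affsub S" "coprime v n" "coprime v' n"
  shows "same_invariants (aff_conj v z S) (aff_conj v' z' S)"
proof -
  obtain u where u: "n dvd v * u - 1" "coprime u n" by (rule ex_inverse[OF assms(2)])
  have "aff_conj v' z' S = aff_conj v' z' (aff_conj u (- u * z) (aff_conj v z S))"
    by (simp only: aff_conj_inverse(2)[OF assms(1) u(1)])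
  also have "\<dots> = aff_conj (v' * u) (v' * (- u * z) + z') (aff_conj v z S)" by (rule aff_conj_conj)
  finally show ?thesis using same_invariants_aff_conj[of "v' * u" "aff_conj v z S"] u(2) assms(3) by simp
qed

lemma transl_mod_point_stab: "0 < D \<Longrightarrow> D dvd n \<Longrightarrow> transl_mod (point_stab D t) D"
  by (simp add: transl_mod_def transl_in_point_stab)

lemma transl_mod_index_sub:
  "prime r \<Longrightarrow> r dvd n \<Longrightarrow> prime s \<Longrightarrow> s dvd ord r \<alpha> \<Longrightarrow> transl_mod (index_sub s r) r"
  using alpha_in_index_sub[of r s 0] prime_pos[of r] by (simp add: transl_mod_def)

lemma transl_mod_twisted_sub: "twisted_ok s r \<Longrightarrow> transl_mod (twisted_sub s r l) (s * r)"
  using transl_in_twisted_sub[of s r] twisted_ok_coprime(2)[of s r] prime_pos[of r] prime_pos[of s]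
  by (auto simp: transl_mod_def twisted_ok_def)

lemma transl_mod_pair_stab: "odd u \<Longrightarrow> 4 dvd D \<Longrightarrow> 0 < D \<Longrightarrow> D dvd n \<Longrightarrow> transl_mod (pair_stab D t u) D"
  by (simp add: transl_mod_def transl_in_pair_stab_4)

lemma transl_mod_ker4: "4 dvd n \<Longrightarrow> transl_mod ker4 4"
  by (simp add: transl_mod_def ker4_def)

lemma prime_factorization_times_primes:
  "prime s \<Longrightarrow> prime r \<Longrightarrow> prime_factorization (s * r) = {#s, r#}" for s r :: int
  using prime_pos[of s] prime_pos[of r] by (simp add: prime_factorization_mult prime_factorization_prime)

lemma prime_factorization_4: "prime_factorization (4::int) = {#2, 2#}"
  using prime_factorization_times_primes[of 2 2] by simp

lemma prime_factorization_4_times: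
  "prime r \<Longrightarrow> prime_factorization (4 * r) = {#2, 2, r#}" for r :: int
  using prime_pos[of r] by (simp add: prime_factorization_mult prime_factorization_4 prime_factorization_prime)

lemma prime_factorization_8: "prime_factorization (8::int) = {#2, 2, 2#}"
  using prime_factorization_4_times[of 2] by simp

text \<open>The translation moduli are \<open>r\<close> for item 1; \<open>s * r\<close>,
  \<open>s * r\<close> and 4 for items 2, 3 and 5; \<open>4 * r\<close> and 8 for items 4 and 6.
  Counting prime factors with multiplicity separates these three groups.\<close>

lemma entry_size:
  assumes "entry i K" "transl_mod K D"
  shows "size (prime_factorization D) = (if i = 1 then 1 else if i \<in> {2, 3, 5} then 2 else 3)"
  using assms(1)
proof cases
  case (entry1 r s)
  then have "D = r" using transl_mod_unique[OF assms(2)] transl_mod_index_sub by blast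
  then show ?thesis using entry1 by (simp add: prime_factorization_prime)
next
  case (entry2 s r)
  then have "0 < s * r" using prime_pos[of s] prime_pos[of r] by simp
  then have "D = s * r" using transl_mod_unique[OF assms(2)] transl_mod_point_stab entry2 by blast
  then show ?thesis using entry2 by (simp add: prime_factorization_times_primes)
next
  case (entry3 s r)
  then have "D = s * r" using transl_mod_unique[OF assms(2)] transl_mod_twisted_sub by blast
  then show ?thesis using entry3 by (simp add: prime_factorization_times_primes twisted_ok_def)
next
  case (entry4 r)
  have "4 * r dvd n" "0 < 4 * r" using conj_entry_pair_stab(2)[of r 1] entry4 prime_pos[of r] by simp_all
  then have "D = 4 * r" using transl_mod_unique[OF assms(2)] transl_mod_pair_stab[of r "4 * r"] entry4 by simp
  then show ?thesis using entry4 by (simp add: prime_factorization_4_times)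
next
  case entry5
  then have "D = 4" using transl_mod_unique[OF assms(2)] transl_mod_ker4 by blast
  then show ?thesis using entry5 by (simp add: prime_factorization_4)
next
  case entry6
  then have "D = 8" using transl_mod_unique[OF assms(2)] transl_mod_pair_stab[of 1 8] by simp
  then show ?thesis using entry6 by (simp add: prime_factorization_8)
qed

lemma entry_transl_mod:
  assumes "entry i K"
  shows "\<exists>D. transl_mod K D"
  using assms
proof cases
  case (entry1 r s)
  then show ?thesis using transl_mod_index_sub by blast
next
  case (entry2 s r)
  then have "0 < s * r" using prime_pos[of s] prime_pos[of r] by simp
  then show ?thesis using transl_mod_point_stab entry2 by blast
next
  case (entry3 s r)
  then show ?thesis using transl_mod_twisted_sub by blast
next
  case (entry4 r)
  have "4 * r dvd n" "0 < 4 * r" using conj_entry_pair_stab(2)[of r 1] entry4 prime_pos[of r] by simp_all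
  then show ?thesis using transl_mod_pair_stab[of r "4 * r"] entry4 by auto
next
  case entry5
  then show ?thesis using transl_mod_ker4 by blast
next
  case entry6
  then show ?thesis using transl_mod_pair_stab[of 1 8] by auto
qed

lemma entry_pos: "entry i K \<Longrightarrow> 0 < i"
  by (erule entry.cases) simp_all

lemma entry_1D: "entry i K \<Longrightarrow> i = 1 \<Longrightarrow>
    \<exists>r s. K = index_sub s r \<and> prime r \<and> r dvd n \<and> prime s \<and> s dvd ord r \<alpha>"
  by (erule entry.cases) (simp_all, blast)

lemma entry_2D: "entry i K \<Longrightarrow> i = 2 \<Longrightarrow>
    \<exists>s r. K = point_stab (s * r) 0 \<and> prime s \<and> prime r \<and> s * r dvd n"
  by (erule entry.cases) (simp_all, blast)

lemma entry_3D: "entry i K \<Longrightarrow> i = 3 \<Longrightarrow> \<exists>s r. K = twisted_sub s r 1 \<and> twisted_ok s r"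
  by (erule entry.cases) (simp_all, blast)

lemma entry_4D: "entry i K \<Longrightarrow> i = 4 \<Longrightarrow>
    \<exists>r. K = pair_stab (4 * r) 0 r \<and> prime r \<and> odd r \<and> r dvd n \<and> 4 dvd n \<and> 4 dvd \<alpha> + 1"
  by (erule entry.cases) (simp_all, blast)

lemma entry_5D: "entry i K \<Longrightarrow> i = 5 \<Longrightarrow> K = ker4"
  by (erule entry.cases) simp_all

lemma entry_6D: "entry i K \<Longrightarrow> i = 6 \<Longrightarrow> K = pair_stab 8 0 1"
  by (erule entry.cases) simp_all

text \<open>Within a group of equal size: item 2 fixes a class modulo \<open>s\<close>, item 3 does
  not; \<alpha> is a multiplier in item 2 but not in item 5; \<open>s * r = 4\<close> contradicts
  \<open>s < r\<close> in item 3; \<open>4 * r = 8\<close> contradicts \<open>r\<close> being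
  odd.\<close>

lemma entry_index_less:
  assumes K: "entry i K" and K': "entry j K'" and inv: "same_invariants K K'"
  shows "\<not> i < j"
proof
  assume ij: "i < j"
  obtain D where D: "transl_mod K D" using entry_transl_mod[OF K] by blast
  then have D': "transl_mod K' D" using inv by (simp add: same_invariants_def)
  have size: "(if i = 1 then 1 else if i \<in> {2, 3, 5} then 2 else 3) =
      (if j = 1 then 1 else if j \<in> {2, 3, 5} then 2 else (3::nat))"
    using entry_size[OF K D] entry_size[OF K' D'] by simp
  show False
    using K'
  proof cases
    case (entry1 r s)
    then show ?thesis using ij entry_pos[OF K] by simp
  next
    case (entry2 s r)
    then have "i = 1" using ij entry_pos[OF K] by simp
    then show ?thesis using size entry2 by simp
  next
    case (entry3 s r)
    have i2: "i = 2" using size ij entry3(1) entry_pos[OF K] by (auto split: if_splits)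
    then obtain s' r' where 2: "K = point_stab (s' * r') 0" "prime s'" "prime r'" "s' * r' dvd n"
      using entry_2D[OF K i2] by blast
    have "0 < s' * r'" using prime_pos[OF 2(2)] prime_pos[OF 2(3)] by simp
    then have "D = s' * r'" using transl_mod_unique[OF D] transl_mod_point_stab 2 by blast
    moreover have "D = s * r" using transl_mod_unique[OF D'] transl_mod_twisted_sub entry3 by blast
    ultimately have "point_stab (s' * r') 0 \<subseteq> point_stab s 0"
      using dvd_mult_left[of s r] by (auto simp: point_stab_def)
    moreover have "s dvd n" using entry3 by (simp add: twisted_ok_def)
    ultimately obtain t where "K' \<subseteq> point_stab s t"
      using inv 2(1) unfolding same_invariants_def by blast
    then show ?thesis using twisted_sub_no_fixed_class[OF entry3(3), of 1 t] entry3(2) by simp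
  next
    case (entry4 r)
    then show ?thesis using size ij entry_pos[OF K] by (auto split: if_splits)
  next
    case entry5
    have "i = 2 \<or> i = 3" using size ij entry5(1) entry_pos[OF K] by (auto split: if_splits)
    then show ?thesis
    proof
      assume "i = 2"
      then have "(\<alpha>, 0) \<in> K" using entry_2D[OF K] by (auto simp: point_stab_def)
      then have "\<alpha> \<in> fst ` K" by (rule fst_imageI)
      then have "\<alpha> \<in> fst ` K'" using inv by (simp add: same_invariants_def)
      then have "4 dvd \<alpha> - 1" using entry5(2) by (auto simp: ker4_def)
      then show ?thesis using entry5(4) by presburger
    next
      assume "i = 3"
      then obtain s r where 3: "K = twisted_sub s r 1" "twisted_ok s r"
        using entry_3D[OF K] by blast
      have "D = s * r" using transl_mod_unique[OF D] transl_mod_twisted_sub 3 by blast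
      moreover have "D = 4" using transl_mod_unique[OF D'] transl_mod_ker4 entry5 by blast
      ultimately have "{#s, r#} = {#2, 2#}"
        using prime_factorization_times_primes[of s r] prime_factorization_4 3(2)
        by (simp add: twisted_ok_def)
      then show ?thesis using twisted_ok_less[OF 3(2)] by (auto simp: add_eq_conv_ex)
    qed
  next
    case entry6
    have "i = 4 \<or> i = 5" using size ij entry6(1) entry_pos[OF K] by (auto split: if_splits)
    then have i4: "i = 4" using size entry6(1) by auto
    then obtain r where 4: "K = pair_stab (4 * r) 0 r" "prime r" "odd r" "r dvd n" "4 dvd n" "4 dvd \<alpha> + 1"
      using entry_4D[OF K i4] by blast
    have "4 * r dvd n" "0 < 4 * r" using conj_entry_pair_stab(2)[of r 1] 4 prime_pos[of r] by simp_all
    then have "D = 4 * r" using transl_mod_unique[OF D] transl_mod_pair_stab[of r "4 * r"] 4 by simp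
    moreover have "D = 8" using transl_mod_unique[OF D'] transl_mod_pair_stab[of 1 8] entry6 by simp
    ultimately show ?thesis using 4(3) by simp
  qed
qed

text \<open>The translation modulus gives the parameters back. Item 1 also needs the multipliers,
  among which \<open>\<alpha> ^ s\<close> reveals \<open>s\<close>; item 3 needs
  \<open>s < r\<close> to order the two primes.\<close>

theorem entry_unique:
  assumes K: "entry i K" and K': "entry j K'"
    and inv: "same_invariants K K'" "same_invariants K' K"
  shows "i = j \<and> K = K'"
proof -
  have ij: "i = j" using entry_index_less[OF K K' inv(1)] entry_index_less[OF K' K inv(2)] by simp
  obtain D where D: "transl_mod K D" using entry_transl_mod[OF K] by blast
  then have D': "transl_mod K' D" using inv(1) by (simp add: same_invariants_def)
  have "K = K'"
    using K
  proof cases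
    case (entry1 r s)
    then obtain r' s' where 1: "K' = index_sub s' r'" "prime r'" "r' dvd n" "prime s'" "s' dvd ord r' \<alpha>"
      using entry_1D[OF K'] ij by blast
    have "D = r" using transl_mod_unique[OF D] transl_mod_index_sub entry1 by blast
    moreover have "D = r'" using transl_mod_unique[OF D'] transl_mod_index_sub 1 by blast
    ultimately have rr: "r' = r" by simp
    have "(\<alpha> ^ s, 0) \<in> K" using entry1 by (simp add: alpha_in_index_sub)
    then have "\<alpha> ^ s \<in> fst ` K" by (rule fst_imageI)
    then have "\<alpha> ^ s \<in> fst ` K'" using inv(1) by (simp add: same_invariants_def)
    then have "s' dvd s" using 1 by (auto simp: alpha_in_index_sub)
    then show ?thesis using primes_dvd_imp_eq 1 entry1 rr by blast
  next
    case (entry2 s r)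
    then obtain s' r' where 2: "K' = point_stab (s' * r') 0" "prime s'" "prime r'" "s' * r' dvd n"
      using entry_2D[OF K'] ij by blast
    have "0 < s * r" "0 < s' * r'" using prime_pos entry2 2 by (simp_all add: zero_less_mult_iff)
    then have "D = s * r" "D = s' * r'"
      using transl_mod_unique[OF D] transl_mod_unique[OF D'] transl_mod_point_stab 2 entry2 by blast+
    then show ?thesis using 2 entry2 by simp
  next
    case (entry3 s r)
    then obtain s' r' where 3: "K' = twisted_sub s' r' 1" "twisted_ok s' r'"
      using entry_3D[OF K'] ij by blast
    have "D = s * r" "D = s' * r'"
      using transl_mod_unique[OF D] transl_mod_unique[OF D'] transl_mod_twisted_sub 3 entry3 by blast+
    then have "{#s, r#} = {#s', r'#}"
      using prime_factorization_times_primes[of s r] prime_factorization_times_primes[of s' r'] 3(2) entry3(3)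
      by (simp add: twisted_ok_def)
    then have "s = s' \<and> r = r'"
      using twisted_ok_less[OF 3(2)] twisted_ok_less[OF entry3(3)] by (auto simp: add_eq_conv_ex)
    then show ?thesis using 3 entry3 by simp
  next
    case (entry4 r)
    then obtain r' where 4: "K' = pair_stab (4 * r') 0 r'" "prime r'" "odd r'" "r' dvd n"
      using entry_4D[OF K'] ij by blast
    have "4 * r dvd n" "0 < 4 * r" "4 * r' dvd n" "0 < 4 * r'"
      using conj_entry_pair_stab(2)[of r 1] conj_entry_pair_stab(2)[of r' 1] entry4 4 prime_pos by simp_all
    then have "D = 4 * r" "D = 4 * r'"
      using transl_mod_unique[OF D] transl_mod_unique[OF D'] transl_mod_pair_stab[of r "4 * r"]
        transl_mod_pair_stab[of r' "4 * r'"] entry4 4 by simp_all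
    then show ?thesis using 4 entry4 by simp
  next
    case entry5
    then show ?thesis using entry_5D[OF K'] ij by simp
  next
    case entry6
    then show ?thesis using entry_6D[OF K'] ij by simp
  qed
  then show ?thesis using ij by simp
qed

end

section \<open>Relative closure of permutation groups\<close>

lemma mult_BijGroup: "f \<in> Bij S \<Longrightarrow> g \<in> Bij S \<Longrightarrow> f \<otimes>\<^bsub>BijGroup S\<^esub> g = compose S f g"
  by (simp add: BijGroup_def)

lemma mult_BijGroup_apply:
  "f \<in> Bij S \<Longrightarrow> g \<in> Bij S \<Longrightarrow> x \<in> S \<Longrightarrow> (f \<otimes>\<^bsub>BijGroup S\<^esub> g) x = f (g x)"
  by (simp add: mult_BijGroup compose_def)

lemma one_BijGroup_apply: "x \<in> S \<Longrightarrow> \<one>\<^bsub>BijGroup S\<^esub> x = x"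
  by (simp add: BijGroup_def)

lemma carrier_BijGroup: "carrier (BijGroup S) = Bij S"
  by (simp add: BijGroup_def)

lemma Bij_apply_closed: "f \<in> Bij S \<Longrightarrow> x \<in> S \<Longrightarrow> f x \<in> S"
  using Bij_imp_funcset by blast

lemma inv_BijGroup_apply:
  assumes "f \<in> Bij S" "x \<in> S"
  shows "f ((inv\<^bsub>BijGroup S\<^esub> f) x) = x" "(inv\<^bsub>BijGroup S\<^esub> f) (f x) = x" "inv\<^bsub>BijGroup S\<^esub> f \<in> Bij S"
proof -
  interpret group "BijGroup S" by (rule group_BijGroup)
  have f: "f \<in> carrier (BijGroup S)" using assms by (simp add: carrier_BijGroup)
  show i: "inv\<^bsub>BijGroup S\<^esub> f \<in> Bij S" using inv_closed[OF f] by (simp add: carrier_BijGroup)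
  show "f ((inv\<^bsub>BijGroup S\<^esub> f) x) = x"
    using r_inv[OF f] mult_BijGroup_apply[OF assms(1) i assms(2)] one_BijGroup_apply[OF assms(2)] by simp
  show "(inv\<^bsub>BijGroup S\<^esub> f) (f x) = x"
    using l_inv[OF f] mult_BijGroup_apply[OF i assms] one_BijGroup_apply[OF assms(2)] by simp
qed

lemma subgroup_perm_group_iff:
  assumes "subgroup G (BijGroup S)"
  shows "subgroup K (perm_group S G) \<longleftrightarrow> subgroup K (BijGroup S) \<and> K \<subseteq> G"
proof
  assume "subgroup K (perm_group S G)"
  then show "subgroup K (BijGroup S) \<and> K \<subseteq> G"
    using group.incl_subgroup[OF group_BijGroup assms] subgroup.subset by fastforce
next
  assume "subgroup K (BijGroup S) \<and> K \<subseteq> G"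
  then show "subgroup K (perm_group S G)"
    using group.subgroup_incl[OF group_BijGroup _ assms] by blast
qed

definition pt_orbit :: "('a \<Rightarrow> 'a) set \<Rightarrow> 'a \<Rightarrow> 'a set" where
  "pt_orbit K x = (\<lambda>k. k x) ` K"

lemma orbits_on_eq: "orbits_on S K = pt_orbit K ` S"
  by (auto simp: orbits_on_def orbits_def orbit_def pt_orbit_def)

lemma pt_orbit_self: "subgroup K (BijGroup S) \<Longrightarrow> x \<in> S \<Longrightarrow> x \<in> pt_orbit K x"
  using subgroup.one_closed[of K "BijGroup S"] one_BijGroup_apply[of x S]
  by (metis pt_orbit_def image_eqI)

lemma subgroup_Bij: "subgroup K (BijGroup S) \<Longrightarrow> k \<in> K \<Longrightarrow> k \<in> Bij S"
  using subgroup.subset carrier_BijGroup by blast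

lemma pt_orbit_subset: "subgroup K (BijGroup S) \<Longrightarrow> x \<in> S \<Longrightarrow> y \<in> pt_orbit K x \<Longrightarrow> pt_orbit K y \<subseteq> pt_orbit K x"
proof
  fix z assume a: "subgroup K (BijGroup S)" "x \<in> S" "y \<in> pt_orbit K x" "z \<in> pt_orbit K y"
  obtain k l where kl: "k \<in> K" "y = k x" "l \<in> K" "z = l y" using a by (auto simp: pt_orbit_def)
  have "l \<otimes>\<^bsub>BijGroup S\<^esub> k \<in> K" by (rule subgroup.m_closed[OF a(1) kl(3,1)])
  moreover have "(l \<otimes>\<^bsub>BijGroup S\<^esub> k) x = z"
    using mult_BijGroup_apply[OF subgroup_Bij[OF a(1) kl(3)] subgroup_Bij[OF a(1) kl(1)] a(2)] kl by simp
  ultimately show "z \<in> pt_orbit K x" by (auto simp: pt_orbit_def)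
qed

lemma pt_orbit_eq:
  assumes K: "subgroup K (BijGroup S)" and x: "x \<in> S" and y: "y \<in> pt_orbit K x"
  shows "pt_orbit K y = pt_orbit K x"
proof
  show "pt_orbit K y \<subseteq> pt_orbit K x" by (rule pt_orbit_subset[OF assms])
  obtain k where k: "k \<in> K" "y = k x" using y by (auto simp: pt_orbit_def)
  have kB: "k \<in> Bij S" by (rule subgroup_Bij[OF K k(1)])
  have "y \<in> S" using Bij_apply_closed[OF kB x] k by simp
  moreover have "x \<in> pt_orbit K y"
    unfolding pt_orbit_def
    by (rule image_eqI[of _ _ "inv\<^bsub>BijGroup S\<^esub> k"])
       (use inv_BijGroup_apply(2)[OF kB x] subgroup.m_inv_closed[OF K k(1)] k(2) in simp_all)
  ultimately show "pt_orbit K x \<subseteq> pt_orbit K y" using pt_orbit_subset[OF K] by blast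
qed

lemma orbits_on_eq_iff:
  assumes "subgroup K (BijGroup S)" "subgroup L (BijGroup S)"
  shows "orbits_on S K = orbits_on S L \<longleftrightarrow> (\<forall>x\<in>S. pt_orbit K x = pt_orbit L x)"
proof
  assume eq: "orbits_on S K = orbits_on S L"
  show "\<forall>x\<in>S. pt_orbit K x = pt_orbit L x"
  proof
    fix x assume x: "x \<in> S"
    have "pt_orbit K x \<in> orbits_on S K" using x by (simp add: orbits_on_eq)
    then have "pt_orbit K x \<in> orbits_on S L" unfolding eq .
    then obtain y where y: "y \<in> S" "pt_orbit K x = pt_orbit L y" by (auto simp: orbits_on_eq)
    have "x \<in> pt_orbit L y" using pt_orbit_self[OF assms(1) x] y(2) by simp
    then show "pt_orbit K x = pt_orbit L x" using pt_orbit_eq[OF assms(2) y(1)] y(2) by simp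
  qed
next
  assume "\<forall>x\<in>S. pt_orbit K x = pt_orbit L x"
  then show "orbits_on S K = orbits_on S L" unfolding orbits_on_eq by (intro image_cong) auto
qed

text \<open>The elements mapping each point into its own \<open>K\<close>-orbit form a subgroup with
  the orbits of \<open>K\<close>, and a subgroup with these orbits consists of such elements. So the
  greatest element exists and is this set.\<close>

lemma relative_closure_eq:
  assumes G: "subgroup G (BijGroup S)" and K: "subgroup K (BijGroup S)" "K \<subseteq> G"
  shows "relative_closure S G K = {g \<in> G. \<forall>x\<in>S. g x \<in> pt_orbit K x}" (is "_ = ?C")
proof -
  interpret B: group "BijGroup S" by (rule group_BijGroup)
  have GB: "g \<in> Bij S" if "g \<in> G" for g by (rule subgroup_Bij[OF G that])
  have C: "subgroup ?C (BijGroup S)"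
  proof (rule B.subgroupI)
    show "?C \<subseteq> carrier (BijGroup S)" using GB by (auto simp: carrier_BijGroup)
    have "\<one>\<^bsub>BijGroup S\<^esub> \<in> ?C"
      using subgroup.one_closed[OF G] pt_orbit_self[OF K(1)] by (simp add: one_BijGroup_apply)
    then show "?C \<noteq> {}" by blast
    fix g assume g: "g \<in> ?C"
    then have gG: "g \<in> G" and gx: "\<And>x. x \<in> S \<Longrightarrow> g x \<in> pt_orbit K x" by auto
    {
      have "(inv\<^bsub>BijGroup S\<^esub> g) x \<in> pt_orbit K x" if x: "x \<in> S" for x
      proof -
        define y where "y = (inv\<^bsub>BijGroup S\<^esub> g) x"
        have y: "y \<in> S" "g y = x"
          using inv_BijGroup_apply(1,3)[OF GB[OF gG] x] Bij_apply_closed x by (auto simp: y_def)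
        then have "x \<in> pt_orbit K y" using gx[OF y(1)] by simp
        then have "pt_orbit K x = pt_orbit K y" by (rule pt_orbit_eq[OF K(1) y(1)])
        then show ?thesis using pt_orbit_self[OF K(1) y(1)] by (simp add: y_def)
      qed
      then show "inv\<^bsub>BijGroup S\<^esub> g \<in> ?C" using subgroup.m_inv_closed[OF G gG] by simp
    next
      fix h assume h: "h \<in> ?C"
      then have hG: "h \<in> G" and hx: "\<And>x. x \<in> S \<Longrightarrow> h x \<in> pt_orbit K x" by auto
      have "(g \<otimes>\<^bsub>BijGroup S\<^esub> h) x \<in> pt_orbit K x" if x: "x \<in> S" for x
      proof -
        have hS: "h x \<in> S" by (rule Bij_apply_closed[OF GB[OF hG] x])
        have "g (h x) \<in> pt_orbit K (h x)" by (rule gx[OF hS])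
        also have "pt_orbit K (h x) = pt_orbit K x" by (rule pt_orbit_eq[OF K(1) x hx[OF x]])
        finally show ?thesis by (simp add: mult_BijGroup_apply[OF GB[OF gG] GB[OF hG] x])
      qed
      then show "g \<otimes>\<^bsub>BijGroup S\<^esub> h \<in> ?C" using subgroup.m_closed[OF G gG hG] by simp
    }
  qed
  have orb: "pt_orbit ?C x = pt_orbit K x" if x: "x \<in> S" for x
  proof
    show "pt_orbit ?C x \<subseteq> pt_orbit K x" using x by (auto simp: pt_orbit_def[of "{g \<in> G. _ g}"])
    have "K \<subseteq> ?C" using K(2) by (auto simp: pt_orbit_def)
    then show "pt_orbit K x \<subseteq> pt_orbit ?C x" by (auto simp: pt_orbit_def)
  qed
  show ?thesis
    unfolding relative_closure_def
  proof (rule Greatest_equality)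
    show "subgroup ?C (perm_group S G) \<and> orbits_on S ?C = orbits_on S K"
      using C orb by (auto simp: subgroup_perm_group_iff[OF G] orbits_on_eq_iff[OF C K(1)])
    fix L assume L: "subgroup L (perm_group S G) \<and> orbits_on S L = orbits_on S K"
    then have L': "subgroup L (BijGroup S)" "L \<subseteq> G" by (auto simp: subgroup_perm_group_iff[OF G])
    then have "\<forall>x\<in>S. pt_orbit L x = pt_orbit K x" using L orbits_on_eq_iff[OF L'(1) K(1)] by blast
    then show "L \<subseteq> ?C" using L'(2) by (fastforce simp: pt_orbit_def)
  qed
qed

lemma relatively_closed_iff:
  assumes "subgroup G (BijGroup S)"
  shows "relatively_closed S G K \<longleftrightarrow> subgroup K (BijGroup S) \<and> K \<subseteq> G \<and>
    (\<forall>g\<in>G. (\<forall>x\<in>S. \<exists>k\<in>K. g x = k x) \<longrightarrow> g \<in> K)"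
proof -
  have "relative_closure S G K = K \<longleftrightarrow> (\<forall>g\<in>G. (\<forall>x\<in>S. \<exists>k\<in>K. g x = k x) \<longrightarrow> g \<in> K)"
    if K: "subgroup K (BijGroup S)" "K \<subseteq> G"
  proof -
    have "g x \<in> pt_orbit K x \<longleftrightarrow> (\<exists>k\<in>K. g x = k x)" for g x by (auto simp: pt_orbit_def)
    then have "relative_closure S G K = {g \<in> G. \<forall>x\<in>S. \<exists>k\<in>K. g x = k x}"
      by (simp only: relative_closure_eq[OF assms K])
    moreover have "K \<subseteq> {g \<in> G. \<forall>x\<in>S. \<exists>k\<in>K. g x = k x}" using K(2) by blast
    ultimately show ?thesis by auto
  qed
  then show ?thesis by (auto simp: relatively_closed_def subgroup_perm_group_iff[OF assms])
qed

section \<open>Affine coordinates\<close>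

text \<open>Here \<open>e\<close> stands for the map from \<open>x\<close> to the image of the base
  point under the \<open>x\<close>-th power of \<open>w\<close>; the assumptions identify the
  integers modulo \<open>n\<close> with the points.\<close>

locale affine_action = affine_group n \<alpha> for n \<alpha> :: int +
  fixes \<Omega> :: "'a set" and e :: "int \<Rightarrow> 'a"
  assumes e_eq: "e x = e y \<longleftrightarrow> n dvd x - y" and e_range: "range e = \<Omega>"
begin

text \<open>Any coordinate of the point may be chosen, since all of them are congruent modulo
  \<open>n\<close>. The restriction to \<open>\<Omega>\<close> is needed because elements of
  \<open>BijGroup\<close> are extensional.\<close>

definition aff :: "int \<Rightarrow> int \<Rightarrow> 'a \<Rightarrow> 'a" where
  "aff c b = (\<lambda>p\<in>\<Omega>. e (c * (SOME x. e x = p) + b))"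

definition affmap :: "(int \<times> int) set \<Rightarrow> ('a \<Rightarrow> 'a) set" where
  "affmap S = {aff c b | c b. (c, b) \<in> S}"

lemma e_in [simp]: "e x \<in> \<Omega>"
  using e_range by blast

lemma e_ex: "p \<in> \<Omega> \<Longrightarrow> \<exists>x. p = e x"
  using e_range by blast

lemma aff_apply [simp]: "aff c b (e x) = e (c * x + b)"
proof -
  have "e (SOME y. e y = e x) = e x" by (rule someI[of "\<lambda>y. e y = e x" x]) simp
  then have "n dvd (SOME y. e y = e x) - x" by (simp add: e_eq)
  then have "n dvd c * (SOME y. e y = e x) + b - (c * x + b)"
    by (rule dvd_lin1[where p = c]) (simp add: algebra_simps)
  then show ?thesis by (simp add: aff_def e_eq)
qed

lemma aff_ext: "aff c b \<in> extensional \<Omega>"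
  by (simp add: aff_def)

lemma aff_eqI:
  assumes "f \<in> extensional \<Omega>" "\<And>x. f (e x) = e (c * x + b)"
  shows "f = aff c b"
proof (rule extensionalityI[OF assms(1) aff_ext])
  fix p assume "p \<in> \<Omega>"
  then obtain x where "p = e x" using e_ex by blast
  then show "f p = aff c b p" using assms(2) by simp
qed

lemma aff_eq_iff: "aff c b = aff c' b' \<longleftrightarrow> n dvd c' - c \<and> n dvd b' - b"
proof
  assume eq: "aff c b = aff c' b'"
  have "e (c * 0 + b) = e (c' * 0 + b')" "e (c * 1 + b) = e (c' * 1 + b')"
    using eq aff_apply by metis+
  then have 1: "n dvd b - b'" "n dvd c + b - (c' + b')" by (simp_all add: e_eq)
  have "n dvd c' - c" by (rule dvd_lin2[OF 1, where p = 1 and q = "-1"]) simp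
  moreover have "n dvd b' - b" using 1(1) by (simp add: dvd_diff_commute)
  ultimately show "n dvd c' - c \<and> n dvd b' - b" by blast
next
  assume a: "n dvd c' - c \<and> n dvd b' - b"
  show "aff c b = aff c' b'"
  proof (rule aff_eqI[OF aff_ext])
    fix x
    have "n dvd c * x + b - (c' * x + b')"
      by (rule dvd_lin2[OF conjunct1[OF a] conjunct2[OF a], where p = "- x" and q = "-1"])
         (simp add: algebra_simps)
    then show "aff c b (e x) = e (c' * x + b')" by (simp add: e_eq)
  qed
qed

lemma aff_Bij:
  assumes "coprime c n"
  shows "aff c b \<in> Bij \<Omega>"
proof -
  obtain c' where c': "n dvd c * c' - 1" using ex_inverse[OF assms] by blast
  have "bij_betw (aff c b) \<Omega> \<Omega>"
  proof (rule bij_betw_imageI)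
    show "inj_on (aff c b) \<Omega>"
    proof (rule inj_onI)
      fix p q assume pq: "p \<in> \<Omega>" "q \<in> \<Omega>" "aff c b p = aff c b q"
      obtain x y where xy: "p = e x" "q = e y" using pq e_ex by blast
      then have "n dvd c * (x - y)" using pq(3) by (simp add: e_eq algebra_simps)
      then have "n dvd x - y" using assms by (simp add: coprime_dvd_mult_right_iff coprime_commute)
      then show "p = q" using xy by (simp add: e_eq)
    qed
    show "aff c b ` \<Omega> = \<Omega>"
    proof
      show "aff c b ` \<Omega> \<subseteq> \<Omega>" using e_ex by fastforce
      show "\<Omega> \<subseteq> aff c b ` \<Omega>"
      proof
        fix p assume "p \<in> \<Omega>"
        then obtain x where x: "p = e x" using e_ex by blast
        have "n dvd x - (c * (c' * (x - b)) + b)"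
          by (rule dvd_lin1[OF c', where p = "- (x - b)"]) (simp add: algebra_simps)
        then have "p = aff c b (e (c' * (x - b)))" by (simp add: x e_eq)
        then show "p \<in> aff c b ` \<Omega>" by (rule image_eqI) simp
      qed
    qed
  qed
  then show ?thesis by (simp add: Bij_def aff_ext)
qed

lemma aff_carrier: "coprime c n \<Longrightarrow> aff c b \<in> carrier (BijGroup \<Omega>)"
  by (simp add: carrier_BijGroup aff_Bij)

lemma Bij_ext: "f \<in> Bij \<Omega> \<Longrightarrow> f \<in> extensional \<Omega>"
  by (simp add: Bij_def)

lemma aff_mult:
  assumes "coprime c n" "coprime c' n"
  shows "aff c b \<otimes>\<^bsub>BijGroup \<Omega>\<^esub> aff c' b' = aff (c * c') (c * b' + b)"
proof (rule aff_eqI)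
  have "aff c b \<otimes>\<^bsub>BijGroup \<Omega>\<^esub> aff c' b' \<in> carrier (BijGroup \<Omega>)"
    by (intro monoid.m_closed[OF group.is_monoid[OF group_BijGroup]] aff_carrier assms)
  then show "aff c b \<otimes>\<^bsub>BijGroup \<Omega>\<^esub> aff c' b' \<in> extensional \<Omega>"
    by (simp add: carrier_BijGroup Bij_ext)
  show "(aff c b \<otimes>\<^bsub>BijGroup \<Omega>\<^esub> aff c' b') (e x) = e (c * c' * x + (c * b' + b))" for x
    by (subst mult_BijGroup_apply) (use assms in \<open>simp_all add: aff_Bij algebra_simps\<close>)
qed

lemma one_eq_aff: "\<one>\<^bsub>BijGroup \<Omega>\<^esub> = aff 1 0"
  by (rule aff_eqI) (simp_all add: BijGroup_def)

lemma aff_in_affmap: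
  assumes "affsub S"
  shows "aff c b \<in> affmap S \<longleftrightarrow> (c, b) \<in> S"
proof
  assume "aff c b \<in> affmap S"
  then obtain c' b' where "(c', b') \<in> S" "aff c' b' = aff c b" by (auto simp: affmap_def)
  then show "(c, b) \<in> S" using affsub_cong[OF assms] by (simp add: aff_eq_iff)
qed (auto simp: affmap_def)

lemma affmap_mono_iff: "affsub S \<Longrightarrow> affsub T \<Longrightarrow> affmap S \<subseteq> affmap T \<longleftrightarrow> S \<subseteq> T"
proof
  assume a: "affsub S" "affsub T" "affmap S \<subseteq> affmap T"
  show "S \<subseteq> T"
  proof clarify
    fix c b assume "(c, b) \<in> S"
    then have "aff c b \<in> affmap T" using a(3) aff_in_affmap[OF a(1)] by blast
    then show "(c, b) \<in> T" by (simp only: aff_in_affmap[OF a(2)])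
  qed
qed (auto simp: affmap_def)

lemma affmap_eq_iff: "affsub S \<Longrightarrow> affsub T \<Longrightarrow> affmap S = affmap T \<longleftrightarrow> S = T"
  using affmap_mono_iff[of S T] affmap_mono_iff[of T S] by blast

lemma affmap_psubset_iff: "affsub S \<Longrightarrow> affsub T \<Longrightarrow> affmap S \<subset> affmap T \<longleftrightarrow> S \<subset> T"
  using affmap_mono_iff[of S T] affmap_eq_iff[of S T] by blast

lemma subgroup_affmap:
  assumes S: "affsub S"
  shows "subgroup (affmap S) (BijGroup \<Omega>)"
proof (rule group.subgroupI[OF group_BijGroup])
  show "affmap S \<subseteq> carrier (BijGroup \<Omega>)" using affsub_coprime[OF S] by (auto simp: affmap_def aff_carrier)
  show "affmap S \<noteq> {}" using affsub_one[OF S] by (auto simp: affmap_def)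
  fix f assume "f \<in> affmap S"
  then obtain c b where f: "f = aff c b" "(c, b) \<in> S" by (auto simp: affmap_def)
  note cop_c = affsub_coprime[OF S f(2)]
  {
    obtain c' b' where i: "(c', b') \<in> S" "n dvd c * c' - 1" "n dvd c * b' + b"
      using affsub_inv[OF S f(2)] by metis
    note cop_c' = affsub_coprime[OF S i(1)]
    have "aff c b \<otimes>\<^bsub>BijGroup \<Omega>\<^esub> aff c' b' = \<one>\<^bsub>BijGroup \<Omega>\<^esub>"
      unfolding aff_mult[OF cop_c cop_c'] one_eq_aff aff_eq_iff
      using i(2) dvd_diff[OF dvd_0_right i(3)] by (simp only: dvd_diff_commute)
    then have "aff c' b' \<otimes>\<^bsub>BijGroup \<Omega>\<^esub> aff c b = \<one>\<^bsub>BijGroup \<Omega>\<^esub>"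
      by (rule group.inv_comm[OF group_BijGroup _ aff_carrier[OF cop_c] aff_carrier[OF cop_c']])
    then have "inv\<^bsub>BijGroup \<Omega>\<^esub> f = aff c' b'"
      unfolding f(1) by (rule group.inv_equality[OF group_BijGroup _ aff_carrier[OF cop_c] aff_carrier[OF cop_c']])
    then show "inv\<^bsub>BijGroup \<Omega>\<^esub> f \<in> affmap S" using i(1) by (auto simp: affmap_def)
  next
    fix g assume "g \<in> affmap S"
    then obtain c' b' where g: "g = aff c' b'" "(c', b') \<in> S" by (auto simp: affmap_def)
    show "f \<otimes>\<^bsub>BijGroup \<Omega>\<^esub> g \<in> affmap S"
      using affsub_mult[OF S f(2) g(2)]
      by (auto simp: f g aff_mult[OF cop_c affsub_coprime[OF S g(2)]] affmap_def)
  }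
qed

definition affpre :: "('a \<Rightarrow> 'a) set \<Rightarrow> (int \<times> int) set" where
  "affpre H = {(c, b). c \<in> mults \<and> aff c b \<in> H}"

lemma mults_cop: "c \<in> mults \<Longrightarrow> coprime c n"
  by (rule mults_coprime[OF _ dvd_refl])

lemma affsub_affpre:
  assumes H: "subgroup H (BijGroup \<Omega>)"
  shows "affsub (affpre H)"
proof (rule affsubI)
  show "(1, 0) \<in> affpre H" using subgroup.one_closed[OF H] by (simp add: affpre_def one_eq_aff)
  show "c \<in> mults" if "(c, b) \<in> affpre H" for c b using that by (simp add: affpre_def)
  fix c b c' b' assume 1: "(c, b) \<in> affpre H"
  {
    assume 2: "(c', b') \<in> affpre H"
    have "aff c b \<otimes>\<^bsub>BijGroup \<Omega>\<^esub> aff c' b' \<in> H"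
      using subgroup.m_closed[OF H] 1 2 by (simp add: affpre_def)
    then show "(c * c', c * b' + b) \<in> affpre H"
      using 1 2 by (simp add: affpre_def aff_mult mults_cop mults_mult)
  next
    assume d: "n dvd c' - c" "n dvd b' - b"
    then have "aff c b = aff c' b'" by (simp add: aff_eq_iff)
    then show "(c', b') \<in> affpre H" using 1 mults_cong[OF _ d(1)] by (simp add: affpre_def)
  }
qed

lemma affmap_affpre:
  assumes "H \<subseteq> affmap full"
  shows "affmap (affpre H) = H"
proof
  show "affmap (affpre H) \<subseteq> H" by (auto simp: affmap_def affpre_def)
  show "H \<subseteq> affmap (affpre H)"
  proof
    fix f assume f: "f \<in> H"
    then obtain c b where "f = aff c b" "c \<in> mults" using assms by (auto simp: affmap_def full_def)
    then show "f \<in> affmap (affpre H)" using f by (auto simp: affmap_def affpre_def)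
  qed
qed

lemma relatively_closed_affmap:
  assumes S: "affsub S"
  shows "relatively_closed \<Omega> (affmap full) (affmap S) \<longleftrightarrow> affclosed S"
proof -
  note GB = subgroup_affmap[OF affsub_full_self]
  have sub: "affmap S \<subseteq> affmap full" using affsub_full[OF S] by (auto simp: affmap_def)
  have pt: "(\<forall>p\<in>\<Omega>. \<exists>k\<in>affmap S. aff c b p = k p) \<longleftrightarrow>
      (\<forall>x. \<exists>c' b'. (c', b') \<in> S \<and> n dvd c * x + b - (c' * x + b'))" for c b
  proof -
    have "(\<forall>p\<in>\<Omega>. \<exists>k\<in>affmap S. aff c b p = k p) \<longleftrightarrow> (\<forall>x. \<exists>k\<in>affmap S. aff c b (e x) = k (e x))"
      using e_ex by (metis e_in)
    also have "\<dots> \<longleftrightarrow> (\<forall>x. \<exists>c' b'. (c', b') \<in> S \<and> aff c b (e x) = aff c' b' (e x))"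
      unfolding affmap_def by blast
    finally show ?thesis by (simp add: e_eq)
  qed
  have "(\<forall>g\<in>affmap full. (\<forall>p\<in>\<Omega>. \<exists>k\<in>affmap S. g p = k p) \<longrightarrow> g \<in> affmap S) \<longleftrightarrow>
    (\<forall>c b. c \<in> mults \<longrightarrow> (\<forall>p\<in>\<Omega>. \<exists>k\<in>affmap S. aff c b p = k p) \<longrightarrow> aff c b \<in> affmap S)"
  proof -
    have full_eq: "affmap full = {aff c b | c b. c \<in> mults}" by (simp add: affmap_def full_def)
    show ?thesis unfolding full_eq by blast
  qed
  also have "\<dots> \<longleftrightarrow> affclosed S"
    unfolding pt aff_in_affmap[OF S] affclosed_def using S by simp
  finally show ?thesis
    unfolding relatively_closed_iff[OF GB] using subgroup_affmap[OF S] sub by simp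
qed

lemma relatively_closed_imp_affmap:
  assumes "relatively_closed \<Omega> (affmap full) H"
  obtains S where "affclosed S" "H = affmap S"
proof -
  have H: "subgroup H (BijGroup \<Omega>)" "H \<subseteq> affmap full"
    using assms by (auto simp: relatively_closed_iff[OF subgroup_affmap[OF affsub_full_self]])
  have eq: "H = affmap (affpre H)" by (rule affmap_affpre[OF H(2), symmetric])
  then have "affclosed (affpre H)"
    using assms relatively_closed_affmap[OF affsub_affpre[OF H(1)]] by simp
  then show ?thesis using that eq by blast
qed

lemma maximal_relatively_closed_affmap:
  assumes M: "affsub M" and S: "affsub S"
  shows "maximal_relatively_closed_in \<Omega> (affmap full) (affmap M) (affmap S) \<longleftrightarrow> maximal_closed M S"
proof
  assume a: "maximal_relatively_closed_in \<Omega> (affmap full) (affmap M) (affmap S)"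
  show "maximal_closed M S"
    unfolding maximal_closed_def
  proof (intro conjI allI impI)
    show "affclosed S" "S \<subset> M"
      using a by (simp_all add: maximal_relatively_closed_in_def relatively_closed_affmap[OF S] affmap_psubset_iff[OF S M])
    fix L assume L: "affclosed L \<and> L \<subset> M \<and> S \<subseteq> L"
    then have sub: "affsub L" using affclosed_sub by blast
    have "affmap L = affmap S"
      using a L by (simp add: maximal_relatively_closed_in_def relatively_closed_affmap[OF sub]
          affmap_psubset_iff[OF sub M] affmap_mono_iff[OF S sub])
    then show "L = S" by (simp add: affmap_eq_iff[OF sub S])
  qed
next
  assume a: "maximal_closed M S"
  show "maximal_relatively_closed_in \<Omega> (affmap full) (affmap M) (affmap S)"
    unfolding maximal_relatively_closed_in_def
  proof (intro conjI allI impI)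
    show "relatively_closed \<Omega> (affmap full) (affmap S)" "affmap S \<subset> affmap M"
      using a by (simp_all add: maximal_closed_def relatively_closed_affmap[OF S] affmap_psubset_iff[OF S M])
    fix L assume L: "relatively_closed \<Omega> (affmap full) L \<and> L \<subset> affmap M \<and> affmap S \<subseteq> L"
    then obtain T where T: "affclosed T" "L = affmap T" using relatively_closed_imp_affmap by blast
    note sub = affclosed_sub[OF T(1)]
    have "T = S"
      using a L T by (simp add: maximal_closed_def affmap_psubset_iff[OF sub M] affmap_mono_iff[OF S sub])
    then show "L = affmap S" using T by simp
  qed
qed

lemma second_maximal_affmap:
  assumes S: "affsub S"
  shows "second_maximal_relatively_closed \<Omega> (affmap full) (affmap S) \<longleftrightarrow> second_maximal S"
proof
  assume "second_maximal_relatively_closed \<Omega> (affmap full) (affmap S)"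
  then obtain N where N: "maximal_relatively_closed_in \<Omega> (affmap full) (affmap full) N"
    "maximal_relatively_closed_in \<Omega> (affmap full) N (affmap S)"
    by (auto simp: second_maximal_relatively_closed_def)
  then obtain M where M: "affclosed M" "N = affmap M"
    using relatively_closed_imp_affmap by (auto simp: maximal_relatively_closed_in_def)
  then show "second_maximal S"
    using N maximal_relatively_closed_affmap[OF affsub_full_self affclosed_sub[OF M(1)]]
      maximal_relatively_closed_affmap[OF affclosed_sub[OF M(1)] S]
    unfolding second_maximal_def by auto
next
  assume "second_maximal S"
  then obtain M where M: "maximal_closed full M" "maximal_closed M S" by (auto simp: second_maximal_def)
  then have "affsub M" using affclosed_sub by (simp add: maximal_closed_def)
  then show "second_maximal_relatively_closed \<Omega> (affmap full) (affmap S)"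
    unfolding second_maximal_relatively_closed_def
    using M maximal_relatively_closed_affmap[OF affsub_full_self] maximal_relatively_closed_affmap[OF _ S] by blast
qed

lemma second_maximal_imp_affmap:
  assumes "second_maximal_relatively_closed \<Omega> (affmap full) H"
  obtains S where "affsub S" "second_maximal S" "H = affmap S"
proof -
  have "relatively_closed \<Omega> (affmap full) H"
    using assms by (auto simp: second_maximal_relatively_closed_def maximal_relatively_closed_in_def)
  then obtain S where S: "affclosed S" "H = affmap S" by (rule relatively_closed_imp_affmap)
  then show ?thesis using that second_maximal_affmap[OF affclosed_sub[OF S(1)]] assms affclosed_sub by blast
qed

lemma aff_conjugate:
  assumes v: "coprime v n" and c: "coprime c n"
  shows "aff v z \<otimes>\<^bsub>BijGroup \<Omega>\<^esub> aff c b \<otimes>\<^bsub>BijGroup \<Omega>\<^esub> inv\<^bsub>BijGroup \<Omega>\<^esub> aff v z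
    = aff c (v * b + z - c * z)"
proof -
  interpret B: group "BijGroup \<Omega>" by (rule group_BijGroup)
  have "aff v z \<otimes>\<^bsub>BijGroup \<Omega>\<^esub> aff c b = aff c (v * b + z - c * z) \<otimes>\<^bsub>BijGroup \<Omega>\<^esub> aff v z"
    by (simp add: aff_mult v c mult.commute)
  then show ?thesis
    using B.inv_solve_right'[of "aff c (v * b + z - c * z)" "aff v z \<otimes>\<^bsub>BijGroup \<Omega>\<^esub> aff c b" "aff v z"]
      aff_carrier v c B.m_closed by simp
qed

lemma conj_affmap:
  assumes v: "coprime v n" and S: "affsub S"
  shows "(\<lambda>x. aff v z \<otimes>\<^bsub>BijGroup \<Omega>\<^esub> x \<otimes>\<^bsub>BijGroup \<Omega>\<^esub> inv\<^bsub>BijGroup \<Omega>\<^esub> aff v z) ` affmap S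
    = affmap (aff_conj v z S)"
proof -
  have "(\<lambda>x. aff v z \<otimes>\<^bsub>BijGroup \<Omega>\<^esub> x \<otimes>\<^bsub>BijGroup \<Omega>\<^esub> inv\<^bsub>BijGroup \<Omega>\<^esub> aff v z) ` affmap S
    = {aff c (v * b + z - c * z) | c b. (c, b) \<in> S}"
    (is "?f ` _ = ?B")
  proof
    have eq: "?f (aff c b) = aff c (v * b + z - c * z)" if "(c, b) \<in> S" for c b
      by (rule aff_conjugate[OF v affsub_coprime[OF S that]])
    show "?f ` affmap S \<subseteq> ?B"
    proof (rule image_subsetI)
      fix f assume "f \<in> affmap S"
      then obtain c b where cb: "f = aff c b" "(c, b) \<in> S" by (auto simp: affmap_def)
      show "?f f \<in> ?B" unfolding cb(1) eq[OF cb(2)] using cb(2) by blast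
    qed
    show "?B \<subseteq> ?f ` affmap S"
    proof
      fix g assume "g \<in> ?B"
      then obtain c b where cb: "g = aff c (v * b + z - c * z)" "(c, b) \<in> S" by blast
      have "aff c b \<in> affmap S" using cb(2) by (auto simp: affmap_def)
      then show "g \<in> ?f ` affmap S" unfolding cb(1) eq[OF cb(2), symmetric] by (rule imageI)
    qed
  qed
  also have "\<dots> = affmap (aff_conj v z S)"
  proof
    show "{aff c (v * b + z - c * z) | c b. (c, b) \<in> S} \<subseteq> affmap (aff_conj v z S)"
      by (auto simp: affmap_def aff_conj_def) (metis diff_self dvd_0_right)
    show "affmap (aff_conj v z S) \<subseteq> {aff c (v * b + z - c * z) | c b. (c, b) \<in> S}"
    proof
      fix f assume "f \<in> affmap (aff_conj v z S)"
      then obtain c b b' where f: "f = aff c b" "(c, b') \<in> S" "n dvd b - (v * b' + z - c * z)"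
        by (auto simp: affmap_def aff_conj_def)
      have "f = aff c (v * b' + z - c * z)" unfolding f(1) aff_eq_iff
        using f(3) by (simp add: dvd_diff_commute)
      then show "f \<in> {aff c (v * b + z - c * z) | c b. (c, b) \<in> S}" using f(2) by blast
    qed
  qed
  finally show ?thesis .
qed

text \<open>The holomorph in coordinates; \<open>holomorph_eq\<close> identifies it with the
  abstract one.\<close>

definition Hol :: "('a \<Rightarrow> 'a) set" where
  "Hol = {aff v z | v z. coprime v n}"

lemma conjugate_by_Hol:
  assumes "affsub S"
  shows "conjugate_by \<Omega> Hol (affmap S) K \<longleftrightarrow> (\<exists>v z. coprime v n \<and> K = affmap (aff_conj v z S))"
proof -
  have "conjugate_by \<Omega> Hol (affmap S) K \<longleftrightarrow> (\<exists>v z. coprime v n \<and>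
      K = (\<lambda>x. aff v z \<otimes>\<^bsub>BijGroup \<Omega>\<^esub> x \<otimes>\<^bsub>BijGroup \<Omega>\<^esub> inv\<^bsub>BijGroup \<Omega>\<^esub> aff v z) ` affmap S)"
    unfolding conjugate_by_def Hol_def by blast
  also have "\<dots> \<longleftrightarrow> (\<exists>v z. coprime v n \<and> K = affmap (aff_conj v z S))"
    using conj_affmap[OF _ assms] by (intro ex_cong1 conj_cong refl) simp
  finally show ?thesis .
qed

end

lemma geo_alternating:
  fixes D c :: int
  assumes "D dvd c + 1"
  shows "even i \<Longrightarrow> D dvd geo c i" "odd i \<Longrightarrow> D dvd geo c i - 1"
proof -
  have "geo c 2 = 1 + c" by (simp add: geo_def numeral_2_eq_2)
  then have "D dvd geo c 2" using assms by (simp add: add.commute)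
  then have e: "D dvd geo c (2 * j)" for j by (simp add: geo_mult)
  then show "even i \<Longrightarrow> D dvd geo c i" by (auto elim!: evenE)
  have "D dvd c\<^sup>2 - 1"
    by (rule dvd_lin1[OF assms, where p = "c - 1"]) (simp add: algebra_simps power2_eq_square)
  then have p: "D dvd (c\<^sup>2) ^ j - 1" for j by (rule dvd_pow_minus_1)
  have "D dvd geo c (2 * j + 1) - 1" for j
    by (rule dvd_lin2[OF e[of j] p[of j], where p = 1 and q = 1]) (simp add: geo_Suc power_mult)
  then show "odd i \<Longrightarrow> D dvd geo c i - 1" by (auto elim!: oddE)
qed

context affine_group
begin

section \<open>Two-generator subgroups\<close>

text \<open>The subgroup generated by \<open>x \<mapsto> \<alpha>\<^sup>k x + b0\<close> and \<open>x \<mapsto> x + D\<close>.\<close>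

definition gen_sub :: "nat \<Rightarrow> int \<Rightarrow> int \<Rightarrow> (int \<times> int) set" where
  "gen_sub k b0 D = {(c, b). \<exists>i. n dvd c - \<alpha> ^ (k * i) \<and> D dvd b - b0 * geo (\<alpha> ^ k) i}"

lemma affsub_gen_sub:
  assumes D: "D dvd n"
  shows "affsub (gen_sub k b0 D)"
proof (rule affsubI)
  show "(1, 0) \<in> gen_sub k b0 D" by (auto simp: gen_sub_def intro!: exI[of _ 0])
  show "c \<in> mults" if "(c, b) \<in> gen_sub k b0 D" for c b
    using that by (auto simp: gen_sub_def mults_def)
  fix c b c' b' assume "(c, b) \<in> gen_sub k b0 D"
  then obtain i where i: "n dvd c - \<alpha> ^ (k * i)" "D dvd b - b0 * geo (\<alpha> ^ k) i" by (auto simp: gen_sub_def)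
  {
    assume "(c', b') \<in> gen_sub k b0 D"
    then obtain j where j: "n dvd c' - \<alpha> ^ (k * j)" "D dvd b' - b0 * geo (\<alpha> ^ k) j" by (auto simp: gen_sub_def)
    have "n dvd c * c' - \<alpha> ^ (k * (i + j))"
      by (rule dvd_lin2[OF i(1) j(1), where p = c' and q = "\<alpha> ^ (k * i)"])
         (simp add: power_add algebra_simps)
    moreover have "D dvd c * b' + b - b0 * geo (\<alpha> ^ k) (i + j)"
      by (rule dvd_lin3[OF i(2) j(2) dvd_trans[OF D i(1)], where p = 1 and q = c and r = "b0 * geo (\<alpha> ^ k) j"])
         (simp only: geo_add power_mult, simp add: algebra_simps)
    ultimately show "(c * c', c * b' + b) \<in> gen_sub k b0 D" by (auto simp: gen_sub_def)
  next
    assume d: "n dvd c' - c" "n dvd b' - b"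
    have "n dvd c' - \<alpha> ^ (k * i)" using dvd_add[OF d(1) i(1)] by simp
    moreover have "D dvd b' - b0 * geo (\<alpha> ^ k) i" using dvd_add[OF dvd_trans[OF D d(2)] i(2)] by simp
    ultimately show "(c', b') \<in> gen_sub k b0 D" by (auto simp: gen_sub_def)
  }
qed

lemma gen_sub_index_sub: "gen_sub s 0 r = index_sub s r"
  by (auto simp: gen_sub_def index_sub_def)

lemma gen_sub_point_stab: "gen_sub 1 0 D = point_stab D 0"
  by (auto simp: gen_sub_def point_stab_def mults_def)

text \<open>The multiplier is 1 modulo \<open>s\<close>, so its geometric sum of \<open>i\<close>
  terms is \<open>i\<close> modulo \<open>s\<close>.\<close>

lemma gen_sub_twisted_sub:
  assumes "0 < s"
  shows "gen_sub (ord s \<alpha>) r (s * r) = twisted_sub s r 1"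
proof -
  have "s * r dvd b - r * geo (\<alpha> ^ ord s \<alpha>) i \<longleftrightarrow> s * r dvd b - r * 1 * int i" for b i
  proof -
    have "s dvd \<alpha> ^ ord s \<alpha> - 1" by (simp add: dvd_power_minus_1_iff_ord[OF assms])
    then have "s dvd geo (\<alpha> ^ ord s \<alpha>) i - int i" by (rule geo_cong_1)
    then have "s * r dvd (geo (\<alpha> ^ ord s \<alpha>) i - int i) * r" by (rule mult_dvd_mono) simp
    moreover have "b - r * 1 * int i = (b - r * geo (\<alpha> ^ ord s \<alpha>) i) + (geo (\<alpha> ^ ord s \<alpha>) i - int i) * r"
      by (simp add: algebra_simps)
    ultimately show ?thesis by (simp only: dvd_add_left_iff)
  qed
  then show ?thesis by (simp add: gen_sub_def twisted_sub_def)
qed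

text \<open>The sums \<open>geo \<alpha> i\<close> alternate between 0 and 1 modulo
  \<open>D\<close>, so the parity of the exponent decides between the two alternatives of the pair
  stabilizer. That \<open>D\<close> does not divide 2 keeps the multipliers 1 and -1 apart. Applied
  with \<open>D = 4\<close>, \<open>u = r\<close> and with \<open>D = 8\<close>,
  \<open>u = 1\<close>.\<close>

lemma gen_sub_pair_stab:
  assumes D: "D dvd \<alpha> + 1" "\<not> D dvd 2" and u: "u \<noteq> 0" and Du: "D * u dvd n"
  shows "gen_sub 1 u (D * u) = pair_stab (D * u) 0 u"
proof -
  have Dn: "D dvd n" by (rule dvd_mult_left[OF Du])
  have "(c, b) \<in> gen_sub 1 u (D * u) \<longleftrightarrow> (c, b) \<in> pair_stab (D * u) 0 u" for c b
  proof
    assume "(c, b) \<in> gen_sub 1 u (D * u)"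
    then obtain i where i: "n dvd c - \<alpha> ^ i" "D * u dvd b - u * geo \<alpha> i" by (auto simp: gen_sub_def)
    have c: "D dvd c - \<alpha> ^ i" by (rule dvd_trans[OF Dn i(1)])
    have "D * u dvd b \<and> D * u dvd c * u - u \<or> D * u dvd b - u \<and> D * u dvd c * u + u"
    proof (cases "even i")
      case True
      have "D * u dvd geo \<alpha> i * u" using geo_alternating(1)[OF D(1) True] by (intro mult_dvd_mono) simp_all
      then have "D * u dvd b" using i(2) by (rule dvd_lin2[where p = 1 and q = 1]) (simp add: algebra_simps)
      moreover have "D dvd c - 1"
        by (rule dvd_lin2[OF c pow_alpha_mod(1)[OF D(1) True], where p = 1 and q = 1]) simp
      then have "D * u dvd (c - 1) * u" by (intro mult_dvd_mono) simp_all
      ultimately show ?thesis by (simp add: algebra_simps)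
    next
      case False
      have "D * u dvd (geo \<alpha> i - 1) * u" using geo_alternating(2)[OF D(1) False] by (intro mult_dvd_mono) simp_all
      then have "D * u dvd b - u" using i(2) by (rule dvd_lin2[where p = 1 and q = 1]) (simp add: algebra_simps)
      moreover have "D dvd c + 1"
        by (rule dvd_lin2[OF c pow_alpha_mod(2)[OF D(1) False], where p = 1 and q = 1]) simp
      then have "D * u dvd (c + 1) * u" by (intro mult_dvd_mono) simp_all
      ultimately show ?thesis by (simp add: algebra_simps)
    qed
    moreover have "c \<in> mults" using i(1) by (auto simp: mults_def)
    ultimately show "(c, b) \<in> pair_stab (D * u) 0 u" by (simp add: pair_stab_def)
  next
    assume a: "(c, b) \<in> pair_stab (D * u) 0 u"
    then obtain i where i: "n dvd c - \<alpha> ^ i" by (auto simp: pair_stab_def mults_def)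
    have c: "D dvd c - \<alpha> ^ i" by (rule dvd_trans[OF Dn i])
    from a consider (1) "D * u dvd b" "D * u dvd c * u - u" | (2) "D * u dvd b - u" "D * u dvd c * u + u"
      by (auto simp: pair_stab_def)
    then have "D * u dvd b - u * geo \<alpha> i"
    proof cases
      case 1
      have "D * u dvd (c - 1) * u" by (rule dvd_lin1[OF 1(2), where p = 1]) (simp add: algebra_simps)
      then have c1: "D dvd c - 1" using u by simp
      have ev: "even i"
      proof (rule ccontr)
        assume "odd i"
        then have "D dvd \<alpha> ^ i + 1" by (rule pow_alpha_mod(2)[OF D(1)])
        then have "D dvd 2" using c c1 by (rule dvd_lin3[where p = 1 and q = 1 and r = "-1"]) simp
        then show False using D(2) by simp
      qed
      have "D * u dvd geo \<alpha> i * u" using geo_alternating(1)[OF D(1) ev] by (intro mult_dvd_mono) simp_all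
      then show ?thesis using 1(1) by (rule dvd_lin2[where p = "-1" and q = 1]) (simp add: algebra_simps)
    next
      case 2
      have "D * u dvd (c + 1) * u" by (rule dvd_lin1[OF 2(2), where p = 1]) (simp add: algebra_simps)
      then have c1: "D dvd c + 1" using u by simp
      have od: "odd i"
      proof
        assume "even i"
        then have "D dvd \<alpha> ^ i - 1" by (rule pow_alpha_mod(1)[OF D(1)])
        then have "D dvd 2" using c c1 by (rule dvd_lin3[where p = "-1" and q = "-1" and r = 1]) simp
        then show False using D(2) by simp
      qed
      have "D * u dvd (geo \<alpha> i - 1) * u" using geo_alternating(2)[OF D(1) od] by (intro mult_dvd_mono) simp_all
      then show ?thesis using 2(1) by (rule dvd_lin2[where p = "-1" and q = 1]) (simp add: algebra_simps)
    qed
    then show "(c, b) \<in> gen_sub 1 u (D * u)" using i by (auto simp: gen_sub_def)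
  qed
  then show ?thesis by auto
qed

lemma gen_sub_ker4:
  assumes n4: "4 dvd n" and \<alpha>4: "4 dvd \<alpha> + 1"
  shows "gen_sub 2 0 4 = ker4"
proof -
  have "(c, b) \<in> gen_sub 2 0 4 \<longleftrightarrow> (c, b) \<in> ker4" for c b
  proof
    assume "(c, b) \<in> gen_sub 2 0 4"
    then obtain i where i: "n dvd c - \<alpha> ^ (2 * i)" "4 dvd b" by (auto simp: gen_sub_def)
    have "4 dvd \<alpha> ^ (2 * i) - 1" by (rule pow_alpha_mod(1)[OF \<alpha>4]) simp
    then have "4 dvd c - 1" using dvd_trans[OF n4 i(1)] by (rule dvd_lin2[where p = 1 and q = 1]) simp
    then show "(c, b) \<in> ker4" using i by (auto simp: ker4_def mults_def)
  next
    assume a: "(c, b) \<in> ker4"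
    then obtain i where i: "n dvd c - \<alpha> ^ i" by (auto simp: ker4_def mults_def)
    have "even i"
    proof (rule ccontr)
      assume "odd i"
      then have "4 dvd \<alpha> ^ i + 1" by (rule pow_alpha_mod(2)[OF \<alpha>4])
      moreover have "4 dvd c - \<alpha> ^ i" by (rule dvd_trans[OF n4 i])
      moreover have "4 dvd c - 1" using a by (simp add: ker4_def)
      ultimately show False by presburger
    qed
    then obtain j where "i = 2 * j" by (elim evenE)
    then show "(c, b) \<in> gen_sub 2 0 4" using a i by (auto simp: gen_sub_def ker4_def)
  qed
  then show ?thesis by auto
qed

text \<open>The \<open>i\<close>-th power of \<open>x \<mapsto> \<alpha>\<^sup>k x + b0\<close>.\<close>

definition iter :: "nat \<Rightarrow> int \<Rightarrow> nat \<Rightarrow> int \<Rightarrow> int" where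
  "iter k b0 i x = \<alpha> ^ (k * i) * x + b0 * geo (\<alpha> ^ k) i"

lemma iter_0 [simp]: "iter k b0 0 x = x"
  by (simp add: iter_def)

lemma iter_diff: "iter k b0 i y - iter k b0 i x = \<alpha> ^ (k * i) * (y - x)"
  by (simp add: iter_def algebra_simps)

lemma iter_add: "iter k b0 (i + j) x = iter k b0 i (iter k b0 j x)"
  unfolding iter_def by (simp only: geo_add power_add power_mult distrib_left, simp add: algebra_simps)

lemma iter_cong_iff:
  assumes D: "D dvd n" and per: "\<And>i. D dvd iter k b0 i x - x \<longleftrightarrow> l dvd i"
  shows "D dvd iter k b0 i x - iter k b0 j x \<longleftrightarrow> int l dvd int i - int j"
proof (induction i j rule: linorder_wlog)
  case (le i j)
  then obtain d where d: "j = i + d" using le_Suc_ex by blast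
  have "coprime D (\<alpha> ^ (k * i))" using mults_coprime[OF mults_pow D] by (simp only: coprime_commute)
  then have "D dvd iter k b0 j x - iter k b0 i x \<longleftrightarrow> D dvd iter k b0 d x - x"
    unfolding d iter_add iter_diff by (rule coprime_dvd_mult_right_iff)
  then have "D dvd iter k b0 i x - iter k b0 j x \<longleftrightarrow> l dvd d" unfolding per by (simp add: dvd_diff_commute)
  then show ?case by (simp add: d)
next
  case (sym i j)
  then show ?case by (simp add: dvd_diff_commute)
qed

lemma iter_mod:
  assumes "0 < l" "D dvd n" "\<And>i. D dvd iter k b0 i x - x \<longleftrightarrow> l dvd i"
  shows "D dvd iter k b0 i x - iter k b0 (i mod l) x"
proof -
  have "int l dvd int i - int (i mod l)"
    by (metis minus_mod_eq_mult_div of_nat_mod dvd_triv_left)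
  then show ?thesis by (simp only: iter_cong_iff[OF assms(2,3)])
qed

end

section \<open>Orbit lengths\<close>

text \<open>Orbit lengths on a part of the points; over disjoint unions of orbits they add
  up.\<close>

definition lengths_in :: "('a \<Rightarrow> 'a) set \<Rightarrow> 'a set \<Rightarrow> nat multiset" where
  "lengths_in K T = image_mset card (mset_set (pt_orbit K ` T))"

lemma orbit_lengths_eq: "orbit_lengths S K = lengths_in K S"
  by (simp add: orbit_lengths_def lengths_in_def orbits_on_eq)

lemma lengths_in_Un:
  assumes K: "subgroup K (BijGroup S)" and fin: "finite S" and sub: "T \<subseteq> S" "T' \<subseteq> S"
    and inv: "\<And>x. x \<in> T \<Longrightarrow> pt_orbit K x \<subseteq> T" and disj: "T \<inter> T' = {}"
  shows "lengths_in K (T \<union> T') = lengths_in K T + lengths_in K T'"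
proof -
  have "pt_orbit K ` T \<inter> pt_orbit K ` T' = {}"
  proof (rule ccontr)
    assume "pt_orbit K ` T \<inter> pt_orbit K ` T' \<noteq> {}"
    then obtain x y where xy: "x \<in> T" "y \<in> T'" "pt_orbit K x = pt_orbit K y" by auto
    have "y \<in> pt_orbit K x" using pt_orbit_self[OF K, of y] xy sub by auto
    then show False using inv[OF xy(1)] xy(2) disj by blast
  qed
  then show ?thesis
    using finite_subset[OF sub(1) fin] finite_subset[OF sub(2) fin]
    by (simp add: lengths_in_def image_Un mset_set_Union)
qed

lemma lengths_in_const:
  assumes K: "subgroup K (BijGroup S)" and fin: "finite S" and sub: "T \<subseteq> S"
    and inv: "\<And>x. x \<in> T \<Longrightarrow> pt_orbit K x \<subseteq> T" and l: "\<And>x. x \<in> T \<Longrightarrow> card (pt_orbit K x) = l" "0 < l"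
  shows "lengths_in K T = replicate_mset (card T div l) l"
proof -
  have finT: "finite T" by (rule finite_subset[OF sub fin])
  have un: "\<Union>(pt_orbit K ` T) = T" using inv pt_orbit_self[OF K] sub by blast
  have "l * card (pt_orbit K ` T) = card (\<Union>(pt_orbit K ` T))"
  proof (rule card_partition)
    show "finite (pt_orbit K ` T)" using finT by simp
    show "finite (\<Union>(pt_orbit K ` T))" using finT un by simp
    show "card c = l" if "c \<in> pt_orbit K ` T" for c using that l by auto
    fix c d assume cd: "c \<in> pt_orbit K ` T" "d \<in> pt_orbit K ` T" "c \<noteq> d"
    obtain x y where xy: "x \<in> T" "c = pt_orbit K x" "y \<in> T" "d = pt_orbit K y" using cd by auto
    show "c \<inter> d = {}"
    proof (rule ccontr)
      assume "c \<inter> d \<noteq> {}"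
      then obtain z where z: "z \<in> pt_orbit K x" "z \<in> pt_orbit K y" using xy by blast
      have "pt_orbit K x = pt_orbit K y"
        using pt_orbit_eq[OF K _ z(1)] pt_orbit_eq[OF K _ z(2)] xy sub by auto
      then show False using cd(3) xy by simp
    qed
  qed
  then have "card (pt_orbit K ` T) = card T div l" using un l(2) by (metis nonzero_mult_div_cancel_left less_numeral_extra(3))
  moreover have "lengths_in K T = image_mset (\<lambda>_. l) (mset_set (pt_orbit K ` T))"
    unfolding lengths_in_def using finT l(1) by (intro image_mset_cong) auto
  ultimately show ?thesis by (simp add: image_mset_const_eq)
qed

lemma card_residues:
  fixes n D :: int
  assumes "0 < D" "D dvd n" "0 < n" and Z: "Z \<subseteq> {0..<D}"
  shows "card {y \<in> {0..<n}. y mod D \<in> Z} = nat (n div D) * card Z"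
proof -
  obtain m where m: "n = D * m" using assms(2) by (elim dvdE)
  have "{y \<in> {0..<n}. y mod D \<in> Z} = (\<lambda>(q, z). D * q + z) ` ({0..<m} \<times> Z)"
  proof
    show "{y \<in> {0..<n}. y mod D \<in> Z} \<subseteq> (\<lambda>(q, z). D * q + z) ` ({0..<m} \<times> Z)"
    proof
      fix y assume y: "y \<in> {y \<in> {0..<n}. y mod D \<in> Z}"
      have "y div D < m"
      proof -
        have "D * (y div D) \<le> y" using assms(1) by (simp add: mult_div_mod_eq[symmetric] minus_mod_eq_mult_div[symmetric])
        then have "D * (y div D) < D * m" using y m by auto
        then show ?thesis using assms(1) by simp
      qed
      moreover have "0 \<le> y div D" using y assms(1) by (simp add: pos_imp_zdiv_nonneg_iff)
      moreover have "y = (\<lambda>(q, z). D * q + z) (y div D, y mod D)" by simp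
      ultimately show "y \<in> (\<lambda>(q, z). D * q + z) ` ({0..<m} \<times> Z)" using y by (intro image_eqI) auto
    qed
    show "(\<lambda>(q, z). D * q + z) ` ({0..<m} \<times> Z) \<subseteq> {y \<in> {0..<n}. y mod D \<in> Z}"
    proof clarify
      fix q z assume q: "q \<in> {0..<m}" and z: "z \<in> Z"
      have z': "0 \<le> z" "z < D" using z Z by auto
      have "D * q + z < D * (q + 1)" using z' by (simp add: algebra_simps)
      also have "\<dots> \<le> D * m" using q assms(1) by (intro mult_left_mono) auto
      finally show "D * q + z \<in> {0..<n} \<and> (D * q + z) mod D \<in> Z"
        using q z z' assms(1) m by auto
    qed
  qed
  moreover have "inj_on (\<lambda>(q, z). D * q + z) ({0..<m} \<times> Z)"
  proof (rule inj_onI, clarify)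
    fix q z q' z' assume a: "z \<in> Z" "z' \<in> Z" "D * q + z = D * q' + z'"
    have b: "0 \<le> z" "z < D" "0 \<le> z'" "z' < D" using a Z by auto
    have "z = (D * q + z) mod D" "z' = (D * q' + z') mod D" using b by simp_all
    then have "z = z'" using a(3) by simp
    then show "q = q' \<and> z = z'" using a(3) assms(1) by simp
  qed
  ultimately have "card {y \<in> {0..<n}. y mod D \<in> Z} = card ({0..<m} \<times> Z)" by (simp add: card_image)
  then show ?thesis using m assms(1) by (simp add: card_cartesian_product)
qed

context affine_action
begin

lemma finite_points: "finite \<Omega>"
proof -
  have "p \<in> e ` {0..<n}" if "p \<in> \<Omega>" for p
  proof -
    obtain x where x: "p = e x" using e_ex \<open>p \<in> \<Omega>\<close> by blast
    have "n dvd x - x mod n" by (simp add: minus_mod_eq_mult_div)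
    then have "p = e (x mod n)" by (simp add: x e_eq)
    then show ?thesis using n_pos by (intro image_eqI[of _ _ "x mod n"]) simp_all
  qed
  then have "\<Omega> \<subseteq> e ` {0..<n}" by blast
  then show ?thesis by (rule finite_subset) simp
qed

lemma card_e_image:
  assumes "\<And>x y. Q x \<Longrightarrow> n dvd y - x \<Longrightarrow> Q y"
  shows "card (e ` {x. Q x}) = card {x \<in> {0..<n}. Q x}"
proof -
  have "e ` {x. Q x} = e ` {x \<in> {0..<n}. Q x}"
  proof
    show "e ` {x. Q x} \<subseteq> e ` {x \<in> {0..<n}. Q x}"
    proof clarify
      fix x assume "Q x"
      have d: "n dvd x - x mod n" by (simp add: minus_mod_eq_mult_div)
      then have "n dvd x mod n - x" by (simp add: dvd_diff_commute)
      then have "Q (x mod n)" using assms \<open>Q x\<close> by blast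
      moreover have "e x = e (x mod n)" using d by (simp add: e_eq)
      ultimately show "e x \<in> e ` {x \<in> {0..<n}. Q x}" using n_pos by (intro image_eqI[of _ _ "x mod n"]) simp_all
    qed
  qed auto
  moreover have "inj_on e {x \<in> {0..<n}. Q x}"
  proof (rule inj_onI)
    fix x y assume a: "x \<in> {x \<in> {0..<n}. Q x}" "y \<in> {x \<in> {0..<n}. Q x}" "e x = e y"
    have "n dvd x - y" using a(3) by (simp only: e_eq)
    then have "x mod n = y mod n" by (simp only: mod_eq_dvd_iff)
    moreover have "x mod n = x" "y mod n = y" using a by simp_all
    ultimately show "x = y" by simp
  qed
  ultimately show ?thesis by (simp add: card_image)
qed

lemma generate_gen_sub:
  assumes D: "D dvd n"
  shows "generate (BijGroup \<Omega>) {aff (\<alpha> ^ k) b0, aff 1 D} = affmap (gen_sub k b0 D)"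
proof
  interpret B: group "BijGroup \<Omega>" by (rule group_BijGroup)
  note sub = affsub_gen_sub[OF D, of k b0]
  have in1: "(\<alpha> ^ k, b0) \<in> gen_sub k b0 D"
    unfolding gen_sub_def by (simp, intro exI[of _ 1]) (simp add: geo_def)
  have in2: "(1, D) \<in> gen_sub k b0 D" unfolding gen_sub_def by (simp, intro exI[of _ 0]) simp
  show "generate (BijGroup \<Omega>) {aff (\<alpha> ^ k) b0, aff 1 D} \<subseteq> affmap (gen_sub k b0 D)"
    by (rule B.generate_subgroup_incl[OF _ subgroup_affmap[OF sub]])
       (use in1 in2 in \<open>auto simp: affmap_def\<close>)
  define H where "H = generate (BijGroup \<Omega>) {aff (\<alpha> ^ k) b0, aff 1 D}"
  have "{aff (\<alpha> ^ k) b0, aff 1 D} \<subseteq> carrier (BijGroup \<Omega>)"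
    using aff_carrier[OF mults_cop[OF mults_pow]] aff_carrier[of 1] by auto
  then have "subgroup H (BijGroup \<Omega>)" unfolding H_def by (rule B.generate_is_subgroup)
  then have P: "affsub (affpre H)" by (rule affsub_affpre)
  have P1: "(\<alpha> ^ k, b0) \<in> affpre H" "(1, D) \<in> affpre H"
    by (simp_all add: affpre_def H_def generate.incl)
  have "gen_sub k b0 D \<subseteq> affpre H"
  proof clarify
    fix c b assume "(c, b) \<in> gen_sub k b0 D"
    then obtain i where i: "n dvd c - \<alpha> ^ (k * i)" "D dvd b - b0 * geo (\<alpha> ^ k) i" by (auto simp: gen_sub_def)
    obtain m where m: "b - b0 * geo (\<alpha> ^ k) i = D * m" using i(2) by (elim dvdE)
    have 1: "((\<alpha> ^ k) ^ i, b0 * geo (\<alpha> ^ k) i) \<in> affpre H" by (rule affsub_pow[OF P P1(1)])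
    have "(1, m * D) \<in> affpre H" by (rule affsub_transl_mult[OF P P1(2)])
    then have "(1 * (\<alpha> ^ k) ^ i, 1 * (b0 * geo (\<alpha> ^ k) i) + m * D) \<in> affpre H"
      by (rule affsub_mult[OF P _ 1])
    then show "(c, b) \<in> affpre H"
    proof (rule affsub_cong[OF P])
      show "n dvd c - 1 * (\<alpha> ^ k) ^ i" using i(1) by (simp add: power_mult)
      have "b - (1 * (b0 * geo (\<alpha> ^ k) i) + m * D) = 0" using m by (simp add: algebra_simps)
      then show "n dvd b - (1 * (b0 * geo (\<alpha> ^ k) i) + m * D)" by (simp only: dvd_0_right)
    qed
  qed
  then show "affmap (gen_sub k b0 D) \<subseteq> generate (BijGroup \<Omega>) {aff (\<alpha> ^ k) b0, aff 1 D}"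
    unfolding H_def[symmetric] by (auto simp: affmap_def affpre_def)
qed

text \<open>The translations by \<open>D\<close> make an orbit a union of residue classes modulo
  \<open>D\<close>, namely those of the iterates of the first generator.\<close>

lemma pt_orbit_gen_sub:
  assumes D: "D dvd n"
  shows "pt_orbit (affmap (gen_sub k b0 D)) (e x) = e ` {y. \<exists>i. D dvd y - iter k b0 i x}"
proof
  show "pt_orbit (affmap (gen_sub k b0 D)) (e x) \<subseteq> e ` {y. \<exists>i. D dvd y - iter k b0 i x}"
  proof
    fix p assume "p \<in> pt_orbit (affmap (gen_sub k b0 D)) (e x)"
    then obtain c b i where i: "p = e (c * x + b)" "n dvd c - \<alpha> ^ (k * i)" "D dvd b - b0 * geo (\<alpha> ^ k) i"
      by (auto simp: pt_orbit_def affmap_def gen_sub_def)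
    have "D dvd c * x + b - iter k b0 i x"
      by (rule dvd_lin2[OF dvd_trans[OF D i(2)] i(3), where p = x and q = 1]) (simp add: iter_def algebra_simps)
    then show "p \<in> e ` {y. \<exists>i. D dvd y - iter k b0 i x}" using i(1) by blast
  qed
  show "e ` {y. \<exists>i. D dvd y - iter k b0 i x} \<subseteq> pt_orbit (affmap (gen_sub k b0 D)) (e x)"
  proof clarify
    fix y i assume i: "D dvd y - iter k b0 i x"
    have "D dvd (y - \<alpha> ^ (k * i) * x) - b0 * geo (\<alpha> ^ k) i"
      using i by (simp add: iter_def algebra_simps)
    then have "(\<alpha> ^ (k * i), y - \<alpha> ^ (k * i) * x) \<in> gen_sub k b0 D"
      unfolding gen_sub_def by (simp, intro exI[of _ i]) simp
    then have "aff (\<alpha> ^ (k * i)) (y - \<alpha> ^ (k * i) * x) \<in> affmap (gen_sub k b0 D)" by (auto simp: affmap_def)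
    moreover have "aff (\<alpha> ^ (k * i)) (y - \<alpha> ^ (k * i) * x) (e x) = e y" by simp
    ultimately show "e y \<in> pt_orbit (affmap (gen_sub k b0 D)) (e x)"
      unfolding pt_orbit_def by (intro image_eqI) (auto simp del: aff_apply)
  qed
qed

text \<open>The orbit meets as many residue classes modulo \<open>D\<close> as the period
  \<open>l\<close> of \<open>x\<close>, and each class has \<open>n div D\<close> points.\<close>

lemma card_pt_orbit_gen_sub:
  assumes D: "0 < D" "D dvd n" and l: "0 < l" and per: "\<And>i. D dvd iter k b0 i x - x \<longleftrightarrow> l dvd i"
  shows "card (pt_orbit (affmap (gen_sub k b0 D)) (e x)) = nat (n div D) * l"
proof -
  define Z where "Z = (\<lambda>i. iter k b0 i x mod D) ` {..<l}"
  have "card Z = card {..<l}" unfolding Z_def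
  proof (rule card_image, rule inj_onI)
    fix i j assume a: "i \<in> {..<l}" "j \<in> {..<l}" "iter k b0 i x mod D = iter k b0 j x mod D"
    then have "int l dvd int i - int j" by (simp only: mod_eq_dvd_iff iter_cong_iff[OF D(2) per])
    then have "i mod l = j mod l" by (metis mod_eq_dvd_iff of_nat_mod of_nat_eq_iff)
    then show "i = j" using a by simp
  qed
  then have cZ: "card Z = l" by simp
  have Y: "{y. \<exists>i. D dvd y - iter k b0 i x} = {y. y mod D \<in> Z}"
  proof -
    have "(\<exists>i. D dvd y - iter k b0 i x) \<longleftrightarrow> y mod D \<in> Z" for y
    proof
      assume "\<exists>i. D dvd y - iter k b0 i x"
      then obtain i where i: "D dvd y - iter k b0 i x" by blast
      have "D dvd y - iter k b0 (i mod l) x" using dvd_add[OF i iter_mod[OF l D(2) per, of i]] by simp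
      then have "y mod D = iter k b0 (i mod l) x mod D" by (simp add: mod_eq_dvd_iff)
      then show "y mod D \<in> Z" unfolding Z_def using l by (intro image_eqI[of _ _ "i mod l"]) simp_all
    qed (auto simp: Z_def mod_eq_dvd_iff)
    then show ?thesis by simp
  qed
  have "Z \<subseteq> {0..<D}" using D(1) by (auto simp: Z_def)
  have "card (e ` {y. y mod D \<in> Z}) = card {y \<in> {0..<n}. y mod D \<in> Z}"
  proof (rule card_e_image)
    fix x y assume "x mod D \<in> Z" "n dvd y - x"
    then have "y mod D = x mod D" using D(2) by (simp add: mod_eq_dvd_iff dvd_trans)
    then show "y mod D \<in> Z" using \<open>x mod D \<in> Z\<close> by simp
  qed
  also have "\<dots> = nat (n div D) * card Z"
    by (rule card_residues[OF D n_pos]) fact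
  finally show ?thesis by (simp add: pt_orbit_gen_sub[OF D(2)] Y cZ)
qed

text \<open>A stratum is a union of orbits of the same length.\<close>

definition stratum :: "nat \<Rightarrow> int \<Rightarrow> int \<Rightarrow> (int \<Rightarrow> bool) \<Rightarrow> nat \<Rightarrow> bool" where
  "stratum k b0 D Q l \<longleftrightarrow> 0 < l \<and> (\<forall>x y i. Q x \<longrightarrow> D dvd y - iter k b0 i x \<longrightarrow> Q y) \<and>
     (\<forall>x. Q x \<longrightarrow> (\<forall>i. D dvd iter k b0 i x - x \<longleftrightarrow> l dvd i))"

lemma stratum_inv:
  assumes "D dvd n" "stratum k b0 D Q l" "p \<in> e ` {x. Q x}"
  shows "pt_orbit (affmap (gen_sub k b0 D)) p \<subseteq> e ` {x. Q x}"
proof -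
  obtain x where "p = e x" "Q x" using assms(3) by auto
  then show ?thesis using assms(2) by (auto simp: pt_orbit_gen_sub[OF assms(1)] stratum_def)
qed

lemma stratum_periodic:
  assumes "D dvd n" "stratum k b0 D Q l" "Q x" "n dvd y - x"
  shows "Q y"
proof -
  have "D dvd y - iter k b0 0 x" using assms(1,4) dvd_trans by simp
  then show ?thesis using assms(2,3) unfolding stratum_def by blast
qed

lemma lengths_in_stratum:
  assumes D: "0 < D" "D dvd n" and Q: "stratum k b0 D Q l"
  shows "lengths_in (affmap (gen_sub k b0 D)) (e ` {x. Q x}) =
    replicate_mset (card {x \<in> {0..<n}. Q x} div (nat (n div D) * l)) (nat (n div D) * l)"
proof -
  have l: "0 < l" using Q by (simp add: stratum_def)
  have "0 < n div D" using D n_pos by (simp add: pos_imp_zdiv_pos_iff zdvd_imp_le)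
  then have pos: "0 < nat (n div D) * l" using l by simp
  have per: "card (e ` {x. Q x}) = card {x \<in> {0..<n}. Q x}"
    by (rule card_e_image) (rule stratum_periodic[OF D(2) Q])
  show ?thesis unfolding per[symmetric]
  proof (rule lengths_in_const[OF subgroup_affmap[OF affsub_gen_sub[OF D(2)]] finite_points])
    show "e ` {x. Q x} \<subseteq> \<Omega>" by auto
    fix p assume p: "p \<in> e ` {x. Q x}"
    show "pt_orbit (affmap (gen_sub k b0 D)) p \<subseteq> e ` {x. Q x}" by (rule stratum_inv[OF D(2) Q p])
    obtain x where x: "p = e x" "Q x" using p by auto
    have "\<And>i. D dvd iter k b0 i x - x \<longleftrightarrow> l dvd i" using Q x(2) by (simp add: stratum_def)
    then show "card (pt_orbit (affmap (gen_sub k b0 D)) p) = nat (n div D) * l"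
      unfolding x(1) by (rule card_pt_orbit_gen_sub[OF D l])
  qed (rule pos)
qed

lemma lengths_in_stratum_Un:
  assumes D: "0 < D" "D dvd n" and Q: "stratum k b0 D Q l" and R: "\<And>x y. R x \<Longrightarrow> n dvd y - x \<Longrightarrow> R y"
    and disj: "\<And>x. Q x \<Longrightarrow> \<not> R x"
  shows "lengths_in (affmap (gen_sub k b0 D)) (e ` {x. Q x \<or> R x}) =
    lengths_in (affmap (gen_sub k b0 D)) (e ` {x. Q x}) + lengths_in (affmap (gen_sub k b0 D)) (e ` {x. R x})"
proof -
  have un: "e ` {x. Q x \<or> R x} = e ` {x. Q x} \<union> e ` {x. R x}" by auto
  have dj: "e ` {x. Q x} \<inter> e ` {x. R x} = {}"
  proof (rule ccontr)
    assume "e ` {x. Q x} \<inter> e ` {x. R x} \<noteq> {}"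
    then obtain x y where xy: "Q x" "R y" "e x = e y" by auto
    then have "n dvd x - y" by (simp add: e_eq)
    then have "R x" using R xy by blast
    then show False using disj xy by blast
  qed
  show ?thesis
    unfolding un
  proof (rule lengths_in_Un[OF subgroup_affmap[OF affsub_gen_sub[OF D(2)]] finite_points _ _ _ dj])
    show "pt_orbit (affmap (gen_sub k b0 D)) p \<subseteq> e ` {x. Q x}" if "p \<in> e ` {x. Q x}" for p
      by (rule stratum_inv[OF D(2) Q that])
  qed auto
qed

end

lemma prime_int_nat: "prime p \<Longrightarrow> \<exists>q. p = int q \<and> prime q" for p :: int
  using prime_gt_0_int[of p] by (intro exI[of _ "nat p"]) (simp add: prime_nat_iff_prime)

context affine_action
begin

section \<open>The listed subgroups in coordinates\<close>

lemma aff_pow: "aff \<alpha> 0 [^]\<^bsub>BijGroup \<Omega>\<^esub> (k::nat) = aff (\<alpha> ^ k) 0"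
proof (induction k)
  case 0
  then show ?case by (simp add: one_eq_aff)
next
  case (Suc k)
  have "coprime (\<alpha> ^ k) n" "coprime \<alpha> n" using mults_cop by simp_all
  then show ?case using Suc by (simp add: aff_mult mult.commute)
qed

lemma transl_pow: "aff 1 1 [^]\<^bsub>BijGroup \<Omega>\<^esub> (k::nat) = aff 1 (int k)"
proof (induction k)
  case (Suc k)
  have "aff 1 (int k) \<otimes>\<^bsub>BijGroup \<Omega>\<^esub> aff 1 1 = aff (1 * 1) (1 * 1 + int k)"
    by (rule aff_mult) simp_all
  then show ?case using Suc by (simp add: add.commute)
qed (simp add: one_eq_aff)

lemma transl_pow_aff_pow:
  "aff 1 1 [^]\<^bsub>BijGroup \<Omega>\<^esub> (j::nat) \<otimes>\<^bsub>BijGroup \<Omega>\<^esub> aff \<alpha> 0 [^]\<^bsub>BijGroup \<Omega>\<^esub> (k::nat) = aff (\<alpha> ^ k) (int j)"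
  using aff_mult[of 1 "\<alpha> ^ k" "int j" 0] mults_cop[OF mults_pow] by (simp add: aff_pow transl_pow)

lemma H1_eq_gen: "int r dvd n \<Longrightarrow> H1 \<Omega> (aff \<alpha> 0) (aff 1 1) s r = affmap (gen_sub s 0 (int r))"
  by (simp add: H1_def aff_pow transl_pow generate_gen_sub)

lemma H2_eq_gen:
  "int (s * r) dvd n \<Longrightarrow> H2 \<Omega> (aff \<alpha> 0) (aff 1 1) s r = affmap (gen_sub 1 0 (int s * int r))"
  using generate_gen_sub[of "int (s * r)" 1 0] by (simp add: H2_def transl_pow)

lemma H3_eq_gen:
  "int (s * r) dvd n \<Longrightarrow>
    H3 \<Omega> \<alpha> (aff \<alpha> 0) (aff 1 1) s r = affmap (gen_sub (ord (int s) \<alpha>) (int r) (int s * int r))"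
  using generate_gen_sub[of "int (s * r)" "ord (int s) \<alpha>" "int r"]
  by (simp add: H3_def transl_pow_aff_pow) (simp add: transl_pow)

lemma H4_eq_gen:
  "int (4 * r) dvd n \<Longrightarrow> H4 \<Omega> (aff \<alpha> 0) (aff 1 1) r = affmap (gen_sub 1 (int r) (4 * int r))"
  using generate_gen_sub[of "int (4 * r)" 1 "int r"] transl_pow_aff_pow[of r 1] aff_pow[of 1]
  by (simp add: H4_def transl_pow)

lemma H5_eq_gen: "4 dvd n \<Longrightarrow> H5 \<Omega> (aff \<alpha> 0) (aff 1 1) = affmap (gen_sub 2 0 4)"
  using generate_gen_sub[of 4 2 0] by (simp only: H5_def aff_pow transl_pow) simp

lemma H6_eq_gen: "8 dvd n \<Longrightarrow> H6 \<Omega> (aff \<alpha> 0) (aff 1 1) = affmap (gen_sub 1 1 8)"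
proof -
  assume "8 dvd n"
  then have "generate (BijGroup \<Omega>) {aff \<alpha> 1, aff 1 8} = affmap (gen_sub 1 1 8)"
    using generate_gen_sub[of 8 1 1] by simp
  moreover have "aff 1 1 \<otimes>\<^bsub>BijGroup \<Omega>\<^esub> aff \<alpha> 0 = aff \<alpha> 1"
    using aff_mult[of 1 \<alpha> 1 0] mults_cop[OF mults_gen] by simp
  moreover have "aff 1 1 [^]\<^bsub>BijGroup \<Omega>\<^esub> (8::nat) = aff 1 8" by (simp only: transl_pow) simp
  ultimately show ?thesis by (simp only: H6_def)
qed

lemma cong_minus_1_iff: "[\<alpha> = -1] (mod m) \<longleftrightarrow> m dvd \<alpha> + 1"
  by (simp add: cong_iff_dvd_diff)

section \<open>The list of subgroups for a modulus given as a natural number\<close>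

context
  fixes N :: nat
  assumes N: "n = int N"
begin

lemma N_pos: "0 < N"
  using n_pos N by simp

lemma in_prime_factors_N: "r \<in> prime_factors N \<longleftrightarrow> prime (int r) \<and> int r dvd n"
  using N_pos by (auto simp: N in_prime_factors_iff)

lemma ord_prime_pos: "prime (int r) \<Longrightarrow> int r dvd n \<Longrightarrow> 0 < ord (int r) \<alpha>"
  using ord_prime_less(1) mults_prime[OF mults_gen] by blast

lemma cond1_iff:
  "cond1 N \<alpha> s r \<longleftrightarrow> prime (int r) \<and> int r dvd n \<and> prime s \<and> s dvd ord (int r) \<alpha>"
  unfolding cond1_def in_prime_factors_N using ord_prime_pos[of r] by (auto simp: in_prime_factors_iff)

lemma cond2_iff: "cond2 N s r \<longleftrightarrow> prime (int s) \<and> prime (int r) \<and> int s * int r dvd n"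
proof -
  have "s * r dvd N \<longleftrightarrow> int s * int r dvd n" unfolding N by (metis int_dvd_int_iff of_nat_mult)
  then show ?thesis
    unfolding cond2_def in_prime_factors_N using dvd_mult_left dvd_mult_right by blast
qed

lemma cond3_iff: "cond3 N \<alpha> s r \<longleftrightarrow> twisted_ok (int s) (int r)"
  unfolding cond3_def Int_iff in_prime_factors_N using ord_prime_pos[of r]
  unfolding coprime_iff_gcd_eq_1[symmetric] twisted_ok_def by (auto simp: in_prime_factors_iff)

lemma cond4_iff:
  "cond4 N \<alpha> r \<longleftrightarrow> prime (int r) \<and> odd (int r) \<and> int r dvd n \<and> 4 dvd n \<and> 4 dvd \<alpha> + 1"
proof -
  have "r \<noteq> 2 \<longleftrightarrow> odd (int r)" if "prime (int r)"
    using that primes_dvd_imp_eq[of 2 r] by auto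
  moreover have "4 dvd N \<longleftrightarrow> 4 dvd n" unfolding N by (metis int_dvd_int_iff of_nat_numeral)
  ultimately show ?thesis
    unfolding cond4_def Diff_iff in_prime_factors_N cong_minus_1_iff by auto
qed

lemma cond5_iff: "cond5 N \<alpha> \<longleftrightarrow> 4 dvd n \<and> 4 dvd \<alpha> + 1"
proof -
  have "4 dvd N \<longleftrightarrow> 4 dvd n" unfolding N by (metis int_dvd_int_iff of_nat_numeral)
  then show ?thesis by (simp add: cond5_def cong_minus_1_iff)
qed

lemma cond6_iff: "cond6 N \<alpha> \<longleftrightarrow> 8 dvd n \<and> 8 dvd \<alpha> + 1"
proof -
  have "8 dvd N \<longleftrightarrow> 8 dvd n" unfolding N by (metis int_dvd_int_iff of_nat_numeral)
  then show ?thesis by (simp add: cond6_def cong_minus_1_iff)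
qed

lemma H1_eq: "cond1 N \<alpha> s r \<Longrightarrow> H1 \<Omega> (aff \<alpha> 0) (aff 1 1) s r = affmap (index_sub s (int r))"
  by (simp add: cond1_iff H1_eq_gen gen_sub_index_sub)

lemma H2_eq: "cond2 N s r \<Longrightarrow> H2 \<Omega> (aff \<alpha> 0) (aff 1 1) s r = affmap (point_stab (int s * int r) 0)"
  by (simp add: cond2_iff H2_eq_gen flip: gen_sub_point_stab)

lemma H3_eq: "cond3 N \<alpha> s r \<Longrightarrow> H3 \<Omega> \<alpha> (aff \<alpha> 0) (aff 1 1) s r = affmap (twisted_sub (int s) (int r) 1)"
proof -
  assume "cond3 N \<alpha> s r"
  then have ok: "twisted_ok (int s) (int r)" by (simp add: cond3_iff)
  then have "0 < int s" using prime_pos[of "int s"] unfolding twisted_ok_def by blast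
  moreover have "int (s * r) dvd n" using twisted_ok_coprime(2)[OF ok] by simp
  ultimately show ?thesis by (simp add: H3_eq_gen gen_sub_twisted_sub)
qed

lemma H4_eq:
  assumes "cond4 N \<alpha> r"
  shows "H4 \<Omega> (aff \<alpha> 0) (aff 1 1) r = affmap (pair_stab (4 * int r) 0 (int r))" "4 * int r dvd n"
proof -
  have c: "prime (int r)" "odd (int r)" "int r dvd n" "4 dvd n" "4 dvd \<alpha> + 1"
    using assms by (auto simp: cond4_iff)
  show rn: "4 * int r dvd n" by (rule conj_entry_pair_stab(2)[OF c(1-5), of 1]) simp
  have "int r \<noteq> 0" using prime_pos[OF c(1)] by simp
  then show "H4 \<Omega> (aff \<alpha> 0) (aff 1 1) r = affmap (pair_stab (4 * int r) 0 (int r))"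
    using rn gen_sub_pair_stab[OF c(5), of "int r"] by (simp add: H4_eq_gen)
qed

lemma H5_eq: "cond5 N \<alpha> \<Longrightarrow> H5 \<Omega> (aff \<alpha> 0) (aff 1 1) = affmap ker4"
  by (simp add: cond5_iff H5_eq_gen gen_sub_ker4)

lemma H6_eq: "cond6 N \<alpha> \<Longrightarrow> H6 \<Omega> (aff \<alpha> 0) (aff 1 1) = affmap (pair_stab 8 0 1)"
  using gen_sub_pair_stab[of 8 1] by (simp add: cond6_iff H6_eq_gen)

lemma listed_iff_entry:
  "listed \<Omega> N \<alpha> (aff \<alpha> 0) (aff 1 1) i K \<longleftrightarrow> (\<exists>S. entry i S \<and> K = affmap S)"
proof
  assume "listed \<Omega> N \<alpha> (aff \<alpha> 0) (aff 1 1) i K"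
  then show "\<exists>S. entry i S \<and> K = affmap S"
  proof cases
    case (1 s r)
    then show ?thesis using H1_eq[of s r] entry1[of "int r" s] by (auto simp: cond1_iff)
  next
    case (2 s r)
    then show ?thesis using H2_eq[of s r] entry2[of "int s" "int r"] by (auto simp: cond2_iff)
  next
    case (3 s r)
    then show ?thesis using H3_eq[of s r] entry3[of "int s" "int r"] by (auto simp: cond3_iff)
  next
    case (4 r)
    then show ?thesis using H4_eq[of r] entry4[of "int r"] by (auto simp: cond4_iff)
  next
    case 5
    then show ?thesis using H5_eq entry5 by (auto simp: cond5_iff)
  next
    case 6
    then show ?thesis using H6_eq entry6 by (auto simp: cond6_iff)
  qed
next
  assume "\<exists>S. entry i S \<and> K = affmap S"
  then obtain S where S: "entry i S" "K = affmap S" by blast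
  from S(1) show "listed \<Omega> N \<alpha> (aff \<alpha> 0) (aff 1 1) i K"
  proof cases
    case (entry1 r s)
    obtain r' where r: "r = int r'" using prime_int_nat[OF entry1(3)] by blast
    have "cond1 N \<alpha> s r'" using entry1 r by (simp add: cond1_iff)
    then show ?thesis using listed.intros(1) H1_eq entry1(1,2) r S(2) by metis
  next
    case (entry2 s r)
    obtain r' s' where r: "r = int r'" "s = int s'" using prime_int_nat entry2(3,4) by blast
    have "cond2 N s' r'" using entry2 r by (simp add: cond2_iff)
    then show ?thesis using listed.intros(2) H2_eq entry2(1,2) r S(2) by metis
  next
    case (entry3 s r)
    obtain r' s' where r: "r = int r'" "s = int s'"
      using prime_int_nat entry3(3) unfolding twisted_ok_def by blast
    have "cond3 N \<alpha> s' r'" using entry3 r by (simp add: cond3_iff)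
    then show ?thesis using listed.intros(3) H3_eq entry3(1,2) r S(2) by metis
  next
    case (entry4 r)
    obtain r' where r: "r = int r'" using prime_int_nat[OF entry4(3)] by blast
    have "cond4 N \<alpha> r'" using entry4 r by (simp add: cond4_iff)
    then show ?thesis using listed.intros(4) H4_eq(1) entry4(1,2) r S(2) by metis
  next
    case entry5
    have "cond5 N \<alpha>" using entry5 by (simp add: cond5_iff)
    then show ?thesis using listed.intros(5) H5_eq entry5(1,2) S(2) by metis
  next
    case entry6
    have "cond6 N \<alpha>" using entry6 by (simp add: cond6_iff)
    then show ?thesis using listed.intros(6) H6_eq entry6(1,2) S(2) by metis
  qed
qed

end

section \<open>The holomorph in coordinates\<close>

definition Transl :: "('a \<Rightarrow> 'a) set" where
  "Transl = range (aff 1)"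

lemma transl_mult: "aff 1 x \<otimes>\<^bsub>BijGroup \<Omega>\<^esub> aff 1 y = aff 1 (x + y)"
  using aff_mult[of 1 1 x y] by (simp add: add.commute)

lemma transl_eq_iff: "aff 1 x = aff 1 y \<longleftrightarrow> n dvd x - y"
  by (simp add: aff_eq_iff dvd_diff_commute)

lemma transl_mod: "aff 1 x = aff 1 (int (nat (x mod n)))"
  using n_pos by (simp add: transl_eq_iff minus_mod_eq_mult_div)

text \<open>An endomorphism of a cyclic group is determined by the image of the generator. Negative
  arguments are reduced modulo \<open>n\<close>, so that induction on natural numbers covers
  them.\<close>

lemma hom_Transl:
  assumes c: "c \<in> hom (perm_group \<Omega> Transl) (perm_group \<Omega> Transl)"
  obtains k where "\<And>x. c (aff 1 x) = aff 1 (k * x)"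
proof -
  have cT: "c (aff 1 x) \<in> Transl" for x
    using c by (auto simp: hom_def Transl_def)
  have add: "c (aff 1 (x + y)) = c (aff 1 x) \<otimes>\<^bsub>BijGroup \<Omega>\<^esub> c (aff 1 y)" for x y
    using hom_mult[OF c, of "aff 1 x" "aff 1 y"] by (simp add: Transl_def transl_mult)
  obtain k where k: "c (aff 1 1) = aff 1 k" using cT[of 1] by (auto simp: Transl_def)
  obtain z where z: "c (aff 1 0) = aff 1 z" using cT[of 0] by (auto simp: Transl_def)
  have "aff 1 z = aff 1 (z + z)" using add[of 0 0] z by (simp add: transl_mult)
  then have c0: "c (aff 1 0) = aff 1 0" using z by (simp add: transl_eq_iff)
  have nat: "c (aff 1 (int m)) = aff 1 (k * int m)" for m
  proof (induction m)
    case (Suc m)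
    have "c (aff 1 (int m + 1)) = aff 1 (k * int m + k)" using add[of "int m" 1] Suc k by (simp add: transl_mult)
    then show ?case by (simp add: algebra_simps)
  qed (simp add: c0)
  have "c (aff 1 x) = aff 1 (k * x)" for x
  proof -
    have "c (aff 1 x) = aff 1 (k * int (nat (x mod n)))" using nat transl_mod[of x] by metis
    also have "k * int (nat (x mod n)) = k * (x mod n)" using n_pos by simp
    also have "aff 1 (k * (x mod n)) = aff 1 (k * x)"
    proof -
      have "n dvd k * (x mod n - x)" by (simp add: dvd_diff_commute minus_mod_eq_mult_div)
      then show ?thesis by (simp add: transl_eq_iff algebra_simps)
    qed
    finally show ?thesis .
  qed
  then show ?thesis by (rule that)
qed

lemma holomorph_subset_Hol: "holomorph \<Omega> (e 0) Transl \<subseteq> Hol"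
proof
  fix h assume "h \<in> holomorph \<Omega> (e 0) Transl"
  then obtain c v where h: "h \<in> Bij \<Omega>" "c \<in> auto (perm_group \<Omega> Transl)" "v \<in> Transl"
    "\<And>u. u \<in> Transl \<Longrightarrow> h (u (e 0)) = (v \<otimes>\<^bsub>BijGroup \<Omega>\<^esub> c u) (e 0)"
    unfolding holomorph_def carrier_BijGroup by blast
  have "c \<in> hom (perm_group \<Omega> Transl) (perm_group \<Omega> Transl)" using h(2) by (simp add: auto_def)
  then obtain k where k: "\<And>x. c (aff 1 x) = aff 1 (k * x)" using hom_Transl by metis
  obtain z where z: "v = aff 1 z" using h(3) by (auto simp: Transl_def)
  have he: "h (e x) = e (k * x + z)" for x
  proof -
    have "aff 1 x \<in> Transl" by (simp add: Transl_def)
    from h(4)[OF this] show ?thesis by (simp add: k z transl_mult add.commute)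
  qed
  have "h = aff k z" by (rule aff_eqI[OF Bij_ext[OF h(1)] he])
  \<comment> \<open>The multiplier is a unit because \<open>h\<close> is injective on the
    points.\<close>
  moreover have "coprime k n"
  proof (rule coprime_if_mult_inj[OF n_pos])
    fix m assume "n dvd k * m"
    then have "h (e m) = h (e 0)" by (simp add: he e_eq)
    moreover have "inj_on h \<Omega>" using h(1) by (simp add: Bij_def bij_betw_def)
    ultimately have "e m = e 0" by (simp add: inj_on_eq_iff)
    then show "n dvd m" by (simp add: e_eq)
  qed
  ultimately show "h \<in> Hol" by (auto simp: Hol_def)
qed

lemma Hol_subset_holomorph: "Hol \<subseteq> holomorph \<Omega> (e 0) Transl"
proof
  fix h assume "h \<in> Hol"
  then obtain v z where v: "h = aff v z" "coprime v n" by (auto simp: Hol_def)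
  \<comment> \<open>The automorphism that multiplies exponents by \<open>v\<close>; it is restricted
    to the translations because automorphisms are extensional on the carrier.\<close>
  define c where "c = (\<lambda>u\<in>Transl. aff 1 (v * (SOME x. u = aff 1 x)))"
  have c: "c (aff 1 x) = aff 1 (v * x)" for x
  proof -
    have "aff 1 x = aff 1 (SOME y. aff 1 x = aff 1 y)" by (rule someI[of "\<lambda>y. aff 1 x = aff 1 y" x]) simp
    then have "n dvd x - (SOME y. aff 1 x = aff 1 y)" by (simp only: transl_eq_iff)
    then have "n dvd v * (SOME y. aff 1 x = aff 1 y) - v * x"
      by (rule dvd_lin1[where p = "- v"]) (simp add: algebra_simps)
    then have "aff 1 (v * (SOME y. aff 1 x = aff 1 y)) = aff 1 (v * x)" by (simp only: transl_eq_iff)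
    then show ?thesis by (simp add: c_def Transl_def)
  qed
  have "c \<in> hom (perm_group \<Omega> Transl) (perm_group \<Omega> Transl)"
    by (auto simp: hom_def Transl_def c transl_mult algebra_simps)
  moreover have "c \<in> Bij Transl"
  proof -
    have "inj_on c Transl"
    proof (rule inj_onI)
      fix f g assume a: "f \<in> Transl" "g \<in> Transl" "c f = c g"
      obtain x y where xy: "f = aff 1 x" "g = aff 1 y" using a by (auto simp: Transl_def)
      have "aff 1 (v * x) = aff 1 (v * y)" using a(3) xy c by simp
      then have "n dvd v * (x - y)" by (simp add: transl_eq_iff algebra_simps)
      then have "n dvd x - y" using v(2) by (simp add: coprime_dvd_mult_right_iff coprime_commute)
      then show "f = g" using xy by (simp add: transl_eq_iff)
    qed
    moreover have "c ` Transl = Transl"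
    proof
      show "c ` Transl \<subseteq> Transl" by (auto simp: Transl_def c)
      show "Transl \<subseteq> c ` Transl"
      proof
        fix f assume "f \<in> Transl"
        then obtain x where x: "f = aff 1 x" by (auto simp: Transl_def)
        obtain v' where v': "n dvd v * v' - 1" using ex_inverse[OF v(2)] by blast
        have "n dvd x - v * (v' * x)" by (rule dvd_lin1[OF v', where p = "- x"]) (simp add: algebra_simps)
        then have "f = c (aff 1 (v' * x))" by (simp only: x c transl_eq_iff)
        then show "f \<in> c ` Transl"
          by (intro image_eqI[of f c "aff 1 (v' * x)"]) (simp_all add: Transl_def)
      qed
    qed
    ultimately show ?thesis by (simp add: Bij_def bij_betw_def c_def)
  qed
  ultimately have "c \<in> auto (perm_group \<Omega> Transl)" by (simp add: auto_def)
  moreover have "aff 1 z \<in> Transl" by (simp add: Transl_def)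
  moreover have "h (u (e 0)) = (aff 1 z \<otimes>\<^bsub>BijGroup \<Omega>\<^esub> c u) (e 0)" if u: "u \<in> Transl" for u
  proof -
    obtain x where x: "u = aff 1 x" using u by (auto simp: Transl_def)
    show ?thesis by (simp add: x c v(1) transl_mult add.commute)
  qed
  moreover have "h \<in> carrier (BijGroup \<Omega>)" using v aff_carrier by simp
  ultimately show "h \<in> holomorph \<Omega> (e 0) Transl" unfolding holomorph_def by blast
qed

lemma holomorph_eq: "holomorph \<Omega> (e 0) Transl = Hol"
  using holomorph_subset_Hol Hol_subset_holomorph by blast

end

lemma diff_div_mult: "0 < M \<Longrightarrow> (M * r - M) div (M * c) = (r - 1) div c" for M r c :: nat
proof -
  assume "0 < M"
  moreover have "M * r - M = M * (r - 1)" by (simp add: diff_mult_distrib2)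
  ultimately show ?thesis by simp
qed

lemma card_Collect_diff:
  "finite I \<Longrightarrow> card {x \<in> I. P x \<and> \<not> Q x} = card {x \<in> I. P x} - card {x \<in> I. P x \<and> Q x}"
proof -
  assume "finite I"
  then have "card ({x \<in> I. P x} - {x \<in> I. P x \<and> Q x}) = card {x \<in> I. P x} - card {x \<in> I. P x \<and> Q x}"
    by (intro card_Diff_subset) auto
  moreover have "{x \<in> I. P x} - {x \<in> I. P x \<and> Q x} = {x \<in> I. P x \<and> \<not> Q x}" by blast
  ultimately show ?thesis by simp
qed

lemma card_Collect_not: "finite I \<Longrightarrow> card {x \<in> I. \<not> Q x} = card I - card {x \<in> I. Q x}"
proof -
  assume "finite I"
  then have "card (I - {x \<in> I. Q x}) = card I - card {x \<in> I. Q x}" by (intro card_Diff_subset) auto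
  moreover have "I - {x \<in> I. Q x} = {x \<in> I. \<not> Q x}" by blast
  ultimately show ?thesis by simp
qed

context affine_action
begin

section \<open>The orbit lengths of the listed subgroups\<close>

lemma card_dvd: "0 < D \<Longrightarrow> D dvd n \<Longrightarrow> card {x \<in> {0..<n}. D dvd x} = nat (n div D)"
  using card_residues[of D n "{0}"] n_pos by (simp add: mod_eq_0_iff_dvd)

text \<open>Multipliers are units modulo \<open>r\<close> and the translations involved are
  multiples of \<open>r\<close>. Hence divisibility by \<open>r\<close> is constant on orbits and
  can define strata.\<close>

lemma iter_dvd_iff:
  assumes "r dvd D" "D dvd n" "r dvd b0" "D dvd y - iter k b0 i x"
  shows "r dvd y \<longleftrightarrow> r dvd x"
proof -
  have rn: "r dvd n" by (rule dvd_trans[OF assms(1,2)])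
  have "coprime r (\<alpha> ^ (k * i))" using mults_coprime[OF mults_pow rn] by (simp only: coprime_commute)
  then have "r dvd x \<longleftrightarrow> r dvd \<alpha> ^ (k * i) * x" by (simp add: coprime_dvd_mult_right_iff)
  also have "\<dots> \<longleftrightarrow> r dvd \<alpha> ^ (k * i) * x + (y - iter k b0 i x + b0 * geo (\<alpha> ^ k) i)"
    using dvd_trans[OF assms(1,4)] assms(3) by (simp only: dvd_add_left_iff dvd_add dvd_mult2)
  also have "\<alpha> ^ (k * i) * x + (y - iter k b0 i x + b0 * geo (\<alpha> ^ k) i) = y" by (simp add: iter_def)
  finally show ?thesis by simp
qed

lemma iter_linear: "iter k 0 i x - x = (\<alpha> ^ (k * i) - 1) * x"
  by (simp add: iter_def algebra_simps)

lemma orbit_lengths_stratum: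
  assumes "0 < D" "D dvd n" "stratum k b0 D (\<lambda>x. True) l"
  shows "orbit_lengths \<Omega> (affmap (gen_sub k b0 D)) =
    replicate_mset (nat n div (nat (n div D) * l)) (nat (n div D) * l)"
proof -
  have "{x \<in> {0..<n}. True} = {0..<n}" by blast
  then have "card {x \<in> {0..<n}. True} = nat n" by (simp only: card_atLeastLessThan_int diff_zero)
  moreover have "e ` {x. True} = \<Omega>" using e_range by simp
  ultimately show ?thesis using lengths_in_stratum[OF assms] by (simp only: orbit_lengths_eq)
qed

lemma orbit_lengths_strata2:
  assumes D: "0 < D" "D dvd n" and Q: "stratum k b0 D Q l" and R: "stratum k b0 D (\<lambda>x. \<not> Q x) l'"
  shows "orbit_lengths \<Omega> (affmap (gen_sub k b0 D)) =
    replicate_mset (card {x \<in> {0..<n}. Q x} div (nat (n div D) * l)) (nat (n div D) * l) +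
    replicate_mset ((nat n - card {x \<in> {0..<n}. Q x}) div (nat (n div D) * l')) (nat (n div D) * l')"
proof -
  have "e ` {x. Q x \<or> \<not> Q x} = \<Omega>" using e_range by simp
  then have "orbit_lengths \<Omega> (affmap (gen_sub k b0 D)) =
      lengths_in (affmap (gen_sub k b0 D)) (e ` {x. Q x \<or> \<not> Q x})" by (simp only: orbit_lengths_eq)
  also have "\<dots> = lengths_in (affmap (gen_sub k b0 D)) (e ` {x. Q x}) +
      lengths_in (affmap (gen_sub k b0 D)) (e ` {x. \<not> Q x})"
    by (rule lengths_in_stratum_Un[OF D Q stratum_periodic[OF D(2) R]]) auto
  also have "card {x \<in> {0..<n}. \<not> Q x} = nat n - card {x \<in> {0..<n}. Q x}"
    by (simp only: card_Collect_not[OF finite_atLeastLessThan_int] card_atLeastLessThan_int diff_zero)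
  ultimately show ?thesis
    by (simp only: lengths_in_stratum[OF D Q] lengths_in_stratum[OF D R])
qed

section \<open>Periods and sizes of the strata for each item\<close>

context
  fixes N :: nat
  assumes N: "n = int N"
begin

lemma nat_div: "nat (n div int d) = N div d"
  by (simp add: N flip: zdiv_int)

lemma orbit_lengths_two_classes:
  assumes r: "0 < r" "int r dvd n" and D: "D = int d" "0 < d" "D dvd n"
    and Q: "stratum k b0 D (\<lambda>x. int r dvd x) l" and R: "stratum k b0 D (\<lambda>x. \<not> int r dvd x) l'"
  shows "orbit_lengths \<Omega> (affmap (gen_sub k b0 D)) =
    replicate_mset ((N div r) div (N div d * l)) (N div d * l) +
    replicate_mset ((N - N div r) div (N div d * l')) (N div d * l')"
proof -
  have D0: "0 < D" using D by simp
  have "card {x \<in> {0..<n}. int r dvd x} = N div r" using card_dvd[of "int r"] r nat_div by simp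
  then show ?thesis
    using orbit_lengths_strata2[OF D0 D(3) Q R] nat_div[of d] by (simp add: D(1) N)
qed

lemma div_eq_mult:
  assumes "int r dvd n" "0 < r"
  obtains M where "N = M * r" "N div r = M" "0 < M"
proof -
  have "r dvd N" using assms(1) by (simp add: N)
  then obtain M where M: "N = r * M" by (elim dvdE)
  have "0 < N" using n_pos N by simp
  then show ?thesis using that[of M] M assms(2) by (simp add: mult.commute)
qed

text \<open>Multiples of \<open>r\<close> have period 1 modulo \<open>r\<close>; on the other
  classes the multiplier \<open>\<alpha> ^ s\<close> acts with period
  \<open>ord r \<alpha> div s\<close>.\<close>

lemma orbit_lengths_H1:
  assumes c: "cond1 N \<alpha> s r"
  shows "orbit_lengths \<Omega> (H1 \<Omega> (aff \<alpha> 0) (aff 1 1) s r) =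
    {#N div r#} + replicate_mset (s * (r - 1) div ord (int r) \<alpha>) (N div r * (ord (int r) \<alpha> div s))"
proof -
  have r: "prime (int r)" "int r dvd n" and s: "prime s" "s dvd ord (int r) \<alpha>"
    using c by (auto simp: cond1_iff[OF N])
  define m where "m = ord (int r) \<alpha>"
  have m: "0 < m" using ord_prime_pos[OF N r] by (simp add: m_def)
  obtain m' where m': "m = s * m'" using s(2) by (auto simp: m_def elim: dvdE)
  then have m'0: "0 < m'" and s0: "0 < s" using m by auto
  have r0: "0 < int r" "0 < r" using prime_pos[OF r(1)] by auto
  have Q: "stratum s 0 (int r) (\<lambda>x. int r dvd x) 1"
    unfolding stratum_def
  proof (intro conjI allI impI)
    fix x y i assume x: "int r dvd x" and y: "int r dvd y - iter s 0 i x"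
    show "int r dvd y" using iter_dvd_iff[OF dvd_refl r(2) dvd_0_right y] x by blast
  next
    fix x i assume "int r dvd x"
    then show "int r dvd iter s 0 i x - x \<longleftrightarrow> 1 dvd i" unfolding iter_linear by simp
  qed simp
  have R: "stratum s 0 (int r) (\<lambda>x. \<not> int r dvd x) m'"
    unfolding stratum_def
  proof (intro conjI allI impI)
    fix x y i assume x: "\<not> int r dvd x" and y: "int r dvd y - iter s 0 i x"
    show "\<not> int r dvd y" using iter_dvd_iff[OF dvd_refl r(2) dvd_0_right y] x by blast
  next
    fix x i assume x: "\<not> int r dvd x"
    have "int r dvd iter s 0 i x - x \<longleftrightarrow> int r dvd \<alpha> ^ (s * i) - 1"
      unfolding iter_linear using x r(1) by (simp add: prime_dvd_mult_iff)
    also have "\<dots> \<longleftrightarrow> m dvd s * i" unfolding m_def by (rule dvd_power_minus_1_iff_ord[OF r0(1)])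
    also have "\<dots> \<longleftrightarrow> m' dvd i" using s0 by (simp add: m')
    finally show "int r dvd iter s 0 i x - x \<longleftrightarrow> m' dvd i" .
  qed (rule m'0)
  obtain M where M: "N = M * r" "N div r = M" "0 < M" using div_eq_mult[OF r(2) r0(2)] .
  have "orbit_lengths \<Omega> (affmap (gen_sub s 0 (int r))) =
      replicate_mset (M div (M * 1)) (M * 1) + replicate_mset ((N - M) div (M * m')) (M * m')"
    using orbit_lengths_two_classes[OF r0(2) r(2) refl r0(2) r(2) Q R] M(2) by simp
  moreover have "(N - M) div (M * m') = s * (r - 1) div m"
    unfolding M(1) diff_div_mult[OF M(3)] m' using s0 by simp
  moreover have "m div s = m'" using m' s0 by simp
  ultimately show ?thesis using M(2,3) H1_eq_gen[OF r(2)] by (simp add: m_def)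
qed

text \<open>Modulo \<open>s * r\<close> the multiples of \<open>r\<close> have period
  \<open>s\<close>, the other points period \<open>ord r \<alpha>\<close>. Compared with item 1 the
  modulus is \<open>s\<close> times as large and so are the periods, whence the same
  lengths.\<close>

lemma orbit_lengths_H3:
  assumes c: "cond3 N \<alpha> s r"
  shows "orbit_lengths \<Omega> (H3 \<Omega> \<alpha> (aff \<alpha> 0) (aff 1 1) s r) =
    {#N div r#} + replicate_mset (s * (r - 1) div ord (int r) \<alpha>) (N div r * (ord (int r) \<alpha> div s))"
proof -
  have ok: "twisted_ok (int s) (int r)" using c by (simp add: cond3_iff[OF N])
  then have r: "prime (int r)" "int r dvd n" and s: "prime (int s)" "int s dvd n"
    and sm: "s dvd ord (int r) \<alpha>" and cop_m: "coprime (ord (int r) \<alpha>) (ord (int s) \<alpha>)"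
    by (auto simp: twisted_ok_def)
  note cop_sr = twisted_ok_coprime(1)[OF ok] and srn = twisted_ok_coprime(2)[OF ok]
  define m where "m = ord (int r) \<alpha>"
  define q where "q = ord (int s) \<alpha>"
  have m: "0 < m" using ord_prime_pos[OF N r] by (simp add: m_def)
  obtain m' where m': "m = s * m'" using sm by (auto simp: m_def elim: dvdE)
  then have s0: "0 < s" using m by auto
  have r0: "0 < int r" "0 < r" and s0': "0 < int s" using prime_pos[OF r(1)] prime_pos[OF s(1)] by auto
  define D where "D = int s * int r"
  have Dn: "D dvd n" and rD: "int r dvd D" using srn by (simp_all add: D_def)
  have inv: "int r dvd y \<longleftrightarrow> int r dvd x" if "D dvd y - iter q (int r) i x" for x y i
    by (rule iter_dvd_iff[OF rD Dn _ that]) simp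
  have per: "D dvd iter q (int r) i x - x \<longleftrightarrow> s dvd i \<and> (int r dvd x \<or> m dvd i)" for x i
  proof -
    have "D dvd iter q (int r) i x - x \<longleftrightarrow>
        int s dvd iter q (int r) i x - x \<and> int r dvd iter q (int r) i x - x"
      unfolding D_def using cop_sr by (meson divides_mult dvd_mult_left dvd_mult_right)
    \<comment> \<open>Modulo \<open>s\<close> the generator is the translation by
      \<open>r\<close>.\<close>
    moreover have "int s dvd iter q (int r) i x - x \<longleftrightarrow> s dvd i"
    proof -
      have sq: "int s dvd \<alpha> ^ q - 1" by (simp add: q_def dvd_power_minus_1_iff_ord[OF s0'])
      then have "int s dvd (\<alpha> ^ q) ^ i - 1" by (rule dvd_pow_minus_1)
      then have "int s dvd ((\<alpha> ^ q) ^ i - 1) * x + int r * (geo (\<alpha> ^ q) i - int i)"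
        using geo_cong_1[OF sq, of i] by (simp only: dvd_add dvd_mult dvd_mult2)
      moreover have "iter q (int r) i x - x = int r * int i +
          (((\<alpha> ^ q) ^ i - 1) * x + int r * (geo (\<alpha> ^ q) i - int i))"
        by (simp only: iter_def power_mult, simp add: algebra_simps)
      ultimately have "int s dvd iter q (int r) i x - x \<longleftrightarrow> int s dvd int r * int i"
        by (simp only: dvd_add_left_iff)
      also have "\<dots> \<longleftrightarrow> s dvd i" using cop_sr coprime_dvd_mult_right_iff[of "int s" "int r" "int i"] by simp
      finally show ?thesis .
    qed
    \<comment> \<open>Modulo \<open>r\<close> the generator is multiplication by
      \<open>\<alpha> ^ q\<close>, whose order is still \<open>m\<close> because \<open>q\<close> is
      coprime to \<open>m\<close>.\<close>
    moreover have "int r dvd iter q (int r) i x - x \<longleftrightarrow> int r dvd x \<or> m dvd i"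
    proof -
      have "iter q (int r) i x - x = (\<alpha> ^ (q * i) - 1) * x + int r * geo (\<alpha> ^ q) i"
        by (simp add: iter_def algebra_simps)
      then have "int r dvd iter q (int r) i x - x \<longleftrightarrow> int r dvd (\<alpha> ^ (q * i) - 1) * x"
        by (simp only: dvd_add_left_iff dvd_triv_left)
      also have "\<dots> \<longleftrightarrow> m dvd q * i \<or> int r dvd x"
        using r(1) by (simp add: prime_dvd_mult_iff dvd_power_minus_1_iff_ord[OF r0(1)] m_def)
      also have "m dvd q * i \<longleftrightarrow> m dvd i" using cop_m coprime_dvd_mult_right_iff[of m q i] by (simp add: m_def q_def)
      finally show ?thesis by blast
    qed
    ultimately show ?thesis by blast
  qed
  have sm': "s dvd m" by (simp add: m')
  have Q: "stratum q (int r) D (\<lambda>x. int r dvd x) s"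
    unfolding stratum_def per using inv s0 by blast
  have R: "stratum q (int r) D (\<lambda>x. \<not> int r dvd x) m"
    unfolding stratum_def per using inv m dvd_trans[OF sm'] by blast
  have Dd: "D = int (s * r)" "0 < s * r" using s0 r0 by (simp_all add: D_def)
  obtain M where M: "N = M * (s * r)" "N div (s * r) = M" "0 < M"
    by (rule div_eq_mult[of "s * r"]) (use Dd Dn in simp_all)
  have Nr: "N div r = M * s" using M(1) r0(2) by simp
  have lengths: "orbit_lengths \<Omega> (affmap (gen_sub q (int r) D)) =
      replicate_mset ((M * s) div (M * s)) (M * s) + replicate_mset ((N - M * s) div (M * m)) (M * m)"
    using orbit_lengths_two_classes[OF r0(2) r(2) Dd Dn Q R] M(2) Nr by simp
  have count: "(N - M * s) div (M * m) = s * (r - 1) div m"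
  proof -
    have "N - M * s = (M * s) * r - M * s" using M(1) by (simp add: mult.assoc)
    moreover have "M * m = (M * s) * m'" by (simp add: m')
    ultimately have "(N - M * s) div (M * m) = (r - 1) div m'" using M(3) s0 by (simp only: diff_div_mult[of "M * s"] mult_pos_pos)
    then show ?thesis using s0 by (simp add: m')
  qed
  have len: "M * m = M * s * (m div s)" using m' s0 by simp
  have one: "(M * s) div (M * s) = 1" using M(3) s0 by simp
  have H: "H3 \<Omega> \<alpha> (aff \<alpha> 0) (aff 1 1) s r = affmap (gen_sub q (int r) D)"
    using H3_eq_gen[of s r] Dn by (simp add: q_def D_def)
  show ?thesis
    unfolding H Nr m_def[symmetric] lengths count one unfolding len by simp
qed

lemma card_dvd_N: "0 < d \<Longrightarrow> int d dvd n \<Longrightarrow> card {x \<in> {0..<n}. int d dvd x} = N div d"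
  using card_dvd[of "int d"] nat_div by simp

text \<open>Three strata modulo \<open>r^2\<close>: multiples of \<open>r^2\<close> are fixed; other
  multiples of \<open>r\<close> see only \<alpha> modulo \<open>r\<close>; for the remaining points
  the period is the order of \<alpha> modulo \<open>r^2\<close>.\<close>

lemma orbit_lengths_H2_square:
  assumes c: "cond2 N r r"
  shows "orbit_lengths \<Omega> (H2 \<Omega> (aff \<alpha> 0) (aff 1 1) r r) =
    {#N div r\<^sup>2#} + replicate_mset ((r - 1) div ord (int r) \<alpha>) (N div r\<^sup>2 * ord (int r) \<alpha>) +
    replicate_mset (r * (r - 1) div ord (int (r\<^sup>2)) \<alpha>) (N div r\<^sup>2 * ord (int (r\<^sup>2)) \<alpha>)"
proof -
  have r: "prime (int r)" and rn: "int r * int r dvd n" using c by (auto simp: cond2_iff[OF N])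
  have r0: "0 < int r" "0 < r" using prime_pos[OF r] by auto
  define D where "D = int r * int r"
  have Dn: "D dvd n" and rD: "int r dvd D" using rn by (simp_all add: D_def)
  have D0: "0 < D" and Dd: "D = int (r\<^sup>2)" using r0 by (simp_all add: D_def power2_eq_square)
  have copD: "coprime D \<alpha>" using mults_coprime[OF mults_gen Dn] by (simp only: coprime_commute)
  define m where "m = ord (int r) \<alpha>"
  define q where "q = ord D \<alpha>"
  have "int r dvd n" by (rule dvd_trans[OF rD Dn])
  then have m: "0 < m" using ord_prime_pos[OF N r] by (simp add: m_def)
  have q: "0 < q" unfolding q_def by (rule ord_int_pos[OF D0 copD])
  have inv_r: "int r dvd y \<longleftrightarrow> int r dvd x" if "D dvd y - iter 1 0 i x" for x y i
    by (rule iter_dvd_iff[OF rD Dn _ that]) simp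
  have inv_D: "D dvd y \<longleftrightarrow> D dvd x" if "D dvd y - iter 1 0 i x" for x y i
    by (rule iter_dvd_iff[OF dvd_refl Dn _ that]) simp
  have per: "D dvd iter 1 0 i x - x \<longleftrightarrow> D dvd (\<alpha> ^ i - 1) * x" for i x
    using iter_linear[of 1 i x] by simp
  have Q1: "stratum 1 0 D (\<lambda>x. D dvd x) 1"
    unfolding stratum_def per
  proof (intro conjI allI impI)
    show "D dvd y" if "D dvd x" "D dvd y - iter 1 0 i x" for x y i using that inv_D by blast
    show "D dvd (\<alpha> ^ i - 1) * x \<longleftrightarrow> 1 dvd i" if "D dvd x" for x i using that by simp
  qed simp
  have Q2: "stratum 1 0 D (\<lambda>x. int r dvd x \<and> \<not> D dvd x) m"
    unfolding stratum_def
  proof (intro conjI allI impI)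
    show "int r dvd y" "\<not> D dvd y" if "int r dvd x \<and> \<not> D dvd x" "D dvd y - iter 1 0 i x" for x y i
      using that inv_r inv_D by blast+
    fix x i assume x: "int r dvd x \<and> \<not> D dvd x"
    obtain x' where x': "x = int r * x'" using x by (elim conjE dvdE)
    have "\<not> int r dvd x'" using x x' by (simp add: D_def)
    then have "D dvd (\<alpha> ^ i - 1) * x \<longleftrightarrow> int r dvd \<alpha> ^ i - 1"
      using r r0 by (simp add: x' D_def mult.left_commute[of _ "int r"] prime_dvd_mult_iff)
    then show "D dvd iter 1 0 i x - x \<longleftrightarrow> m dvd i"
      unfolding per m_def by (simp only: dvd_power_minus_1_iff_ord[OF r0(1)])
  qed (rule m)
  have Q3: "stratum 1 0 D (\<lambda>x. \<not> int r dvd x) q"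
    unfolding stratum_def
  proof (intro conjI allI impI)
    show "\<not> int r dvd y" if "\<not> int r dvd x" "D dvd y - iter 1 0 i x" for x y i
      using that inv_r by blast
    fix x i assume "\<not> int r dvd x"
    then have "coprime (int r) x" by (rule prime_imp_coprime[OF r])
    then have "coprime D x" by (simp add: D_def)
    then have "D dvd (\<alpha> ^ i - 1) * x \<longleftrightarrow> D dvd \<alpha> ^ i - 1" by (rule coprime_dvd_mult_left_iff)
    then show "D dvd iter 1 0 i x - x \<longleftrightarrow> q dvd i"
      unfolding per q_def by (simp only: dvd_power_minus_1_iff_ord[OF D0])
  qed (rule q)
  obtain M where M: "N = M * r\<^sup>2" "N div r\<^sup>2 = M" "0 < M"
    by (rule div_eq_mult[of "r\<^sup>2"]) (use Dd Dn r0 in simp_all)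
  have nD: "nat (n div D) = M" unfolding Dd nat_div by (rule M(2))
  have Nr: "N div r = M * r" using M(1) r0(2) by (simp add: power2_eq_square)
  let ?K = "affmap (gen_sub 1 0 D)"
  have cD: "card {x \<in> {0..<n}. D dvd x} = M" using card_dvd[OF D0 Dn] nD by simp
  have cr: "card {x \<in> {0..<n}. int r dvd x} = M * r" using card_dvd_N[OF r0(2) \<open>int r dvd n\<close>] Nr by simp
  have "{x \<in> {0..<n}. int r dvd x \<and> D dvd x} = {x \<in> {0..<n}. D dvd x}" using dvd_trans[OF rD] by blast
  then have c2: "card {x \<in> {0..<n}. int r dvd x \<and> \<not> D dvd x} = M * r - M"
    using card_Collect_diff[of "{0..<n}" "\<lambda>x. int r dvd x" "\<lambda>x. D dvd x"] cr cD by simp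
  have c3: "card {x \<in> {0..<n}. \<not> int r dvd x} = (M * r) * r - M * r"
  proof -
    have "nat n = (M * r) * r" unfolding N nat_int M(1) by (simp add: power2_eq_square mult.assoc)
    then show ?thesis
      by (simp only: card_Collect_not[OF finite_atLeastLessThan_int] cr card_atLeastLessThan_int diff_zero)
  qed
  have "e ` {x. D dvd x \<or> (int r dvd x \<and> \<not> D dvd x \<or> \<not> int r dvd x)} = \<Omega>"
    using e_range by (metis (no_types, lifting) Collect_cong UNIV_def)
  then have "orbit_lengths \<Omega> ?K = lengths_in ?K (e ` {x. D dvd x \<or> (int r dvd x \<and> \<not> D dvd x \<or> \<not> int r dvd x)})"
    by (simp only: orbit_lengths_eq)
  also have "\<dots> = lengths_in ?K (e ` {x. D dvd x}) +
      lengths_in ?K (e ` {x. int r dvd x \<and> \<not> D dvd x \<or> \<not> int r dvd x})"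
  proof (rule lengths_in_stratum_Un[OF D0 Dn Q1])
    show "int r dvd y \<and> \<not> D dvd y \<or> \<not> int r dvd y"
      if "int r dvd x \<and> \<not> D dvd x \<or> \<not> int r dvd x" "n dvd y - x" for x y
      using that stratum_periodic[OF Dn Q2] stratum_periodic[OF Dn Q3] by blast
    show "\<not> (int r dvd x \<and> \<not> D dvd x \<or> \<not> int r dvd x)" if "D dvd x" for x
      using that dvd_trans[OF rD] by blast
  qed
  also have "lengths_in ?K (e ` {x. int r dvd x \<and> \<not> D dvd x \<or> \<not> int r dvd x}) =
      lengths_in ?K (e ` {x. int r dvd x \<and> \<not> D dvd x}) + lengths_in ?K (e ` {x. \<not> int r dvd x})"
    by (rule lengths_in_stratum_Un[OF D0 Dn Q2 stratum_periodic[OF Dn Q3]]) auto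
  finally have "orbit_lengths \<Omega> ?K = replicate_mset (M div (M * 1)) (M * 1) +
      (replicate_mset ((M * r - M) div (M * m)) (M * m) +
       replicate_mset (((M * r) * r - M * r) div (M * q)) (M * q))"
    by (simp only: lengths_in_stratum[OF D0 Dn Q1] lengths_in_stratum[OF D0 Dn Q2]
        lengths_in_stratum[OF D0 Dn Q3] nD cD c2 c3)
  moreover have "(M * r - M) div (M * m) = (r - 1) div m" by (rule diff_div_mult[OF M(3)])
  moreover have "((M * r) * r - M * r) div (M * q) = r * (r - 1) div q"
  proof -
    have "(M * r) * r - M * r = M * (r * (r - 1))" by (simp add: diff_mult_distrib2)
    then show ?thesis using M(3) by simp
  qed
  moreover have "int (r * r) dvd n" using rn by simp
  ultimately show ?thesis using M(2,3) H2_eq_gen[of r r] by (simp add: m_def q_def D_def power2_eq_square)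
qed

text \<open>The four strata are given by divisibility by \<open>s\<close> and by \<open>r\<close>; a
  prime dividing the point removes its own condition on the period.\<close>

lemma orbit_lengths_H2_distinct:
  assumes c: "cond2 N s r" and sr: "s \<noteq> r"
  shows "orbit_lengths \<Omega> (H2 \<Omega> (aff \<alpha> 0) (aff 1 1) s r) =
    {#N div (s * r)#} +
    replicate_mset ((r - 1) div ord (int r) \<alpha>) (N div (s * r) * ord (int r) \<alpha>) +
    replicate_mset ((s - 1) div ord (int s) \<alpha>) (N div (s * r) * ord (int s) \<alpha>) +
    replicate_mset ((s - 1) * (r - 1) div ord (int (s * r)) \<alpha>) (N div (s * r) * ord (int (s * r)) \<alpha>)"
proof -
  have r: "prime (int r)" and s: "prime (int s)" and srn: "int s * int r dvd n"
    using c by (auto simp: cond2_iff[OF N])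
  have r0: "0 < int r" "0 < r" and s0: "0 < int s" "0 < s" using prime_pos[OF r] prime_pos[OF s] by auto
  have cop: "coprime (int s) (int r)" by (rule primes_coprime[OF s r]) (use sr in simp)
  define D where "D = int s * int r"
  have Dn: "D dvd n" and rD: "int r dvd D" and sD: "int s dvd D" using srn by (simp_all add: D_def)
  have D0: "0 < D" and Dd: "D = int (s * r)" using r0 s0 by (simp_all add: D_def)
  have rn: "int r dvd n" and sn: "int s dvd n" by (rule dvd_trans[OF rD Dn], rule dvd_trans[OF sD Dn])
  have D_iff: "D dvd x \<longleftrightarrow> int s dvd x \<and> int r dvd x" for x
    unfolding D_def using cop by (meson divides_mult dvd_mult_left dvd_mult_right)
  have copD: "coprime D \<alpha>" using mults_coprime[OF mults_gen Dn] by (simp only: coprime_commute)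
  define m where "m = ord (int r) \<alpha>"
  define m' where "m' = ord (int s) \<alpha>"
  define q where "q = ord D \<alpha>"
  have m: "0 < m" "0 < m'" using ord_prime_pos[OF N r rn] ord_prime_pos[OF N s sn] by (simp_all add: m_def m'_def)
  have q: "0 < q" unfolding q_def by (rule ord_int_pos[OF D0 copD])
  have inv_r: "int r dvd y \<longleftrightarrow> int r dvd x" if "D dvd y - iter 1 0 i x" for x y i
    by (rule iter_dvd_iff[OF rD Dn _ that]) simp
  have inv_s: "int s dvd y \<longleftrightarrow> int s dvd x" if "D dvd y - iter 1 0 i x" for x y i
    by (rule iter_dvd_iff[OF sD Dn _ that]) simp
  have per: "D dvd iter 1 0 i x - x \<longleftrightarrow> (m' dvd i \<or> int s dvd x) \<and> (m dvd i \<or> int r dvd x)" for i x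
  proof -
    have "D dvd iter 1 0 i x - x \<longleftrightarrow> int s dvd (\<alpha> ^ i - 1) * x \<and> int r dvd (\<alpha> ^ i - 1) * x"
      using iter_linear[of 1 i x] by (simp add: D_iff)
    then show ?thesis
      using r s by (simp add: prime_dvd_mult_iff dvd_power_minus_1_iff_ord[OF r0(1)]
          dvd_power_minus_1_iff_ord[OF s0(1)] m_def m'_def)
  qed
  \<comment> \<open>The order modulo \<open>s * r\<close> is the least common multiple of the two
    orders, expressed through divisibility.\<close>
  have q_iff: "q dvd i \<longleftrightarrow> m' dvd i \<and> m dvd i" for i
    unfolding q_def m_def m'_def dvd_power_minus_1_iff_ord[OF D0, symmetric]
      dvd_power_minus_1_iff_ord[OF r0(1), symmetric] dvd_power_minus_1_iff_ord[OF s0(1), symmetric]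
    by (rule D_iff)
  have Q1: "stratum 1 0 D (\<lambda>x. int s dvd x \<and> int r dvd x) 1"
    unfolding stratum_def per using inv_r inv_s one_dvd zero_less_one by blast
  have Q2: "stratum 1 0 D (\<lambda>x. int s dvd x \<and> \<not> int r dvd x) m"
    unfolding stratum_def per using inv_r inv_s m by blast
  have Q3: "stratum 1 0 D (\<lambda>x. int r dvd x \<and> \<not> int s dvd x) m'"
    unfolding stratum_def per using inv_r inv_s m by blast
  have Q4: "stratum 1 0 D (\<lambda>x. \<not> int s dvd x \<and> \<not> int r dvd x) q"
    unfolding stratum_def per q_iff using inv_r inv_s q by blast
  obtain M where M: "N = M * (s * r)" "N div (s * r) = M" "0 < M"
    by (rule div_eq_mult[of "s * r"]) (use Dd Dn r0 s0 in simp_all)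
  have nD: "nat (n div D) = M" unfolding Dd nat_div by (rule M(2))
  have Nr: "N div r = M * s" and Ns: "N div s = M * r" using M(1) r0(2) s0(2) by (simp_all add: mult.commute mult.left_commute)
  let ?K = "affmap (gen_sub 1 0 D)"
  let ?I = "{0..<n}"
  have c1: "card {x \<in> ?I. int s dvd x \<and> int r dvd x} = M"
    using card_dvd[OF D0 Dn] nD by (simp only: D_iff)
  then have c1': "card {x \<in> ?I. int r dvd x \<and> int s dvd x} = M" by (simp only: conj_commute)
  have cr: "card {x \<in> ?I. int r dvd x} = M * s" using card_dvd_N[OF r0(2) rn] Nr by simp
  have cs: "card {x \<in> ?I. int s dvd x} = M * r" using card_dvd_N[OF s0(2) sn] Ns by simp
  have c2: "card {x \<in> ?I. int s dvd x \<and> \<not> int r dvd x} = M * r - M"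
    using card_Collect_diff[of ?I "\<lambda>x. int s dvd x" "\<lambda>x. int r dvd x"] cs c1 by simp
  have c3: "card {x \<in> ?I. int r dvd x \<and> \<not> int s dvd x} = M * s - M"
    using card_Collect_diff[of ?I "\<lambda>x. int r dvd x" "\<lambda>x. int s dvd x"] cr c1' by simp
  have cns: "card {x \<in> ?I. \<not> int s dvd x} = M * (s * r) - M * r"
  proof -
    have "nat n = M * (s * r)" unfolding N nat_int by (rule M(1))
    then show ?thesis
      by (simp only: card_Collect_not[OF finite_atLeastLessThan_int] cs card_atLeastLessThan_int diff_zero)
  qed
  have c4: "card {x \<in> ?I. \<not> int s dvd x \<and> \<not> int r dvd x} = M * ((s - 1) * (r - 1))"
  proof -
    have "{x \<in> ?I. \<not> int s dvd x \<and> int r dvd x} = {x \<in> ?I. int r dvd x \<and> \<not> int s dvd x}" by blast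
    then have "card {x \<in> ?I. \<not> int s dvd x \<and> \<not> int r dvd x} = (M * (s * r) - M * r) - (M * s - M)"
      using card_Collect_diff[of ?I "\<lambda>x. \<not> int s dvd x" "\<lambda>x. int r dvd x"] cns c3 by simp
    also have "\<dots> = M * ((s - 1) * (r - 1))"
      using r0 s0 by (cases s; cases r) (simp_all add: algebra_simps)
    finally show ?thesis .
  qed
  \<comment> \<open>Opaque names for the two divisibility conditions, so that the splitting into
    strata is purely propositional.\<close>
  define P where "P x \<longleftrightarrow> int s dvd x" for x
  define R where "R x \<longleftrightarrow> int r dvd x" for x
  note PR = P_def[symmetric] R_def[symmetric]
  note Qs = Q1[unfolded PR] Q2[unfolded PR] Q3[unfolded PR] Q4[unfolded PR]
  note pers = stratum_periodic[OF Dn Qs(2)] stratum_periodic[OF Dn Qs(3)] stratum_periodic[OF Dn Qs(4)]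
  have "{x. P x \<and> R x \<or> (P x \<and> \<not> R x \<or> (R x \<and> \<not> P x \<or> \<not> P x \<and> \<not> R x))} = UNIV" by blast
  then have "e ` {x. P x \<and> R x \<or> (P x \<and> \<not> R x \<or> (R x \<and> \<not> P x \<or> \<not> P x \<and> \<not> R x))} = \<Omega>"
    using e_range by simp
  then have "orbit_lengths \<Omega> ?K =
      lengths_in ?K (e ` {x. P x \<and> R x \<or> (P x \<and> \<not> R x \<or> (R x \<and> \<not> P x \<or> \<not> P x \<and> \<not> R x))})"
    by (simp only: orbit_lengths_eq)
  also have "\<dots> = lengths_in ?K (e ` {x. P x \<and> R x}) +
      lengths_in ?K (e ` {x. P x \<and> \<not> R x \<or> (R x \<and> \<not> P x \<or> \<not> P x \<and> \<not> R x)})"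
  proof (rule lengths_in_stratum_Un[OF D0 Dn Qs(1)])
    show "P y \<and> \<not> R y \<or> (R y \<and> \<not> P y \<or> \<not> P y \<and> \<not> R y)"
      if "P x \<and> \<not> R x \<or> (R x \<and> \<not> P x \<or> \<not> P x \<and> \<not> R x)" "n dvd y - x" for x y
      using that pers by blast
  qed blast
  also have "lengths_in ?K (e ` {x. P x \<and> \<not> R x \<or> (R x \<and> \<not> P x \<or> \<not> P x \<and> \<not> R x)}) =
      lengths_in ?K (e ` {x. P x \<and> \<not> R x}) + lengths_in ?K (e ` {x. R x \<and> \<not> P x \<or> \<not> P x \<and> \<not> R x})"
  proof (rule lengths_in_stratum_Un[OF D0 Dn Qs(2)])
    show "R y \<and> \<not> P y \<or> \<not> P y \<and> \<not> R y" if "R x \<and> \<not> P x \<or> \<not> P x \<and> \<not> R x" "n dvd y - x" for x y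
      using that pers by blast
  qed blast
  also have "lengths_in ?K (e ` {x. R x \<and> \<not> P x \<or> \<not> P x \<and> \<not> R x}) =
      lengths_in ?K (e ` {x. R x \<and> \<not> P x}) + lengths_in ?K (e ` {x. \<not> P x \<and> \<not> R x})"
    by (rule lengths_in_stratum_Un[OF D0 Dn Qs(3) pers(3)]) auto
  finally have "orbit_lengths \<Omega> ?K = replicate_mset (M div (M * 1)) (M * 1) +
      (replicate_mset ((M * r - M) div (M * m)) (M * m) +
       (replicate_mset ((M * s - M) div (M * m')) (M * m') +
        replicate_mset (M * ((s - 1) * (r - 1)) div (M * q)) (M * q)))"
    by (simp only: lengths_in_stratum[OF D0 Dn Qs(1)] lengths_in_stratum[OF D0 Dn Qs(2)]
        lengths_in_stratum[OF D0 Dn Qs(3)] lengths_in_stratum[OF D0 Dn Qs(4)] nD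
        c1[unfolded PR] c2[unfolded PR] c3[unfolded PR] c4[unfolded PR])
  moreover have "(M * r - M) div (M * m) = (r - 1) div m" "(M * s - M) div (M * m') = (s - 1) div m'"
    by (rule diff_div_mult[OF M(3)])+
  moreover have "M * ((s - 1) * (r - 1)) div (M * q) = (s - 1) * (r - 1) div q" using M(3) by simp
  moreover have "int (s * r) dvd n" using srn by simp
  ultimately show ?thesis
    using M(2,3) H2_eq_gen[of s r] by (simp add: m_def m'_def q_def D_def)
qed

text \<open>Modulo 4 every point has period 2, modulo \<open>r\<close> the period is 1 or
  \<open>ord r \<alpha>\<close>; so the strata have periods 2 and
  \<open>lcm 2 (ord r \<alpha>)\<close>. This lcm is the origin of the gcd in the formula.\<close>

lemma orbit_lengths_H4:
  assumes c: "cond4 N \<alpha> r"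
  shows "orbit_lengths \<Omega> (H4 \<Omega> (aff \<alpha> 0) (aff 1 1) r) =
    replicate_mset 2 (N div (2 * r)) +
    replicate_mset (2 * (r - 1) * gcd 2 (ord (int r) \<alpha>) div ord (int r) \<alpha>)
      (N div (2 * r) * (ord (int r) \<alpha> div gcd 2 (ord (int r) \<alpha>)))"
proof -
  have r: "prime (int r)" "odd (int r)" "int r dvd n" and \<alpha>4: "4 dvd \<alpha> + 1"
    using c by (auto simp: cond4_iff[OF N])
  have r0: "0 < int r" "0 < r" using prime_pos[OF r(1)] by auto
  define D where "D = 4 * int r"
  have Dn: "D dvd n" and rD: "int r dvd D" using H4_eq(2)[OF N c] by (simp_all add: D_def)
  have Dd: "D = int (4 * r)" "0 < 4 * r" using r0 by (simp_all add: D_def)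
  have "coprime (2\<^sup>2) (int r)" using r(2) by (simp only: coprime_power_left_iff) (simp add: coprime_left_2_iff_odd)
  then have cop4: "coprime 4 (int r)" by simp
  define m where "m = ord (int r) \<alpha>"
  have m: "0 < m" using ord_prime_pos[OF N r(1,3)] by (simp add: m_def)
  define g where "g = gcd 2 m"
  have "g dvd m" by (simp add: g_def)
  then obtain m' where m': "m = g * m'" by (elim dvdE)
  have g0: "0 < g" unfolding g_def by simp
  have m'0: "0 < m'" using m m' by (metis gr0I mult_0_right)
  define l where "l = 2 * m'"
  have l: "l dvd i \<longleftrightarrow> 2 dvd i \<and> m dvd i" for i
  proof -
    have "g * lcm 2 m = 2 * (g * m')"
      unfolding g_def m'[unfolded g_def, symmetric] by (rule prod_gcd_lcm_nat[symmetric])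
    then have "g * lcm 2 m = g * l" by (simp add: l_def mult.left_commute)
    then have "lcm 2 m = l" using g0 by simp
    then show ?thesis by (metis lcm_least_iff)
  qed
  have inv: "int r dvd y \<longleftrightarrow> int r dvd x" if "D dvd y - iter 1 (int r) i x" for x y i
    by (rule iter_dvd_iff[OF rD Dn _ that]) simp
  have per: "D dvd iter 1 (int r) i x - x \<longleftrightarrow> 2 dvd i \<and> (int r dvd x \<or> m dvd i)" for x i
  proof -
    have it: "iter 1 (int r) i x - x = (\<alpha> ^ i - 1) * x + int r * geo \<alpha> i" by (simp add: iter_def algebra_simps)
    have "D dvd iter 1 (int r) i x - x \<longleftrightarrow> 4 dvd iter 1 (int r) i x - x \<and> int r dvd iter 1 (int r) i x - x"
      unfolding D_def using cop4 by (meson divides_mult dvd_mult_left dvd_mult_right)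
    moreover have "4 dvd iter 1 (int r) i x - x \<longleftrightarrow> 2 dvd i"
    proof (cases "even i")
      case True
      have "4 dvd iter 1 (int r) i x - x"
        by (rule dvd_lin2[OF pow_alpha_mod(1)[OF \<alpha>4 True] geo_alternating(1)[OF \<alpha>4 True], where p = x and q = "int r"])
           (simp only: it, simp add: algebra_simps)
      then show ?thesis using True by simp
    next
      case False
      have "4 dvd (\<alpha> ^ i + 1) * x + int r * (geo \<alpha> i - 1)"
        using pow_alpha_mod(2)[OF \<alpha>4 False] geo_alternating(2)[OF \<alpha>4 False] by simp
      then have "even ((\<alpha> ^ i + 1) * x + int r * (geo \<alpha> i - 1))" by (rule dvd_trans[rotated]) simp
      \<comment> \<open>For an odd exponent the iterate is \<open>r - x\<close> modulo 4, and the
        displacement \<open>r - 2 * x\<close> is odd.\<close>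
      moreover have "iter 1 (int r) i x - x = ((\<alpha> ^ i + 1) * x + int r * (geo \<alpha> i - 1)) + (int r - 2 * x)"
        by (simp only: it, simp add: algebra_simps)
      ultimately have "odd (iter 1 (int r) i x - x)" using r(2) by (simp only: even_add) simp
      moreover have "even z" if "4 dvd z" for z :: int by (rule dvd_trans[OF _ that]) simp
      ultimately have "\<not> 4 dvd iter 1 (int r) i x - x" by blast
      then show ?thesis using False by simp
    qed
    moreover have "int r dvd iter 1 (int r) i x - x \<longleftrightarrow> int r dvd x \<or> m dvd i"
    proof -
      have "int r dvd iter 1 (int r) i x - x \<longleftrightarrow> int r dvd (\<alpha> ^ i - 1) * x"
        unfolding it by (simp only: dvd_add_left_iff dvd_triv_left)
      also have "\<dots> \<longleftrightarrow> m dvd i \<or> int r dvd x"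
        using r(1) by (simp add: prime_dvd_mult_iff dvd_power_minus_1_iff_ord[OF r0(1)] m_def)
      finally show ?thesis by blast
    qed
    ultimately show ?thesis by blast
  qed
  have Q: "stratum 1 (int r) D (\<lambda>x. int r dvd x) 2"
    unfolding stratum_def per using inv pos2 by blast
  have "0 < l" using m'0 by (simp add: l_def)
  then have R: "stratum 1 (int r) D (\<lambda>x. \<not> int r dvd x) l"
    unfolding stratum_def per l using inv by blast
  obtain M where M: "N = M * (4 * r)" "N div (4 * r) = M" "0 < M"
    by (rule div_eq_mult[of "4 * r"]) (use Dd Dn in simp_all)
  have "N = (M * 4) * r" "N = (M * 2) * (2 * r)" using M(1) by simp_all
  then have Nr: "N div r = M * 4" and N2: "N div (2 * r) = M * 2" using r0(2) by (metis nonzero_mult_div_cancel_right not_gr_zero mult_eq_0_iff zero_neq_numeral)+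
  have "orbit_lengths \<Omega> (affmap (gen_sub 1 (int r) D)) =
      replicate_mset ((M * 4) div (M * 2)) (M * 2) + replicate_mset ((N - M * 4) div (M * l)) (M * l)"
    using orbit_lengths_two_classes[OF r0(2) r(3) Dd Dn Q R] M(2) Nr by simp
  moreover have "(M * 4) div (M * 2) = 2" using M(3) by simp
  moreover have "(N - M * 4) div (M * l) = 2 * (r - 1) * g div m"
  proof -
    have "N - M * 4 = (M * 2) * (2 * (r - 1))" using M(1) by (simp add: diff_mult_distrib2)
    moreover have "M * l = (M * 2) * m'" by (simp add: l_def)
    ultimately have "(N - M * 4) div (M * l) = 2 * (r - 1) div m'" using M(3) by simp
    moreover have "2 * (r - 1) * g div m = 2 * (r - 1) div m'"
      unfolding m' using g0 by (simp add: mult.commute[of _ g])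
    ultimately show ?thesis by simp
  qed
  moreover have "M * l = M * 2 * (m div g)" using m' g0 by (simp add: l_def)
  moreover have "int (4 * r) dvd n" using Dn Dd by simp
  ultimately show ?thesis using H4_eq_gen[of r] N2 by (simp add: m_def g_def D_def)
qed

lemma orbit_lengths_H5:
  assumes c: "cond5 N \<alpha>"
  shows "orbit_lengths \<Omega> (H5 \<Omega> (aff \<alpha> 0) (aff 1 1)) = replicate_mset 4 (N div 4)"
proof -
  have n4: "4 dvd n" and \<alpha>4: "4 dvd \<alpha> + 1" using c by (auto simp: cond5_iff[OF N])
  have "4 dvd iter 2 0 i x - x" for i x
  proof -
    have "4 dvd \<alpha> ^ (2 * i) - 1" by (rule pow_alpha_mod(1)[OF \<alpha>4]) simp
    then show ?thesis by (simp add: iter_linear)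
  qed
  then have Q: "stratum 2 0 4 (\<lambda>x. True) 1" by (simp add: stratum_def)
  obtain M where M: "N = M * 4" "N div 4 = M" "0 < M"
    by (rule div_eq_mult[of 4]) (use n4 in simp_all)
  have "nat (n div 4) = M" using nat_div[of 4] M(2) by simp
  then have "orbit_lengths \<Omega> (affmap (gen_sub 2 0 4)) = replicate_mset (N div (M * 1)) (M * 1)"
    using orbit_lengths_stratum[OF _ n4 Q] N by simp
  then show ?thesis using M H5_eq_gen[OF n4] by simp
qed

text \<open>Modulo 8 the first generator is the reflection \<open>x -> 1 - x\<close>, which fixes no
  class; so every point has period 2.\<close>

lemma orbit_lengths_H6:
  assumes c: "cond6 N \<alpha>"
  shows "orbit_lengths \<Omega> (H6 \<Omega> (aff \<alpha> 0) (aff 1 1)) = replicate_mset 4 (N div 4)"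
proof -
  have n8: "8 dvd n" and \<alpha>8: "8 dvd \<alpha> + 1" using c by (auto simp: cond6_iff[OF N])
  have "8 dvd iter 1 1 i x - x \<longleftrightarrow> 2 dvd i" for i x
  proof -
    have it: "iter 1 1 i x - x = (\<alpha> ^ i - 1) * x + geo \<alpha> i" by (simp add: iter_def algebra_simps)
    show ?thesis
    proof (cases "even i")
      case True
      have "8 dvd iter 1 1 i x - x"
        by (rule dvd_lin2[OF pow_alpha_mod(1)[OF \<alpha>8 True] geo_alternating(1)[OF \<alpha>8 True], where p = x and q = 1])
           (simp only: it, simp add: algebra_simps)
      then show ?thesis using True by simp
    next
      case False
      have "8 dvd (\<alpha> ^ i + 1) * x + (geo \<alpha> i - 1)"
        using pow_alpha_mod(2)[OF \<alpha>8 False] geo_alternating(2)[OF \<alpha>8 False] by simp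
      then have "even ((\<alpha> ^ i + 1) * x + (geo \<alpha> i - 1))" by (rule dvd_trans[rotated]) simp
      moreover have "iter 1 1 i x - x = ((\<alpha> ^ i + 1) * x + (geo \<alpha> i - 1)) + (1 - 2 * x)"
        by (simp only: it, simp add: algebra_simps)
      ultimately have "odd (iter 1 1 i x - x)" by (simp only: even_add) simp
      moreover have "even z" if "8 dvd z" for z :: int by (rule dvd_trans[OF _ that]) simp
      ultimately have "\<not> 8 dvd iter 1 1 i x - x" by blast
      then show ?thesis using False by simp
    qed
  qed
  then have Q: "stratum 1 1 8 (\<lambda>x. True) 2" by (simp add: stratum_def)
  obtain M where M: "N = M * 8" "N div 8 = M" "0 < M"
    by (rule div_eq_mult[of 8]) (use n8 in simp_all)
  have "nat (n div 8) = M" using nat_div[of 8] M(2) by simp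
  then have "orbit_lengths \<Omega> (affmap (gen_sub 1 1 8)) = replicate_mset (N div (M * 2)) (M * 2)"
    using orbit_lengths_stratum[OF _ n8 Q] N by simp
  moreover have "N div (M * 2) = 4" "M * 2 = N div 4" using M by simp_all
  ultimately show ?thesis using H6_eq_gen[OF n8] by simp
qed

end

section \<open>Conjugacy and maximality of the listed permutation groups\<close>

lemma entry_affsub: "entry i S \<Longrightarrow> affsub S"
  using entry_second_maximal[of i S]
  by (auto simp: second_maximal_def maximal_closed_def intro: affclosed_sub)

lemma ex1_listed_conjugate:
  assumes N: "n = int N" and H: "second_maximal_relatively_closed \<Omega> (affmap full) H"
  shows "\<exists>!(i, K). listed \<Omega> N \<alpha> (aff \<alpha> 0) (aff 1 1) i K \<and> conjugate_by \<Omega> Hol H K"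
proof -
  obtain S where S: "affsub S" "second_maximal S" "H = affmap S"
    using second_maximal_imp_affmap[OF H] by blast
  have iff: "listed \<Omega> N \<alpha> (aff \<alpha> 0) (aff 1 1) i K \<and> conjugate_by \<Omega> Hol H K \<longleftrightarrow>
      (\<exists>v z. coprime v n \<and> entry i (aff_conj v z S) \<and> K = affmap (aff_conj v z S))" for i K
  proof
    assume "listed \<Omega> N \<alpha> (aff \<alpha> 0) (aff 1 1) i K \<and> conjugate_by \<Omega> Hol H K"
    then obtain T v z where T: "entry i T" "K = affmap T" and v: "coprime v n" "K = affmap (aff_conj v z S)"
      using listed_iff_entry[OF N] conjugate_by_Hol[OF S(1)] S(3) by auto
    have "T = aff_conj v z S"
      using affmap_eq_iff[OF entry_affsub[OF T(1)] affsub_aff_conj[OF S(1)]] T(2) v(2) by metis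
    then show "\<exists>v z. coprime v n \<and> entry i (aff_conj v z S) \<and> K = affmap (aff_conj v z S)"
      using T(1) v by blast
  next
    assume "\<exists>v z. coprime v n \<and> entry i (aff_conj v z S) \<and> K = affmap (aff_conj v z S)"
    then show "listed \<Omega> N \<alpha> (aff \<alpha> 0) (aff 1 1) i K \<and> conjugate_by \<Omega> Hol H K"
      using listed_iff_entry[OF N] conjugate_by_Hol[OF S(1)] S(3) by auto
  qed
  obtain i v z where i: "coprime v n" "entry i (aff_conj v z S)"
    using second_maximal_conj_entry[OF S(2)] by (auto simp: conj_entry_def)
  \<comment> \<open>Two entries conjugate to the same group are conjugate to each other, so they
    share their invariants and \<open>entry_unique\<close> applies.\<close>
  have unique: "j = i \<and> K = affmap (aff_conj v z S)"
    if "coprime v' n \<and> entry j (aff_conj v' z' S) \<and> K = affmap (aff_conj v' z' S)" for j K v' z'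
    using entry_unique[OF _ i(2), of j "aff_conj v' z' S"] that
      same_invariants_sym_conj[OF S(1)] i(1) by metis
  show ?thesis
  proof (rule ex1I[of _ "(i, affmap (aff_conj v z S))"])
    show "case (i, affmap (aff_conj v z S)) of (i, K) \<Rightarrow>
        listed \<Omega> N \<alpha> (aff \<alpha> 0) (aff 1 1) i K \<and> conjugate_by \<Omega> Hol H K"
      unfolding prod.case iff using i by blast
    fix p
    assume "case p of (i, K) \<Rightarrow> listed \<Omega> N \<alpha> (aff \<alpha> 0) (aff 1 1) i K \<and> conjugate_by \<Omega> Hol H K"
    then show "p = (i, affmap (aff_conj v z S))"
      using unique unfolding case_prod_beta iff by (metis prod.collapse)
  qed
qed

lemma listed_second_maximal:
  assumes N: "n = int N" and "listed \<Omega> N \<alpha> (aff \<alpha> 0) (aff 1 1) i K"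
  shows "second_maximal_relatively_closed \<Omega> (affmap full) K"
proof -
  obtain S where "entry i S" "K = affmap S" using assms listed_iff_entry[OF N] by blast
  then show ?thesis using second_maximal_affmap[OF entry_affsub] entry_second_maximal by simp
qed

lemma generate_full: "generate (BijGroup \<Omega>) {aff \<alpha> 0, aff 1 1} = affmap full"
proof -
  have "gen_sub 1 0 1 = full" unfolding gen_sub_point_stab by (simp add: point_stab_def full_def)
  then show ?thesis using generate_gen_sub[of 1 1 0] by simp
qed

end

section \<open>Cyclic regular normal subgroups\<close>

text \<open>Conjugation by \<open>a\<close> is a homomorphism, so it multiplies every exponent by
  \<alpha>. The form without inverse can be evaluated at the base point, which \<open>a\<close>
  fixes.\<close>

lemma conjugate_int_pow:
  assumes "group G" and a: "a \<in> carrier G" and w: "w \<in> carrier G"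
    and rel: "a \<otimes>\<^bsub>G\<^esub> w \<otimes>\<^bsub>G\<^esub> inv\<^bsub>G\<^esub> a = w [^]\<^bsub>G\<^esub> (\<alpha>::int)"
  shows "a \<otimes>\<^bsub>G\<^esub> w [^]\<^bsub>G\<^esub> (x::int) = w [^]\<^bsub>G\<^esub> (\<alpha> * x) \<otimes>\<^bsub>G\<^esub> a"
proof -
  interpret group G by fact
  let ?c = "\<lambda>g. a \<otimes>\<^bsub>G\<^esub> g \<otimes>\<^bsub>G\<^esub> inv\<^bsub>G\<^esub> a"
  have "?c g \<otimes>\<^bsub>G\<^esub> ?c h = ?c (g \<otimes>\<^bsub>G\<^esub> h)" if "g \<in> carrier G" "h \<in> carrier G" for g h
    using that a by (simp add: m_assoc inv_solve_left')
  then have "?c \<in> hom G G" using a by (simp add: hom_def)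
  then have "group_hom G G ?c" by (simp add: group_hom_def group_hom_axioms_def)
  then have "?c (w [^]\<^bsub>G\<^esub> x) = (w [^]\<^bsub>G\<^esub> \<alpha>) [^]\<^bsub>G\<^esub> x"
    using group_hom.hom_int_pow[of G G ?c w x] w rel by simp
  then have "?c (w [^]\<^bsub>G\<^esub> x) = w [^]\<^bsub>G\<^esub> (\<alpha> * x)" using w by (simp add: int_pow_pow)
  then show ?thesis using a w by (metis int_pow_closed inv_closed inv_solve_right' m_closed)
qed

theorem theorem8p2:
  fixes \<Omega> :: "'a set" and \<omega> :: 'a
    and G W A :: "('a \<Rightarrow> 'a) set" and a w :: "'a \<Rightarrow> 'a"
    and n :: nat and \<alpha> :: int
  assumes "finite \<Omega>" and "\<omega> \<in> \<Omega>"
    and "a \<in> carrier (BijGroup \<Omega>)" and "w \<in> carrier (BijGroup \<Omega>)"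
    and "G = generate (BijGroup \<Omega>) {a, w}"
    and "W = generate (BijGroup \<Omega>) {w}"
    and "W \<lhd> perm_group \<Omega> G" and "regular_on \<Omega> W" and "card W = n"
    and "A = generate (BijGroup \<Omega>) {a}"
    and "A = stabilizer (perm_group \<Omega> G) (\<lambda>g. g) \<omega>"
    and "a \<otimes>\<^bsub>BijGroup \<Omega>\<^esub> w \<otimes>\<^bsub>BijGroup \<Omega>\<^esub> inv\<^bsub>BijGroup \<Omega>\<^esub> a = w [^]\<^bsub>BijGroup \<Omega>\<^esub> \<alpha>"
  shows
    "(\<forall>H. second_maximal_relatively_closed \<Omega> G H \<longrightarrow>
        (\<exists>!(i, K). listed \<Omega> n \<alpha> a w i K \<and> conjugate_by \<Omega> (holomorph \<Omega> \<omega> W) H K)) \<and>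
     (\<forall>i K. listed \<Omega> n \<alpha> a w i K \<longrightarrow> second_maximal_relatively_closed \<Omega> G K) \<and>
     (\<forall>s r. cond1 n \<alpha> s r \<longrightarrow>
        orbit_lengths \<Omega> (H1 \<Omega> a w s r) =
          {#n div r#} +
          replicate_mset (s * (r - 1) div ord (int r) \<alpha>) (n div r * (ord (int r) \<alpha> div s))) \<and>
     (\<forall>s r. cond3 n \<alpha> s r \<longrightarrow>
        orbit_lengths \<Omega> (H3 \<Omega> \<alpha> a w s r) =
          {#n div r#} +
          replicate_mset (s * (r - 1) div ord (int r) \<alpha>) (n div r * (ord (int r) \<alpha> div s))) \<and>
     (\<forall>s r. cond2 n s r \<and> s = r \<longrightarrow>
        orbit_lengths \<Omega> (H2 \<Omega> a w s r) =
          {#n div r\<^sup>2#} +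
          replicate_mset ((r - 1) div ord (int r) \<alpha>) (n div r\<^sup>2 * ord (int r) \<alpha>) +
          replicate_mset (r * (r - 1) div ord (int (r\<^sup>2)) \<alpha>)
            (n div r\<^sup>2 * ord (int (r\<^sup>2)) \<alpha>)) \<and>
     (\<forall>s r. cond2 n s r \<and> s \<noteq> r \<longrightarrow>
        orbit_lengths \<Omega> (H2 \<Omega> a w s r) =
          {#n div (s * r)#} +
          replicate_mset ((r - 1) div ord (int r) \<alpha>) (n div (s * r) * ord (int r) \<alpha>) +
          replicate_mset ((s - 1) div ord (int s) \<alpha>) (n div (s * r) * ord (int s) \<alpha>) +
          replicate_mset ((s - 1) * (r - 1) div ord (int (s * r)) \<alpha>)
            (n div (s * r) * ord (int (s * r)) \<alpha>)) \<and>
     (\<forall>r. cond4 n \<alpha> r \<longrightarrow>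
        orbit_lengths \<Omega> (H4 \<Omega> a w r) =
          replicate_mset 2 (n div (2 * r)) +
          replicate_mset (2 * (r - 1) * gcd 2 (ord (int r) \<alpha>) div ord (int r) \<alpha>)
            (n div (2 * r) * (ord (int r) \<alpha> div gcd 2 (ord (int r) \<alpha>)))) \<and>
     (cond5 n \<alpha> \<longrightarrow> orbit_lengths \<Omega> (H5 \<Omega> a w) = replicate_mset 4 (n div 4)) \<and>
     (cond6 n \<alpha> \<longrightarrow> orbit_lengths \<Omega> (H6 \<Omega> a w) = replicate_mset 4 (n div 4))"
proof -
  interpret B: group "BijGroup \<Omega>" by (rule group_BijGroup)
  note prems = assms
  have a: "a \<in> Bij \<Omega>" and w: "w \<in> Bij \<Omega>" using prems(3,4) by (simp_all add: carrier_BijGroup)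
  \<comment> \<open>The coordinate of a point is the exponent of the power of \<open>w\<close> that
    moves the base point to it.\<close>
  define e where "e x = (w [^]\<^bsub>BijGroup \<Omega>\<^esub> x) \<omega>" for x :: int
  have W: "W = {w [^]\<^bsub>BijGroup \<Omega>\<^esub> k | k::int. k \<in> UNIV}" using B.generate_pow prems(4,6) by simp
  have wpow: "w [^]\<^bsub>BijGroup \<Omega>\<^esub> k \<in> W" for k :: int by (auto simp: W)
  have wBij: "w [^]\<^bsub>BijGroup \<Omega>\<^esub> k \<in> Bij \<Omega>" for k :: int
    using B.int_pow_closed[OF prems(4), of k] by (simp add: carrier_BijGroup)
  have w_e: "(w [^]\<^bsub>BijGroup \<Omega>\<^esub> k) (e x) = e (k + x)" for k x :: int
    using mult_BijGroup_apply[OF wBij wBij prems(2), of k x] B.int_pow_mult[OF prems(4), of k x]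
    by (simp add: e_def)
  have regular: "\<exists>!g. g \<in> W \<and> g x = y" if "x \<in> \<Omega>" "y \<in> \<Omega>" for x y
    using prems(8) that by (simp add: regular_on_def)
  have e_in: "e x \<in> \<Omega>" for x unfolding e_def by (rule Bij_apply_closed[OF wBij prems(2)])
  have inj: "inj_on (\<lambda>g. g \<omega>) W"
  proof (rule inj_onI)
    fix g h assume gh: "g \<in> W" "h \<in> W" "g \<omega> = h \<omega>"
    have "g \<omega> \<in> \<Omega>" using gh(1) wBij Bij_apply_closed[OF _ prems(2)] by (auto simp: W)
    from regular[OF prems(2) this] gh show "g = h" by metis
  qed
  have "finite W"
  proof (rule inj_on_finite[OF inj _ prems(1)])
    show "(\<lambda>g. g \<omega>) ` W \<subseteq> \<Omega>" using e_in by (auto simp: W e_def)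
  qed
  then have n: "0 < n" "n = B.ord w"
    using prems(9) wpow[of 0] B.generate_pow_card[OF prems(4)] prems(6) by (auto simp: card_gt_0_iff)
  have e_eq: "e x = e y \<longleftrightarrow> int n dvd x - y" for x y
  proof -
    have "e x = e y \<longleftrightarrow> w [^]\<^bsub>BijGroup \<Omega>\<^esub> x = w [^]\<^bsub>BijGroup \<Omega>\<^esub> y"
      using inj_on_eq_iff[OF inj wpow wpow] by (simp add: e_def)
    also have "\<dots> \<longleftrightarrow> int n dvd y - x" using B.int_pow_eq[OF prems(4)] n(2) by simp
    finally show ?thesis by (simp add: dvd_diff_commute)
  qed
  have e_range: "range e = \<Omega>"
  proof
    show "\<Omega> \<subseteq> range e"
    proof
      fix y assume "y \<in> \<Omega>"
      then obtain g where "g \<in> W" "g \<omega> = y" using regular[OF prems(2)] by blast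
      then show "y \<in> range e" by (auto simp: W e_def)
    qed
  qed (use e_in in blast)
  have "a \<in> generate (BijGroup \<Omega>) {a}" by (rule generate.incl) simp
  then have "a \<in> stabilizer (perm_group \<Omega> G) (\<lambda>g. g) \<omega>" using prems(10,11) by simp
  \<comment> \<open>Here \<open>A\<close> being the point stabilizer enters: in coordinates
    \<open>a\<close> has no translation part.\<close>
  then have "a \<omega> = \<omega>" by (simp add: stabilizer_def)
  then have a_e: "a (e x) = e (\<alpha> * x)" for x
    using conjugate_int_pow[OF group_BijGroup prems(3,4,12), of x]
      mult_BijGroup_apply[OF a wBij prems(2), of x] mult_BijGroup_apply[OF wBij a prems(2), of "\<alpha> * x"]
    by (simp add: e_def)
  \<comment> \<open>A consequence of \<open>a\<close> being injective on the points.\<close>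
  have "coprime \<alpha> (int n)"
  proof (rule coprime_if_mult_inj)
    fix m assume "int n dvd \<alpha> * m"
    then have "a (e m) = a (e 0)" by (simp add: a_e e_eq)
    moreover have "inj_on a \<Omega>" using a by (simp add: Bij_def bij_betw_def)
    ultimately have "e m = e 0" using e_in by (simp add: inj_on_eq_iff)
    then show "int n dvd m" by (simp add: e_eq)
  qed (use n(1) in simp)
  then interpret C: affine_action "int n" \<alpha> \<Omega> e
    using n(1) e_eq e_range by unfold_locales simp_all
  have a_aff: "a = C.aff \<alpha> 0" by (rule C.aff_eqI[OF C.Bij_ext[OF a]]) (simp add: a_e)
  have wk_aff: "w [^]\<^bsub>BijGroup \<Omega>\<^esub> k = C.aff 1 k" for k :: int
    by (rule C.aff_eqI[OF C.Bij_ext[OF wBij]]) (simp add: w_e add.commute)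
  have w_aff: "w = C.aff 1 1" using wk_aff[of 1] prems(4) by (simp add: B.int_pow_1)
  have G: "G = C.affmap C.full" using prems(5) C.generate_full by (simp add: a_aff w_aff)
  have "W = C.Transl" by (auto simp: W C.Transl_def wk_aff)
  moreover have "\<omega> = e 0" using one_BijGroup_apply[OF prems(2)] by (simp add: e_def)
  ultimately have Hol: "holomorph \<Omega> \<omega> W = C.Hol" using C.holomorph_eq by simp
  show ?thesis
    unfolding G Hol a_aff w_aff
  proof (intro conjI allI impI; (elim conjE)?)
    show "second_maximal_relatively_closed \<Omega> (C.affmap C.full) K"
      if "listed \<Omega> n \<alpha> (C.aff \<alpha> 0) (C.aff 1 1) i K" for i K
      using C.listed_second_maximal[OF refl that] .
  qed (simp_all only: not_False_eq_True C.ex1_listed_conjugate[OF refl]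
      C.orbit_lengths_H1[OF refl] C.orbit_lengths_H2_square[OF refl]
      C.orbit_lengths_H2_distinct[OF refl] C.orbit_lengths_H3[OF refl]
      C.orbit_lengths_H4[OF refl] C.orbit_lengths_H5[OF refl] C.orbit_lengths_H6[OF refl])
qed

end
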